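(* Let $m\in(0,m_c]$ with $m_c=\frac{N-2}{N+2}$, $p>\frac{N+2}2$, and let $r\ge1$ satisfy $\lambda_r>0$, where $\lambda_s:=N(m-1)+2s$ for $s>0$. Then there exists a constant $C=C(N,m,\nu,L,p,r)$ such that whenever $\boldsymbol A$ satisfies (G1)--(G3) and $u$ is a locally bounded, local weak solution of $\partial_t u-\operatorname{div}\boldsymbol A(x,t,u,Du^{[m]})=\operatorname{div}F$ in $\Omega_T$ with $F\in L^{2p}_{\rm loc}(\Omega_T,\mathbb R^{kN})$, then for all cylinders $Q_{\rho,\vartheta}\equiv Q_{\rho,\vartheta}(z_o):=B_\rho(x_o)\times(t_o-\vartheta,t_o]\Subset\Omega_T$ (with $\rho,\vartheta>0$, $z_o=(x_o,t_o)$) and all $\sigma\in[\frac12,1)$ we have $$\sup_{Q_{\sigma\rho,\sigma\vartheta}}|u|\le\max\Bigg\{\bigg[\frac{C}{(1-\sigma)^{N+2}}\Big(\frac{\rho^2}{\vartheta}\Big)^{\frac N2}\operatorname{avg}_{Q_{\rho,\vartheta}}\big[|u|^r\big]\bigg]^{\frac{2}{\lambda_r}},\ \bigg[\Big(\frac{\vartheta}{\rho^2}\Big)^{p-\frac N2}\operatorname{avg}_{Q_{\rho,\vartheta}}\big[|\rho F|^{2p}\big]\bigg]^{\frac{2}{\lambda_{p(1+m)}}},\ \Big(\frac{\vartheta}{\rho^2}\Big)^{\frac1{1-m}}\Bigg\},$$ where $Q_{\sigma\rho,\sigma\vartheta}=Q_{\sigma\rho,\sigma\vartheta}(z_o)$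.
   Context: Setting. $N,k\in\mathbb N$ (the condition $m\in(0,m_c]$ forces $N\ge3$), $\Omega\subset\mathbb R^N$ is a bounded open set, $T>0$, $\Omega_T:=\Omega\times(0,T]$. For $w\in\mathbb R^k$ and $\alpha>0$ put $w^{[\alpha]}:=|w|^{\alpha-1}w$, with $0^{[\alpha]}:=0$. $D$ denotes the spatial gradient. For a measurable set $E\subset\mathbb R^N\times\mathbb R$ of positive finite measure, $\operatorname{avg}_E[f]:=\frac1{|E|}\iint_E f\,dx\,dt$. Suprema of $|u|$ over cylinders are essential suprema. $\boldsymbol A\colon\Omega_T\times\mathbb R^k\times\mathbb R^{kN}\to\mathbb R^{kN}$ is a Carathéodory vector field with components $\boldsymbol A_\alpha\in\mathbb R^k$, $\alpha=1,\dots,N$ (likewise $\xi=(\xi_\alpha)_{\alpha=1}^N$, $\xi_\alpha\in\mathbb R^k$), and with constants $\nu,L>0$ such that for a.e. $(x,t)\in\Omega_T$ and all $(u,\xi)\in\mathbb R^k\times\mathbb R^{kN}$: (G1) $\boldsymbol A(x,t,u,\xi)\cdot\xi\ge\nu|\xi|^2$; (G2) $|\boldsymbol A(x,t,u,\xi)|\le L|\xi|$; (G3) $\sum_{\alpha=1}^N\big(\boldsymbol A_\alpha(x,t,u,\xi)\cdot u^{[m]}\big)\big(\xi_\alpha\cdot u^{[m]}\big)\ge0$. (Local) weak solution. Let $m>0$, let $\boldsymbol A\colon\Omega_T\times\mathbb R^k\times\mathbb R^{kN}\to\mathbb R^{kN}$ be a Carathéodory vector field satisfying (G1), (G2) and (G3),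 and let $F\in L^2(\Omega_T,\mathbb R^{kN})$. A function $u\in C^0((0,T);L^{1+m}(\Omega,\mathbb R^k))$ with $u^{[m]}\in L^2(0,T;W^{1,2}(\Omega,\mathbb R^k))$ is a (local) weak solution of $\partial_tu-\operatorname{div}\boldsymbol A(x,t,u,Du^{[m]})=\operatorname{div}F$ in $\Omega_T$ iff $$\iint_{\Omega_T}\big[u\cdot\partial_t\varphi-\boldsymbol A(x,t,u,Du^{[m]})\cdot D\varphi\big]dx\,dt=\iint_{\Omega_T}F\cdot D\varphi\,dx\,dt$$ for all smooth $\varphi$ with values in $\mathbb R^k$ and compact support in $\Omega\times(0,T)$. Constants written $C=C(\cdot)$ depend only on the listed quantities. *)

theory Defs
  imports "HOL-Analysis.Analysis" "HOL-Probability.Essential_Supremum"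
begin

section \<open>Vectors with a variable number of components\<close>

text \<open>
  The constant of the theorem must not depend on \<open>k\<close>, so \<open>k\<close> has to be quantified inside the
  statement and cannot be a type. \<open>fvec k\<close> consists of the sequences vanishing from index \<open>k\<close> on:
  with real entries it is \<open>R^k\<close>, and with entries in \<open>real ^ 'n\<close> it is \<open>R^(kN)\<close>. In the latter case
  entry \<open>i\<close> of \<open>\<xi>\<close> is the spatial gradient of component \<open>i\<close>, and
  \<open>\<xi>\<^sub>\<alpha> = (\<lambda>i. \<xi> i $ \<alpha>)\<close> is the \<open>\<alpha>\<close>-th column. On \<open>fvec k\<close> the product topology of the
  function type is the Euclidean topology.
\<close>

definition fvec :: "nat \<Rightarrow> (nat \<Rightarrow> 'a::zero) set" where
  "fvec k = {v. \<forall>i\<ge>k. v i = 0}"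

definition fnorm :: "nat \<Rightarrow> (nat \<Rightarrow> 'a::real_normed_vector) \<Rightarrow> real" where
  "fnorm k v = L2_set (\<lambda>i. norm (v i)) {..<k}"

definition finner :: "nat \<Rightarrow> (nat \<Rightarrow> 'a::real_inner) \<Rightarrow> (nat \<Rightarrow> 'a) \<Rightarrow> real" where
  "finner k v w = (\<Sum>i<k. v i \<bullet> w i)"

definition column :: "(nat \<Rightarrow> real ^ 'n) \<Rightarrow> 'n \<Rightarrow> nat \<Rightarrow> real" where
  "column \<xi> \<alpha> = (\<lambda>i. \<xi> i $ \<alpha>)"

text \<open>\<open>w\<^sup>[\<^sup>a\<^sup>] = |w|\<^sup>a\<^sup>-\<^sup>1 w\<close>; since \<open>0 powr b = 0\<close> the value at \<open>w = 0\<close> is \<open>0\<close>.\<close>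

definition signed_pow :: "nat \<Rightarrow> real \<Rightarrow> (nat \<Rightarrow> real) \<Rightarrow> nat \<Rightarrow> real" where
  "signed_pow k a w = (\<lambda>i. fnorm k w powr (a - 1) * w i)"


section \<open>Smooth functions and test functions\<close>

primrec C_diff :: "nat \<Rightarrow> ('a::euclidean_space \<Rightarrow> real) \<Rightarrow> bool" where
  "C_diff 0 f \<longleftrightarrow> continuous_on UNIV f"
| "C_diff (Suc j) f \<longleftrightarrow> (\<forall>x. f differentiable (at x)) \<and>
     (\<forall>b\<in>Basis. C_diff j (\<lambda>x. frechet_derivative f (at x) b))"

definition test_function :: "'a::euclidean_space set \<Rightarrow> ('a \<Rightarrow> real) \<Rightarrow> bool" where
  "test_function U \<phi> \<longleftrightarrow> (\<forall>j. C_diff j \<phi>) \<and>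
     compact (closure {x. \<phi> x \<noteq> 0}) \<and> closure {x. \<phi> x \<noteq> 0} \<subseteq> U"

definition grad :: "(real ^ 'n \<Rightarrow> real) \<Rightarrow> real ^ 'n \<Rightarrow> real ^ 'n" where
  "grad f x = (\<chi> \<alpha>. frechet_derivative f (at x) (axis \<alpha> 1))"

definition Dx :: "((real ^ 'n) \<times> real \<Rightarrow> real) \<Rightarrow> (real ^ 'n) \<times> real \<Rightarrow> real ^ 'n" where
  "Dx f z = grad (\<lambda>y. f (y, snd z)) (fst z)"

definition Dt :: "((real ^ 'n) \<times> real \<Rightarrow> real) \<Rightarrow> (real ^ 'n) \<times> real \<Rightarrow> real" where
  "Dt f z = deriv (\<lambda>s. f (fst z, s)) (snd z)"


section \<open>Function spaces\<close>

definition in_Lp ::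
  "real \<Rightarrow> nat \<Rightarrow> 'a::euclidean_space set \<Rightarrow> ('a \<Rightarrow> nat \<Rightarrow> 'b::euclidean_space) \<Rightarrow> bool" where
  "in_Lp q k S f \<longleftrightarrow> (\<forall>z\<in>S. f z \<in> fvec k) \<and>
     (\<forall>i<k. (\<lambda>z. f z i) \<in> borel_measurable (lebesgue_on S)) \<and>
     set_integrable lebesgue S (\<lambda>z. fnorm k (f z) powr q)"

definition Lp_norm ::
  "real \<Rightarrow> nat \<Rightarrow> 'a::euclidean_space set \<Rightarrow> ('a \<Rightarrow> nat \<Rightarrow> 'b::euclidean_space) \<Rightarrow> real" where
  "Lp_norm q k S f = (LINT z:S|lebesgue. fnorm k (f z) powr q) powr (1 / q)"

definition in_Lp_loc ::
  "real \<Rightarrow> nat \<Rightarrow> 'a::euclidean_space set \<Rightarrow> ('a \<Rightarrow> nat \<Rightarrow> 'b::euclidean_space) \<Rightarrow> bool" where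
  "in_Lp_loc q k S f \<longleftrightarrow> (\<forall>K. compact K \<and> K \<subseteq> S \<longrightarrow> in_Lp q k K f)"

definition locally_bdd ::
  "nat \<Rightarrow> 'a::euclidean_space set \<Rightarrow> ('a \<Rightarrow> nat \<Rightarrow> 'b::euclidean_space) \<Rightarrow> bool" where
  "locally_bdd k S f \<longleftrightarrow>
     (\<forall>K. compact K \<and> K \<subseteq> S \<longrightarrow> (\<exists>M. AE z in lebesgue. z \<in> K \<longrightarrow> fnorm k (f z) \<le> M))"

text \<open>\<open>f \<in> C\<^sup>0((0,T); L\<^sup>q(\<Omega>, R\<^sup>k))\<close>\<close>

definition in_C0_Lp ::
  "real \<Rightarrow> nat \<Rightarrow> (real ^ 'n) set \<Rightarrow> real \<Rightarrow> ((real ^ 'n) \<times> real \<Rightarrow> nat \<Rightarrow> real) \<Rightarrow> bool" where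
  "in_C0_Lp q k \<Omega> T f \<longleftrightarrow>
     (\<forall>t\<in>{0<..<T}. in_Lp q k \<Omega> (\<lambda>x. f (x, t))) \<and>
     (\<forall>s\<in>{0<..<T}.
        ((\<lambda>t. Lp_norm q k \<Omega> (\<lambda>x i. f (x, t) i - f (x, s) i)) \<longlongrightarrow> 0) (at s within {0<..<T}))"

text \<open>\<open>f \<in> W\<^sup>1\<^sup>,\<^sup>2(\<Omega>, R\<^sup>k)\<close> with weak gradient \<open>g\<close>\<close>

definition has_W12_gradient ::
  "nat \<Rightarrow> (real ^ 'n) set \<Rightarrow> (real ^ 'n \<Rightarrow> nat \<Rightarrow> real) \<Rightarrow> (real ^ 'n \<Rightarrow> nat \<Rightarrow> real ^ 'n) \<Rightarrow> bool" where
  "has_W12_gradient k \<Omega> f g \<longleftrightarrow> in_Lp 2 k \<Omega> f \<and> in_Lp 2 k \<Omega> g \<and>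
     (\<forall>i<k. \<forall>\<phi>. test_function \<Omega> \<phi> \<longrightarrow>
        (LINT x:\<Omega>|lebesgue. f x i *\<^sub>R grad \<phi> x) = - (LINT x:\<Omega>|lebesgue. \<phi> x *\<^sub>R g x i))"

text \<open>\<open>f \<in> L\<^sup>2(0,T; W\<^sup>1\<^sup>,\<^sup>2(\<Omega>, R\<^sup>k))\<close> with spatial weak gradient \<open>g\<close>, determined up to a null set\<close>

definition has_L2_W12_gradient ::
  "nat \<Rightarrow> (real ^ 'n) set \<Rightarrow> real \<Rightarrow> ((real ^ 'n) \<times> real \<Rightarrow> nat \<Rightarrow> real) \<Rightarrow>
     ((real ^ 'n) \<times> real \<Rightarrow> nat \<Rightarrow> real ^ 'n) \<Rightarrow> bool" where
  "has_L2_W12_gradient k \<Omega> T f g \<longleftrightarrow>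
     in_Lp 2 k (\<Omega> \<times> {0<..T}) f \<and> in_Lp 2 k (\<Omega> \<times> {0<..T}) g \<and>
     (AE t in lebesgue. t \<in> {0<..<T} \<longrightarrow>
        has_W12_gradient k \<Omega> (\<lambda>x. f (x, t)) (\<lambda>x. g (x, t)))"


section \<open>The vector field and weak solutions\<close>

type_synonym 'n vfield =
  "(real ^ 'n) \<times> real \<Rightarrow> (nat \<Rightarrow> real) \<Rightarrow> (nat \<Rightarrow> real ^ 'n) \<Rightarrow> nat \<Rightarrow> real ^ 'n"

definition caratheodory :: "nat \<Rightarrow> (real ^ 'n) set \<Rightarrow> real \<Rightarrow> 'n vfield \<Rightarrow> bool" where
  "caratheodory k \<Omega> T A \<longleftrightarrow>
     (\<forall>z\<in>\<Omega> \<times> {0<..T}. \<forall>u\<in>fvec k. \<forall>\<xi>\<in>fvec k. A z u \<xi> \<in> fvec k) \<and>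
     (\<forall>u\<in>fvec k. \<forall>\<xi>\<in>fvec k. \<forall>i<k.
        (\<lambda>z. A z u \<xi> i) \<in> borel_measurable (lebesgue_on (\<Omega> \<times> {0<..T}))) \<and>
     (AE z in lebesgue. z \<in> \<Omega> \<times> {0<..T} \<longrightarrow>
        (\<forall>i<k. continuous_on (fvec k \<times> fvec k) (\<lambda>(u, \<xi>). A z u \<xi> i)))"

definition G1 :: "nat \<Rightarrow> (real ^ 'n) set \<Rightarrow> real \<Rightarrow> real \<Rightarrow> 'n vfield \<Rightarrow> bool" where
  "G1 k \<Omega> T \<nu> A \<longleftrightarrow> (AE z in lebesgue. z \<in> \<Omega> \<times> {0<..T} \<longrightarrow>
     (\<forall>u\<in>fvec k. \<forall>\<xi>\<in>fvec k. finner k (A z u \<xi>) \<xi> \<ge> \<nu> * (fnorm k \<xi>)\<^sup>2))"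

definition G2 :: "nat \<Rightarrow> (real ^ 'n) set \<Rightarrow> real \<Rightarrow> real \<Rightarrow> 'n vfield \<Rightarrow> bool" where
  "G2 k \<Omega> T L A \<longleftrightarrow> (AE z in lebesgue. z \<in> \<Omega> \<times> {0<..T} \<longrightarrow>
     (\<forall>u\<in>fvec k. \<forall>\<xi>\<in>fvec k. fnorm k (A z u \<xi>) \<le> L * fnorm k \<xi>))"

definition G3 :: "nat \<Rightarrow> real \<Rightarrow> (real ^ 'n) set \<Rightarrow> real \<Rightarrow> 'n vfield \<Rightarrow> bool" where
  "G3 k m \<Omega> T A \<longleftrightarrow> (AE z in lebesgue. z \<in> \<Omega> \<times> {0<..T} \<longrightarrow>
     (\<forall>u\<in>fvec k. \<forall>\<xi>\<in>fvec k.
        (\<Sum>\<alpha>\<in>UNIV. finner k (column (A z u \<xi>) \<alpha>) (signed_pow k m u) *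
                    finner k (column \<xi> \<alpha>) (signed_pow k m u)) \<ge> 0))"

definition weak_solution ::
  "nat \<Rightarrow> real \<Rightarrow> (real ^ 'n) set \<Rightarrow> real \<Rightarrow> 'n vfield \<Rightarrow>
     ((real ^ 'n) \<times> real \<Rightarrow> nat \<Rightarrow> real ^ 'n) \<Rightarrow> ((real ^ 'n) \<times> real \<Rightarrow> nat \<Rightarrow> real) \<Rightarrow> bool" where
  "weak_solution k m \<Omega> T A F u \<longleftrightarrow>
     in_Lp 2 k (\<Omega> \<times> {0<..T}) F \<and>
     (\<forall>z\<in>\<Omega> \<times> {0<..T}. u z \<in> fvec k) \<and>
     (\<forall>i<k. (\<lambda>z. u z i) \<in> borel_measurable (lebesgue_on (\<Omega> \<times> {0<..T}))) \<and>
     in_C0_Lp (1 + m) k \<Omega> T u \<and>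
     (\<exists>G. has_L2_W12_gradient k \<Omega> T (\<lambda>z. signed_pow k m (u z)) G \<and>
        (\<forall>\<phi>. (\<forall>i<k. test_function (\<Omega> \<times> {0<..<T}) (\<phi> i)) \<longrightarrow>
           (LINT z:\<Omega> \<times> {0<..T}|lebesgue.
              finner k (u z) (\<lambda>i. Dt (\<phi> i) z) -
              finner k (A z (u z) (G z)) (\<lambda>i. Dx (\<phi> i) z)) =
           (LINT z:\<Omega> \<times> {0<..T}|lebesgue. finner k (F z) (\<lambda>i. Dx (\<phi> i) z))))"


section \<open>Cylinders, averages, suprema, exponents\<close>

definition cylinder :: "real ^ 'n \<Rightarrow> real \<Rightarrow> real \<Rightarrow> real \<Rightarrow> ((real ^ 'n) \<times> real) set" where
  "cylinder x0 t0 \<rho> \<theta> = ball x0 \<rho> \<times> {t0 - \<theta><..t0}"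

definition avg :: "'a::euclidean_space set \<Rightarrow> ('a \<Rightarrow> real) \<Rightarrow> real" where
  "avg E f = 1 / measure lebesgue E * (LINT z:E|lebesgue. f z)"

definition ess_sup_norm ::
  "nat \<Rightarrow> 'a::euclidean_space set \<Rightarrow> ('a \<Rightarrow> nat \<Rightarrow> real) \<Rightarrow> ereal" where
  "ess_sup_norm k E f = esssup (lebesgue_on E) (\<lambda>z. ereal (fnorm k (f z)))"

definition lambda_exp :: "nat \<Rightarrow> real \<Rightarrow> real \<Rightarrow> real" where
  "lambda_exp N m s = real N * (m - 1) + 2 * s"

end

theory Submission
  imports Defs
begin

text \<open>
 On almost every time slice the equation is tested with \<open>\<eta> h(|v|\<^sup>2) v\<close>, where \<open>v = |u|\<^sup>m\<^sup>-\<^sup>1 u\<close>, \<open>\<eta>\<close> is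
 a cutoff and \<open>h\<close> a smooth truncation at a level. Condition (G3) gives the term with the derivative of
 \<open>h\<close> a sign, and as \<open>u\<close> has no time derivative, the parabolic term is bounded from below by
 increments of a convex function of \<open>|u|\<close>. This energy estimate and the Faber--Krahn inequality give
 the De Giorgi lemma on intrinsic cylinders, whose length is \<open>M\<^sup>1\<^sup>-\<^sup>m\<close> times the squared radius: if
 \<open>|u| \<le> M\<close>, the source is small and \<open>{|u| > M/4}\<close> fills a small fraction of the cylinder, then
 \<open>|u| \<le> M/2\<close> on the half cylinder.

 Let \<open>K\<close> be the right-hand side of the claim. As \<open>u\<close> is locally bounded, \<open>|u| \<le> 2\<^sup>J K\<close> for some \<open>J\<close>, and
 the bound is halved \<open>J\<close> times. To pass from \<open>2\<^sup>i K\<close> to \<open>2\<^sup>i\<^sup>-\<^sup>1 K\<close> the cylinder shrinks by a factor of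
 order \<open>(1 - \<sigma>) q\<^sup>i\<close>, which leaves room for small intrinsic cylinders around each point. With the choice
 \<open>q\<^sup>N\<^sup>+\<^sup>2 = 2\<close> to the power \<open>- \<lambda>\<^sub>r / 2\<close>, Chebyshev's inequality for \<open>|u|\<^sup>r\<close> bounds the superlevel sets by
 the same fraction in every step, so that the constant does not depend on \<open>J\<close>.
\<close>

section \<open>Smooth functions and mollification\<close>

text \<open>The entries of the maximum are what one halving at a level M >= K needs. The intrinsic
  cylinder has length \<delta>^2 \<theta> and radius R with R^2 = \<delta>^2 \<theta> M^(m-1). The
  third entry gives R <= \<delta> \<rho>, so that it fits into the room left by shrinking. Its
  volume contains R^N, hence M^(N(m-1)/2), and Chebyshev contributes M^(-r); the quotient is
  M^(\<lambda>_r/2), the origin of the exponent 2/\<lambda>_r. The source leads to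
  \<lambda>_{p(1+m)} in the same way. The condition \<lambda>_r > 0 makes q < 1, so that the
  shrinking is summable, and p > (N+2)/2 makes the exponent of the De Giorgi recursion exceed one.
  The obstacle in the energy estimate is that convexity controls an increment u(t) - u(s) only when
  it is tested at the later time t, while the flux runs over all times between s and t. This
  mismatch is removed by averaging over t with a fixed lag and by the continuity of translations in
  L^2. All pointwise conditions hold almost everywhere only, so the analysis runs on Borel
  representatives extended by zero.\<close>

lemmas bochner_bound = Bochner_Integration.integrable_bound
lemmas bochner_nonneg = Bochner_Integration.integral_nonneg
lemmas bochner_diff = Bochner_Integration.integral_diff
lemmas bochner_cong = Bochner_Integration.integral_cong

abbreviation nn_lborel :: "('a::euclidean_space => ennreal) => ennreal" (binder "NNI " 10)
 where "nn_lborel f \<equiv> nn_integral lborel f"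

section \<open>Calculus of the class \<open>C_diff\<close>\<close>

lemma C_diff_SucI:
 assumes "\<And>x. (f has_derivative D x) (at x)" and "\<And>b. b \<in> Basis ==> C_diff j (\<lambda>x. D x b)"
 shows "C_diff (Suc j) f"
proof -
 have "frechet_derivative f (at x) = D x" for x
  using assms(1) by (metis frechet_derivative_at)
 then show ?thesis
  using assms by (auto simp: differentiable_def)
qed

lemma C_diff_has_derivative:
 "C_diff (Suc j) f ==> (f has_derivative frechet_derivative f (at x)) (at x)"
 by (simp add: frechet_derivative_works)

lemma C_diff_Suc_D: "C_diff (Suc j) f ==> C_diff j f"
proof (induction j arbitrary: f)
 case 0
 then show ?case
  by (auto intro!: continuous_at_imp_continuous_on differentiable_imp_continuous_within)
next
 case (Suc j)
 then show ?case by auto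
qed

lemma C_diff_continuous: "C_diff j f ==> continuous_on UNIV f"
 by (induction j) (use C_diff_Suc_D in auto)

lemma C_diff_const: "C_diff j (\<lambda>x. c)"
proof (induction j arbitrary: c)
 case (Suc j)
 show ?case by (rule C_diff_SucI[where D="\<lambda>x b. 0"]) (use Suc in auto)
qed auto

lemma C_diff_add: "C_diff j f ==> C_diff j g ==> C_diff j (\<lambda>x. f x + g x)"
proof (induction j arbitrary: f g)
 case 0
 then show ?case by (auto intro!: continuous_intros)
next
 case (Suc j)
 show ?case
  by (rule C_diff_SucI[OF has_derivative_add[OF C_diff_has_derivative C_diff_has_derivative]])
   (use Suc in auto)
qed

lemma C_diff_mult: "C_diff j f ==> C_diff j g ==> C_diff j (\<lambda>x. f x * g x)"
proof (induction j arbitrary: f g)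
 case 0
 then show ?case by (auto intro!: continuous_intros)
next
 case (Suc j)
 show ?case
 proof (rule C_diff_SucI[OF has_derivative_mult[OF C_diff_has_derivative C_diff_has_derivative]])
  fix b :: 'a assume b: "b \<in> Basis"
  show "C_diff j (\<lambda>x. f x * frechet_derivative g (at x) b + frechet_derivative f (at x) b * g x)"
   using Suc b by (intro C_diff_add Suc.IH C_diff_Suc_D[of j f] C_diff_Suc_D[of j g]) auto
 qed (use Suc in auto)
qed

lemma C_diff_sum:
 "(\<And>i. i \<in> I ==> C_diff j (f i)) ==> C_diff j (\<lambda>x. \<Sum>i\<in>I. f i x)"
 by (induction I rule: infinite_finite_induct) (auto intro: C_diff_const C_diff_add)

lemma C_diff_bounded_linear: "bounded_linear f ==> C_diff j f"
proof (induction j)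
 case 0
 then show ?case by (simp add: linear_continuous_on)
next
 case (Suc j)
 show ?case
  by (rule C_diff_SucI[of f "\<lambda>x. f"])
   (use Suc bounded_linear_imp_has_derivative C_diff_const in auto)
qed

lemma C_diff_compose_linear:
 fixes l :: "'a::euclidean_space => 'b::euclidean_space"
 assumes "bounded_linear l"
 shows "C_diff j f ==> C_diff j (\<lambda>x. f (l x + c))"
proof (induction j arbitrary: f)
 case 0
 then show ?case
  using linear_continuous_on[OF assms]
  by (auto intro!: continuous_on_compose2[of UNIV f] continuous_intros)
next
 case (Suc j)
 show ?case
 proof (rule C_diff_SucI)
  fix x :: 'a
  have "((\<lambda>x. l x + c) has_derivative l) (at x)"
   by (auto intro!: derivative_eq_intros bounded_linear_imp_has_derivative assms)
  then show "((\<lambda>x. f (l x + c)) has_derivative (\<lambda>h. frechet_derivative f (at (l x + c)) (l h))) (at x)"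
   by (rule has_derivative_compose) (use Suc C_diff_has_derivative in blast)
 next
  fix b :: 'a assume "b \<in> Basis"
  \<comment> \<open>\<open>C_diff\<close> speaks of derivatives along basis vectors only, so the
    direction \<open>l b\<close> is expanded in the basis.\<close>
  have *: "frechet_derivative f (at y) (l b) = (\<Sum>e\<in>Basis. (l b \<bullet> e) * frechet_derivative f (at y) e)" for y
  proof -
   have "bounded_linear (frechet_derivative f (at y))"
    using Suc.prems C_diff_has_derivative has_derivative_bounded_linear by blast
   then have "linear (frechet_derivative f (at y))" by (simp add: bounded_linear.linear)
   then have "frechet_derivative f (at y) (\<Sum>e\<in>Basis. (l b \<bullet> e) *\<^sub>R e)
     = (\<Sum>e\<in>Basis. (l b \<bullet> e) *\<^sub>R frechet_derivative f (at y) e)"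
    by (simp add: linear_sum linear_scale)
   then show ?thesis by (simp add: euclidean_representation)
  qed
  show "C_diff j (\<lambda>x. frechet_derivative f (at (l x + c)) (l b))"
   unfolding * using Suc by (intro C_diff_sum C_diff_mult C_diff_const Suc.IH) auto
 qed
qed

text \<open>The whole family exp(-1/x) / x^n, extended by zero, is closed under differentiation: the
  derivative of \<open>bump n\<close> is a combination of \<open>bump (n + 2)\<close> and
  \<open>bump (n + 1)\<close>. Smoothness then follows by one induction that treats all
  \<open>n\<close> together. Below, \<open>bump 0\<close> is the profile of every cutoff and
  \<open>bump 2\<close> is its derivative.\<close>

definition bump :: "nat => real => real" where
 "bump n x = (if x > 0 then exp (- 1 / x) / x ^ n else 0)"

lemma bump_Suc: "bump n x = x * bump (Suc n) x"
 by (simp add: bump_def)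

lemma power_div_fact_le_exp:
 fixes y :: real assumes "y \<ge> 0" shows "y ^ n / fact n <= exp y"
proof -
 have "(\<Sum>i\<in>{n}. y ^ i /\<^sub>R fact i) <= (\<Sum>i. y ^ i /\<^sub>R fact i)"
  by (intro sum_le_suminf summable_exp_generic) (use assms in auto)
 then show ?thesis by (simp add: exp_def divide_inverse mult.commute)
qed

lemma bump_le_0: "x <= 0 ==> bump n x = 0"
 by (simp add: bump_def)

lemma bump_nonneg: "0 <= bump n x"
 by (simp add: bump_def)

text \<open>With y = 1/x this is y^n <= n! exp y, a single term of the exponential series. It keeps
  all derivatives bounded up to the origin.\<close>

lemma bump_le: "bump n x <= fact n"
proof (cases "x > 0")
 case True
 have "(1 / x) ^ n / fact n <= exp (1 / x)"
  using True by (intro power_div_fact_le_exp) auto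
 then have "exp (- 1 / x) * ((1 / x) ^ n / fact n) <= exp (- 1 / x) * exp (1 / x)"
  by (intro mult_left_mono) auto
 also have "... = 1" by (simp flip: exp_add)
 finally show ?thesis using True by (simp add: bump_def field_simps)
qed (simp add: bump_def)

lemma bump_deriv:
 "(bump n has_field_derivative bump (n + 2) x - real n * bump (n + 1) x) (at x)"
proof (cases x "0 :: real" rule: linorder_cases)
 case less
 have "((\<lambda>x. 0) has_field_derivative 0) (at x)" by simp
 then have "(bump n has_field_derivative 0) (at x)"
  by (rule has_field_derivative_transform_within_open[where S="{..<0}"])
   (use less in \<open>auto simp: bump_def\<close>)
 then show ?thesis using less by (simp add: bump_def)
next
 case equal
 \<comment> \<open>At the origin the difference quotient is \<open>bump (n + 1) y\<close>; one more
   factor \<open>y\<close> is gained by passing to the bounded function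
   \<open>bump (n + 2)\<close>.\<close>
 have "\<bar>bump n y / y\<bar> <= fact (n + 2) * \<bar>y\<bar>" if "y \<noteq> 0" for y
 proof -
  have "bump n y / y = bump (Suc n) y"
   using that by (subst bump_Suc) simp
  also have "... = bump (n + 2) y * y"
   by (subst bump_Suc) simp
  finally have "\<bar>bump n y / y\<bar> = bump (n + 2) y * \<bar>y\<bar>"
   using bump_nonneg[of "n + 2" y] by (simp only: abs_mult abs_of_nonneg)
  also have "... <= fact (n + 2) * \<bar>y\<bar>"
   by (intro mult_right_mono bump_le) simp
  finally show ?thesis .
 qed
 then have "\<forall>\<^sub>F y in at 0. norm (bump n y / y) <= fact (n + 2) * \<bar>y\<bar>"
  unfolding eventually_at by (intro exI[of _ 1]) simp
 moreover have "((\<lambda>y. fact (n + 2) * \<bar>y\<bar>) \<longlongrightarrow> (0::real)) (at 0)"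
  by (rule tendsto_eq_intros refl | simp)+
 ultimately have "((\<lambda>y. bump n y / y) \<longlongrightarrow> 0) (at 0)"
  by (rule Lim_null_comparison)
 then have "(bump n has_field_derivative 0) (at 0)"
  unfolding has_field_derivative_iff by (simp add: bump_le_0)
 then show ?thesis using equal by (simp add: bump_le_0)
next
 case greater
 have D: "((\<lambda>x. exp (- inverse x) * inverse x ^ n) has_field_derivative
   exp (- inverse x) * (inverse x)\<^sup>2 * inverse x ^ n +
   exp (- inverse x) * (real n * inverse x ^ (n - 1) * (- (inverse x)\<^sup>2))) (at x)"
  using greater by - ((rule derivative_eq_intros refl | simp)+, simp add: power2_eq_square algebra_simps)
 have m: "real n * inverse x ^ (n - 1) * (- (inverse x)\<^sup>2) = - real n * inverse x ^ (n + 1)"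
  by (cases n) (simp_all add: power2_eq_square algebra_simps)
 have eq: "exp (- 1 / y) / y ^ i = exp (- inverse y) * inverse y ^ i" for y :: real and i
  unfolding power_inverse divide_inverse by simp
 have E: "exp (- 1 / x) / x ^ (n + 2) - real n * (exp (- 1 / x) / x ^ (n + 1)) =
   exp (- inverse x) * (inverse x)\<^sup>2 * inverse x ^ n + exp (- inverse x) * (- real n * inverse x ^ (n + 1))"
  unfolding eq by (simp add: power2_eq_square)
 have "((\<lambda>x. exp (- 1 / x) / x ^ n) has_field_derivative
   exp (- 1 / x) / x ^ (n + 2) - real n * (exp (- 1 / x) / x ^ (n + 1))) (at x)"
  unfolding E using D unfolding m eq .
 then have "(bump n has_field_derivative
   exp (- 1 / x) / x ^ (n + 2) - real n * (exp (- 1 / x) / x ^ (n + 1))) (at x)"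
  by (rule has_field_derivative_transform_within_open[where S="{0<..}"])
   (use greater in \<open>auto simp: bump_def\<close>)
 then show ?thesis using greater by (simp add: bump_def)
qed

lemma continuous_bump: "continuous_on UNIV (bump n)"
 by (rule continuous_at_imp_continuous_on) (use bump_deriv DERIV_isCont in blast)

lemma bump_pos_iff: "bump n x > 0 \<longleftrightarrow> x > 0"
 by (simp add: bump_def)

lemma bump_0_le_1: "bump 0 x <= 1"
 using bump_le[of 0 x] by simp

text \<open>\<open>bump 2\<close> squared is \<open>bump 4\<close> times \<open>bump 0\<close>, and
  \<open>bump 4\<close> is at most 4!. Since the squared derivative of the profile is controlled by
  the profile itself, terms with derivatives of cutoffs can be absorbed by Young's inequality
  without raising the cutoffs to a power.\<close>

lemma bump_2_sq: "(bump 2 x)^2 <= 24 * bump 0 x"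
proof -
 have "(bump 2 x)^2 = bump 4 x * bump 0 x"
  by (simp add: bump_def power2_eq_square power4_eq_xxxx mult.assoc)
 then show ?thesis
  using bump_le[of 4 x] bump_nonneg[of 0 x] by (simp add: mult_right_mono fact_numeral)
qed

text \<open>The profile is not normalised to reach 1; a cutoff counts as full where its argument is
  at least 1. The factors \<open>exp (- 1)\<close>, \<open>exp (- 2)\<close> and
  \<open>exp (- 4)\<close> of the later estimates all come from here.\<close>

lemma bump_0_ge: "x \<ge> 1 ==> bump 0 x \<ge> exp (- 1)"
 by (simp add: bump_def divide_simps)

lemma bump_mono: "x <= y ==> bump 0 x <= bump 0 y"
 by (auto simp: bump_def divide_simps)

text \<open>Induction on the order with \<open>n\<close> arbitrary, because the chain rule leads
  from \<open>n\<close> to \<open>n + 1\<close> and \<open>n + 2\<close>.\<close>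

lemma C_diff_bump: "(\<And>i. C_diff i g) ==> C_diff j (\<lambda>x. bump n (g x))"
proof (induction j arbitrary: n)
 case 0
 show ?case
  using continuous_on_compose2[OF continuous_bump C_diff_continuous[OF 0]] by simp
next
 case (Suc j)
 show ?case
 proof (rule C_diff_SucI)
  fix x
  have "(g has_derivative frechet_derivative g (at x)) (at x)"
   using C_diff_has_derivative Suc.prems by blast
  moreover have "(bump n has_derivative (\<lambda>h. h *
   (bump (n + 2) (g x) + (- real n) * bump (n + 1) (g x)))) (at (g x))"
   using bump_deriv[of n "g x"] by (simp add: has_field_derivative_def mult_commute_abs)
  ultimately show "((\<lambda>x. bump n (g x)) has_derivative (\<lambda>h. frechet_derivative g (at x) h *
   (bump (n + 2) (g x) + (- real n) * bump (n + 1) (g x)))) (at x)"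
   by (rule has_derivative_compose)
  fix b :: 'a assume "b \<in> Basis"
  then show "C_diff j (\<lambda>x. frechet_derivative g (at x) b *
   (bump (n + 2) (g x) + (- real n) * bump (n + 1) (g x)))"
   using Suc.prems[of "Suc j"] by (intro C_diff_mult C_diff_add C_diff_const Suc) auto
 qed
qed

text \<open>Differentiation under the integral sign; continuity of the partial derivatives of \<open>J\<close> makes the
 remainder uniformly small, because \<open>J\<close> has compact support.\<close>

definition conv :: "('a::euclidean_space => real) => ('a => real) => 'a => real" where
 "conv J f x = (LBINT y. J (x - y) * f y)"

section \<open>Convolution with smooth kernels of bounded support\<close>

lemma smooth_bounded:
 fixes J :: "'a::euclidean_space => real"
 assumes "continuous_on UNIV J" "\<forall>x. R <= norm x --> J x = 0"
 obtains C where "C > 0" "\<And>x. \<bar>J x\<bar> <= C"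
proof -
 have "compact (J ` cball (0::'a::euclidean_space) R)"
  by (intro compact_continuous_image continuous_on_subset[OF assms(1)]) auto
 then obtain C where C: "C > 0" "\<And>y. y \<in> J ` cball 0 R ==> norm y <= C"
  using compact_imp_bounded bounded_pos by meson
 have "\<bar>J x\<bar> <= C" for x
  using C(1) C(2)[OF imageI, of x] assms(2)[rule_format, of x] by (cases "norm x \<ge> R") auto
 then show thesis using C that by blast
qed

lemma integrable_conv:
 fixes f :: "'a::euclidean_space => real"
 assumes J: "continuous_on UNIV J" "\<forall>x. R <= norm x --> J x = 0" and f: "integrable lborel f"
 shows "integrable lborel (\<lambda>y. J (x - y) * f y)"
proof -
 obtain C where C: "C > 0" "\<And>x. \<bar>J x\<bar> <= C"
  using smooth_bounded[OF J] by blast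
 have [measurable]: "J \<in> borel_measurable borel" "f \<in> borel_measurable borel"
  using J f by (auto intro: borel_measurable_continuous_onI)
 show ?thesis
 proof (rule bochner_bound)
  show "integrable lborel (\<lambda>y. C * f y)" using f by simp
  show "AE y in lborel. norm (J (x - y) * f y) <= norm (C * f y)"
   using C by (intro AE_I2) (simp add: abs_mult mult_right_mono)
 qed measurable
qed

lemma frechet_vanish:
 fixes J :: "'a::euclidean_space => real"
 assumes "C_diff (Suc 0) J" "\<forall>x. R <= norm x --> J x = 0" "norm x > R"
 shows "frechet_derivative J (at x) b = 0"
proof -
 have "((\<lambda>x. 0) has_derivative (\<lambda>x. 0)) (at x)" by simp
 then have "(J has_derivative (\<lambda>x. 0)) (at x)"
  by (rule has_derivative_transform_within_open[where s="- cball 0 R"])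
   (use assms in auto)
 then show ?thesis by (metis frechet_derivative_at)
qed

text \<open>Compactness gives uniform continuity on the ball of radius R + 1. If one of two points
  at distance less than 1 lies outside that ball, the function vanishes at both.\<close>

lemma uniform_continuous_vanish:
 fixes J :: "'a::euclidean_space => real"
 assumes "continuous_on UNIV J" "\<And>x. norm x > R ==> J x = 0" "e > 0"
 obtains d where "d > 0" "\<And>x y. norm (x - y) < d ==> \<bar>J x - J y\<bar> < e"
proof -
 have "uniformly_continuous_on (cball 0 (R + 1)) J"
  by (intro compact_uniformly_continuous continuous_on_subset[OF assms(1)]) auto
 then obtain d where d: "d > 0" "\<And>x y. x \<in> cball 0 (R + 1) ==> y \<in> cball 0 (R + 1) ==>
   dist y x < d ==> dist (J y) (J x) < e"
  unfolding uniformly_continuous_on_def using \<open>e > 0\<close> by meson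
 have "\<bar>J x - J y\<bar> < e" if "norm (x - y) < min d 1" for x y
 proof (cases "norm x > R + 1 \<or> norm y > R + 1")
  case True
  have "norm x <= norm y + norm (x - y)" "norm y <= norm x + norm (x - y)"
   using norm_triangle_sub[of x y] norm_triangle_sub[of y x] by (simp_all add: norm_minus_commute)
  then have "norm x > R" "norm y > R" using True that by auto
  then show ?thesis using assms by simp
 next
  case False
  then show ?thesis using d(2)[of y x] that by (simp add: dist_norm)
 qed
 then show thesis using d(1) that[of "min d 1"] by simp
qed

text \<open>The mean value inequality is applied to J minus its linear part at z. The derivative of
  this difference is small near z, uniformly in z, by the uniform continuity of the partial
  derivatives.\<close>

lemma C1_uniform_remainder:
 fixes J :: "'a::euclidean_space => real"
 assumes J: "C_diff (Suc 0) J" "\<forall>x. R <= norm x --> J x = 0" and "e > 0"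
 shows "\<exists>d>0. \<forall>z h. norm h < d -->
  \<bar>J (z + h) - J z - (\<Sum>b\<in>Basis. (h \<bullet> b) * frechet_derivative J (at z) b)\<bar> <= e * norm h"
proof -
 define D where "D z h = (\<Sum>b\<in>Basis. (h \<bullet> b) * frechet_derivative J (at z) b)" for z h
 have "\<exists>d>0. \<forall>x y. norm (x - y) < d -->
   \<bar>frechet_derivative J (at x) b - frechet_derivative J (at y) b\<bar> < e / DIM('a)"
  if "b \<in> Basis" for b
 proof -
  have "continuous_on UNIV (\<lambda>x. frechet_derivative J (at x) b)" using J that by auto
  then show ?thesis
   by (rule uniform_continuous_vanish[where R=R and e="e / DIM('a)"])
    (use frechet_vanish[OF J] \<open>e > 0\<close> in \<open>auto\<close>)
 qed
 then obtain d where d: "\<And>b. b \<in> Basis ==> d b > 0" "\<And>b x y. b \<in> Basis ==> norm (x - y) < d b ==>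
   \<bar>frechet_derivative J (at x) b - frechet_derivative J (at y) b\<bar> < e / DIM('a)"
  by metis
 define d0 where "d0 = Min (d ` Basis)"
 have d0: "d0 > 0" "\<And>b. b \<in> Basis ==> d0 <= d b"
  unfolding d0_def using d(1) by auto
 have dD: "(J has_derivative D z) (at z)" for z
 proof -
  have *: "(J has_derivative frechet_derivative J (at z)) (at z)"
   using J by (simp add: frechet_derivative_works)
  have lin: "linear (frechet_derivative J (at z))"
   using * has_derivative_linear by blast
  have "frechet_derivative J (at z) h = D z h" for h
  proof -
   have "frechet_derivative J (at z) (\<Sum>b\<in>Basis. (h \<bullet> b) *\<^sub>R b) = D z h"
    unfolding D_def using lin by (simp add: linear_sum linear_scale)
   then show ?thesis by (simp add: euclidean_representation)
  qed
  then have "frechet_derivative J (at z) = D z" by auto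
  then show ?thesis using * by simp
 qed
 have main: "\<bar>J (z + h) - J z - D z h\<bar> <= e * norm h" if "norm h < d0" for z h
 proof -
  have blD: "bounded_linear (D z)" for z using dD has_derivative_bounded_linear by blast
  define g where "g y = J y - D z y" for y
  have "norm (g (z + h) - g z) <= e * norm (z + h - z)"
  proof (rule differentiable_bound[where S="ball z d0"])
   fix y assume y: "y \<in> ball z d0"
   show "(g has_derivative (\<lambda>k. D y k - D z k)) (at y within ball z d0)"
    unfolding g_def
    by (intro has_derivative_diff has_derivative_at_withinI[OF dD]
      bounded_linear_imp_has_derivative blD)
   show "onorm (\<lambda>k. D y k - D z k) <= e"
   proof (rule onorm_bound)
    fix k
    have "norm (D y k - D z k) = \<bar>\<Sum>b\<in>Basis. (k \<bullet> b) *
      (frechet_derivative J (at y) b - frechet_derivative J (at z) b)\<bar>"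
     by (simp add: D_def sum_subtractf right_diff_distrib)
    also have "... <= (\<Sum>b\<in>Basis. \<bar>(k \<bullet> b) *
      (frechet_derivative J (at y) b - frechet_derivative J (at z) b)\<bar>)"
     by (rule sum_abs)
    also have "... <= (\<Sum>b\<in>(Basis :: 'a set). norm k * (e / DIM('a)))"
    proof (rule sum_mono)
     fix b :: 'a assume b: "b \<in> Basis"
     have "\<bar>frechet_derivative J (at y) b - frechet_derivative J (at z) b\<bar> <= e / DIM('a)"
      using d(2)[OF b, of y z] d0(2)[OF b] y by (simp add: dist_norm norm_minus_commute)
     then show "\<bar>(k \<bullet> b) * (frechet_derivative J (at y) b - frechet_derivative J (at z) b)\<bar>
       <= norm k * (e / DIM('a))"
      unfolding abs_mult by (intro mult_mono) (auto simp: Basis_le_norm b)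
    qed
    also have "... = e * norm k" by simp
    finally show "norm (D y k - D z k) <= e * norm k" .
   qed (use \<open>e > 0\<close> in simp)
  qed (use d0 that in \<open>auto simp: dist_norm\<close>)
  moreover have "D z (z + h) = D z z + D z h" using blD by (simp add: linear_simps)
  ultimately show ?thesis by (simp add: g_def)
 qed
 show ?thesis
  using d0(1) main[unfolded D_def] by (intro exI[of _ d0]) simp
qed

lemma has_derivative_conv:
 fixes f :: "'a::euclidean_space => real"
 assumes J: "C_diff (Suc 0) J" "\<forall>x. R <= norm x --> J x = 0" and f: "integrable lborel f"
 shows "(conv J f has_derivative
  (\<lambda>h. \<Sum>b\<in>Basis. (h \<bullet> b) * conv (\<lambda>x. frechet_derivative J (at x) b) f x)) (at x)"
  (is "(_ has_derivative ?L) _")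
 unfolding has_derivative_at_alt
proof (intro conjI allI impI)
 show "bounded_linear ?L"
  by (intro bounded_linear_sum bounded_linear_mult_const bounded_linear_inner_left)
 fix e :: real assume "e > 0"
 \<comment> \<open>The added 1 keeps \<open>c\<close> positive when \<open>f\<close> vanishes almost
   everywhere.\<close>
 define c where "c = (LBINT y. \<bar>f y\<bar>) + 1"
 have c: "c > 0" unfolding c_def by (simp add: add_nonneg_pos)
 obtain d where d: "d > 0" "\<And>z h. norm h < d ==>
  \<bar>J (z + h) - J z - (\<Sum>b\<in>Basis. (h \<bullet> b) * frechet_derivative J (at z) b)\<bar> <= (e / c) * norm h"
  using C1_uniform_remainder[OF J divide_pos_pos[OF \<open>e > 0\<close> c]] by auto
 have iJ: "integrable lborel (\<lambda>y. J (x - y) * f y)" for x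
  by (rule integrable_conv[OF C_diff_continuous[OF J(1)] J(2) f])
 have iD: "integrable lborel (\<lambda>y. frechet_derivative J (at (x - y)) b * f y)" if "b \<in> Basis" for b x
 proof (rule integrable_conv[where J="\<lambda>z. frechet_derivative J (at z) b" and R="R+1"])
  show "continuous_on UNIV (\<lambda>z. frechet_derivative J (at z) b)" using J(1) that by simp
  show "\<forall>x. R + 1 <= norm x --> frechet_derivative J (at x) b = 0"
   using frechet_vanish[OF J] by simp
 qed (rule f)
 show "\<exists>d>0. \<forall>y. norm (y - x) < d --> norm (conv J f y - conv J f x - ?L (y - x)) <= e * norm (y - x)"
 proof (rule exI[of _ d], intro conjI allI impI)
  show "d > 0" by fact
  fix x' assume x': "norm (x' - x) < d"
  let ?h = "x' - x"
  let ?r = "\<lambda>y. J (x - y + ?h) - J (x - y) - (\<Sum>b\<in>Basis. (?h \<bullet> b) * frechet_derivative J (at (x - y)) b)"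
  have "conv J f x' - conv J f x - ?L ?h = (LBINT y. ?r y * f y)"
  proof -
   have eq: "?r y * f y = J (x' - y) * f y - J (x - y) * f y -
     (\<Sum>b\<in>Basis. (?h \<bullet> b) * (frechet_derivative J (at (x - y)) b * f y))" for y
   proof -
    have "x - y + ?h = x' - y" by simp
    then show ?thesis
     by (simp only: left_diff_distrib sum_distrib_right mult.assoc)
   qed
   have "has_bochner_integral lborel (\<lambda>y. ?r y * f y) (conv J f x' - conv J f x - ?L ?h)"
    unfolding eq conv_def
    by (intro has_bochner_integral_diff has_bochner_integral_sum has_bochner_integral_mult_right
      has_bochner_integral_integrable iJ iD)
   then show ?thesis by (simp only: has_bochner_integral_integral_eq)
  qed
  also have "\<bar>...\<bar> <= (LBINT y. ((e / c) * norm ?h) * \<bar>f y\<bar>)"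
  proof (rule order_trans[OF integral_abs_bound])
   have "\<bar>?r y * f y\<bar> <= (e / c) * norm ?h * \<bar>f y\<bar>" for y
    unfolding abs_mult by (intro mult_right_mono d(2)[OF x']) simp
   then show "(LBINT y. \<bar>?r y * f y\<bar>) <= (LBINT y. ((e / c) * norm ?h) * \<bar>f y\<bar>)"
    using \<open>e > 0\<close> c f by (intro integral_mono_AE' AE_I2) simp_all
  qed
  also have "... = (e / c) * norm ?h * (LBINT y. \<bar>f y\<bar>)" by simp
  also have "... <= (e / c) * norm ?h * c"
   using \<open>e > 0\<close> c by (intro mult_left_mono) (auto simp: c_def)
  also have "... = e * norm ?h" using c by simp
  finally show "norm (conv J f x' - conv J f x - ?L (x' - x)) <= e * norm (x' - x)" by simp
 qed
qed

lemma frechet_conv: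
 fixes f :: "'a::euclidean_space => real"
 assumes J: "C_diff (Suc 0) J" "\<forall>x. R <= norm x --> J x = 0" and f: "integrable lborel f"
  and b: "b \<in> Basis"
 shows "frechet_derivative (conv J f) (at x) b = conv (\<lambda>x. frechet_derivative J (at x) b) f x"
proof -
 have "frechet_derivative (conv J f) (at x) =
  (\<lambda>h. \<Sum>b\<in>Basis. (h \<bullet> b) * conv (\<lambda>x. frechet_derivative J (at x) b) f x)"
  by (rule frechet_derivative_at[OF has_derivative_conv[OF J f], symmetric])
 then show ?thesis using b by (simp add: inner_Basis if_distrib[of "\<lambda>x. x * _"] cong: if_cong)
qed

lemma C_diff_conv:
 fixes f :: "'a::euclidean_space => real"
 assumes f: "integrable lborel f"
 shows "[|\<And>i. C_diff i J; \<forall>x. R <= norm x --> J x = 0|] ==> C_diff j (conv J f)"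
proof (induction j arbitrary: J R)
 case 0
 show ?case
  using has_derivative_conv[OF 0(1) 0(2) f]
  by (auto intro!: continuous_at_imp_continuous_on has_derivative_continuous)
next
 case (Suc j)
 show ?case
 proof (rule C_diff_SucI[OF has_derivative_conv[OF Suc.prems(1,2) f]])
  fix b :: 'a assume b: "b \<in> Basis"
  have "C_diff i (\<lambda>x. frechet_derivative J (at x) b)" for i
   using Suc.prems(1)[of "Suc i"] b by auto
  \<comment> \<open>\<open>frechet_vanish\<close> asks for a norm strictly above R, so the radius
    grows by 1 with each derivative; this is why the induction is over arbitrary R.\<close>
  moreover have "\<forall>x. R + 1 <= norm x --> frechet_derivative J (at x) b = 0"
   using frechet_vanish[OF Suc.prems(1,2)] by simp
  ultimately have "C_diff j (conv (\<lambda>x. frechet_derivative J (at x) b) f)"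
   by (rule Suc.IH)
  then show "C_diff j (\<lambda>x. \<Sum>ba\<in>Basis. (b \<bullet> ba) * conv (\<lambda>x. frechet_derivative J (at x) ba) f x)"
   using b by (simp add: inner_Basis if_distrib[of "\<lambda>x. x * _"] cong: if_cong)
 qed
qed

section \<open>Translation invariance and continuity of translations in L^1 and L^2\<close>

lemma lborel_shift: "distr lborel borel (\<lambda>x. x + c) = (lborel :: 'a::euclidean_space measure)"
 unfolding add.commute[of _ c] by (rule lborel_distr_plus)

lemma lborel_reflect: "distr lborel borel (\<lambda>x. c - x) = (lborel :: 'a::euclidean_space measure)"
 using lborel_affine[of "-1" c] by (simp add: density_1)

lemma nn_integral_shift:
 fixes f :: "'a::euclidean_space => ennreal"
 assumes "f \<in> borel_measurable borel"
 shows "(NNI x. f (x + c)) = (NNI x. f x)"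
 using assms by (subst (2) lborel_shift[of c, symmetric]) (simp add: nn_integral_distr)

lemma nn_integral_reflect:
 fixes f :: "'a::euclidean_space => ennreal"
 assumes "f \<in> borel_measurable borel"
 shows "(NNI x. f (c - x)) = (NNI x. f x)"
 using assms by (subst (2) lborel_reflect[of c, symmetric]) (simp add: nn_integral_distr)

lemma integrable_shift:
 fixes f :: "'a::euclidean_space => real"
 assumes "integrable lborel f"
 shows "integrable lborel (\<lambda>x. f (x + c))"
proof -
 have "integrable (distr lborel borel (\<lambda>x. x + c)) f" using assms by (simp add: lborel_shift)
 then show ?thesis by (subst (asm) integrable_distr_eq) (use assms in auto)
qed

lemma integral_shift:
 fixes f :: "'a::euclidean_space => real"
 assumes "f \<in> borel_measurable borel"
 shows "(LBINT x. f (x + c)) = (LBINT x. f x)"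
 using assms by (subst (2) lborel_shift[of c, symmetric]) (simp add: integral_distr)

lemma integral_reflect:
 fixes f :: "'a::euclidean_space => real"
 assumes "f \<in> borel_measurable borel"
 shows "(LBINT x. f (c - x)) = (LBINT x. f x)"
 using assms by (subst (2) lborel_reflect[of c, symmetric]) (simp add: integral_distr)

lemma integrable_reflect:
 fixes f :: "'a::euclidean_space => real"
 assumes "integrable lborel f"
 shows "integrable lborel (\<lambda>x. f (c - x))"
proof -
 have "integrable (distr lborel borel (\<lambda>x. c - x)) f" using assms by (simp add: lborel_reflect)
 then show ?thesis by (subst (asm) integrable_distr_eq) (use assms in auto)
qed

text \<open>Dominated convergence yields limits along sequences; this converts them into the uniform
  smallness for all short shifts that the mollification argument consumes.\<close>

lemma eps_delta_from_sequences:
 fixes F :: "'a::real_normed_vector => real"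
 assumes "\<And>h. h \<longlonglongrightarrow> 0 ==> (\<lambda>n. F (h n)) \<longlonglongrightarrow> 0" and "e > 0"
 shows "\<exists>d>0. \<forall>h. norm h < d --> F h < e"
proof (rule ccontr)
 assume "\<not> ?thesis"
 then have *: "\<exists>h. norm h < 1 / (real n + 1) \<and> F h \<ge> e" for n
  by (metis not_le zero_less_divide_1_iff add_pos_nonneg zero_less_one of_nat_0_le_iff add.commute)
 define h where "h n = (SOME h. norm h < 1 / (real n + 1) \<and> F h \<ge> e)" for n
 have h: "norm (h n) < 1 / (real n + 1)" "F (h n) \<ge> e" for n
  unfolding h_def using someI_ex[OF *[of n]] by auto
 have "h \<longlonglongrightarrow> 0"
 proof (rule Lim_null_comparison)
  show "(\<lambda>n. 1 / (real n + 1)) \<longlonglongrightarrow> 0" using LIMSEQ_inverse_real_of_nat by (simp add: inverse_eq_divide add.commute)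
  show "\<forall>\<^sub>F n in sequentially. norm (h n) <= 1 / (real n + 1)"
   using h(1) by (simp add: less_imp_le add.commute)
 qed
 then have "(\<lambda>n. F (h n)) \<longlonglongrightarrow> 0" by (rule assms(1))
 then have "\<forall>\<^sub>F n in sequentially. F (h n) < e" using \<open>e > 0\<close> order_tendstoD(2) by blast
 then show False using h(2) by (auto simp: eventually_sequentially not_less[symmetric])
qed

text \<open>A point of the open set U stays in U under small shifts, so the positive part of 1_U(x)
  - 1_U(x + h) tends to 0 pointwise and is dominated by 1_U. The difference itself has integral
  zero, so its absolute value integrates to twice the positive part.\<close>

lemma translation_continuous_open:
 fixes U :: "'a::euclidean_space set"
 assumes U: "open U" "emeasure lborel U < \<infinity>" and e: "e > 0"
 shows "\<exists>d>0. \<forall>h. norm h < d --> (LBINT x. \<bar>indicator U (x + h) - indicator U x\<bar>) < (e::real)"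
proof (rule eps_delta_from_sequences[OF _ e])
 fix h :: "nat => 'a" assume h: "h \<longlonglongrightarrow> 0"
 let ?u = "indicator U :: 'a => real"
 have [measurable]: "U \<in> sets borel" using U by simp
 have iU: "integrable lborel ?u" using U by (simp add: integrable_indicator_iff)
 have iUh: "integrable lborel (\<lambda>x. ?u (x + h n))" for n by (rule integrable_shift[OF iU])
 have "(\<lambda>n. LBINT x. max 0 (?u x - ?u (x + h n))) \<longlonglongrightarrow> (\<integral>x. (0::real) \<partial>(lborel :: 'a measure))"
 proof (rule integral_dominated_convergence[where w="?u"])
  show "AE x in lborel. (\<lambda>n. max 0 (?u x - ?u (x + h n))) \<longlonglongrightarrow> 0"
  proof (rule AE_I2)
   fix x
   show "(\<lambda>n. max 0 (?u x - ?u (x + h n))) \<longlonglongrightarrow> 0"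
   proof (cases "x \<in> U")
    case True
    have "(\<lambda>n. x + h n) \<longlonglongrightarrow> x" using tendsto_add[OF tendsto_const h, of x] by simp
    then have "\<forall>\<^sub>F n in sequentially. x + h n \<in> U"
     using U(1) True topological_tendstoD by blast
    then have "\<forall>\<^sub>F n in sequentially. max 0 (?u x - ?u (x + h n)) = 0"
     by eventually_elim (use True in simp)
    then show ?thesis by (rule tendsto_eventually)
   next
    case False
    then have "max 0 (?u x - ?u (x + h n)) = 0" for n by simp
    then show ?thesis by simp
   qed
  qed
 qed (use iU in \<open>auto split: split_indicator\<close>)
 moreover have "(LBINT x. \<bar>?u (x + h n) - ?u x\<bar>) = 2 * (LBINT x. max 0 (?u x - ?u (x + h n)))" for n
 proof -
  have i: "integrable lborel (\<lambda>x. max 0 (?u x - ?u (x + h n)))"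
   using iU iUh by (intro integrable_max) auto
  have "(LBINT x. \<bar>?u (x + h n) - ?u x\<bar>) =
   (LBINT x. 2 * max 0 (?u x - ?u (x + h n)) + (?u (x + h n) - ?u x))"
   by (rule bochner_cong) (auto simp: max_def split: split_indicator)
  also have "... = 2 * (LBINT x. max 0 (?u x - ?u (x + h n))) +
    ((LBINT x. ?u (x + h n)) - (LBINT x. ?u x))"
   using i iU iUh by simp
  also have "(LBINT x. ?u (x + h n)) = (LBINT x. ?u x)" by (rule integral_shift) simp
  finally show ?thesis by simp
 qed
 ultimately show "(\<lambda>n. LBINT x. \<bar>?u (x + h n) - ?u x\<bar>) \<longlonglongrightarrow> 0"
  using tendsto_mult_right_zero[of _ sequentially 2] by simp
qed

text \<open>Replacing f by g costs their L^1 distance twice, once for f and once for its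
  translate.\<close>

lemma L1_diff_triangle:
 fixes f g :: "'a::euclidean_space => real"
 assumes f: "integrable lborel f" and g: "integrable lborel g"
 shows "(LBINT x. \<bar>f (x + h) - f x\<bar>) <=
  (LBINT x. \<bar>g (x + h) - g x\<bar>) + 2 * (LBINT x. \<bar>f x - g x\<bar>)"
proof -
 have i: "integrable lborel (\<lambda>x. \<bar>g (x + h) - g x\<bar>)" "integrable lborel (\<lambda>x. \<bar>f x - g x\<bar>)"
  "integrable lborel (\<lambda>x. \<bar>f (x + h) - f x\<bar>)" "integrable lborel (\<lambda>x. \<bar>f (x + h) - g (x + h)\<bar>)"
  using f g integrable_shift[OF f] integrable_shift[OF g] by auto
 have "(LBINT x. \<bar>f (x + h) - f x\<bar>) <=
  (LBINT x. \<bar>f (x + h) - g (x + h)\<bar> + (\<bar>g (x + h) - g x\<bar> + \<bar>f x - g x\<bar>))"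
  by (intro integral_mono Bochner_Integration.integrable_add i) linarith
 also have "... = (LBINT x. \<bar>f (x + h) - g (x + h)\<bar>) +
   ((LBINT x. \<bar>g (x + h) - g x\<bar>) + (LBINT x. \<bar>f x - g x\<bar>))"
  using i by simp
 also have "(LBINT x. \<bar>f (x + h) - g (x + h)\<bar>) = (LBINT x. \<bar>f x - g x\<bar>)"
  using integral_shift[of "\<lambda>x. \<bar>f x - g x\<bar>" h] f g by simp
 finally show ?thesis by simp
qed

text \<open>Outer regularity reduces indicators of Borel sets to open sets; sums are immediate, and
  L^1 limits are covered by \<open>L1_diff_triangle\<close>.\<close>

proposition translation_continuous_L1:
 fixes f :: "'a::euclidean_space => real"
 assumes "integrable lborel f" and "e > 0"
 shows "\<exists>d>0. \<forall>h. norm h < d --> (LBINT x. \<bar>f (x + h) - f x\<bar>) < e"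
 using assms
proof (induction f arbitrary: e rule: integrable_induct)
 case (base A c)
 show ?case
 proof (cases "c = 0")
  case True
  then show ?thesis using base(3) by (auto intro: exI[of _ 1])
 next
  case False
  \<comment> \<open>The shift of U costs less than e', the passage from A to U at most twice e'; the
    total stays below 4 e'.\<close>
  define e' where "e' = e / (4 * \<bar>c\<bar>)"
  have e': "e' > 0" using base(3) False by (simp add: e'_def)
  have A[measurable]: "A \<in> sets borel" using base by simp
  obtain U where U: "open U" "A \<subseteq> U" "emeasure lborel (U - A) < ennreal e'"
   using outer_regular_lborel[OF A e'] by metis
  have [measurable]: "U \<in> sets borel" using U by simp
  have "emeasure lborel U <= emeasure lborel A + emeasure lborel (U - A)"
   by (rule order_trans[OF emeasure_mono[of U "A \<union> (U - A)"] emeasure_subadditive]) auto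
  then have fU: "emeasure lborel U < \<infinity>"
   using base(2) U(3) by (metis ennreal_add_less_top ennreal_less_top infinity_ennreal_def le_less_trans less_trans)
  obtain d where d: "d > 0" "\<And>h. norm h < d ==>
    (LBINT x. \<bar>indicator U (x + h) - indicator U x\<bar>) < e'"
   using translation_continuous_open[OF U(1) fU e'] by auto
  have iA: "integrable lborel (indicator A :: 'a => real)" and iU: "integrable lborel (indicator U :: 'a => real)"
   using base(2) fU by (simp_all add: integrable_indicator_iff)
  have AU: "(LBINT x. \<bar>indicator A x - indicator U x\<bar>) <= e'"
  proof -
   have "(LBINT x. \<bar>indicator A x - indicator U x :: real\<bar>) = (LBINT x. indicator (U - A) x)"
    by (rule bochner_cong) (use U(2) in \<open>auto split: split_indicator\<close>)
   also have "... = measure lborel (U - A)" by simp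
   also have "... <= e'" using U(3) e' by (simp add: measure_def enn2real_leI less_imp_le)
   finally show ?thesis .
  qed
  show ?thesis
  proof (rule exI[of _ d], intro conjI allI impI)
   show "d > 0" by fact
   fix h :: 'a assume h: "norm h < d"
   have "(LBINT x. \<bar>indicator A (x + h) - indicator A x\<bar>) < 4 * e'"
    using L1_diff_triangle[OF iA iU, of h] AU d(2)[OF h] e' by linarith
   then have "\<bar>c\<bar> * (LBINT x. \<bar>indicator A (x + h) - indicator A x\<bar>) < \<bar>c\<bar> * (4 * e')"
    using False by simp
   also have "... = e" using False by (simp add: e'_def)
   also have "\<bar>c\<bar> * (LBINT x. \<bar>indicator A (x + h) - indicator A x\<bar>) =
    (LBINT x. \<bar>indicator A (x + h) *\<^sub>R c - indicator A x *\<^sub>R c\<bar>)"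
    unfolding integral_mult_right_zero[symmetric]
    by (rule bochner_cong) (auto simp: abs_mult[symmetric] algebra_simps)
   finally show "(LBINT x. \<bar>indicator A (x + h) *\<^sub>R c - indicator A x *\<^sub>R c\<bar>) < e" .
  qed
 qed
next
 case (add f g)
 obtain d1 where d1: "d1 > 0" "\<And>h. norm h < d1 ==> (LBINT x. \<bar>f (x + h) - f x\<bar>) < e / 2"
  using add.IH(1)[of "e/2"] add.prems by auto
 obtain d2 where d2: "d2 > 0" "\<And>h. norm h < d2 ==> (LBINT x. \<bar>g (x + h) - g x\<bar>) < e / 2"
  using add.IH(2)[of "e/2"] add.prems by auto
 show ?case
 proof (rule exI[of _ "min d1 d2"], intro conjI allI impI)
  show "0 < min d1 d2" using d1 d2 by simp
  fix h :: 'a assume h: "norm h < min d1 d2"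
  have i: "integrable lborel (\<lambda>x. \<bar>f (x + h) - f x\<bar>)" "integrable lborel (\<lambda>x. \<bar>g (x + h) - g x\<bar>)"
   "integrable lborel (\<lambda>x. \<bar>f (x + h) + g (x + h) - (f x + g x)\<bar>)"
   using add.hyps integrable_shift[OF add.hyps(1)] integrable_shift[OF add.hyps(2)] by auto
  have "(LBINT x. \<bar>f (x + h) + g (x + h) - (f x + g x)\<bar>) <=
    (LBINT x. \<bar>f (x + h) - f x\<bar> + \<bar>g (x + h) - g x\<bar>)"
   by (intro integral_mono Bochner_Integration.integrable_add i) linarith
  also have "... = (LBINT x. \<bar>f (x + h) - f x\<bar>) + (LBINT x. \<bar>g (x + h) - g x\<bar>)"
   using i by simp
  finally show "(LBINT x. \<bar>f (x + h) + g (x + h) - (f x + g x)\<bar>) < e"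
   using d1(2)[of h] d2(2)[of h] h by simp
 qed
next
 case (lim f s)
 have "(\<lambda>i. LBINT x. \<bar>f x - s i x\<bar>) \<longlonglongrightarrow> (\<integral>x. 0 \<partial>(lborel :: 'a measure))"
 \<comment> \<open>The approximating sequence satisfies |s_i| <= 2 |f|, which explains the factor
   3.\<close>
 proof (rule integral_dominated_convergence[where w="\<lambda>x. 3 * \<bar>f x\<bar>"])
  show "AE x in lborel. (\<lambda>i. \<bar>f x - s i x\<bar>) \<longlonglongrightarrow> 0"
  proof (rule AE_I2)
   fix x :: 'a
   have "(\<lambda>i. s i x) \<longlonglongrightarrow> f x" using lim by simp
   then have "(\<lambda>i. \<bar>f x - s i x\<bar>) \<longlonglongrightarrow> \<bar>f x - f x\<bar>" by (intro tendsto_intros)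
   then show "(\<lambda>i. \<bar>f x - s i x\<bar>) \<longlonglongrightarrow> 0" by simp
  qed
  show "AE x in lborel. norm \<bar>f x - s i x\<bar> <= 3 * \<bar>f x\<bar>" for i
  proof (rule AE_I2)
   fix x :: 'a
   have "norm (s i x) <= 2 * norm (f x)" using lim by simp
   then show "norm \<bar>f x - s i x\<bar> <= 3 * \<bar>f x\<bar>" by simp
  qed
 qed (use lim in auto)
 then have "\<forall>\<^sub>F i in sequentially. (LBINT x. \<bar>f x - s i x\<bar>) < e / 4"
  using lim.prems by (intro order_tendstoD(2)) auto
 then obtain i where i: "(LBINT x. \<bar>f x - s i x\<bar>) < e / 4"
  by (auto simp: eventually_sequentially)
 obtain d where d: "d > 0" "\<And>h. norm h < d ==> (LBINT x. \<bar>s i (x + h) - s i x\<bar>) < e / 2"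
  using lim.IH(1)[of "e/2" i] lim.prems by auto
 show ?case
 proof (rule exI[of _ d], intro conjI allI impI)
  fix h :: 'a assume "norm h < d"
  then show "(LBINT x. \<bar>f (x + h) - f x\<bar>) < e"
   using d(2)[of h] i L1_diff_triangle[OF lim.hyps(4) lim.hyps(1), of h i] by linarith
 qed (rule d(1))
qed

text \<open>Positive and negative parts are separated because (p - q)^2 <= |p^2 - q^2| requires p, q
  >= 0.\<close>

lemma sq_diff_le_parts:
 fixes a b :: real
 shows "(a - b)\<^sup>2 <= 2 * \<bar>(max a 0)\<^sup>2 - (max b 0)\<^sup>2\<bar> + 2 * \<bar>(max (- a) 0)\<^sup>2 - (max (- b) 0)\<^sup>2\<bar>"
proof -
 have *: "(p - q)^2 <= \<bar>p^2 - q^2\<bar>" if "p \<ge> 0" "q \<ge> 0" for p q :: real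
 proof -
  have "(p - q)^2 = \<bar>p - q\<bar> * \<bar>p - q\<bar>" by (simp add: power2_eq_square)
  also have "... <= \<bar>p - q\<bar> * \<bar>p + q\<bar>" using that by (intro mult_left_mono) auto
  also have "... = \<bar>p^2 - q^2\<bar>" by (simp add: power2_eq_square algebra_simps flip: abs_mult)
  finally show ?thesis .
 qed
 have "(x - y)^2 <= 2 * x^2 + 2 * y^2" for x y :: real
  using sum_squares_bound[of x "-y"] by (simp add: power2_diff)
 from this[of "max a 0 - max b 0" "max (- a) 0 - max (- b) 0"]
 have "(a - b)\<^sup>2 <= 2 * (max a 0 - max b 0)\<^sup>2 + 2 * (max (- a) 0 - max (- b) 0)\<^sup>2"
  by (simp add: max_def split: if_splits)
 then show ?thesis
  using *[of "max a 0" "max b 0"] *[of "max (- a) 0" "max (- b) 0"] by simp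
qed

text \<open>\<open>(a - b)\<^sup>2 \<le> \<bar>a\<^sup>2 - b\<^sup>2\<bar>\<close> for \<open>a, b \<ge> 0\<close> reduces \<open>L\<^sup>2\<close> to \<open>L\<^sup>1\<close>.\<close>

proposition translation_continuous_L2:
 fixes f :: "'a::euclidean_space => real"
 assumes f[measurable]: "f \<in> borel_measurable borel" "integrable lborel (\<lambda>x. (f x)^2)" and e: "e > 0"
 shows "\<exists>d>0. \<forall>h. norm h < d --> (NNI x. ennreal ((f (x + h) - f x)^2)) <= ennreal e"
proof -
 let ?p = "\<lambda>x. (max (f x) 0)\<^sup>2" and ?q = "\<lambda>x. (max (- f x) 0)\<^sup>2"
 have ip: "integrable lborel ?p" and iq: "integrable lborel ?q"
  by (rule bochner_bound[OF f(2)], simp, rule AE_I2, simp add: max_def)+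
 obtain d1 where d1: "d1 > 0" "\<And>h. norm h < d1 ==> (LBINT x. \<bar>?p (x + h) - ?p x\<bar>) < e / 4"
  using translation_continuous_L1[OF ip, of "e/4"] e by auto
 obtain d2 where d2: "d2 > 0" "\<And>h. norm h < d2 ==> (LBINT x. \<bar>?q (x + h) - ?q x\<bar>) < e / 4"
  using translation_continuous_L1[OF iq, of "e/4"] e by auto
 show ?thesis
 proof (rule exI[of _ "min d1 d2"], intro conjI allI impI)
  show "0 < min d1 d2" using d1 d2 by simp
  fix h :: 'a assume h: "norm h < min d1 d2"
  have i: "integrable lborel (\<lambda>x. 2 * \<bar>?p (x + h) - ?p x\<bar> + 2 * \<bar>?q (x + h) - ?q x\<bar>)"
   using integrable_shift[OF ip, of h] integrable_shift[OF iq, of h] ip iq by auto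
  have "(NNI x. ennreal ((f (x + h) - f x)^2)) <=
   (NNI x. ennreal (2 * \<bar>?p (x + h) - ?p x\<bar> + 2 * \<bar>?q (x + h) - ?q x\<bar>))"
   by (intro nn_integral_mono ennreal_leI sq_diff_le_parts)
  also have "... = ennreal (LBINT x. 2 * \<bar>?p (x + h) - ?p x\<bar> + 2 * \<bar>?q (x + h) - ?q x\<bar>)"
   by (rule nn_integral_eq_integral[OF i]) simp
  also have "(LBINT x. 2 * \<bar>?p (x + h) - ?p x\<bar> + 2 * \<bar>?q (x + h) - ?q x\<bar>) =
    2 * (LBINT x. \<bar>?p (x + h) - ?p x\<bar>) + 2 * (LBINT x. \<bar>?q (x + h) - ?q x\<bar>)"
   using integrable_shift[OF ip, of h] integrable_shift[OF iq, of h] ip iq by simp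
  also have "ennreal ... <= ennreal e"
   using d1(2)[of h] d2(2)[of h] h by (intro ennreal_leI) simp
  finally show "(NNI x. ennreal ((f (x + h) - f x)^2)) <= ennreal e" .
 qed
qed

text \<open>Expand the nonnegative integral of J (g - c)^2, where c is the J-mean of g. The
  right-hand side is an extended integral, so the case of an infinite second moment is
  trivial.\<close>

lemma jensen_square:
 fixes J g :: "'a::euclidean_space => real"
 assumes [measurable]: "J \<in> borel_measurable borel" "g \<in> borel_measurable borel"
  and J: "\<And>x. J x \<ge> 0" "integrable lborel J" "(LBINT x. J x) = 1"
  and i: "integrable lborel (\<lambda>x. J x * g x)"
 shows "ennreal ((LBINT x. J x * g x)^2) <= (NNI x. ennreal (J x * (g x)^2))"
proof (cases "integrable lborel (\<lambda>x. J x * (g x)^2)")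
 case True
 define c where "c = (LBINT x. J x * g x)"
 have "0 <= (LBINT x. J x * (g x - c)^2)"
  using J(1) by (intro bochner_nonneg) simp
 also have "... = (LBINT x. J x * (g x)^2 - 2 * c * (J x * g x) + c^2 * J x)"
  by (rule bochner_cong) (simp_all add: power2_eq_square algebra_simps)
 also have "... = (LBINT x. J x * (g x)^2) - c^2"
  using True i J by (simp add: power2_eq_square flip: c_def)
 finally have "ennreal (c^2) <= ennreal (LBINT x. J x * (g x)^2)"
  by (intro ennreal_leI) simp
 then show ?thesis
  using True J by (subst nn_integral_eq_integral) (auto simp: c_def)
next
 case False
 then have "(NNI x. ennreal (J x * (g x)^2)) = \<infinity>"
  using J(1) unfolding integrable_iff_bounded by (simp add: abs_mult not_less top_unique)
 then show ?thesis by simp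
qed


section \<open>Mollifiers and approximation in L^2\<close>

definition mollifier :: "real => 'a::euclidean_space => real" where
 "mollifier r x = bump 0 (r^2 - x \<bullet> x) / (\<integral>y. bump 0 (r^2 - y \<bullet> y) \<partial>(lborel :: 'a measure))"

lemma C_diff_inner_self: "C_diff j (\<lambda>x::'a::euclidean_space. x \<bullet> x)"
proof -
 have "C_diff j (\<lambda>x::'a. \<Sum>b\<in>Basis. (x \<bullet> b) * (x \<bullet> b))"
  by (rule C_diff_sum, rule C_diff_mult; rule C_diff_bounded_linear, rule bounded_linear_inner_left)
 moreover have "(\<lambda>x::'a. x \<bullet> x) = (\<lambda>x. \<Sum>b\<in>Basis. (x \<bullet> b) * (x \<bullet> b))"
  by (rule ext) (rule euclidean_inner)
 ultimately show ?thesis by simp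
qed

lemma C_diff_radial_bump: "C_diff j (\<lambda>x::'a::euclidean_space. bump n (a - b * (x \<bullet> x)))"
proof (rule C_diff_bump)
 fix i
 have "C_diff i (\<lambda>x::'a. a + (- b) * (x \<bullet> x))"
  by (rule C_diff_add[OF C_diff_const C_diff_mult[OF C_diff_const C_diff_inner_self]])
 then show "C_diff i (\<lambda>x::'a. a - b * (x \<bullet> x))" by simp
qed

text \<open>The profile is positive on the open ball of radius r, which is not a null set; hence the
  normalising integral cannot vanish.\<close>

lemma mollifier_mass_pos:
 assumes "r > 0"
 shows "integrable lborel (\<lambda>x::'a::euclidean_space. bump 0 (r^2 - x \<bullet> x))"
  and "(\<integral>y. bump 0 (r^2 - y \<bullet> y) \<partial>(lborel :: 'a measure)) > 0"
proof -
 let ?b = "\<lambda>x::'a. bump 0 (r^2 - x \<bullet> x)"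
 have cont: "continuous_on UNIV ?b" using C_diff_continuous[OF C_diff_radial_bump[of 0 0 "r^2" 1]] by simp
 have [measurable]: "?b \<in> borel_measurable borel" by (rule borel_measurable_continuous_onI[OF cont])
 have sq: "x \<bullet> x \<ge> r^2" if "norm x \<ge> r" for x :: 'a
  using that assms power_mono[of r "norm x" 2] by (simp add: power2_norm_eq_inner)
 have sq': "x \<bullet> x < r^2" if "norm x < r" for x :: 'a
  using that power_strict_mono[of "norm x" r 2] by (simp add: power2_norm_eq_inner)
 show i: "integrable lborel ?b"
 proof (rule bochner_bound)
  show "integrable lborel (indicator (cball 0 r) :: 'a => real)"
   using emeasure_bounded_finite[of "cball (0::'a) r"] by (simp add: integrable_indicator_iff)
  show "AE x in lborel. norm (?b x) <= norm (indicator (cball 0 r) x :: real)"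
   using sq bump_le_0 bump_0_le_1 bump_nonneg by (intro AE_I2) (auto split: split_indicator)
 qed simp
 have "(LBINT x. ?b x) \<noteq> 0"
 proof
  assume "(LBINT x. ?b x) = 0"
  then have "AE x in lborel. ?b x = 0"
   using integral_nonneg_eq_0_iff_AE[OF i] bump_nonneg by auto
  then have "AE x in lborel. x \<notin> ball (0::'a) r"
  proof eventually_elim
   case (elim x)
   then have "\<not> 0 < r^2 - x \<bullet> x" using bump_pos_iff[of 0 "r^2 - x \<bullet> x"] by simp
   then show ?case using sq'[of x] by auto
  qed
  then have "ball (0::'a) r \<in> null_sets lborel"
   by (simp add: AE_iff_null_sets)
  then show False
   using content_ball_gt_0_iff[of "0::'a" r] assms by (simp add: null_sets_def measure_def)
 qed
 moreover have "(LBINT x. ?b x) \<ge> 0" by (simp add: bump_nonneg)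
 ultimately show "(LBINT x. ?b x) > 0" by simp
qed

lemma mollifier:
 assumes r: "r > 0"
 shows mollifier_smooth: "C_diff j (mollifier r :: 'a::euclidean_space => real)"
  and mollifier_vanish: "\<forall>x::'a. r <= norm x --> mollifier r x = 0"
  and mollifier_nonneg: "mollifier r (x::'a) \<ge> 0"
  and mollifier_integrable: "integrable lborel (mollifier r :: 'a => real)"
  and mollifier_integral: "(LBINT x. mollifier r (x::'a)) = 1"
  and mollifier_measurable: "(mollifier r :: 'a => real) \<in> borel_measurable borel"
  and mollifier_symmetric: "mollifier r (- x) = mollifier r (x::'a)"
proof -
 let ?c = "\<integral>y. bump 0 (r^2 - y \<bullet> y) \<partial>(lborel :: 'a measure)"
 have eq: "mollifier r = (\<lambda>x::'a. (1 / ?c) * bump 0 (r^2 - 1 * (x \<bullet> x)))"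
  by (simp add: mollifier_def fun_eq_iff)
 show sm: "C_diff j (mollifier r :: 'a => real)" for j
  unfolding eq by (rule C_diff_mult[OF C_diff_const C_diff_radial_bump])
 show "mollifier r x \<ge> 0" using mollifier_mass_pos(2)[OF r, where 'a='a] by (simp add: mollifier_def bump_nonneg)
 show "\<forall>x::'a. r <= norm x --> mollifier r x = 0"
 proof (intro allI impI)
  fix x :: 'a assume "r <= norm x"
  then have "r^2 <= x \<bullet> x" using r power_mono[of r "norm x" 2] by (simp add: power2_norm_eq_inner)
  then show "mollifier r x = 0" by (simp add: mollifier_def bump_le_0)
 qed
 show "integrable lborel (mollifier r :: 'a => real)"
  unfolding eq using mollifier_mass_pos(1)[OF r, where 'a='a] by simp
 show "(LBINT x. mollifier r (x::'a)) = 1"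
  unfolding eq using mollifier_mass_pos(2)[OF r, where 'a='a] by simp
 show "(mollifier r :: 'a => real) \<in> borel_measurable borel"
  by (rule borel_measurable_continuous_onI[OF C_diff_continuous[OF sm]])
 show "mollifier r (- x) = mollifier r x" by (simp add: mollifier_def)
qed

text \<open>By Jensen's inequality with the weight J(x - .) and by Fubini, the squared error is at
  most an average over |h| < r of the squared L^2 distance between f and its translate by h.\<close>

proposition mollify_L2:
 fixes f :: "'a::euclidean_space => real"
 assumes f[measurable]: "f \<in> borel_measurable borel" and f1: "integrable lborel f"
  and f2: "integrable lborel (\<lambda>x. (f x)^2)" and e: "e > 0"
 shows "\<exists>r0>0. \<forall>r. 0 < r \<and> r < r0 -->
  (NNI x. ennreal ((conv (mollifier r) f x - f x)^2)) <= ennreal e"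
proof -
 obtain d where d: "d > 0" "\<And>h. norm h < d ==>
   (NNI x. ennreal ((f (x + h) - f x)^2)) <= ennreal e"
  using translation_continuous_L2[OF f(1) f2 e] by auto
 have "(NNI x. ennreal ((conv (mollifier r) f x - f x)^2)) <= ennreal e"
  if r: "0 < r" "r < d" for r
 proof -
  let ?J = "mollifier r :: 'a => real"
  note J = mollifier[OF r(1), where 'a='a]
  note [measurable] = J(6)
  have iJx: "integrable lborel (\<lambda>y. ?J (x - y))" for x by (rule integrable_reflect[OF J(4)])
  have iJf: "integrable lborel (\<lambda>y. ?J (x - y) * f y)" for x
   by (rule integrable_conv[OF C_diff_continuous[OF J(1)[of 0]] J(2) f1])
  have one: "(LBINT y. ?J (x - y)) = 1" for x
   using integral_reflect[of ?J x] J(5) by simp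
  have "ennreal ((conv ?J f x - f x)^2) <= (NNI y. ennreal (?J (x - y) * (f y - f x)^2))" for x
  proof -
   have "conv ?J f x - f x = (LBINT y. ?J (x - y) * (f y - f x))"
    unfolding conv_def right_diff_distrib using iJx iJf one by simp
   moreover have "integrable lborel (\<lambda>y. ?J (x - y) * (f y - f x))"
    unfolding right_diff_distrib using iJx iJf by simp
   ultimately show ?thesis
    using jensen_square[of "\<lambda>y. ?J (x - y)" "\<lambda>y. f y - f x"] J(3) iJx one by simp
  qed
  then have "(NNI x. ennreal ((conv ?J f x - f x)^2)) <=
   (NNI x. NNI y. ennreal (?J (x - y) * (f y - f x)^2))"
   by (intro nn_integral_mono)
  also have "... = (NNI x. NNI h. ennreal (?J h * (f (x + h) - f x)^2))"
  proof (rule nn_integral_cong)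
   fix x
   have "(NNI y. ennreal (?J (x - y) * (f y - f x)^2)) =
    (NNI h. ennreal (?J (x - (h + x)) * (f (h + x) - f x)^2))"
    by (rule nn_integral_shift[symmetric]) simp
   then show "(NNI y. ennreal (?J (x - y) * (f y - f x)^2)) =
    (NNI h. ennreal (?J h * (f (x + h) - f x)^2))"
    by (simp add: J(7) add.commute)
  qed
  also have "... = (NNI h. NNI x. ennreal (?J h * (f (x + h) - f x)^2))"
   by (rule lborel_pair.Fubini'[symmetric]) simp
  also have "... <= (NNI h. ennreal (?J h) * ennreal e)"
  proof (rule nn_integral_mono)
   fix h :: 'a
   show "(NNI x. ennreal (?J h * (f (x + h) - f x)^2)) <= ennreal (?J h) * ennreal e"
   proof (cases "norm h < d")
    case True
    have "(NNI x. ennreal (?J h * (f (x + h) - f x)^2)) =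
     ennreal (?J h) * (NNI x. ennreal ((f (x + h) - f x)^2))"
     using J(3) by (simp add: ennreal_mult nn_integral_cmult)
    then show ?thesis using d(2)[OF True] by (simp add: mult_left_mono)
   next
    case False
    then have "?J h = 0" using J(2) r by simp
    then show ?thesis by simp
   qed
  qed
  also have "... = (NNI h. ennreal (?J h)) * ennreal e"
   by (rule nn_integral_multc) simp
  also have "(NNI h. ennreal (?J h)) = 1"
   using nn_integral_eq_integral[OF J(4)] J(3,5) by simp
  finally show ?thesis by simp
 qed
 then show ?thesis using d(1) by blast
qed

lemma sq_add_le: "(a + b :: real)^2 <= 2 * a^2 + 2 * b^2"
 using sum_squares_bound[of a b] by (simp add: power2_sum)

text \<open>Passing to a fast subsequence makes the mollifications dominated in \<open>L\<^sup>2\<close>.\<close>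

proposition mollify_dominated_sequence:
 fixes f :: "'c => 'a::euclidean_space => real"
 assumes I: "finite I"
  and meas[measurable]: "\<And>a. f a \<in> borel_measurable borel"
  and f1: "\<And>a. a \<in> I ==> integrable lborel (f a)"
  and f2: "\<And>a. a \<in> I ==> integrable lborel (\<lambda>x. (f a x)^2)" and \<delta>: "\<delta> > 0"
 obtains r :: "nat => real" and W where "\<And>n. 0 < r n" "\<And>n. r n < \<delta>" "integrable lborel W"
  "AE x in lborel. \<forall>a\<in>I. (\<lambda>n. conv (mollifier (r n)) (f a) x) \<longlonglongrightarrow> f a x"
  "AE x in lborel. \<forall>a\<in>I. \<forall>n. (conv (mollifier (r n)) (f a) x)^2 <= W x"
proof -
 \<comment> \<open>Each function of the family may use the share 1/c of the error (1/2)^n; the added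
   1 keeps c positive for empty I.\<close>
 define c where "c = real (card I) + 1"
 have c: "c > 0" by (simp add: c_def add_nonneg_pos)
 have "\<exists>r. 0 < r \<and> r < \<delta> \<and> (\<forall>a\<in>I. (NNI x. ennreal ((conv (mollifier r) (f a) x - f a x)^2)) <=
   ennreal ((1/2)^n / c))" for n :: nat
 proof -
  have "\<exists>r0. \<forall>a\<in>I. r0 a > 0 \<and> (\<forall>r. 0 < r \<and> r < r0 a -->
   (NNI x. ennreal ((conv (mollifier r) (f a) x - f a x)^2)) <= ennreal ((1/2)^n / c))"
  proof (rule bchoice, rule ballI)
   fix a assume a: "a \<in> I"
   have "(1/2)^n / c > 0" using c by simp
   from mollify_L2[OF meas f1[OF a] f2[OF a] this]
   show "\<exists>y>0. \<forall>r. 0 < r \<and> r < y -->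
    (NNI x. ennreal ((conv (mollifier r) (f a) x - f a x)^2)) <= ennreal ((1/2)^n / c)" .
  qed
  then obtain r0 where r0: "\<And>a. a \<in> I ==> r0 a > 0" "\<And>a r. a \<in> I ==> 0 < r ==> r < r0 a ==>
   (NNI x. ennreal ((conv (mollifier r) (f a) x - f a x)^2)) <= ennreal ((1/2)^n / c)"
   by meson
  define m where "m = Min (insert \<delta> (r0 ` I))"
  have m: "m > 0" "m <= \<delta>" "\<And>a. a \<in> I ==> m <= r0 a"
   using I r0(1) \<delta> by (auto simp: m_def)
  show ?thesis
  proof (intro exI[of _ "m/2"] conjI ballI)
   fix a assume "a \<in> I"
   then show "(NNI x. ennreal ((conv (mollifier (m/2)) (f a) x - f a x)^2)) <= ennreal ((1/2)^n / c)"
    using m(1) m(3)[of a] by (intro r0(2)) auto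
  qed (use m in auto)
 qed
 then obtain r :: "nat => real" where r: "\<And>n. 0 < r n" "\<And>n. r n < \<delta>" "\<And>n a. a \<in> I ==>
  (NNI x. ennreal ((conv (mollifier (r n)) (f a) x - f a x)^2)) <= ennreal ((1/2)^n / c)"
  by metis
 have mc: "conv (mollifier (r n)) (f a) \<in> borel_measurable borel" if "a \<in> I" for n a
  by (rule borel_measurable_continuous_onI, rule C_diff_continuous[of 0], rule C_diff_conv[OF f1[OF that]])
   (rule mollifier_smooth[OF r(1)] mollifier_vanish[OF r(1)])+
 define D where "D n x = (\<Sum>a\<in>I. (conv (mollifier (r n)) (f a) x - f a x)^2)" for n x
 have [measurable]: "D n \<in> borel_measurable borel" for n
  unfolding D_def by (intro borel_measurable_sum borel_measurable_power borel_measurable_diff mc meas)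
 have D0: "D n x \<ge> 0" for n x by (simp add: D_def sum_nonneg)
 have Dint: "(NNI x. ennreal (D n x)) <= ennreal ((1/2)^n)" for n
 proof -
  have "(NNI x. ennreal (D n x)) =
   (\<Sum>a\<in>I. NNI x. ennreal ((conv (mollifier (r n)) (f a) x - f a x)^2))"
   unfolding D_def using mc by (subst nn_integral_sum[symmetric]) (simp_all add: sum_ennreal)
  also have "... <= (\<Sum>a\<in>I. ennreal ((1/2)^n / c))" by (rule sum_mono[OF r(3)])
  also have "... = ennreal (card I * ((1/2)^n / c))"
   using c by (simp add: ennreal_of_nat_eq_real_of_nat flip: ennreal_mult)
  also have "... <= ennreal ((1/2)^n)"
   using c by (intro ennreal_leI) (simp add: c_def divide_le_eq mult_left_mono)
  finally show ?thesis .
 qed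
 \<comment> \<open>The errors along the subsequence are summable in L^1. Their sum is finite almost
   everywhere, which forces pointwise convergence, and it dominates all errors at once.\<close>
 define E where "E x = (\<Sum>n. ennreal (D n x))" for x
 have [measurable]: "E \<in> borel_measurable borel" unfolding E_def by measurable
 have "(NNI x. E x) = (\<Sum>n. NNI x. ennreal (D n x))"
  unfolding E_def by (rule nn_integral_suminf) simp
 also have "... <= (\<Sum>n. ennreal ((1/2)^n))" by (intro suminf_le Dint) auto
 also have "... = ennreal (\<Sum>n. (1/2)^n)" by (rule suminf_ennreal2) auto
 also have "... < \<infinity>" by simp
 finally have Efin: "(NNI x. E x) < \<infinity>" .
 have AEfin: "AE x in lborel. E x \<noteq> \<infinity>"
  by (rule nn_integral_noteq_infinite) (use Efin in auto)
 have iE: "integrable lborel (\<lambda>x. enn2real (E x))"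
 proof (rule integrableI_nonneg)
  have "(NNI x. ennreal (enn2real (E x))) = (NNI x. E x)"
   by (rule nn_integral_cong_AE) (use AEfin in \<open>eventually_elim, simp add: less_top\<close>)
  then show "(NNI x. ennreal (enn2real (E x))) < \<infinity>" using Efin by simp
 qed auto
 define W where "W x = 2 * (\<Sum>a\<in>I. (f a x)^2) + 2 * enn2real (E x)" for x
 have DE: "D n x <= enn2real (E x)" if "E x \<noteq> \<infinity>" for n x
 proof -
  have "ennreal (D n x) <= E x"
   unfolding E_def using sum_le_suminf[of "\<lambda>n. ennreal (D n x)" "{n}"] by simp
  then show ?thesis using that D0 enn2real_mono[of "ennreal (D n x)" "E x"] by (simp add: less_top)
 qed
 show thesis
 proof (rule that[of r W])
  show "0 < r n" "r n < \<delta>" for n using r by auto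
  show "integrable lborel W"
   unfolding W_def using f2 iE by (intro Bochner_Integration.integrable_add
    Bochner_Integration.integrable_mult_right Bochner_Integration.integrable_sum) auto
  show "AE x in lborel. \<forall>a\<in>I. (\<lambda>n. conv (mollifier (r n)) (f a) x) \<longlonglongrightarrow> f a x"
   using AEfin
  proof eventually_elim
   case (elim x)
   have "summable (\<lambda>n. D n x)"
    using elim D0 by (intro summable_suminf_not_top) (auto simp: E_def)
   then have D: "(\<lambda>n. D n x) \<longlonglongrightarrow> 0" by (rule summable_LIMSEQ_zero)
   show ?case
   proof
    fix a assume a: "a \<in> I"
    have "(\<lambda>n. (conv (mollifier (r n)) (f a) x - f a x)^2) \<longlonglongrightarrow> 0"
    proof (rule tendsto_sandwich[OF _ _ tendsto_const D])
     show "\<forall>\<^sub>F n in sequentially. (conv (mollifier (r n)) (f a) x - f a x)^2 <= D n x"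
      unfolding D_def using member_le_sum[OF a _ I, of "\<lambda>a. (conv (mollifier (r _)) (f a) x - f a x)^2"]
      by (intro always_eventually allI) (rule member_le_sum[OF a _ I], simp)
    qed simp
    then have "(\<lambda>n. sqrt ((conv (mollifier (r n)) (f a) x - f a x)^2)) \<longlonglongrightarrow> sqrt 0"
     by (rule tendsto_real_sqrt)
    then have "(\<lambda>n. conv (mollifier (r n)) (f a) x - f a x) \<longlonglongrightarrow> 0"
     by (simp add: tendsto_rabs_zero_iff)
    then show "(\<lambda>n. conv (mollifier (r n)) (f a) x) \<longlonglongrightarrow> f a x" by (rule LIM_zero_cancel)
   qed
  qed
  show "AE x in lborel. \<forall>a\<in>I. \<forall>n. (conv (mollifier (r n)) (f a) x)^2 <= W x"
   using AEfin
  proof eventually_elim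
   case (elim x)
   show ?case
   proof (intro ballI allI)
    fix a n assume a: "a \<in> I"
    let ?u = "conv (mollifier (r n)) (f a) x"
    have "?u^2 = (f a x + (?u - f a x))^2" by simp
    also have "... <= 2 * (f a x)^2 + 2 * (?u - f a x)^2"
     by (rule sq_add_le)
    also have "(?u - f a x)^2 <= enn2real (E x)"
     using DE[OF elim, of n] member_le_sum[OF a _ I, of "\<lambda>a. (conv (mollifier (r n)) (f a) x - f a x)^2"]
     by (simp add: D_def)
    also have "(f a x)^2 <= (\<Sum>a\<in>I. (f a x)^2)"
     by (rule member_le_sum[OF a _ I]) simp
    finally show "?u^2 <= W x" by (simp add: W_def)
   qed
  qed
 qed
qed

lemma conv_bound:
 fixes f :: "'a::euclidean_space => real"
 assumes r: "r > 0" and f: "integrable lborel f" and M: "\<And>x. \<bar>f x\<bar> <= M"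
 shows "\<bar>conv (mollifier r) f x\<bar> <= M"
proof -
 note J = mollifier[OF r, where 'a='a]
 have iJx: "integrable lborel (\<lambda>y. mollifier r (x - y))" by (rule integrable_reflect[OF J(4)])
 have "\<bar>conv (mollifier r) f x\<bar> <= (LBINT y. \<bar>mollifier r (x - y) * f y\<bar>)"
  unfolding conv_def by (rule integral_abs_bound)
 also have "... <= (LBINT y. M * mollifier r (x - y))"
 proof (rule integral_mono)
  show "integrable lborel (\<lambda>y. \<bar>mollifier r (x - y) * f y\<bar>)"
   by (rule integrable_abs) (rule integrable_conv[OF C_diff_continuous[OF J(1)[of 0]] J(2) f])
  show "\<bar>mollifier r (x - y) * f y\<bar> <= M * mollifier r (x - y)" for y
   using J(3)[of "x - y"] M[of y] by (simp add: abs_mult mult.commute mult_right_mono)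
 qed (use iJx in simp)
 also have "... = M" using integral_reflect[OF J(6), of x] J(5) by simp
 finally show ?thesis .
qed

section \<open>Weak gradients and mollification\<close>

lemma grad_component: "grad f x $ \<alpha> = frechet_derivative f (at x) (axis \<alpha> 1)"
 by (simp add: grad_def)

text \<open>Integrals over the whole space can be used because test functions vanish outside B. In
  this form v may be extended by zero, with a jump across the boundary of B.\<close>

definition weak_grad_on :: "(real ^ 'n) set => (real ^ 'n => real) => (real ^ 'n => real ^ 'n) => bool" where
 "weak_grad_on B v g \<longleftrightarrow> (\<forall>\<phi> \<alpha>. test_function B \<phi> -->
  (LBINT x. v x * grad \<phi> x $ \<alpha>) = - (LBINT x. \<phi> x * g x $ \<alpha>))"

lemma test_function_mollifier:
 fixes x :: "'a::euclidean_space"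
 assumes r: "r > 0" and sub: "cball x r \<subseteq> B"
 shows "test_function B (\<lambda>y. mollifier r (x - y))"
proof -
 note J = mollifier[OF r, where 'a='a]
 have "C_diff j (\<lambda>y. mollifier r (- y + x))" for j
  by (rule C_diff_compose_linear[OF _ J(1)]) (rule bounded_linear_minus[OF bounded_linear_ident])
 then have sm: "C_diff j (\<lambda>y. mollifier r (x - y))" for j by simp
 have "{y. mollifier r (x - y) \<noteq> 0} \<subseteq> cball x r"
  using J(2) by (auto simp: dist_norm not_le[symmetric]) (meson nle_le)
 then have cl: "closure {y. mollifier r (x - y) \<noteq> 0} \<subseteq> cball x r"
  by (rule closure_minimal) simp
 then have "bounded (closure {y. mollifier r (x - y) \<noteq> 0})"
  using bounded_subset bounded_cball by blast
 then show ?thesis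
  using sm cl sub unfolding test_function_def by (auto simp: compact_eq_bounded_closed)
qed

text \<open>The derivative falls on the kernel, and y |-> J(x - y) is itself a test function in B
  when the closed r-ball around x lies in B. Differentiation and mollification are thus exchanged
  only away from the boundary.\<close>

lemma grad_mollified:
 fixes v :: "real ^ 'n => real"
 assumes r: "r > 0" and v: "integrable lborel v" and wg: "weak_grad_on B v g" and sub: "cball x r \<subseteq> B"
 shows "grad (conv (mollifier r) v) x $ \<alpha> = conv (mollifier r) (\<lambda>y. g y $ \<alpha>) x"
proof -
 note J = mollifier[OF r, where 'a="real ^ 'n"]
 let ?J = "mollifier r :: real ^ 'n => real"
 have ax: "axis \<alpha> 1 \<in> (Basis :: (real ^ 'n) set)" by (simp add: axis_in_Basis_iff)
 have dJ: "grad (\<lambda>y. ?J (x - y)) y $ \<alpha> = - frechet_derivative ?J (at (x - y)) (axis \<alpha> 1)" for y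
 proof -
  have "(?J has_derivative frechet_derivative ?J (at (x - y))) (at (x - y))"
   by (rule C_diff_has_derivative[OF J(1)])
  moreover have "((\<lambda>y. x - y) has_derivative (\<lambda>h. - h)) (at y)"
   by (auto intro!: derivative_eq_intros)
  ultimately have d: "((\<lambda>y. ?J (x - y)) has_derivative (\<lambda>h. frechet_derivative ?J (at (x - y)) (- h))) (at y)"
   by (rule has_derivative_compose[rotated])
  have "linear (frechet_derivative ?J (at (x - y)))"
   using C_diff_has_derivative[OF J(1)] has_derivative_linear by blast
  then show ?thesis
   unfolding grad_component frechet_derivative_at[OF d, symmetric] by (simp add: linear_neg)
 qed
 have "grad (conv ?J v) x $ \<alpha> = conv (\<lambda>x. frechet_derivative ?J (at x) (axis \<alpha> 1)) v x"
  unfolding grad_component by (rule frechet_conv[OF J(1) J(2) v ax])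
 also have "... = - (LBINT y. v y * grad (\<lambda>y. ?J (x - y)) y $ \<alpha>)"
  unfolding conv_def dJ by (simp add: mult.commute)
 also have "... = conv ?J (\<lambda>y. g y $ \<alpha>) x"
  using wg test_function_mollifier[OF r sub] unfolding weak_grad_on_def conv_def by simp
 finally show ?thesis .
qed

section \<open>Truncated test functions on time slices\<close>

lemma AE_lborel_shift:
 fixes P :: "'a::euclidean_space => bool"
 assumes "AE x in lborel. P x" shows "AE x in lborel. P (x + c)"
proof -
 have "AE x in distr lborel borel (\<lambda>x. x + c). P x" by (subst lborel_shift) (rule assms)
 then show ?thesis by (rule AE_distrD[rotated]) simp
qed

section \<open>Gradients, spatial cutoffs and truncations\<close>

lemma grad_eqI:
 assumes "(f has_derivative (\<lambda>h. G \<bullet> h)) (at x)" shows "grad f x = G"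
 unfolding grad_def frechet_derivative_at[OF assms, symmetric] by (simp add: vec_eq_iff inner_axis)

lemma C_diff_has_grad:
 fixes f :: "real ^ 'n => real"
 assumes "C_diff (Suc j) f" shows "(f has_derivative (\<lambda>h. grad f x \<bullet> h)) (at x)"
proof -
 let ?F = "frechet_derivative f (at x)"
 have d: "(f has_derivative ?F) (at x)" by (rule C_diff_has_derivative[OF assms])
 have lin: "linear ?F" using d has_derivative_linear by blast
 have "?F h = grad f x \<bullet> h" for h
 proof -
  have "?F h = ?F (\<Sum>\<alpha>\<in>UNIV. (h $ \<alpha>) *\<^sub>R axis \<alpha> 1)"
   by (subst (1) basis_expansion[of h, symmetric]) (simp add: scalar_mult_eq_scaleR)
  also have "... = (\<Sum>\<alpha>\<in>UNIV. h $ \<alpha> * ?F (axis \<alpha> 1))"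
   using lin by (simp add: linear_sum linear_scale)
  also have "... = grad f x \<bullet> h" by (simp add: inner_vec_def grad_def mult.commute)
  finally show ?thesis .
 qed
 then have "?F = (\<lambda>h. grad f x \<bullet> h)" by auto
 then show ?thesis using d by simp
qed

lemma continuous_grad:
 fixes f :: "real ^ 'n => real"
 assumes "C_diff (Suc 0) f" shows "continuous_on UNIV (grad f)"
proof -
 have "continuous_on UNIV (\<lambda>x. frechet_derivative f (at x) (axis \<alpha> 1))" for \<alpha>
  using assms by (simp add: axis_in_Basis_iff)
 then show ?thesis unfolding grad_def by (intro continuous_on_vec_lambda)
qed

text \<open>For b > 0 a radial cutoff supported in the ball of radius R. The parameter b is its
  steepness: b (R^2 - r^2) >= 1 makes it at least exp(-1) on the ball of radius r, see
  \<open>cut_ge\<close>, at the price of a gradient of order b R.\<close>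

definition cutoff :: "real ^ 'n => real => real => real ^ 'n => real" where
 "cutoff x0 R b x = bump 0 (b * R^2 - b * ((x - x0) \<bullet> (x - x0)))"

definition Dcutoff :: "real ^ 'n => real => real => real ^ 'n => real ^ 'n" where
 "Dcutoff x0 R b x = (- 2 * b * bump 2 (b * R\<^sup>2 - b * ((x - x0) \<bullet> (x - x0)))) *\<^sub>R (x - x0)"

text \<open>The smooth truncation h, to be evaluated at q = |v|^2: for \<Delta> > 0 it is zero up to
  the level \<kappa> and at least exp(-1) from \<kappa> + \<Delta> on.\<close>

definition lev :: "real => real => real => real" where
 "lev \<kappa> \<Delta> q = bump 0 ((q - \<kappa>) / \<Delta>)"

definition Dlev :: "real => real => real => real" where
 "Dlev \<kappa> \<Delta> q = bump 2 ((q - \<kappa>) / \<Delta>) / \<Delta>"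

definition sqn :: "nat => (nat => 'a => real) => 'a => real" where
 "sqn k v x = (\<Sum>i<k. (v i x)^2)"

lemma bump_has_derivative:
 assumes "(f has_derivative F) (at x)"
 shows "((\<lambda>x. bump 0 (f x)) has_derivative (\<lambda>h. bump 2 (f x) * F h)) (at x)"
proof -
 have "(bump 0 has_derivative (\<lambda>h. h * bump 2 (f x))) (at (f x))"
  using bump_deriv[of 0 "f x"] by (simp add: has_field_derivative_def mult_commute_abs numeral_2_eq_2)
 from has_derivative_compose[OF assms this] show ?thesis by (simp add: mult.commute)
qed

lemma cut_has_derivative: "(cutoff x0 R b has_derivative (\<lambda>h. Dcutoff x0 R b x \<bullet> h)) (at x)"
proof -
 have "((\<lambda>x. b * R^2 - b * ((x - x0) \<bullet> (x - x0))) has_derivative (\<lambda>h. - b * (2 * ((x - x0) \<bullet> h)))) (at x)"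
  by (rule derivative_eq_intros refl | simp add: inner_commute)+
 from bump_has_derivative[OF this] show ?thesis
  by (simp add: cutoff_def[abs_def] Dcutoff_def algebra_simps)
qed

lemma lev_has_derivative:
 assumes "\<Delta> > 0" "(f has_derivative F) (at x)"
 shows "((\<lambda>x. lev \<kappa> \<Delta> (f x)) has_derivative (\<lambda>h. Dlev \<kappa> \<Delta> (f x) * F h)) (at x)"
proof -
 have "((\<lambda>x. (f x - \<kappa>) * (1 / \<Delta>)) has_derivative (\<lambda>h. F h * (1 / \<Delta>))) (at x)"
  by (rule derivative_eq_intros assms refl | simp)+
 from bump_has_derivative[OF this] show ?thesis by (simp add: lev_def Dlev_def)
qed

lemma C_diff_cut: "C_diff j (cutoff x0 R b)"
proof -
 have "C_diff j (\<lambda>x. bump 0 (b * R^2 - b * ((x + (- x0)) \<bullet> (x + (- x0)))))"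
  by (rule C_diff_compose_linear[OF bounded_linear_ident C_diff_radial_bump])
 then show ?thesis by (simp add: cutoff_def[abs_def])
qed

lemma C_diff_lev: "(\<And>i. C_diff i f) ==> C_diff j (\<lambda>x. lev \<kappa> \<Delta> (f x))"
proof -
 assume f: "\<And>i. C_diff i f"
 have "C_diff i (\<lambda>x. (1 / \<Delta>) * (f x + - \<kappa>))" for i
  by (rule C_diff_mult[OF C_diff_const C_diff_add[OF f C_diff_const]])
 then have "C_diff j (\<lambda>x. bump 0 ((1 / \<Delta>) * (f x + - \<kappa>)))" by (rule C_diff_bump)
 then show ?thesis by (simp add: lev_def)
qed

lemma C_diff_sqn: "(\<And>i j. C_diff j (v i)) ==> C_diff j (sqn k v)"
 unfolding sqn_def power2_eq_square by (rule C_diff_sum) (rule C_diff_mult)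

lemma cut_bounds: "0 <= cutoff x0 R b x" "cutoff x0 R b x <= 1"
 by (simp_all add: cutoff_def bump_nonneg bump_0_le_1)

lemma lev_bounds: "0 <= lev \<kappa> \<Delta> q" "lev \<kappa> \<Delta> q <= 1"
 by (simp_all add: lev_def bump_nonneg bump_0_le_1)

lemma Dlev_bounds: "\<Delta> > 0 ==> 0 <= Dlev \<kappa> \<Delta> q" "\<Delta> > 0 ==> Dlev \<kappa> \<Delta> q <= 2 / \<Delta>"
 using bump_le[of 2 "(q - \<kappa>) / \<Delta>"] by (simp_all add: Dlev_def bump_nonneg divide_right_mono numeral_2_eq_2)

lemma Dlev_sq: "\<Delta> > 0 ==> (Dlev \<kappa> \<Delta> q)^2 <= 24 / \<Delta>^2 * lev \<kappa> \<Delta> q"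
 using bump_2_sq[of "(q - \<kappa>) / \<Delta>"] by (simp add: Dlev_def lev_def power_divide divide_right_mono)

lemma lev_zero: "\<Delta> > 0 ==> q <= \<kappa> ==> lev \<kappa> \<Delta> q = 0" "\<Delta> > 0 ==> q <= \<kappa> ==> Dlev \<kappa> \<Delta> q = 0"
 by (simp_all add: lev_def Dlev_def bump_le_0 divide_nonpos_pos)

lemma lev_ge: "\<Delta> > 0 ==> q \<ge> \<kappa> + \<Delta> ==> lev \<kappa> \<Delta> q \<ge> exp (- 1)"
 unfolding lev_def by (rule bump_0_ge) (simp add: le_divide_eq)

lemma lev_mono: "\<Delta> > 0 ==> q <= q' ==> lev \<kappa> \<Delta> q <= lev \<kappa> \<Delta> q'"
 unfolding lev_def by (rule bump_mono) (simp add: divide_right_mono)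

lemma cut_zero:
 assumes "b \<ge> 0" "R \<ge> 0" "norm (x - x0) \<ge> R"
 shows "cutoff x0 R b x = 0" "Dcutoff x0 R b x = 0"
proof -
 have "R^2 <= (x - x0) \<bullet> (x - x0)" using assms power_mono[of R "norm (x - x0)" 2] by (simp add: power2_norm_eq_inner)
 then have "b * R^2 - b * ((x - x0) \<bullet> (x - x0)) <= 0" using assms(1) by (simp add: mult_left_mono)
 then show "cutoff x0 R b x = 0" "Dcutoff x0 R b x = 0" by (simp_all add: cutoff_def Dcutoff_def bump_le_0)
qed

lemma cut_ge:
 assumes "b * (R^2 - r^2) \<ge> 1" "b \<ge> 0" "norm (x - x0) <= r"
 shows "cutoff x0 R b x \<ge> exp (- 1)"
proof -
 have "(x - x0) \<bullet> (x - x0) <= r^2" using assms power_mono[of "norm (x - x0)" r 2] by (simp add: power2_norm_eq_inner)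
 then have "b * ((x - x0) \<bullet> (x - x0)) <= b * r^2" using assms(2) by (rule mult_left_mono)
 then show ?thesis unfolding cutoff_def using assms(1) by (intro bump_0_ge) (simp add: algebra_simps)
qed

lemma Dcut_norm:
 assumes "b \<ge> 0" "R \<ge> 0" shows "norm (Dcutoff x0 R b x) <= 4 * b * R"
proof (cases "norm (x - x0) \<ge> R")
 case True
 then show ?thesis using cut_zero[OF assms True] assms by simp
next
 case False
 have "norm (Dcutoff x0 R b x) = 2 * b * bump 2 (b * R^2 - b * ((x - x0) \<bullet> (x - x0))) * norm (x - x0)"
  using assms bump_nonneg by (simp add: Dcutoff_def abs_mult)
 also have "... <= 2 * b * 2 * R"
  using assms False bump_le[of 2] bump_nonneg[of 2]
  by (intro mult_mono mult_nonneg_nonneg) (simp_all add: numeral_2_eq_2)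
 finally show ?thesis by simp
qed

text \<open>\<open>bump_2_sq\<close> carried over to the cutoff: the factor 96 is 4 times 24, and |x
  - x0| < R where the gradient is not zero.\<close>

lemma Dcut_sq:
 assumes "b \<ge> 0" "R \<ge> 0" shows "(norm (Dcutoff x0 R b x))^2 <= 96 * b^2 * R^2 * cutoff x0 R b x"
proof (cases "norm (x - x0) \<ge> R")
 case True
 then show ?thesis using cut_zero[OF assms True] by simp
next
 case False
 let ?t = "b * R^2 - b * ((x - x0) \<bullet> (x - x0))"
 have "(norm (Dcutoff x0 R b x))^2 = 4 * b^2 * (bump 2 ?t)^2 * (norm (x - x0))^2"
  by (simp add: Dcutoff_def power_mult_distrib)
 also have "... <= 4 * b^2 * (24 * bump 0 ?t) * R^2"
  using False assms bump_2_sq[of ?t] bump_nonneg[of 0]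
  by (intro mult_mono power_mono) simp_all
 finally show ?thesis by (simp add: cutoff_def mult_ac)
qed

text \<open>The scalar factor \<eta> h(|v|^2) of the test function W v. \<open>DW\<close> and
  \<open>DP\<close> are the gradients of W and of W v_i as given by the chain and product rules,
  with an arbitrary family g in place of the gradient of v; so they make sense for weak gradients
  too.\<close>

definition W :: "nat => real ^ 'n => real => real => real => real => (nat => real ^ 'n => real) => real ^ 'n => real" where
 "W k x0 R b \<kappa> \<Delta> v x = cutoff x0 R b x * lev \<kappa> \<Delta> (sqn k v x)"

definition DW :: "nat => real ^ 'n => real => real => real => real => (nat => real ^ 'n => real) =>
  (nat => real ^ 'n => real ^ 'n) => real ^ 'n => real ^ 'n" where
 "DW k x0 R b \<kappa> \<Delta> v g x = lev \<kappa> \<Delta> (sqn k v x) *\<^sub>R Dcutoff x0 R b x +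
  (2 * cutoff x0 R b x * Dlev \<kappa> \<Delta> (sqn k v x)) *\<^sub>R (\<Sum>j<k. v j x *\<^sub>R g j x)"

definition DP :: "nat => real ^ 'n => real => real => real => real => (nat => real ^ 'n => real) =>
  (nat => real ^ 'n => real ^ 'n) => nat => real ^ 'n => real ^ 'n" where
 "DP k x0 R b \<kappa> \<Delta> v g i x = v i x *\<^sub>R DW k x0 R b \<kappa> \<Delta> v g x + W k x0 R b \<kappa> \<Delta> v x *\<^sub>R g i x"

lemma C_diff_W: "(\<And>i j. C_diff j (v i)) ==> C_diff j (W k x0 R b \<kappa> \<Delta> v)"
 unfolding W_def by (intro C_diff_mult C_diff_cut C_diff_lev C_diff_sqn)

lemma grad_W:
 assumes "\<And>i j. C_diff j (v i)" "\<Delta> > 0"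
 shows "grad (W k x0 R b \<kappa> \<Delta> v) x = DW k x0 R b \<kappa> \<Delta> v (\<lambda>i. grad (v i)) x"
proof (rule grad_eqI)
 have "((\<lambda>x. \<Sum>i<k. v i x * v i x) has_derivative
   (\<lambda>h. \<Sum>i<k. v i x * (grad (v i) x \<bullet> h) + (grad (v i) x \<bullet> h) * v i x)) (at x)"
  by (rule has_derivative_sum, rule has_derivative_mult; rule C_diff_has_grad[OF assms(1)])
 moreover have "(\<Sum>i<k. v i x * (grad (v i) x \<bullet> h) + (grad (v i) x \<bullet> h) * v i x) =
   2 * ((\<Sum>j<k. v j x *\<^sub>R grad (v j) x) \<bullet> h)" for h
  by (simp add: inner_sum_left sum_distrib_left mult.commute)
 ultimately have "(sqn k v has_derivative (\<lambda>h. 2 * ((\<Sum>j<k. v j x *\<^sub>R grad (v j) x) \<bullet> h))) (at x)"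
  by (simp add: sqn_def[abs_def] power2_eq_square)
 from has_derivative_mult[OF cut_has_derivative lev_has_derivative[OF assms(2) this]]
 have "(W k x0 R b \<kappa> \<Delta> v has_derivative (\<lambda>h. cutoff x0 R b x * (Dlev \<kappa> \<Delta> (sqn k v x) *
   (2 * ((\<Sum>j<k. v j x *\<^sub>R grad (v j) x) \<bullet> h))) + (Dcutoff x0 R b x \<bullet> h) * lev \<kappa> \<Delta> (sqn k v x))) (at x)"
  by (simp add: W_def[abs_def])
 then show "(W k x0 R b \<kappa> \<Delta> v has_derivative (\<lambda>h. DW k x0 R b \<kappa> \<Delta> v (\<lambda>i. grad (v i)) x \<bullet> h)) (at x)"
  by (simp add: DW_def inner_add_left mult_ac add.commute)
qed

lemma grad_P:
 assumes "\<And>i j. C_diff j (v i)" "\<Delta> > 0"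
 shows "grad (\<lambda>x. W k x0 R b \<kappa> \<Delta> v x * v i x) x = DP k x0 R b \<kappa> \<Delta> v (\<lambda>i. grad (v i)) i x"
proof (rule grad_eqI)
 have "((\<lambda>x. W k x0 R b \<kappa> \<Delta> v x * v i x) has_derivative (\<lambda>h. W k x0 R b \<kappa> \<Delta> v x * (grad (v i) x \<bullet> h) +
   (grad (W k x0 R b \<kappa> \<Delta> v) x \<bullet> h) * v i x)) (at x)"
  by (rule has_derivative_mult[OF C_diff_has_grad C_diff_has_grad]) (rule C_diff_W assms)+
 then show "((\<lambda>x. W k x0 R b \<kappa> \<Delta> v x * v i x) has_derivative
   (\<lambda>h. DP k x0 R b \<kappa> \<Delta> v (\<lambda>i. grad (v i)) i x \<bullet> h)) (at x)"
  by (simp add: DP_def inner_add_left grad_W[OF assms] mult_ac add.commute)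
qed

lemma W_bounds: "0 <= W k x0 R b \<kappa> \<Delta> v x" "W k x0 R b \<kappa> \<Delta> v x <= 1"
 using cut_bounds[of x0 R b x] lev_bounds[of \<kappa> \<Delta> "sqn k v x"] by (simp_all add: W_def mult_le_one)

lemma W_zero:
 assumes "b \<ge> 0" "R \<ge> 0" "norm (x - x0) \<ge> R"
 shows "W k x0 R b \<kappa> \<Delta> v x = 0" "DW k x0 R b \<kappa> \<Delta> v g x = 0" "DP k x0 R b \<kappa> \<Delta> v g i x = 0"
 using cut_zero[OF assms] by (simp_all add: W_def DW_def DP_def)

text \<open>The bound is affine in the bound S of the gradients, so an L^2 majorant of the gradients
  yields one for the truncated gradients, as dominated convergence requires.\<close>

lemma DW_norm:
 assumes b: "b \<ge> 0" "R \<ge> 0" and \<Delta>: "\<Delta> > 0" and v: "\<And>j. \<bar>v j x\<bar> <= M" and g: "\<And>j. j < k ==> norm (g j x) <= S"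
 shows "norm (DW k x0 R b \<kappa> \<Delta> v g x) <= 4 * b * R + 4 / \<Delta> * (real k * (M * S))"
proof -
 have "norm (\<Sum>j<k. v j x *\<^sub>R g j x) <= (\<Sum>j<k. M * S)"
  using v g order_trans[OF abs_ge_zero v] by (intro sum_norm_le) (auto intro!: mult_mono)
 then have s: "norm (\<Sum>j<k. v j x *\<^sub>R g j x) <= real k * (M * S)" by simp
 have "norm (DW k x0 R b \<kappa> \<Delta> v g x) <= norm (lev \<kappa> \<Delta> (sqn k v x) *\<^sub>R Dcutoff x0 R b x) +
   norm ((2 * cutoff x0 R b x * Dlev \<kappa> \<Delta> (sqn k v x)) *\<^sub>R (\<Sum>j<k. v j x *\<^sub>R g j x))"
  unfolding DW_def by (rule norm_triangle_ineq)
 also have "... <= 1 * (4 * b * R) + (2 * 1 * (2 / \<Delta>)) * (real k * (M * S))"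
  unfolding norm_scaleR
  using lev_bounds[of \<kappa> \<Delta> "sqn k v x"] cut_bounds[of x0 R b x] Dlev_bounds[OF \<Delta>, of \<kappa> "sqn k v x"] \<Delta>
   mult_mono[of "cutoff x0 R b x" 1 "Dlev \<kappa> \<Delta> (sqn k v x)" "2 / \<Delta>"]
  by (intro add_mono mult_mono Dcut_norm b s) (simp_all add: abs_mult)
 finally show ?thesis by simp
qed

lemma DP_norm:
 assumes b: "b \<ge> 0" "R \<ge> 0" and \<Delta>: "\<Delta> > 0" and v: "\<And>j. \<bar>v j x\<bar> <= M" and g: "\<And>j. j < k ==> norm (g j x) <= S"
  and i: "i < k"
 shows "norm (DP k x0 R b \<kappa> \<Delta> v g i x) <= M * (4 * b * R) + (4 / \<Delta> * (real k * (M * M)) + 1) * S"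
proof -
 have M: "M \<ge> 0" using order_trans[OF abs_ge_zero v] .
 have "norm (DP k x0 R b \<kappa> \<Delta> v g i x) <= norm (v i x *\<^sub>R DW k x0 R b \<kappa> \<Delta> v g x) +
   norm (W k x0 R b \<kappa> \<Delta> v x *\<^sub>R g i x)"
  unfolding DP_def by (rule norm_triangle_ineq)
 also have "... <= M * (4 * b * R + 4 / \<Delta> * (real k * (M * S))) + 1 * S"
  unfolding norm_scaleR using W_bounds[of k x0 R b \<kappa> \<Delta> v x] M
  by (intro add_mono mult_mono DW_norm b \<Delta> v g i) simp_all
 finally show ?thesis by (simp add: algebra_simps)
qed


section \<open>A single time slice and its smooth approximation\<close>

lemma integrable_indicator_ball: "integrable lborel (indicator (ball (x::'a::euclidean_space) s) :: 'a => real)"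
 using emeasure_bounded_finite[of "ball x s"] by (simp add: integrable_indicator_iff)

lemma integrable_indicator_cball: "integrable lborel (indicator (cball (x::'a::euclidean_space) s) :: 'a => real)"
 using emeasure_bounded_finite[of "cball x s"] by (simp add: integrable_indicator_iff)

lemma borel_measurable_vec_component [measurable (raw)]:
 "f \<in> borel_measurable M ==> (\<lambda>x. f x $ \<alpha> :: real) \<in> borel_measurable M"
 by (rule measurable_compose[OF _ borel_measurable_continuous_onI]) (auto intro: continuous_intros)

lemma abs_le_one_plus_sq: "\<bar>t\<bar> <= 1 + (t::real)^2"
 using sum_squares_bound[of "\<bar>t\<bar>" 1] by simp

text \<open>One time slice of v together with its spatial gradient, both extended by zero. The
  gradient is a weak gradient inside the open ball only, so every use keeps to a radius R <
  \<rho>.\<close>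

locale slice =
 fixes k :: nat and x0 :: "real ^ 'n" and \<rho> M :: real
  and v :: "nat => real ^ 'n => real" and g :: "nat => real ^ 'n => real ^ 'n"
 assumes v_meas[measurable]: "\<And>i. v i \<in> borel_measurable borel"
  and v_bound: "\<And>i x. \<bar>v i x\<bar> <= M"
  and v_zero: "\<And>i x. x \<notin> ball x0 \<rho> ==> v i x = 0"
  and g_meas[measurable]: "\<And>i. g i \<in> borel_measurable borel"
  and g_zero: "\<And>i x. x \<notin> ball x0 \<rho> ==> g i x = 0"
  and g_L2: "\<And>i. integrable lborel (\<lambda>x. (norm (g i x))^2)"
  and weak: "\<And>i. weak_grad_on (ball x0 \<rho>) (v i) (g i)"
begin

lemma M_nonneg: "M \<ge> 0"
 using order_trans[OF abs_ge_zero v_bound] .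

lemma v_int: "integrable lborel (v i)"
proof (rule bochner_bound)
 show "integrable lborel (\<lambda>x. M * indicator (ball x0 \<rho>) x)"
  by (simp add: integrable_indicator_ball)
 show "AE x in lborel. norm (v i x) <= norm (M * indicator (ball x0 \<rho>) x)"
  using v_bound[of i] v_zero M_nonneg by (intro AE_I2) (auto split: split_indicator)
qed simp

lemma v_int2: "integrable lborel (\<lambda>x. (v i x)^2)"
proof (rule bochner_bound)
 show "integrable lborel (\<lambda>x. M^2 * indicator (ball x0 \<rho>) x)"
  by (simp add: integrable_indicator_ball)
 have "(v i x)^2 <= M^2" for x
  using power_mono[OF v_bound, of i x 2] by simp
 then show "AE x in lborel. norm ((v i x)^2) <= norm (M^2 * indicator (ball x0 \<rho>) x)"
  using v_zero by (intro AE_I2) (auto split: split_indicator)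
qed simp

lemma g_comp_int2: "integrable lborel (\<lambda>x. (g i x $ \<alpha>)^2)"
proof (rule bochner_bound[OF g_L2[of i]])
 have "(g i x $ \<alpha>)^2 <= (norm (g i x))^2" for x
  using power_mono[OF component_le_norm_cart, of "g i x" \<alpha> 2] by simp
 then show "AE x in lborel. norm ((g i x $ \<alpha>)^2) <= norm ((norm (g i x))^2)"
  by (intro AE_I2) simp
qed simp

lemma g_comp_int: "integrable lborel (\<lambda>x. g i x $ \<alpha>)"
proof (rule bochner_bound)
 show "integrable lborel (\<lambda>x. indicator (ball x0 \<rho>) x + (g i x $ \<alpha>)^2)"
  by (simp add: integrable_indicator_ball g_comp_int2)
 show "AE x in lborel. norm (g i x $ \<alpha>) <= norm (indicator (ball x0 \<rho>) x + (g i x $ \<alpha>)^2)"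
  using g_zero abs_le_one_plus_sq by (intro AE_I2) (auto split: split_indicator)
qed simp

text \<open>All components and all their partial derivatives are mollified along one common sequence
  of radii, which gives simultaneous convergence and a single majorant V. Radii below \<rho> - R
  guarantee that on the closed R-ball the gradient of the mollification is the mollification of
  g.\<close>

lemma smooth_sequence:
 assumes R: "0 < R" "R < \<rho>"
 obtains vn :: "nat => nat => real ^ 'n => real" and V where
  "\<And>n i j. C_diff j (vn n i)" "\<And>n i x. \<bar>vn n i x\<bar> <= M" "integrable lborel V" "\<And>x. V x \<ge> 0"
  "AE x in lborel. \<forall>i<k. (\<lambda>n. vn n i x) \<longlonglongrightarrow> v i x"
  "AE x in lborel. x \<in> cball x0 R --> (\<forall>i<k. (\<lambda>n. grad (vn n i) x) \<longlonglongrightarrow> g i x)"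
  "AE x in lborel. x \<in> cball x0 R --> (\<forall>i<k. \<forall>n. norm (grad (vn n i) x) <= V x)"
  "integrable lborel (\<lambda>x. (V x)^2)"
proof -
 \<comment> \<open>\<open>(i, None)\<close> stands for v_i and \<open>(i, Some \<alpha>)\<close> for
   its \<alpha>-th partial derivative; this makes them one finite family.\<close>
 define f :: "nat \<times> 'n option => real ^ 'n => real" where
  "f = (\<lambda>(i, c). case c of None => v i | Some \<alpha> => \<lambda>x. g i x $ \<alpha>)"
 define I where "I = {..<k} \<times> (UNIV :: 'n option set)"
 have I: "finite I" by (simp add: I_def)
 have f1: "f a \<in> borel_measurable borel" "integrable lborel (f a)" "integrable lborel (\<lambda>x. (f a x)^2)" for a
  unfolding f_def by (cases a; cases "snd a"; simp add: v_int v_int2 g_comp_int g_comp_int2)+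
 obtain r W where r: "\<And>n. 0 < r n" "\<And>n. r n < \<rho> - R" and W: "integrable lborel W"
  and conv: "AE x in lborel. \<forall>a\<in>I. (\<lambda>n. conv (mollifier (r n)) (f a) x) \<longlonglongrightarrow> f a x"
  and dom: "AE x in lborel. \<forall>a\<in>I. \<forall>n. (conv (mollifier (r n)) (f a) x)^2 <= W x"
  using mollify_dominated_sequence[of I f "\<rho> - R"] I f1 R by auto
 have [measurable]: "W \<in> borel_measurable borel" using W by auto
 define vn where "vn n i = conv (mollifier (r n)) (v i)" for n i
 \<comment> \<open>Restricted to the closed R-ball, since the mollified gradients are controlled
   there only.\<close>
 define V where "V x = indicator (cball x0 R) x * sqrt (CARD('n) * \<bar>W x\<bar>)" for x
 have gr: "grad (vn n i) x $ \<alpha> = conv (mollifier (r n)) (f (i, Some \<alpha>)) x" if "x \<in> cball x0 R" for n i x \<alpha>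
 proof -
  have "cball x (r n) \<subseteq> ball x0 \<rho>"
  proof
   fix y assume "y \<in> cball x (r n)"
   then have "dist x0 y < \<rho>"
    using that r(2)[of n] dist_triangle[of x0 y x] by simp
   then show "y \<in> ball x0 \<rho>" by simp
  qed
  then show ?thesis
   unfolding vn_def f_def using grad_mollified[OF r(1) v_int weak] by simp
 qed
 have V2: "(V x)^2 = (CARD('n) * \<bar>W x\<bar>) * indicator (cball x0 R) x" for x
  by (simp add: V_def power_mult_distrib split: split_indicator)
 have iV2: "integrable lborel (\<lambda>x. (V x)^2)"
  unfolding V2 by (rule integrable_real_mult_indicator) (use W in simp_all)
 show thesis
 proof (rule that[of vn V])
  show "C_diff j (vn n i)" for n i j
   unfolding vn_def by (rule C_diff_conv[OF v_int mollifier_smooth[OF r(1)] mollifier_vanish[OF r(1)]])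
  show "\<bar>vn n i x\<bar> <= M" for n i x
   unfolding vn_def by (rule conv_bound[OF r(1) v_int v_bound])
  show "V x \<ge> 0" for x by (simp add: V_def)
  show "integrable lborel V"
  proof (rule bochner_bound)
   show "integrable lborel (\<lambda>x. indicator (cball x0 R) x + (V x)^2)"
    by (simp add: integrable_indicator_cball iV2)
   have "V x <= indicator (cball x0 R) x + (V x)^2" for x
   proof (cases "x \<in> cball x0 R")
    case True
    then show ?thesis using abs_le_one_plus_sq[of "V x"] by simp
   qed (simp add: V_def)
   moreover have "V x \<ge> 0" for x by (simp add: V_def)
   ultimately show "AE x in lborel. norm (V x) <= norm (indicator (cball x0 R) x + (V x)^2)"
    by (intro AE_I2) simp
   have "cball x0 R \<in> sets borel" by simp
   then have "V \<in> borel_measurable borel" unfolding V_def by measurable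
   then show "V \<in> borel_measurable lborel" by simp
  qed
  show "AE x in lborel. \<forall>i<k. (\<lambda>n. vn n i x) \<longlonglongrightarrow> v i x"
   using conv
  proof eventually_elim
   case (elim x)
   show ?case
   proof (intro allI impI)
    fix i assume "i < k"
    then have "(i, None) \<in> I" by (simp add: I_def)
    then show "(\<lambda>n. vn n i x) \<longlonglongrightarrow> v i x" using elim by (auto simp: vn_def f_def dest: bspec)
   qed
  qed
  show "AE x in lborel. x \<in> cball x0 R --> (\<forall>i<k. (\<lambda>n. grad (vn n i) x) \<longlonglongrightarrow> g i x)"
   using conv
  proof eventually_elim
   case (elim x)
   show ?case
   proof (intro allI impI vec_tendstoI)
    fix i \<alpha> assume x: "x \<in> cball x0 R" and i: "i < k"
    then have "(i, Some \<alpha>) \<in> I" by (simp add: I_def)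
    from bspec[OF elim this] show "(\<lambda>n. grad (vn n i) x $ \<alpha>) \<longlonglongrightarrow> g i x $ \<alpha>"
     unfolding gr[OF x] by (simp add: f_def)
   qed
  qed
  show "AE x in lborel. x \<in> cball x0 R --> (\<forall>i<k. \<forall>n. norm (grad (vn n i) x) <= V x)"
   using dom
  proof eventually_elim
   case (elim x)
   show ?case
   proof (intro allI impI)
    fix i n assume x: "x \<in> cball x0 R" and i: "i < k"
    have "(norm (grad (vn n i) x))^2 = (\<Sum>\<alpha>\<in>UNIV. (grad (vn n i) x $ \<alpha>)^2)"
     by (simp add: norm_vec_def L2_set_def sum_nonneg)
    also have "... <= (\<Sum>\<alpha>\<in>(UNIV :: 'n set). \<bar>W x\<bar>)"
    proof (rule sum_mono)
     fix \<alpha> :: 'n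
     have "(i, Some \<alpha>) \<in> I" using i by (simp add: I_def)
     from bspec[OF elim this] have "(grad (vn n i) x $ \<alpha>)^2 <= W x" unfolding gr[OF x] by simp
     then show "(grad (vn n i) x $ \<alpha>)^2 <= \<bar>W x\<bar>" by linarith
    qed
    finally have "(norm (grad (vn n i) x))^2 <= CARD('n) * \<bar>W x\<bar>" by simp
    then show "norm (grad (vn n i) x) <= V x" using x by (simp add: V_def real_le_rsqrt)
   qed
  qed
  show "integrable lborel (\<lambda>x. (V x)^2)" by (rule iV2)
 qed
qed

end

lemma mult_le_sum_squares: "(a :: real) \<ge> 0 ==> b \<ge> 0 ==> a * b <= a^2 + b^2"
 using sum_squares_bound[of a b] mult_nonneg_nonneg[of a b] by linarith

section \<open>Limits and measurability of the truncated test functions\<close>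

lemma tendsto_lev: "(f \<longlongrightarrow> a) F ==> ((\<lambda>n. lev \<kappa> \<Delta> (f n)) \<longlongrightarrow> lev \<kappa> \<Delta> a) F"
 unfolding lev_def
 by (rule isCont_tendsto_compose[of _ "bump 0"])
  (auto intro!: tendsto_intros DERIV_isCont bump_deriv simp: divide_inverse)

lemma tendsto_Dlev: "(f \<longlongrightarrow> a) F ==> ((\<lambda>n. Dlev \<kappa> \<Delta> (f n)) \<longlongrightarrow> Dlev \<kappa> \<Delta> a) F"
 unfolding Dlev_def divide_inverse
 by (rule tendsto_mult[OF isCont_tendsto_compose[of _ "bump 2"] tendsto_const])
  (auto intro!: tendsto_intros DERIV_isCont bump_deriv)

lemma borel_measurable_bump [measurable]: "bump n \<in> borel_measurable borel"
 by (rule borel_measurable_continuous_onI[OF continuous_bump])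

lemma borel_measurable_cutoff [measurable]: "cutoff x0 R b \<in> borel_measurable borel"
 by (rule borel_measurable_continuous_onI[OF C_diff_continuous[OF C_diff_cut]])

lemma borel_measurable_Dcutoff [measurable]: "Dcutoff x0 R b \<in> borel_measurable borel"
 unfolding Dcutoff_def[abs_def] by measurable

lemma borel_measurable_lev [measurable]: "lev \<kappa> \<Delta> \<in> borel_measurable borel"
 unfolding lev_def[abs_def] by measurable

lemma borel_measurable_Dlev [measurable]: "Dlev \<kappa> \<Delta> \<in> borel_measurable borel"
 unfolding Dlev_def[abs_def] by measurable

lemma borel_measurable_sqn:
 assumes [measurable]: "\<And>i. v i \<in> borel_measurable M"
 shows "sqn k v \<in> borel_measurable M"
 unfolding sqn_def[abs_def] by measurable

lemma borel_measurable_W: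
 assumes [measurable]: "\<And>i. v i \<in> borel_measurable borel"
 shows "W k x0 R b \<kappa> \<Delta> v \<in> borel_measurable borel"
proof -
 note borel_measurable_sqn[measurable]
 show ?thesis unfolding W_def[abs_def] by measurable
qed

lemma borel_measurable_DW:
 assumes [measurable]: "\<And>i. v i \<in> borel_measurable borel" "\<And>i. g i \<in> borel_measurable borel"
 shows "DW k x0 R b \<kappa> \<Delta> v g \<in> borel_measurable borel"
proof -
 note borel_measurable_sqn[measurable]
 show ?thesis unfolding DW_def[abs_def] by measurable
qed

lemma borel_measurable_DP:
 assumes [measurable]: "\<And>i. v i \<in> borel_measurable borel" "\<And>i. g i \<in> borel_measurable borel"
 shows "DP k x0 R b \<kappa> \<Delta> v g i \<in> borel_measurable borel"
proof -
 note borel_measurable_W[measurable] borel_measurable_DW[measurable]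
 show ?thesis unfolding DP_def[abs_def] by measurable
qed

lemma W_tendsto:
 assumes "\<forall>i<k. (\<lambda>n. vn n i x) \<longlonglongrightarrow> v i x"
 shows "(\<lambda>n. W k x0 R b \<kappa> \<Delta> (vn n) x) \<longlonglongrightarrow> W k x0 R b \<kappa> \<Delta> v x"
 unfolding W_def sqn_def using assms
 by (intro tendsto_mult tendsto_const tendsto_lev tendsto_sum tendsto_power) auto

lemma DW_tendsto:
 assumes "\<forall>i<k. (\<lambda>n. vn n i x) \<longlonglongrightarrow> v i x" "\<forall>i<k. (\<lambda>n. gn n i x) \<longlonglongrightarrow> g i x"
 shows "(\<lambda>n. DW k x0 R b \<kappa> \<Delta> (vn n) (gn n) x) \<longlonglongrightarrow> DW k x0 R b \<kappa> \<Delta> v g x"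
 unfolding DW_def sqn_def using assms
 by (intro tendsto_add tendsto_scaleR tendsto_mult tendsto_const tendsto_lev tendsto_Dlev tendsto_sum tendsto_power) auto

lemma DP_tendsto:
 assumes "\<forall>i<k. (\<lambda>n. vn n i x) \<longlonglongrightarrow> v i x" "\<forall>i<k. (\<lambda>n. gn n i x) \<longlonglongrightarrow> g i x" "i < k"
 shows "(\<lambda>n. DP k x0 R b \<kappa> \<Delta> (vn n) (gn n) i x) \<longlonglongrightarrow> DP k x0 R b \<kappa> \<Delta> v g i x"
 unfolding DP_def using assms by (intro tendsto_add tendsto_scaleR DW_tendsto W_tendsto) auto

lemma test_function_cutoff:
 assumes "\<And>j. C_diff j f" "\<And>x. x \<notin> cball x0 R ==> f x = 0" "cball x0 R \<subseteq> B"
 shows "test_function B f"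
proof -
 have "{x. f x \<noteq> 0} \<subseteq> cball x0 R"
 proof
  fix x assume "x \<in> {x. f x \<noteq> 0}"
  then show "x \<in> cball x0 R" using assms(2)[of x] by blast
 qed
 then have cl: "closure {x. f x \<noteq> 0} \<subseteq> cball x0 R" by (rule closure_minimal) simp
 then have "bounded (closure {x. f x \<noteq> 0})" by (rule bounded_subset[OF bounded_cball])
 then show ?thesis
  using assms cl unfolding test_function_def by (auto simp: compact_eq_bounded_closed)
qed

context slice
begin

text \<open>W v_i is not smooth. It is approximated by the same expression formed with the mollified
  v, which is a test function because the cutoff confines it to the closed R-ball. Both sides pass
  to the limit by dominated convergence, the right-hand one with a majorant quadratic in |c| and
  V.\<close>

proposition test_identity_extends:
 assumes d: "integrable lborel d" and b[measurable]: "c \<in> borel_measurable borel"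
  and c2: "integrable lborel (\<lambda>x. (norm (c x))^2)"
  and hyp: "\<And>\<phi>. test_function (ball x0 \<rho>) \<phi> ==>
   (LBINT x. d x * \<phi> x) = - (LBINT x. c x \<bullet> grad \<phi> x)"
  and R: "0 < R" "R < \<rho>" and b0: "b \<ge> 0" and \<Delta>: "\<Delta> > 0" and i: "i < k"
 shows "(LBINT x. d x * (W k x0 R b \<kappa> \<Delta> v x * v i x)) = - (LBINT x. c x \<bullet> DP k x0 R b \<kappa> \<Delta> v g i x)"
proof -
 obtain vn :: "nat => nat => real ^ 'n => real" and V where
  sm: "\<And>n i j. C_diff j (vn n i)" and vb: "\<And>n i x. \<bar>vn n i x\<bar> <= M" and V0: "\<And>x. V x \<ge> 0" and
  vc: "AE x in lborel. \<forall>i<k. (\<lambda>n. vn n i x) \<longlonglongrightarrow> v i x" and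
  gc: "AE x in lborel. x \<in> cball x0 R --> (\<forall>i<k. (\<lambda>n. grad (vn n i) x) \<longlonglongrightarrow> g i x)" and
  gd: "AE x in lborel. x \<in> cball x0 R --> (\<forall>i<k. \<forall>n. norm (grad (vn n i) x) <= V x)" and
  V2: "integrable lborel (\<lambda>x. (V x)^2)"
  by (rule smooth_sequence[OF R]) blast
 have R0: "R \<ge> 0" using R by simp
 have [measurable]: "vn n i \<in> borel_measurable borel" "grad (vn n i) \<in> borel_measurable borel" for n i
  using borel_measurable_continuous_onI[OF C_diff_continuous[OF sm]]
   borel_measurable_continuous_onI[OF continuous_grad[OF sm]] by auto
 have [measurable]: "d \<in> borel_measurable borel" using d by auto
 let ?W = "\<lambda>v. W k x0 R b \<kappa> \<Delta> v" and ?DP = "\<lambda>v g i. DP k x0 R b \<kappa> \<Delta> v g i"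
 let ?gn = "\<lambda>n i. grad (vn n i)"
 note [measurable] = borel_measurable_W borel_measurable_DP
 have id: "(LBINT x. d x * (?W (vn n) x * vn n i x)) = - (LBINT x. c x \<bullet> ?DP (vn n) (?gn n) i x)" for n
 proof -
  have "test_function (ball x0 \<rho>) (\<lambda>x. ?W (vn n) x * vn n i x)"
  proof (rule test_function_cutoff[of _ x0 R])
   show "C_diff j (\<lambda>x. ?W (vn n) x * vn n i x)" for j by (intro C_diff_mult C_diff_W sm)
   show "?W (vn n) x * vn n i x = 0" if "x \<notin> cball x0 R" for x
    using W_zero(1)[OF b0 R0, of x x0] that by (simp add: dist_norm norm_minus_commute)
  qed (use R in auto)
  from hyp[OF this] show ?thesis using grad_P[where v="vn n", OF sm \<Delta>] by simp
 qed
 have lim1: "(\<lambda>n. LBINT x. d x * (?W (vn n) x * vn n i x)) \<longlonglongrightarrow> (LBINT x. d x * (?W v x * v i x))"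
 proof (rule integral_dominated_convergence[where w="\<lambda>x. \<bar>d x\<bar> * M"])
  show "AE x in lborel. (\<lambda>n. d x * (?W (vn n) x * vn n i x)) \<longlonglongrightarrow> d x * (?W v x * v i x)"
   using vc by eventually_elim (use i in \<open>intro tendsto_mult tendsto_const W_tendsto, auto\<close>)
  show "AE x in lborel. norm (d x * (?W (vn n) x * vn n i x)) <= \<bar>d x\<bar> * M" for n
  proof (rule AE_I2)
   fix x
   have "\<bar>?W (vn n) x\<bar> * \<bar>vn n i x\<bar> <= 1 * M"
    using W_bounds[of k x0 R b \<kappa> \<Delta> "vn n" x] vb[of n i x] by (intro mult_mono) auto
   then show "norm (d x * (?W (vn n) x * vn n i x)) <= \<bar>d x\<bar> * M"
    by (simp add: abs_mult mult_left_mono)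
  qed
 qed (use d in auto)
 define C1 where "C1 = M * (4 * b * R)"
 define C2 where "C2 = 4 / \<Delta> * (real k * (M * M)) + 1"
 have lim2: "(\<lambda>n. LBINT x. c x \<bullet> ?DP (vn n) (?gn n) i x) \<longlonglongrightarrow> (LBINT x. c x \<bullet> ?DP v g i x)"
 proof (rule integral_dominated_convergence[where w="\<lambda>x. (norm (c x))^2 + (2 * C1^2 * indicator (cball x0 R) x + 2 * C2^2 * (V x)^2)"])
  show "AE x in lborel. (\<lambda>n. c x \<bullet> ?DP (vn n) (?gn n) i x) \<longlonglongrightarrow> c x \<bullet> ?DP v g i x"
   using vc gc
  proof eventually_elim
   case (elim x)
   show ?case
   proof (cases "x \<in> cball x0 R")
    case True
    then show ?thesis using elim i by (intro tendsto_inner tendsto_const DP_tendsto) auto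
   next
    case False
    then show ?thesis using W_zero(3)[OF b0 R0, of x x0] by (simp add: dist_norm norm_minus_commute)
   qed
  qed
  show "AE x in lborel. norm (c x \<bullet> ?DP (vn n) (?gn n) i x) <=
   (norm (c x))^2 + (2 * C1^2 * indicator (cball x0 R) x + 2 * C2^2 * (V x)^2)" for n
   using gd
  proof eventually_elim
   case (elim x)
   show ?case
   proof (cases "x \<in> cball x0 R")
    case True
    have "norm (?DP (vn n) (?gn n) i x) <= C1 + C2 * V x"
     unfolding C1_def C2_def using elim True by (intro DP_norm b0 R0 \<Delta> vb i) auto
    then have "(norm (?DP (vn n) (?gn n) i x))^2 <= (C1 + C2 * V x)^2"
     by (rule power_mono) simp
    also have "... <= 2 * C1^2 + 2 * (C2 * V x)^2" by (rule sq_add_le)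
    finally have 1: "(norm (?DP (vn n) (?gn n) i x))^2 <= 2 * C1^2 + 2 * C2^2 * (V x)^2"
     by (simp add: power_mult_distrib)
    have "\<bar>c x \<bullet> ?DP (vn n) (?gn n) i x\<bar> <= norm (c x) * norm (?DP (vn n) (?gn n) i x)"
     by (rule Cauchy_Schwarz_ineq2)
    also have "... <= (norm (c x))^2 + (norm (?DP (vn n) (?gn n) i x))^2"
     by (rule mult_le_sum_squares) simp_all
    finally show ?thesis using 1 True by simp
   next
    case False
    then show ?thesis using W_zero(3)[OF b0 R0, of x x0] by (simp add: dist_norm norm_minus_commute)
   qed
  qed
  show "integrable lborel (\<lambda>x. (norm (c x))^2 + (2 * C1^2 * indicator (cball x0 R) x + 2 * C2^2 * (V x)^2))"
   using c2 V2 by (simp add: integrable_indicator_cball)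
 qed auto
 have "(\<lambda>n. - (LBINT x. c x \<bullet> ?DP (vn n) (?gn n) i x)) \<longlonglongrightarrow> - (LBINT x. c x \<bullet> ?DP v g i x)"
  by (rule tendsto_minus[OF lim2])
 then show ?thesis using LIMSEQ_unique[OF lim1] id by simp
qed

end

text \<open>The increment is the integral of the gradient along the segment from x to x + y;
  Jensen's inequality on [0, 1], Fubini and translation invariance do the rest.\<close>

lemma translation_smooth:
 fixes w :: "real ^ 'n => real"
 assumes w: "C_diff (Suc 0) w"
 shows "(NNI x. ennreal ((w (x + y) - w x)^2)) <=
  ennreal ((norm y)^2) * (NNI x. ennreal ((norm (grad w x))^2))"
proof -
 have [measurable]: "grad w \<in> borel_measurable borel" "w \<in> borel_measurable borel"
  using borel_measurable_continuous_onI[OF continuous_grad[OF w]]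
   borel_measurable_continuous_onI[OF C_diff_continuous[OF w]] by auto
 let ?I = "indicator {0..1} :: real => real"
 have "ennreal ((w (x + y) - w x)^2) <= (NNI t. ennreal (?I t * ((norm y)^2 * (norm (grad w (x + t *\<^sub>R y)))^2)))" for x
 proof -
  let ?f = "\<lambda>t. grad w (x + t *\<^sub>R y) \<bullet> y"
  have D: "((\<lambda>t. w (x + t *\<^sub>R y)) has_real_derivative ?f t) (at t)" for t
  proof -
   have "((\<lambda>t. x + t *\<^sub>R y) has_derivative (\<lambda>h. h *\<^sub>R y)) (at t)"
    by (rule derivative_eq_intros refl | simp)+
   from has_derivative_compose[OF this C_diff_has_grad[OF w]]
   show ?thesis by (simp add: has_field_derivative_def mult_commute_abs)
  qed
  have cf: "isCont ?f t" for t
  proof -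
   have "continuous_on UNIV (\<lambda>t::real. x + t *\<^sub>R y)"
    by (rule continuous_on_add[OF continuous_on_const continuous_on_scaleR[OF continuous_on_id continuous_on_const]])
   then have "continuous_on UNIV (\<lambda>t. grad w (x + t *\<^sub>R y))"
    by (rule continuous_on_compose2[OF continuous_grad[OF w]]) simp
   then have "continuous_on UNIV ?f" by (rule continuous_on_inner[OF _ continuous_on_const])
   then show ?thesis by (simp add: continuous_on_eq_continuous_at)
  qed
  have fb: "has_bochner_integral lborel (\<lambda>t. ?f t * ?I t) (w (x + 1 *\<^sub>R y) - w (x + 0 *\<^sub>R y))"
   by (rule has_bochner_integral_FTC_Icc_real) (use D cf in auto)
  have "ennreal ((LBINT t. ?I t * ?f t)^2) <= (NNI t. ennreal (?I t * (?f t)^2))"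
  proof (rule jensen_square)
   show "integrable lborel (\<lambda>t. ?I t * ?f t)"
    using fb by (simp add: has_bochner_integral_iff mult.commute[of "?I _"])
   show "?f \<in> borel_measurable borel" by measurable
  qed (auto simp: integrable_indicator_iff)
  also have "(LBINT t. ?I t * ?f t) = w (x + y) - w x"
   using has_bochner_integral_integral_eq[OF fb] by (simp add: mult.commute[of "?I _"])
  also have "(NNI t. ennreal (?I t * (?f t)^2)) <=
    (NNI t. ennreal (?I t * ((norm y)^2 * (norm (grad w (x + t *\<^sub>R y)))^2)))"
  proof (intro nn_integral_mono ennreal_leI mult_left_mono)
   fix t
   have "(?f t)^2 <= (norm (grad w (x + t *\<^sub>R y)) * norm y)^2"
    using Cauchy_Schwarz_ineq2[of "grad w (x + t *\<^sub>R y)" y] power_mono[of "\<bar>?f t\<bar>" _ 2] by simp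
   then show "(?f t)^2 <= (norm y)^2 * (norm (grad w (x + t *\<^sub>R y)))^2"
    by (simp add: power_mult_distrib mult.commute)
  qed simp
  finally show ?thesis .
 qed
 then have "(NNI x. ennreal ((w (x + y) - w x)^2)) <=
  (NNI x. NNI t. ennreal (?I t * ((norm y)^2 * (norm (grad w (x + t *\<^sub>R y)))^2)))"
  by (intro nn_integral_mono)
 also have "... = (NNI t. NNI x. ennreal (?I t * ((norm y)^2 * (norm (grad w (x + t *\<^sub>R y)))^2)))"
  by (rule lborel_pair.Fubini'[symmetric]) measurable
 also have "... = (NNI t. ennreal (?I t) * (ennreal ((norm y)^2) * (NNI x. ennreal ((norm (grad w x))^2))))"
 proof (rule nn_integral_cong)
  fix t :: real
  have "(NNI x. ennreal ((norm (grad w (x + t *\<^sub>R y)))^2)) = (NNI x. ennreal ((norm (grad w x))^2))"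
   by (rule nn_integral_shift) measurable
  then show "(NNI x. ennreal (?I t * ((norm y)^2 * (norm (grad w (x + t *\<^sub>R y)))^2))) =
   ennreal (?I t) * (ennreal ((norm y)^2) * (NNI x. ennreal ((norm (grad w x))^2)))"
   by (simp add: ennreal_mult nn_integral_cmult)
 qed
 also have "... = (NNI t. ennreal (?I t)) * (ennreal ((norm y)^2) * (NNI x. ennreal ((norm (grad w x))^2)))"
  by (rule nn_integral_multc) simp
 also have "(NNI t. ennreal (?I t)) = 1"
  by (simp add: ennreal_indicator)
 finally show ?thesis by simp
qed

text \<open>The Faber--Krahn inequality: if \<open>w\<close> vanishes on half of each ball of radius \<open>l\<close>, then
 \<open>|w(x)|^2\<close> is controlled by the average of \<open>|w(x + y) - w(x)|^2\<close> over \<open>|y| < l\<close>.\<close>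

proposition faber_krahn:
 fixes w :: "'a::euclidean_space => real"
 assumes [measurable]: "w \<in> borel_measurable borel"
  and T: "\<And>y. (NNI x. ennreal ((w (x + y) - w x)^2)) <= ennreal ((norm y)^2) * K"
  and a: "emeasure lborel {x. w x \<noteq> 0} <= ennreal a" and l: "l > 0"
  and al: "2 * a <= measure lborel (ball (0::'a) l)"
 shows "(NNI x. ennreal ((w x)^2)) <= ennreal (2 * l^2) * K"
proof -
 let ?B = "ball (0::'a) l"
 define m where "m = measure lborel ?B"
 have [measurable]: "?B \<in> sets borel" "{z. w z = 0} \<in> sets borel" "{z. w z \<noteq> 0} \<in> sets borel" by measurable
 have m: "m > 0" using l content_ball_gt_0_iff[of "0::'a" l] by (simp add: m_def)
 have em: "emeasure lborel ?B = ennreal m"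
  using emeasure_bounded_finite[of ?B] by (simp add: m_def emeasure_eq_ennreal_measure top.not_eq_extremum)
 have half: "ennreal (m / 2) <= (NNI y. indicator ?B y * indicator {z. w z = 0} (x + y))" for x
 proof -
  have "ennreal m = (NNI y. indicator ?B y)" using em by simp
  also have "... <= (NNI y. indicator ?B y * indicator {z. w z = 0} (x + y) + indicator {z. w z \<noteq> 0} (y + x))"
   by (intro nn_integral_mono) (auto split: split_indicator simp: add.commute)
  also have "... = (NNI y. indicator ?B y * indicator {z. w z = 0} (x + y)) +
    (NNI y. indicator {z. w z \<noteq> 0} (y + x))"
   by (rule nn_integral_add) measurable
  also have "(NNI y. indicator {z. w z \<noteq> 0} (y + x)) = emeasure lborel {z. w z \<noteq> 0}"
   using nn_integral_shift[of "indicator {z. w z \<noteq> 0}" x] by simp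
  also have "... <= ennreal (m / 2)"
   using a al by (rule_tac order_trans[OF a]) (simp add: m_def ennreal_leI)
  finally have "ennreal m <= (NNI y. indicator ?B y * indicator {z. w z = 0} (x + y)) + ennreal (m / 2)"
   by (simp add: add_left_mono)
  moreover have "ennreal m = ennreal (m / 2) + ennreal (m / 2)"
   using m by (simp flip: ennreal_plus)
  ultimately show ?thesis by (simp add: ennreal_add_left_cancel_le add.commute)
 qed
 have "ennreal (m / 2) * (NNI x. ennreal ((w x)^2)) = (NNI x. ennreal ((w x)^2) * ennreal (m / 2))"
  by (subst nn_integral_multc) (simp_all add: mult.commute)
 also have "... <= (NNI x. ennreal ((w x)^2) * (NNI y. indicator ?B y * indicator {z. w z = 0} (x + y)))"
  by (intro nn_integral_mono mult_left_mono half) simp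
 also have "... = (NNI x. NNI y. ennreal ((w x)^2) * (indicator ?B y * indicator {z. w z = 0} (x + y)))"
  by (intro nn_integral_cong nn_integral_cmult[symmetric]) measurable
 \<comment> \<open>Where w(x + y) = 0, the square of w(x) is the square of the increment.\<close>
 also have "... <= (NNI x. NNI y. indicator ?B y * ennreal ((w (x + y) - w x)^2))"
  by (intro nn_integral_mono) (auto split: split_indicator)
 also have "... = (NNI y. NNI x. indicator ?B y * ennreal ((w (x + y) - w x)^2))"
  by (rule lborel_pair.Fubini'[symmetric]) measurable
 also have "... = (NNI y. indicator ?B y * (NNI x. ennreal ((w (x + y) - w x)^2)))"
  by (intro nn_integral_cong nn_integral_cmult) measurable
 also have "... <= (NNI y. indicator ?B y * (ennreal (l^2) * K))"
 proof (rule nn_integral_mono)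
  fix y :: 'a
  show "indicator ?B y * (NNI x. ennreal ((w (x + y) - w x)^2)) <= indicator ?B y * (ennreal (l^2) * K)"
  proof (cases "y \<in> ?B")
   case True
   then have "ennreal ((norm y)^2) <= ennreal (l^2)" by (intro ennreal_leI power_mono) auto
   then show ?thesis using True order_trans[OF T mult_right_mono] by simp
  qed simp
 qed
 also have "... = ennreal m * (ennreal (l^2) * K)"
  using em by (subst nn_integral_multc) simp_all
 finally have 1: "ennreal (m / 2) * (NNI x. ennreal ((w x)^2)) <= ennreal m * (ennreal (l^2) * K)" .
 have "(NNI x. ennreal ((w x)^2)) = ennreal (2 / m) * (ennreal (m / 2) * (NNI x. ennreal ((w x)^2)))"
  using m by (simp add: mult.assoc[symmetric] ennreal_mult[symmetric])
 also have "... <= ennreal (2 / m) * (ennreal m * (ennreal (l^2) * K))"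
  by (intro mult_left_mono 1) simp
 also have "... = ennreal (2 * l^2) * K"
  using m by (simp add: mult.assoc[symmetric] ennreal_mult[symmetric])
 finally show ?thesis .
qed

context slice
begin

text \<open>\<open>translation_smooth\<close> holds for the smooth approximations; Fatou's lemma on
  the left and dominated convergence on the right carry it over to v.\<close>

proposition translation_W:
 assumes R: "0 < R" "R < \<rho>" and b0: "b \<ge> 0" and \<Delta>: "\<Delta> > 0"
 shows "(NNI x. ennreal ((W k x0 R b \<kappa> \<Delta> v (x + y) - W k x0 R b \<kappa> \<Delta> v x)^2)) <=
  ennreal ((norm y)^2) * (NNI x. ennreal ((norm (DW k x0 R b \<kappa> \<Delta> v g x))^2))"
proof -
 obtain vn :: "nat => nat => real ^ 'n => real" and V where
  sm: "\<And>n i j. C_diff j (vn n i)" and vb: "\<And>n i x. \<bar>vn n i x\<bar> <= M" and V0: "\<And>x. V x \<ge> 0" and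
  vc: "AE x in lborel. \<forall>i<k. (\<lambda>n. vn n i x) \<longlonglongrightarrow> v i x" and
  gc: "AE x in lborel. x \<in> cball x0 R --> (\<forall>i<k. (\<lambda>n. grad (vn n i) x) \<longlonglongrightarrow> g i x)" and
  gd: "AE x in lborel. x \<in> cball x0 R --> (\<forall>i<k. \<forall>n. norm (grad (vn n i) x) <= V x)" and
  V2: "integrable lborel (\<lambda>x. (V x)^2)"
  by (rule smooth_sequence[OF R]) blast
 have R0: "R \<ge> 0" using R by simp
 have [measurable]: "vn n i \<in> borel_measurable borel" "grad (vn n i) \<in> borel_measurable borel" for n i
  using borel_measurable_continuous_onI[OF C_diff_continuous[OF sm]]
   borel_measurable_continuous_onI[OF continuous_grad[OF sm]] by auto
 let ?W = "\<lambda>v. W k x0 R b \<kappa> \<Delta> v" and ?DW = "\<lambda>v g. DW k x0 R b \<kappa> \<Delta> v g"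
 let ?gn = "\<lambda>n i. grad (vn n i)"
 note [measurable] = borel_measurable_W borel_measurable_DW
 define C1 where "C1 = 4 * b * R"
 define C2 where "C2 = 4 / \<Delta> * (real k * M)"
 have smooth: "(NNI x. ennreal ((?W (vn n) (x + y) - ?W (vn n) x)^2)) <=
   ennreal ((norm y)^2) * (NNI x. ennreal ((norm (?DW (vn n) (?gn n) x))^2))" for n
  using translation_smooth[of "?W (vn n)" y, OF C_diff_W[OF sm]] grad_W[where v="vn n", OF sm \<Delta>] by simp
 let ?w = "\<lambda>x. 2 * C1^2 * indicator (cball x0 R) x + 2 * C2^2 * (V x)^2"
 have lim: "(\<lambda>n. NNI x. ennreal ((norm (?DW (vn n) (?gn n) x))^2)) \<longlonglongrightarrow>
   (NNI x. ennreal ((norm (?DW v g x))^2))"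
 proof (rule nn_integral_dominated_convergence[where w="\<lambda>x. ennreal (?w x)"])
  have iw: "integrable lborel ?w" using V2 by (simp add: integrable_indicator_cball)
  show "(NNI x. ennreal (?w x)) < \<infinity>"
   by (subst nn_integral_eq_integral[OF iw]) (auto intro!: AE_I2 add_nonneg_nonneg)
  show "(\<lambda>x. ennreal (?w x)) \<in> borel_measurable lborel"
   by (rule measurable_compose[OF borel_measurable_integrable[OF iw] measurable_ennreal])
  show "AE x in lborel. (\<lambda>n. ennreal ((norm (?DW (vn n) (?gn n) x))^2)) \<longlonglongrightarrow> ennreal ((norm (?DW v g x))^2)"
   using vc gc
  proof eventually_elim
   case (elim x)
   show ?case
   proof (cases "x \<in> cball x0 R")
    case True
    then show ?thesis using elim by (intro tendsto_ennrealI tendsto_power tendsto_norm DW_tendsto) auto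
   next
    case False
    then show ?thesis using W_zero(2)[OF b0 R0, of x x0] by (simp add: dist_norm norm_minus_commute)
   qed
  qed
  show "AE x in lborel. ennreal ((norm (?DW (vn n) (?gn n) x))^2) <= ennreal (?w x)" for n
   using gd
  proof eventually_elim
   case (elim x)
   show ?case
   proof (cases "x \<in> cball x0 R")
    case True
    have "norm (?DW (vn n) (?gn n) x) <= 4 * b * R + 4 / \<Delta> * (real k * (M * V x))"
     using elim True by (intro DW_norm b0 R0 \<Delta> vb) auto
    then have "norm (?DW (vn n) (?gn n) x) <= C1 + C2 * V x"
     by (simp add: C1_def C2_def mult_ac)
    then have "(norm (?DW (vn n) (?gn n) x))^2 <= (C1 + C2 * V x)^2" by (rule power_mono) simp
    also have "... <= 2 * C1^2 + 2 * (C2 * V x)^2" by (rule sq_add_le)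
    finally show ?thesis using True by (intro ennreal_leI) (simp add: power_mult_distrib)
   next
    case False
    then show ?thesis using W_zero(2)[OF b0 R0, of x x0] by (simp add: dist_norm norm_minus_commute)
   qed
  qed
 qed auto
 have vcy: "AE x in lborel. \<forall>i<k. (\<lambda>n. vn n i (x + y)) \<longlonglongrightarrow> v i (x + y)"
  by (rule AE_lborel_shift[OF vc])
 show ?thesis
 \<comment> \<open>In extended reals the limit of the product is safe unless a factor 0 meets an
   infinite one; treating y = 0 apart excludes this.\<close>
 proof (cases "y = 0")
  case False
 have "(NNI x. ennreal ((?W v (x + y) - ?W v x)^2)) =
  (NNI x. liminf (\<lambda>n. ennreal ((?W (vn n) (x + y) - ?W (vn n) x)^2)))"
 proof (rule nn_integral_cong_AE)
  show "AE x in lborel. ennreal ((?W v (x + y) - ?W v x)^2) =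
    liminf (\<lambda>n. ennreal ((?W (vn n) (x + y) - ?W (vn n) x)^2))"
   using vc vcy
  proof eventually_elim
   case (elim x)
   then have "(\<lambda>n. ennreal ((?W (vn n) (x + y) - ?W (vn n) x)^2)) \<longlonglongrightarrow> ennreal ((?W v (x + y) - ?W v x)^2)"
    by (intro tendsto_ennrealI tendsto_power tendsto_diff W_tendsto) auto
   then show ?case by (intro lim_imp_Liminf[symmetric]) simp_all
  qed
 qed
 also have "... <= liminf (\<lambda>n. NNI x. ennreal ((?W (vn n) (x + y) - ?W (vn n) x)^2))"
  by (rule nn_integral_liminf) measurable
 also have "... <= liminf (\<lambda>n. ennreal ((norm y)^2) * (NNI x. ennreal ((norm (?DW (vn n) (?gn n) x))^2)))"
  by (intro Liminf_mono always_eventually allI smooth)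
 also have "... = ennreal ((norm y)^2) * (NNI x. ennreal ((norm (?DW v g x))^2))"
  by (intro lim_imp_Liminf tendsto_mult_ennreal tendsto_const lim) (simp_all add: False)
 finally show ?thesis .
 qed simp
qed

end

section \<open>Local solutions and the energy estimate\<close>

lemma AE_lborel_prod:
 assumes "AE z in lborel. P (z :: 'a::euclidean_space \<times> 'b::euclidean_space)"
 shows "AE t in lborel. AE x in lborel. P (x, t)"
proof -
 obtain N where N: "{z \<in> space lborel. \<not> P z} \<subseteq> N" "emeasure lborel N = 0" "N \<in> sets lborel"
  using AE_E[OF assms] by blast
 have [measurable]: "N \<in> sets (borel \<Otimes>\<^sub>M borel)" using N(3) by (subst borel_prod) simp
 have "AE z in lborel \<Otimes>\<^sub>M lborel. z \<notin> N"
  unfolding lborel_prod using N by (intro AE_not_in) auto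
 then have "AE x in lborel. AE t in lborel. (x, t) \<notin> N"
  by (rule lborel_pair.AE_pair)
 then have "AE t in lborel. AE x in lborel. (x, t) \<notin> N"
  by (subst (asm) lborel_pair.AE_commute) measurable
 then show ?thesis
 proof eventually_elim
  case (elim t)
  then show ?case by eventually_elim (use N(1) in auto)
 qed
qed

lemma integral_lborel_prod:
 fixes f :: "'a::euclidean_space \<times> 'b::euclidean_space => 'c::{banach, second_countable_topology}"
 assumes f: "integrable lborel f"
 shows "(LBINT z. f z) = (LBINT t. (LBINT x. f (x, t)))"
  and "(LBINT z. f z) = (LBINT x. (LBINT t. f (x, t)))"
  and "integrable lborel (\<lambda>t. LBINT x. f (x, t))"
  and "integrable lborel (\<lambda>x. LBINT t. f (x, t))"
  and "AE t in lborel. integrable lborel (\<lambda>x. f (x, t))"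
  and "AE x in lborel. integrable lborel (\<lambda>t. f (x, t))"
proof -
 have f': "integrable (lborel \<Otimes>\<^sub>M lborel) (case_prod (\<lambda>x t. f (x, t)))"
  using f by (simp add: lborel_prod)
 have i: "(LBINT z. f z) = integral\<^sup>L (lborel \<Otimes>\<^sub>M lborel) (case_prod (\<lambda>x t. f (x, t)))"
  by (simp add: lborel_prod)
 show "(LBINT z. f z) = (LBINT t. (LBINT x. f (x, t)))"
  unfolding i by (rule lborel_pair.integral_snd[OF f', symmetric])
 show "(LBINT z. f z) = (LBINT x. (LBINT t. f (x, t)))"
  unfolding i by (rule lborel_pair.integral_fst[OF f', symmetric])
 show "integrable lborel (\<lambda>t. LBINT x. f (x, t))" by (rule lborel_pair.integrable_snd[OF f'])
 show "integrable lborel (\<lambda>x. LBINT t. f (x, t))" by (rule lborel_pair.integrable_fst[OF f'])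
 show "AE t in lborel. integrable lborel (\<lambda>x. f (x, t))" by (rule lborel_pair.AE_integrable_snd[OF f'])
 show "AE x in lborel. integrable lborel (\<lambda>t. f (x, t))" by (rule lborel_pair.AE_integrable_fst[OF f'])
qed

lemma nn_integral_lborel_prod:
 fixes f :: "'a::euclidean_space \<times> 'b::euclidean_space => ennreal"
 assumes [measurable]: "f \<in> borel_measurable borel"
 shows "(NNI z. f z) = (NNI t. (NNI x. f (x, t)))"
  and "(NNI z. f z) = (NNI x. (NNI t. f (x, t)))"
proof -
 have f: "f \<in> borel_measurable (lborel \<Otimes>\<^sub>M lborel)" by (simp add: lborel_prod)
 show "(NNI z. f z) = (NNI t. (NNI x. f (x, t)))"
  using lborel_pair.nn_integral_snd[OF f] by (simp add: lborel_prod)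
 show "(NNI z. f z) = (NNI x. (NNI t. f (x, t)))"
  using lborel.nn_integral_fst[OF f] by (simp add: lborel_prod)
qed

text \<open>\<open>psi\<close> is |v| h(|v|^2) as a function of s = |u|, where |v| = s^m, and
  \<open>Psi\<close> is its primitive. Since \<open>psi\<close> is increasing, \<open>Psi\<close> is
  convex; it is the energy density whose time derivative would formally be h(|v|^2) v . u_t.\<close>

definition psi :: "real => real => real => real => real" where
 "psi m \<kappa> \<Delta> s = (if s > 0 then s powr m * lev \<kappa> \<Delta> (s powr (2 * m)) else 0)"

definition Psi :: "real => real => real => real => real" where
 "Psi m \<kappa> \<Delta> s = (LBINT \<sigma>. indicator {0..s} \<sigma> * psi m \<kappa> \<Delta> \<sigma>)"

lemma psi_nonneg: "0 <= psi m \<kappa> \<Delta> s"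
 by (simp add: psi_def lev_bounds)

lemma psi_mono: "m > 0 ==> \<Delta> > 0 ==> s <= t ==> psi m \<kappa> \<Delta> s <= psi m \<kappa> \<Delta> t"
 by (auto simp: psi_def intro!: mult_mono lev_mono powr_mono2 lev_bounds mult_nonneg_nonneg)

lemma psi_measurable [measurable]: "psi m \<kappa> \<Delta> \<in> borel_measurable borel"
 unfolding psi_def[abs_def] by measurable

lemma psi_le: "0 <= s ==> psi m \<kappa> \<Delta> s <= s powr m"
 using lev_bounds[of \<kappa> \<Delta> "s powr (2*m)"] by (simp add: psi_def mult_left_le)

lemma Psi_bounds:
 assumes m: "m > 0" and \<Delta>: "\<Delta> > 0" and ab: "0 <= a" "a <= b"
 shows "(b - a) * psi m \<kappa> \<Delta> a <= Psi m \<kappa> \<Delta> b - Psi m \<kappa> \<Delta> a"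
  and "Psi m \<kappa> \<Delta> b - Psi m \<kappa> \<Delta> a <= (b - a) * psi m \<kappa> \<Delta> b"
proof -
 let ?p = "psi m \<kappa> \<Delta>"
 have int: "integrable lborel (\<lambda>\<sigma>. indicator {c..d} \<sigma> * ?p \<sigma>)" for c d :: real
 proof (rule bochner_bound)
  show "integrable lborel (\<lambda>\<sigma>. ?p d * indicator {c..d} \<sigma>)"
   by (simp add: integrable_indicator_iff emeasure_lborel_Icc_eq)
  show "AE x in lborel. norm (indicator {c..d} x * ?p x) <= norm (?p d * indicator {c..d} x)"
   using psi_nonneg psi_mono[OF m \<Delta>] by (intro AE_I2) (auto split: split_indicator)
 qed simp
 have "Psi m \<kappa> \<Delta> b - Psi m \<kappa> \<Delta> a = (LBINT \<sigma>. indicator {0..b} \<sigma> * ?p \<sigma> - indicator {0..a} \<sigma> * ?p \<sigma>)"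
  unfolding Psi_def by (rule bochner_diff[symmetric]) (rule int)+
 also have "... = (LBINT \<sigma>. indicator {a<..b} \<sigma> * ?p \<sigma>)"
  by (rule bochner_cong) (use ab in \<open>auto split: split_indicator\<close>)
 finally have eq: "Psi m \<kappa> \<Delta> b - Psi m \<kappa> \<Delta> a = (LBINT \<sigma>. indicator {a<..b} \<sigma> * ?p \<sigma>)" .
 have int': "integrable lborel (\<lambda>\<sigma>. indicator {a<..b} \<sigma> * ?p \<sigma>)"
  by (rule bochner_bound[OF int[of a b]])
   (auto split: split_indicator intro!: AE_I2)
 have c: "(LBINT \<sigma>. c * indicator {a<..b} \<sigma>) = (b - a) * c" for c :: real
  using ab by simp
 have ic: "integrable lborel (\<lambda>\<sigma>. c * indicator {a<..b} \<sigma> :: real)" for c :: real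
  using ab by (simp add: integrable_indicator_iff)
 have "(LBINT \<sigma>. ?p a * indicator {a<..b} \<sigma>) <= (LBINT \<sigma>. indicator {a<..b} \<sigma> * ?p \<sigma>)"
  by (intro integral_mono ic int') (auto split: split_indicator intro: psi_mono[OF m \<Delta>])
 then show "(b - a) * ?p a <= Psi m \<kappa> \<Delta> b - Psi m \<kappa> \<Delta> a" unfolding eq c .
 have "(LBINT \<sigma>. indicator {a<..b} \<sigma> * ?p \<sigma>) <= (LBINT \<sigma>. ?p b * indicator {a<..b} \<sigma>)"
  by (intro integral_mono ic int') (auto split: split_indicator intro: psi_mono[OF m \<Delta>])
 then show "Psi m \<kappa> \<Delta> b - Psi m \<kappa> \<Delta> a <= (b - a) * ?p b" unfolding eq c .
qed

lemma Psi_0: "Psi m \<kappa> \<Delta> 0 = 0"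
proof -
 have "(\<lambda>\<sigma>. indicator {0..0} \<sigma> * psi m \<kappa> \<Delta> \<sigma>) = (\<lambda>\<sigma>. 0)"
  by (auto simp: psi_def fun_eq_iff split: split_indicator)
 then show ?thesis by (simp add: Psi_def)
qed

lemma Psi_nonneg: "0 <= Psi m \<kappa> \<Delta> s"
 unfolding Psi_def by (rule bochner_nonneg) (simp add: psi_nonneg)

text \<open>The subgradient inequality at \<open>a\<close>. In the application \<open>a\<close>
  belongs to the later and \<open>b\<close> to the earlier time.\<close>

lemma Psi_convex:
 assumes m: "m > 0" and \<Delta>: "\<Delta> > 0" and ab: "0 <= a" "0 <= b"
 shows "Psi m \<kappa> \<Delta> a - Psi m \<kappa> \<Delta> b <= (a - b) * psi m \<kappa> \<Delta> a"
proof (cases "a <= b")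
 case True
 then show ?thesis using Psi_bounds(1)[OF m \<Delta> ab(1) True, of \<kappa>] by (simp add: algebra_simps)
next
 case False
 then show ?thesis using Psi_bounds(2)[OF m \<Delta> ab(2), of a \<kappa>] by simp
qed

lemma Psi_lipschitz:
 assumes m: "m > 0" and \<Delta>: "\<Delta> > 0" and ab: "0 <= a" "a <= M" "0 <= b" "b <= M"
 shows "\<bar>Psi m \<kappa> \<Delta> a - Psi m \<kappa> \<Delta> b\<bar> <= M powr m * \<bar>a - b\<bar>"
proof -
 have "\<bar>Psi m \<kappa> \<Delta> c - Psi m \<kappa> \<Delta> d\<bar> <= M powr m * \<bar>c - d\<bar>" if "0 <= d" "d <= c" "c <= M" for c d
 proof -
  have "0 <= (c - d) * psi m \<kappa> \<Delta> d" using that psi_nonneg by simp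
  then have "0 <= Psi m \<kappa> \<Delta> c - Psi m \<kappa> \<Delta> d" using Psi_bounds(1)[OF m \<Delta> that(1,2), of \<kappa>] by linarith
  moreover have "psi m \<kappa> \<Delta> c <= M powr m"
   using psi_le[of c m \<kappa> \<Delta>] powr_mono2[of m c M] that m by linarith
  then have "(c - d) * psi m \<kappa> \<Delta> c <= (c - d) * M powr m" using that by (intro mult_left_mono) auto
  ultimately show ?thesis using Psi_bounds(2)[OF m \<Delta> that(1,2), of \<kappa>] that by (simp add: mult.commute)
 qed
 from this[of a b] this[of b a] show ?thesis using ab by (cases "a <= b") (auto simp: abs_minus_commute)
qed

lemma Psi_le:
 assumes m: "m > 0" and \<Delta>: "\<Delta> > 0" and s: "0 <= s"
 shows "Psi m \<kappa> \<Delta> s <= s * psi m \<kappa> \<Delta> s"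
 using Psi_convex[OF m \<Delta> s order_refl, of \<kappa>] by (simp add: Psi_0)

lemma Psi_ge:
 assumes m: "m > 0" and \<Delta>: "\<Delta> > 0" and s: "0 <= s'" "s' <= s"
 shows "(s - s') * psi m \<kappa> \<Delta> s' <= Psi m \<kappa> \<Delta> s"
 using Psi_bounds(1)[OF m \<Delta> s, of \<kappa>] Psi_nonneg[of m \<kappa> \<Delta> s'] by linarith

lemma Psi_measurable:
 assumes "m > 0" "\<Delta> > 0" shows "Psi m \<kappa> \<Delta> \<in> borel_measurable borel"
proof (rule borel_measurable_mono)
 show "mono (Psi m \<kappa> \<Delta>)"
 proof (rule monoI)
  fix s t :: real assume st: "s <= t"
  show "Psi m \<kappa> \<Delta> s <= Psi m \<kappa> \<Delta> t"
  proof (cases "s \<ge> 0")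
   case True
   then have "0 <= (t - s) * psi m \<kappa> \<Delta> s" using st psi_nonneg by simp
   then show ?thesis using Psi_bounds(1)[OF assms True st, of \<kappa>] by linarith
  next
   case False
   then have "Psi m \<kappa> \<Delta> s = 0" by (simp add: Psi_def)
   then show ?thesis using Psi_nonneg by simp
  qed
 qed
qed

text \<open>The setting of all estimates: Borel functions extended by zero outside a bounded
  cylinder, for which ellipticity, growth and the sign condition hold at every point. S is |u|, V is
  v, G its gradient and A the field along the solution. \<open>T\<close> is a set of good times of
  full measure. For these the slices have weak gradients, \<open>evolution\<close> is the equation
  integrated between two of them, and \<open>continuity\<close> is continuity in L^1 along
  \<open>T\<close>.\<close>

locale local_solution =
 fixes k :: nat and m \<nu> L M :: real and x0 :: "real ^ 'n" and \<rho> t1 t2 :: real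
  and U :: "nat => (real ^ 'n) \<times> real => real"
  and G A F :: "nat => (real ^ 'n) \<times> real => real ^ 'n"
  and T :: "real set"
 fixes S :: "(real ^ 'n) \<times> real => real" and V :: "nat => (real ^ 'n) \<times> real => real"
 defines "S \<equiv> \<lambda>z. sqrt (sqn k U z)" and "V \<equiv> \<lambda>i z. S z powr (m - 1) * U i z"
 assumes m: "0 < m" "m < 1" and \<nu>: "\<nu> > 0" and L: "L > 0" and M: "M > 0" and \<rho>: "\<rho> > 0" and t12: "t1 < t2"
  and U_meas[measurable]: "\<And>i. U i \<in> borel_measurable borel"
  and G_meas[measurable]: "\<And>i. G i \<in> borel_measurable borel"
  and A_meas[measurable]: "\<And>i. A i \<in> borel_measurable borel"
  and F_meas[measurable]: "\<And>i. F i \<in> borel_measurable borel"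
  and S_bound: "\<And>z. S z <= M"
  and outside: "\<And>i z. z \<notin> ball x0 \<rho> \<times> {t1<..<t2} \<or> i \<ge> k ==> U i z = 0 \<and> G i z = 0 \<and> A i z = 0 \<and> F i z = 0"
  and G_L2: "\<And>i. integrable lborel (\<lambda>z. (norm (G i z))^2)"
  and A_L2: "\<And>i. integrable lborel (\<lambda>z. (norm (A i z))^2)"
  and F_L2: "\<And>i. integrable lborel (\<lambda>z. (norm (F i z))^2)"
  and ellipticity: "\<And>z. \<nu> * (\<Sum>i<k. (norm (G i z))^2) <= (\<Sum>i<k. A i z \<bullet> G i z)"
  and growth: "\<And>z. (\<Sum>i<k. (norm (A i z))^2) <= L^2 * (\<Sum>i<k. (norm (G i z))^2)"
  and sign: "\<And>z. (\<Sum>i<k. V i z *\<^sub>R A i z) \<bullet> (\<Sum>i<k. V i z *\<^sub>R G i z) \<ge> 0"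
  and T_sub: "T \<subseteq> {t1<..<t2}" and T_full: "AE t in lborel. t \<in> {t1<..<t2} --> t \<in> T"
  and slice_weak: "\<And>t i. t \<in> T ==> weak_grad_on (ball x0 \<rho>) (\<lambda>x. V i (x, t)) (\<lambda>x. G i (x, t))"
  and slice_L2: "\<And>t i. t \<in> T ==> integrable lborel (\<lambda>x. (norm (G i (x, t)))^2)"
  and evolution: "\<And>s t i \<phi>. s \<in> T ==> t \<in> T ==> s < t ==> test_function (ball x0 \<rho>) \<phi> ==>
   (LBINT x. (U i (x, t) - U i (x, s)) * \<phi> x) =
   - (LBINT z. indicator {s<..<t} (snd z) * ((A i z + F i z) \<bullet> grad \<phi> (fst z)))"
  and continuity: "\<And>s e. s \<in> T ==> e > 0 ==>
   \<exists>d>0. \<forall>t\<in>T. \<bar>t - s\<bar> < d --> (LBINT x. (\<Sum>i<k. \<bar>U i (x, t) - U i (x, s)\<bar>)) < e"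
begin

lemma sqn_nonneg: "0 <= sqn k U z"
 by (simp add: sqn_def sum_nonneg)

lemma S_nonneg: "0 <= S z"
 by (simp add: S_def sqn_nonneg)

lemma S_sq: "(S z)^2 = sqn k U z"
 by (simp add: S_def sqn_nonneg)

lemma S_meas[measurable]: "S \<in> borel_measurable borel"
proof -
 note borel_measurable_sqn[measurable]
 show ?thesis unfolding S_def by measurable
qed

lemma V_meas[measurable]: "V i \<in> borel_measurable borel"
 unfolding V_def by measurable

lemma U_le_S: "\<bar>U i z\<bar> <= S z"
proof (cases "i < k")
 case True
 have "(U i z)^2 <= sqn k U z"
  unfolding sqn_def by (rule member_le_sum) (use True in auto)
 then show ?thesis by (simp add: S_def real_le_rsqrt)
next
 case False
 then show ?thesis using outside[of z i] S_nonneg by simp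
qed

lemma sqn_V: "sqn k V z = S z powr (2 * m)"
proof (cases "S z = 0")
 case True
 then show ?thesis by (simp add: sqn_def V_def)
next
 case False
 then have s: "S z > 0" using S_nonneg[of z] by simp
 have "sqn k V z = (S z powr (m - 1))^2 * (S z)^2"
  unfolding S_sq by (simp add: sqn_def V_def power_mult_distrib sum_distrib_left)
 also have "... = (S z powr (m - 1) * S z powr 1)^2" using s by (simp add: power_mult_distrib)
 also have "S z powr (m - 1) * S z powr 1 = S z powr m" by (subst powr_add[symmetric]) simp
 also have "(S z powr m)^2 = S z powr (2 * m)"
  using s by (simp add: power2_eq_square flip: powr_add)
 finally show ?thesis .
qed

lemma V_U: "(\<Sum>i<k. V i z * U i z) = S z powr m * S z"
proof (cases "S z = 0")
 case False
 then have s: "S z > 0" using S_nonneg[of z] by simp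
 have "(\<Sum>i<k. V i z * U i z) = S z powr (m - 1) * (S z)^2"
  unfolding S_sq by (simp add: sqn_def V_def sum_distrib_left power2_eq_square mult.assoc)
 also have "... = (S z powr (m - 1) * S z powr 1) * S z" using s by (simp add: power2_eq_square)
 also have "S z powr (m - 1) * S z powr 1 = S z powr m" by (subst powr_add[symmetric]) simp
 finally show ?thesis .
qed (simp add: V_def)

definition \<Lambda> :: real where "\<Lambda> = M powr (2 * m)"

lemma \<Lambda>_pos: "\<Lambda> > 0" using M by (simp add: \<Lambda>_def)

lemma sqn_V_le: "sqn k V z <= \<Lambda>"
 unfolding sqn_V \<Lambda>_def using S_nonneg S_bound m by (intro powr_mono2) auto

lemma V_bound: "\<bar>V i z\<bar> <= M powr m"
proof (cases "i < k")
 case True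
 have "(V i z)^2 <= sqn k V z"
  unfolding sqn_def by (rule member_le_sum) (use True in auto)
 also have "... <= (M powr m)^2"
  using sqn_V_le[of z] by (simp add: \<Lambda>_def power2_eq_square flip: powr_add)
 finally show ?thesis by (simp add: abs_le_square_iff[symmetric])
next
 case False
 then show ?thesis using outside[of z i] by (simp add: V_def)
qed

lemma slice_at:
 assumes "t \<in> T"
 shows "slice x0 \<rho> (M powr m) (\<lambda>i x. V i (x, t)) (\<lambda>i x. G i (x, t))"
proof
 show "\<bar>V i (x, t)\<bar> <= M powr m" for i x by (rule V_bound)
 show "V i (x, t) = 0" if "x \<notin> ball x0 \<rho>" for i x using outside[of "(x, t)" i] that by (simp add: V_def)
 show "G i (x, t) = 0" if "x \<notin> ball x0 \<rho>" for i x using outside[of "(x, t)" i] that by simp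
 show "integrable lborel (\<lambda>x. (norm (G i (x, t)))^2)" for i by (rule slice_L2[OF assms])
 show "weak_grad_on (ball x0 \<rho>) (\<lambda>x. V i (x, t)) (\<lambda>x. G i (x, t))" for i by (rule slice_weak[OF assms])
qed measurable

end

lemma borel_measurable_fst_borel [measurable (raw)]:
 fixes f :: "'c => 'a::euclidean_space \<times> 'b::euclidean_space"
 shows "f \<in> M \<rightarrow>\<^sub>M borel ==> (\<lambda>x. fst (f x)) \<in> M \<rightarrow>\<^sub>M borel"
 by (rule measurable_compose[OF _ borel_measurable_continuous_onI[OF continuous_on_fst[OF continuous_on_id]]])

lemma borel_measurable_snd_borel [measurable (raw)]:
 fixes f :: "'c => 'a::euclidean_space \<times> 'b::euclidean_space"
 shows "f \<in> M \<rightarrow>\<^sub>M borel ==> (\<lambda>x. snd (f x)) \<in> M \<rightarrow>\<^sub>M borel"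
 by (rule measurable_compose[OF _ borel_measurable_continuous_onI[OF continuous_on_snd[OF continuous_on_id]]])

lemma translation_continuous_L2_vec:
 fixes f :: "'a::euclidean_space => real ^ 'n"
 assumes [measurable]: "f \<in> borel_measurable borel" and f2: "integrable lborel (\<lambda>x. (norm (f x))^2)" and e: "e > 0"
 shows "\<exists>d>0. \<forall>h. norm h < d --> (NNI x. ennreal ((norm (f (x + h) - f x))^2)) <= ennreal e"
proof -
 have *: "\<exists>d>0. \<forall>h. norm h < d --> (NNI x. ennreal ((f (x + h) $ \<alpha> - f x $ \<alpha>)^2)) <= ennreal (e / CARD('n))" for \<alpha>
 proof (rule translation_continuous_L2[where f="\<lambda>x. f x $ \<alpha>"])
  show "integrable lborel (\<lambda>x. (f x $ \<alpha>)^2)"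
  proof (rule bochner_bound[OF f2])
   have "(f x $ \<alpha>)^2 <= (norm (f x))^2" for x
    using power_mono[OF component_le_norm_cart, of "f x" \<alpha> 2] by simp
   then show "AE x in lborel. norm ((f x $ \<alpha>)^2) <= norm ((norm (f x))^2)" by (intro AE_I2) simp
  qed measurable
  show "0 < e / CARD('n)" using e by simp
 qed measurable
 from choice[OF allI[OF *]] obtain d where
  d: "\<forall>\<alpha>. d \<alpha> > 0 \<and> (\<forall>h. norm h < d \<alpha> -->
   (NNI x. ennreal ((f (x + h) $ \<alpha> - f x $ \<alpha>)^2)) <= ennreal (e / CARD('n)))" ..
 show ?thesis
 proof (rule exI[of _ "Min (range d)"], intro conjI allI impI)
  show "0 < Min (range d)" using d by simp
  fix h :: 'a assume h: "norm h < Min (range d)"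
  have "(norm (f (x + h) - f x))^2 = (\<Sum>\<alpha>\<in>UNIV. (f (x + h) $ \<alpha> - f x $ \<alpha>)^2)" for x
   by (simp add: norm_vec_def L2_set_def sum_nonneg)
  then have "(NNI x. ennreal ((norm (f (x + h) - f x))^2)) =
   (\<Sum>\<alpha>\<in>UNIV. NNI x. ennreal ((f (x + h) $ \<alpha> - f x $ \<alpha>)^2))"
   by (subst nn_integral_sum[symmetric]) (simp_all add: sum_ennreal)
  also have "... <= (\<Sum>\<alpha>\<in>(UNIV::'n set). ennreal (e / CARD('n)))"
   using h d by (intro sum_mono) simp
  also have "... = ennreal e"
   using e by (simp add: ennreal_of_nat_eq_real_of_nat flip: ennreal_mult)
  finally show "(NNI x. ennreal ((norm (f (x + h) - f x))^2)) <= ennreal e" .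
 qed
qed

text \<open>As \<open>g\<close> depends on x alone, the time integral can be taken of P first. A
  flux term in space-time thereby becomes one for the time-integrated flux.\<close>

lemma integral_inner_fst:
 fixes P :: "'a::euclidean_space \<times> 'b::euclidean_space => 'c::euclidean_space"
 assumes P: "integrable lborel P" and [measurable]: "g \<in> borel_measurable borel"
  and i: "integrable lborel (\<lambda>z. P z \<bullet> g (fst z))"
 shows "(LBINT z. P z \<bullet> g (fst z)) = (LBINT x. (LBINT t. P (x, t)) \<bullet> g x)"
proof -
 have "(LBINT z. P z \<bullet> g (fst z)) = (LBINT x. (LBINT t. P (x, t) \<bullet> g x))"
  using integral_lborel_prod(2)[OF i] by simp
 also have "... = (LBINT x. (LBINT t. P (x, t)) \<bullet> g x)"
 proof (rule integral_cong_AE)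
  show "AE x in lborel. (LBINT t. P (x, t) \<bullet> g x) = (LBINT t. P (x, t)) \<bullet> g x"
   using integral_lborel_prod(6)[OF P] by eventually_elim simp
  have "(\<lambda>x. LBINT t. P (x, t) \<bullet> g x) \<in> borel_measurable lborel"
   using borel_measurable_integrable[OF integral_lborel_prod(4)[OF i]] by simp
  then show "(\<lambda>x. LBINT t. P (x, t) \<bullet> g x) \<in> borel_measurable lborel" .
  have [measurable]: "(\<lambda>x. LBINT t. P (x, t)) \<in> borel_measurable borel"
   using borel_measurable_integrable[OF integral_lborel_prod(4)[OF P]] by simp
  show "(\<lambda>x. (LBINT t. P (x, t)) \<bullet> g x) \<in> borel_measurable lborel" by measurable
 qed
 finally show ?thesis .
qed

lemma integrable_mult_fst_snd:
 fixes f :: "'a::euclidean_space => real" and g :: "'b::euclidean_space => real"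
 assumes f: "integrable lborel f" and g: "integrable lborel g"
 shows "integrable lborel (\<lambda>z. f (fst z) * g (snd z))"
proof (rule integrableI_bounded)
 have [measurable]: "f \<in> borel_measurable borel" "g \<in> borel_measurable borel" using f g by auto
 show "(\<lambda>z. f (fst z) * g (snd z)) \<in> borel_measurable lborel" by measurable
 have "(NNI z. ennreal (norm (f (fst z) * g (snd z)))) =
  (NNI t. (NNI x. ennreal (norm (f x)) * ennreal (norm (g t))))"
  by (subst nn_integral_lborel_prod(1)) (simp_all add: abs_mult ennreal_mult)
 also have "... = (NNI t. (NNI x. ennreal (norm (f x))) * ennreal (norm (g t)))"
  by (intro nn_integral_cong nn_integral_multc) measurable
 also have "... = (NNI x. ennreal (norm (f x))) * (NNI t. ennreal (norm (g t)))"
  by (rule nn_integral_cmult) measurable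
 also have "... < \<infinity>"
  using f g unfolding integrable_iff_bounded by (simp add: ennreal_mult_less_top)
 finally show "(NNI z. ennreal (norm (f (fst z) * g (snd z)))) < \<infinity>" .
qed

lemma integrable_inner_L2:
 fixes f g :: "'a => 'b::euclidean_space"
 assumes [measurable]: "f \<in> borel_measurable M" "g \<in> borel_measurable M"
  and f: "integrable M (\<lambda>x. (norm (f x))^2)" and g: "integrable M (\<lambda>x. (norm (g x))^2)"
 shows "integrable M (\<lambda>x. f x \<bullet> g x)"
proof (rule bochner_bound)
 show "integrable M (\<lambda>x. (norm (f x))^2 + (norm (g x))^2)" using f g by simp
 have "\<bar>f x \<bullet> g x\<bar> <= (norm (f x))^2 + (norm (g x))^2" for x
  by (rule order_trans[OF Cauchy_Schwarz_ineq2 mult_le_sum_squares]) simp_all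
 then show "AE x in M. norm (f x \<bullet> g x) <= norm ((norm (f x))^2 + (norm (g x))^2)"
  by (intro AE_I2) simp
qed measurable

context local_solution
begin

abbreviation "Q \<equiv> ball x0 \<rho> \<times> {t1<..<t2}"

lemma Q_meas[measurable]: "Q \<in> sets borel"
 by (intro borel_open open_Times) auto

lemma Q_int: "integrable lborel (indicator Q :: _ => real)"
proof -
 have "bounded Q" by (intro bounded_Times) auto
 then show ?thesis using emeasure_bounded_finite[of Q] by (simp add: integrable_indicator_iff)
qed

text \<open>The total flux, for which the equation reads u_t = div B.\<close>

definition B :: "nat => (real ^ 'n) \<times> real => real ^ 'n" where "B i z = A i z + F i z"

lemma B_meas[measurable]: "B i \<in> borel_measurable borel"
 unfolding B_def by measurable

lemma B_outside: "z \<notin> Q \<or> i \<ge> k ==> B i z = 0"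
 using outside[of z i] by (simp add: B_def)

lemma B_L2: "integrable lborel (\<lambda>z. (norm (B i z))^2)"
proof (rule bochner_bound)
 show "integrable lborel (\<lambda>z. 2 * (norm (A i z))^2 + 2 * (norm (F i z))^2)"
  using A_L2 F_L2 by simp
 have "(norm (B i z))^2 <= 2 * (norm (A i z))^2 + 2 * (norm (F i z))^2" for z
  unfolding B_def by (rule order_trans[OF power_mono[OF norm_triangle_ineq] sq_add_le]) simp
 then show "AE z in lborel. norm ((norm (B i z))^2) <= norm (2 * (norm (A i z))^2 + 2 * (norm (F i z))^2)"
  by (intro AE_I2) simp
qed measurable

lemma B_int: "integrable lborel (B i)"
proof (rule bochner_bound)
 show "integrable lborel (\<lambda>z. indicator Q z + (norm (B i z))^2)"
  using Q_int B_L2 by simp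
 have "norm (B i z) <= indicator Q z + (norm (B i z))^2" for z
  using abs_le_one_plus_sq[of "norm (B i z)"] B_outside[of z i] by (cases "z \<in> Q") simp_all
 then show "AE z in lborel. norm (B i z) <= norm (indicator Q z + (norm (B i z))^2)"
  by (intro AE_I2) simp
qed measurable

end

text \<open>Fixes one cutoff, supported strictly inside the ball, and one truncation. Each step of
  the iteration uses two instances.\<close>

locale energy_setup = local_solution where x0 = x0 for x0 :: "real ^ 'n" +
 fixes R b \<kappa> \<Delta> :: real
 assumes R: "0 < R" "R < \<rho>" and b: "b > 0" and \<kappa>: "\<kappa> \<ge> 0" and \<Delta>: "\<Delta> > 0"
begin

definition w where "w z = cutoff x0 R b (fst z) * lev \<kappa> \<Delta> (sqn k V z)"

text \<open>The spatial gradient of the i-th component of the test function w v, as a function on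
  space-time; on a slice it is \<open>DP\<close>, see \<open>H_DP\<close>.\<close>

definition H where "H i z = V i z *\<^sub>R (lev \<kappa> \<Delta> (sqn k V z) *\<^sub>R Dcutoff x0 R b (fst z) +
 (2 * cutoff x0 R b (fst z) * Dlev \<kappa> \<Delta> (sqn k V z)) *\<^sub>R (\<Sum>j<k. V j z *\<^sub>R G j z)) + w z *\<^sub>R G i z"

definition En where "En t = (LBINT x. cutoff x0 R b x * Psi m \<kappa> \<Delta> (S (x, t)))"

lemma sqnV_meas[measurable]: "sqn k V \<in> borel_measurable borel"
 by (rule borel_measurable_sqn) measurable

lemma w_meas[measurable]: "w \<in> borel_measurable borel"
 unfolding w_def by measurable

lemma H_meas[measurable]: "H i \<in> borel_measurable borel"
 unfolding H_def by measurable

lemma sqn_section: "sqn k (\<lambda>i x. V i (x, t)) x = sqn k V (x, t)"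
 by (simp add: sqn_def)

lemma w_W: "w (x, t) = W k x0 R b \<kappa> \<Delta> (\<lambda>i x. V i (x, t)) x"
 by (simp add: w_def W_def sqn_section)

lemma H_DP: "H i (x, t) = DP k x0 R b \<kappa> \<Delta> (\<lambda>i x. V i (x, t)) (\<lambda>i x. G i (x, t)) i x"
 by (simp add: H_def DP_def DW_def w_W sqn_section)

lemma R0: "R \<ge> 0" and b0: "b \<ge> 0" using R b by simp_all

lemma V_outside: "z \<notin> Q \<or> i \<ge> k ==> V i z = 0"
 using outside[of z i] by (simp add: V_def)

lemma H_outside: "z \<notin> Q \<or> i \<ge> k ==> H i z = 0"
 using V_outside[of z i] outside[of z i] by (simp add: H_def)

text \<open>H vanishes off the cylinder and grows at most linearly in |G| inside, because v is
  bounded and cutoff and truncation have bounded derivatives.\<close>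

lemma H_L2: "integrable lborel (\<lambda>z. (norm (H i z))^2)"
proof -
 define C1 where "C1 = M powr m * (4 * b * R)"
 define C2 where "C2 = 4 / \<Delta> * (real k * (M powr m * M powr m)) + 1"
 have bd: "(norm (H i z))^2 <= 2 * C1^2 * indicator Q z + 2 * C2^2 * (real k * (\<Sum>j<k. (norm (G j z))^2))" for z
 proof (cases "z \<in> Q \<and> i < k")
  case True
  obtain x t where z: "z = (x, t)" by (cases z)
  have "norm (H i z) <= C1 + C2 * (\<Sum>j<k. norm (G j z))"
   unfolding z H_DP C1_def C2_def
   by (rule DP_norm[OF b0 R0 \<Delta>]) (use True V_bound in \<open>auto intro: member_le_sum\<close>)
  then have "(norm (H i z))^2 <= (C1 + C2 * (\<Sum>j<k. norm (G j z)))^2" by (rule power_mono) simp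
  also have "... <= 2 * C1^2 + 2 * (C2 * (\<Sum>j<k. norm (G j z)))^2" by (rule sq_add_le)
  also have "(C2 * (\<Sum>j<k. norm (G j z)))^2 <= C2^2 * (real k * (\<Sum>j<k. (norm (G j z))^2))"
   unfolding power_mult_distrib
   using sum_squared_le_sum_of_squares[of "\<lambda>j. norm (G j z)" "{..<k}"]
   by (intro mult_left_mono) (simp_all add: mult.commute)
  finally show ?thesis using True by (simp add: mult.assoc)
 next
  case False
  then have "H i z = 0" using H_outside[of z i] by auto
  then show ?thesis by (simp add: sum_nonneg)
 qed
 show ?thesis
 proof (rule bochner_bound)
  show "integrable lborel (\<lambda>z. 2 * C1^2 * indicator Q z + 2 * C2^2 * (real k * (\<Sum>j<k. (norm (G j z))^2)))"
   using Q_int G_L2 by simp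
  show "AE z in lborel. norm ((norm (H i z))^2) <=
    norm (2 * C1^2 * indicator Q z + 2 * C2^2 * (real k * (\<Sum>j<k. (norm (G j z))^2)))"
   using bd by (intro AE_I2) (simp add: abs_of_nonneg order_trans[OF zero_le_power2 bd])
 qed measurable
qed

lemma S_outside: "z \<notin> Q ==> S z = 0"
 using outside[of z] by (simp add: S_def sqn_def)

lemma PsiS_meas[measurable]: "(\<lambda>z. Psi m \<kappa> \<Delta> (S z)) \<in> borel_measurable borel"
 by (rule measurable_compose[OF S_meas Psi_measurable[OF m(1) \<Delta>]])

lemma PsiS_bound: "Psi m \<kappa> \<Delta> (S z) <= M * M powr m"
proof -
 have "psi m \<kappa> \<Delta> (S z) <= M powr m"
  using psi_le[OF S_nonneg, of m \<kappa> \<Delta> z] powr_mono2[of m "S z" M] S_nonneg[of z] S_bound[of z] m by linarith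
 then have "S z * psi m \<kappa> \<Delta> (S z) <= M * M powr m"
  using S_nonneg[of z] S_bound[of z] psi_nonneg M by (intro mult_mono) auto
 then show ?thesis using Psi_le[OF m(1) \<Delta> S_nonneg, of \<kappa> z] by linarith
qed

lemma En_integrand_bound: "\<bar>cutoff x0 R b (fst z) * Psi m \<kappa> \<Delta> (S z)\<bar> <= M * M powr m * indicator Q z"
proof (cases "z \<in> Q")
 case True
 have "cutoff x0 R b (fst z) * Psi m \<kappa> \<Delta> (S z) <= 1 * (M * M powr m)"
  using cut_bounds PsiS_bound Psi_nonneg by (intro mult_mono) auto
 then show ?thesis using True cut_bounds[of x0 R b] Psi_nonneg by simp
next
 case False
 then show ?thesis using S_outside[of z] Psi_0 by simp
qed

lemma En_int_z: "integrable lborel (\<lambda>z. cutoff x0 R b (fst z) * Psi m \<kappa> \<Delta> (S z))"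
proof (rule bochner_bound)
 show "integrable lborel (\<lambda>z. M * M powr m * indicator Q z)" using Q_int by simp
 show "AE z in lborel. norm (cutoff x0 R b (fst z) * Psi m \<kappa> \<Delta> (S z)) <= norm (M * M powr m * indicator Q z)"
  using En_integrand_bound M by (intro AE_I2) simp
qed measurable

lemma En_int: "integrable lborel En"
 unfolding En_def using integral_lborel_prod(3)[OF En_int_z] by simp

lemma integrable_bounded_ball:
 fixes f :: "real ^ 'n => real"
 assumes [measurable]: "f \<in> borel_measurable borel" and "\<And>x. \<bar>f x\<bar> <= c" "\<And>x. x \<notin> ball x0 \<rho> ==> f x = 0"
 shows "integrable lborel f"
proof (rule bochner_bound)
 show "integrable lborel (\<lambda>x. c * indicator (ball x0 \<rho>) x)" by (simp add: integrable_indicator_ball)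
 show "AE x in lborel. norm (f x) <= norm (c * indicator (ball x0 \<rho>) x)"
 proof (rule AE_I2)
  fix x
  show "norm (f x) <= norm (c * indicator (ball x0 \<rho>) x)"
   using assms(2)[of x] assms(3)[of x] by (cases "x \<in> ball x0 \<rho>") auto
 qed
qed measurable

lemma En_int_x: "integrable lborel (\<lambda>x. cutoff x0 R b x * Psi m \<kappa> \<Delta> (S (x, t)))"
proof (rule integrable_bounded_ball)
 show "\<bar>cutoff x0 R b x * Psi m \<kappa> \<Delta> (S (x, t))\<bar> <= M * M powr m" for x
  using En_integrand_bound[of "(x, t)"] M by (auto split: split_indicator_asm)
 show "cutoff x0 R b x * Psi m \<kappa> \<Delta> (S (x, t)) = 0" if "x \<notin> ball x0 \<rho>" for x
  using that S_outside[of "(x, t)"] Psi_0 by simp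
qed measurable

lemma S_diff: "\<bar>S (x, t) - S (x, s)\<bar> <= (\<Sum>i<k. \<bar>U i (x, t) - U i (x, s)\<bar>)"
proof -
 have S: "S z = L2_set (\<lambda>i. U i z) {..<k}" for z by (simp add: S_def sqn_def L2_set_def)
 have tri: "S z - S y <= (\<Sum>i<k. \<bar>U i z - U i y\<bar>)" for z y
 proof -
  have "S z = L2_set (\<lambda>i. U i y + (U i z - U i y)) {..<k}" by (simp add: S)
  also have "... <= S y + L2_set (\<lambda>i. U i z - U i y) {..<k}"
   unfolding S by (rule L2_set_triangle_ineq)
  also have "L2_set (\<lambda>i. U i z - U i y) {..<k} <= (\<Sum>i<k. \<bar>U i z - U i y\<bar>)"
   by (rule L2_set_le_sum_abs)
  finally show ?thesis by simp
 qed
 show ?thesis using tri[of "(x, t)" "(x, s)"] tri[of "(x, s)" "(x, t)"] by (simp add: abs_le_iff abs_minus_commute)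
qed

lemma U_diff_int: "integrable lborel (\<lambda>x. (\<Sum>i<k. \<bar>U i (x, t) - U i (x, s)\<bar>))"
proof (intro Bochner_Integration.integrable_sum integrable_abs integrable_bounded_ball)
 show "\<bar>U i (x, t) - U i (x, s)\<bar> <= 2 * M" for i x
  using U_le_S[of i "(x, t)"] U_le_S[of i "(x, s)"] S_bound[of "(x, t)"] S_bound[of "(x, s)"] by simp
 show "U i (x, t) - U i (x, s) = 0" if "x \<notin> ball x0 \<rho>" for i x
  using outside[of "(x, t)" i] outside[of "(x, s)" i] that by simp
qed measurable

text \<open>\<open>Psi\<close> is Lipschitz on [0, M] and |u| is Lipschitz in u. Continuity of u in
  L^1 along good times thus passes to the energy.\<close>

lemma En_diff: "\<bar>En t - En s\<bar> <= M powr m * (LBINT x. (\<Sum>i<k. \<bar>U i (x, t) - U i (x, s)\<bar>))"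
proof -
 let ?f = "\<lambda>t x. cutoff x0 R b x * Psi m \<kappa> \<Delta> (S (x, t))"
 have eq: "En t - En s = (LBINT x. ?f t x - ?f s x)"
  unfolding En_def by (rule bochner_diff[symmetric]) (rule En_int_x)+
 have "\<bar>En t - En s\<bar> <= (LBINT x. \<bar>?f t x - ?f s x\<bar>)"
  unfolding eq by (rule integral_abs_bound)
 also have "... <= (LBINT x. M powr m * (\<Sum>i<k. \<bar>U i (x, t) - U i (x, s)\<bar>))"
 proof (rule integral_mono)
  show "integrable lborel (\<lambda>x. \<bar>?f t x - ?f s x\<bar>)"
   by (intro integrable_abs Bochner_Integration.integrable_diff En_int_x)
  show "integrable lborel (\<lambda>x. M powr m * (\<Sum>i<k. \<bar>U i (x, t) - U i (x, s)\<bar>))"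
   by (intro Bochner_Integration.integrable_mult_right U_diff_int)
  fix x
  have "\<bar>?f t x - ?f s x\<bar> = cutoff x0 R b x * \<bar>Psi m \<kappa> \<Delta> (S (x, t)) - Psi m \<kappa> \<Delta> (S (x, s))\<bar>"
   using cut_bounds(1)[of x0 R b x] by (simp add: abs_mult flip: right_diff_distrib)
  also have "... <= 1 * (M powr m * \<bar>S (x, t) - S (x, s)\<bar>)"
   using cut_bounds[of x0 R b x] S_nonneg S_bound by (intro mult_mono Psi_lipschitz m \<Delta>) auto
  also have "... <= M powr m * (\<Sum>i<k. \<bar>U i (x, t) - U i (x, s)\<bar>)"
   using S_diff by (simp add: mult_left_mono)
  finally show "\<bar>?f t x - ?f s x\<bar> <= M powr m * (\<Sum>i<k. \<bar>U i (x, t) - U i (x, s)\<bar>)" .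
 qed
 finally show ?thesis by simp
qed

lemma En_continuous:
 assumes "s \<in> T" "e > 0" shows "\<exists>d>0. \<forall>t\<in>T. \<bar>t - s\<bar> < d --> \<bar>En t - En s\<bar> < e"
proof -
 have Mm: "M powr m > 0" using M by simp
 from continuity[OF assms(1) divide_pos_pos[OF assms(2) Mm]]
 obtain d where d: "d > 0" "\<forall>t\<in>T. \<bar>t - s\<bar> < d -->
   (LBINT x. (\<Sum>i<k. \<bar>U i (x, t) - U i (x, s)\<bar>)) < e / M powr m" by (elim exE conjE)
 show ?thesis
 proof (rule exI[of _ d], intro conjI ballI impI)
  fix t assume "t \<in> T" "\<bar>t - s\<bar> < d"
  from d(2)[rule_format, OF this] have "M powr m * (LBINT x. (\<Sum>i<k. \<bar>U i (x, t) - U i (x, s)\<bar>)) < e"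
   using Mm by (simp add: pos_less_divide_eq mult.commute)
  then show "\<bar>En t - En s\<bar> < e" using En_diff[of t s] by linarith
 qed (rule d(1))
qed

text \<open>This replaces the chain rule in time. Cauchy--Schwarz bounds U(z) . U(y) by S(z) S(y),
  which reduces the vectorial increment to the scalar one S(z) - S(y); then
  \<open>Psi_convex\<close> applies.\<close>

lemma convexity_pointwise:
 "Psi m \<kappa> \<Delta> (S z) - Psi m \<kappa> \<Delta> (S y) <= lev \<kappa> \<Delta> (sqn k V z) * (\<Sum>i<k. V i z * (U i z - U i y))"
proof (cases "S z = 0")
 case True
 then have "sqn k V z = 0" by (simp add: sqn_V)
 then have "lev \<kappa> \<Delta> (sqn k V z) = 0" using lev_zero(1)[OF \<Delta>, of "sqn k V z" \<kappa>] \<kappa> by simp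
 then show ?thesis using True Psi_0 Psi_nonneg by simp
next
 case False
 then have s: "S z > 0" using S_nonneg[of z] by simp
 have "(\<Sum>i<k. V i z * U i y) <= \<bar>\<Sum>i<k. U i z * U i y\<bar> * S z powr (m - 1)"
 proof -
  have "(\<Sum>i<k. V i z * U i y) = (\<Sum>i<k. U i z * U i y) * S z powr (m - 1)"
   unfolding V_def sum_distrib_right by (rule sum.cong) simp_all
  also have "... <= \<bar>\<Sum>i<k. U i z * U i y\<bar> * S z powr (m - 1)" by (intro mult_right_mono) auto
  finally show ?thesis .
 qed
 also have "... <= (S z * S y) * S z powr (m - 1)"
 proof (rule mult_right_mono)
  have "\<bar>\<Sum>i<k. U i z * U i y\<bar> <= (\<Sum>i<k. \<bar>U i z\<bar> * \<bar>U i y\<bar>)"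
   by (rule order_trans[OF sum_abs]) (simp add: abs_mult)
  also have "... <= L2_set (\<lambda>i. U i z) {..<k} * L2_set (\<lambda>i. U i y) {..<k}"
   by (rule L2_set_mult_ineq)
  finally show "\<bar>\<Sum>i<k. U i z * U i y\<bar> <= S z * S y" by (simp add: S_def sqn_def L2_set_def)
 qed simp
 also have "... = S z powr m * S y"
  using s by (simp add: powr_diff)
 finally have "S z powr m * (S z - S y) <= (\<Sum>i<k. V i z * (U i z - U i y))"
  using V_U[of z] by (simp add: right_diff_distrib sum_subtractf)
 then have "lev \<kappa> \<Delta> (sqn k V z) * (S z powr m * (S z - S y)) <=
   lev \<kappa> \<Delta> (sqn k V z) * (\<Sum>i<k. V i z * (U i z - U i y))"
  by (rule mult_left_mono) (rule lev_bounds)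
 moreover have "lev \<kappa> \<Delta> (sqn k V z) * (S z powr m * (S z - S y)) = (S z - S y) * psi m \<kappa> \<Delta> (S z)"
  using s by (simp add: psi_def sqn_V)
 ultimately show ?thesis using Psi_convex[OF m(1) \<Delta> S_nonneg S_nonneg, of \<kappa> z y] by linarith
qed

end

lemma grad_bounded:
 assumes "test_function D (\<phi> :: real ^ 'n => real)"
 obtains C where "\<And>x. x \<in> cball x0 \<rho> ==> norm (grad \<phi> x) <= C"
proof -
 have "continuous_on UNIV (grad \<phi>)"
  using assms by (intro continuous_grad) (simp add: test_function_def)
 then have "compact (grad \<phi> ` cball x0 \<rho>)"
  by (intro compact_continuous_image) (auto intro: continuous_on_subset)
 then obtain C where C: "\<And>y. y \<in> grad \<phi> ` cball x0 \<rho> ==> norm y <= C"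
  using compact_imp_bounded bounded_iff by metis
 show thesis by (rule that) (use C in blast)
qed

context local_solution
begin

text \<open>The flux integrated over the times between s and t. With it the evolution becomes an
  identity in space alone, to which \<open>slice.test_identity_extends\<close> applies.\<close>

definition c where "c i s t x = (LBINT \<tau>. indicator {s<..<t} \<tau> *\<^sub>R B i (x, \<tau>))"

lemma tB_int: "integrable lborel (\<lambda>z. indicator {s<..<t} (snd z) *\<^sub>R B i z)"
proof (rule bochner_bound[OF B_int[of i]])
 show "AE z in lborel. norm (indicator {s<..<t} (snd z) *\<^sub>R B i z) <= norm (B i z)"
  by (intro AE_I2) (simp split: split_indicator)
qed measurable

lemma c_meas[measurable]: "c i s t \<in> borel_measurable borel"
proof -
 have "(\<lambda>x. LBINT \<tau>. indicator {s<..<t} \<tau> *\<^sub>R B i (x, \<tau>)) \<in> borel_measurable lborel"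
  using borel_measurable_integrable[OF integral_lborel_prod(4)[OF tB_int[of s t i]]] by simp
 then show ?thesis by (simp add: c_def[abs_def])
qed

lemma c_L2:
 assumes st: "s < t" shows "integrable lborel (\<lambda>x. (norm (c i s t x))^2)"
proof -
 have 1: "AE x in lborel. ennreal ((norm (c i s t x))^2) <= ennreal (t - s) * (NNI \<tau>. ennreal ((norm (B i (x, \<tau>)))^2))"
  using integral_lborel_prod(6)[OF B_int[of i]]
 proof eventually_elim
  case (elim x)
  \<comment> \<open>The normalised indicator of (s, t) is a probability density, so Jensen's
    inequality acts as Cauchy--Schwarz in time.\<close>
  let ?J = "\<lambda>\<tau>. indicator {s<..<t} \<tau> / (t - s) :: real"
  let ?n = "\<lambda>\<tau>. norm (B i (x, \<tau>))"
  have iJ: "integrable lborel (\<lambda>\<tau>. ?J \<tau> * ?n \<tau>)"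
  proof (rule bochner_bound)
   show "integrable lborel (\<lambda>\<tau>. (1 / (t - s)) * ?n \<tau>)" using elim by simp
   show "AE \<tau> in lborel. norm (?J \<tau> * ?n \<tau>) <= norm ((1 / (t - s)) * ?n \<tau>)"
    using st by (intro AE_I2) (simp split: split_indicator)
  qed measurable
  have "ennreal ((LBINT \<tau>. ?J \<tau> * ?n \<tau>)^2) <= (NNI \<tau>. ennreal (?J \<tau> * (?n \<tau>)^2))"
   by (rule jensen_square) (use st iJ in \<open>simp_all add: integrable_indicator_iff\<close>)
  also have "... <= (NNI \<tau>. ennreal (1 / (t - s)) * ennreal ((?n \<tau>)^2))"
   using st by (intro nn_integral_mono) (simp add: ennreal_mult[symmetric] ennreal_leI split: split_indicator)
  also have "... = ennreal (1 / (t - s)) * (NNI \<tau>. ennreal ((?n \<tau>)^2))"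
   by (rule nn_integral_cmult) measurable
  finally have 2: "ennreal ((LBINT \<tau>. ?J \<tau> * ?n \<tau>)^2) <= ennreal (1 / (t - s)) * (NNI \<tau>. ennreal ((?n \<tau>)^2))" .
  define I where "I = (LBINT \<tau>. ?J \<tau> * ?n \<tau>)"
  have "norm (c i s t x) <= (LBINT \<tau>. norm (indicator {s<..<t} \<tau> *\<^sub>R B i (x, \<tau>)))"
   unfolding c_def by (rule integral_norm_bound)
  also have "... = (LBINT \<tau>. (t - s) * (?J \<tau> * ?n \<tau>))"
   by (rule bochner_cong) (use st in \<open>simp_all split: split_indicator\<close>)
  also have "... = (t - s) * I" unfolding I_def by (rule integral_mult_right_zero)
  finally have "(norm (c i s t x))^2 <= ((t - s) * I)^2"
   by (rule power_mono) simp
  then have "ennreal ((norm (c i s t x))^2) <= ennreal ((t - s)^2 * I^2)"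
   unfolding power_mult_distrib by (rule ennreal_leI)
  also have "... = ennreal ((t - s)^2) * ennreal (I^2)" by (rule ennreal_mult) simp_all
  also have "... <= ennreal ((t - s)^2) * (ennreal (1 / (t - s)) * (NNI \<tau>. ennreal ((?n \<tau>)^2)))"
   by (rule mult_left_mono[OF 2[folded I_def]]) simp
  also have "... = ennreal (t - s) * (NNI \<tau>. ennreal ((?n \<tau>)^2))"
   using st by (simp add: mult.assoc[symmetric] ennreal_mult[symmetric] power2_eq_square)
  finally show ?case .
 qed
 show ?thesis
 proof (rule integrableI_nonneg)
  have "(NNI x. ennreal ((norm (c i s t x))^2)) <=
   (NNI x. ennreal (t - s) * (NNI \<tau>. ennreal ((norm (B i (x, \<tau>)))^2)))"
   by (rule nn_integral_mono_AE[OF 1])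
  also have "... = ennreal (t - s) * (NNI x. (NNI \<tau>. ennreal ((norm (B i (x, \<tau>)))^2)))"
   by (rule nn_integral_cmult) measurable
  also have "... = ennreal (t - s) * (NNI z. ennreal ((norm (B i z))^2))"
   by (subst nn_integral_lborel_prod(2)[symmetric]) measurable
  also have "... < \<infinity>"
   using B_L2[of i] unfolding integrable_iff_bounded by (simp add: ennreal_mult_less_top)
  finally show "(NNI x. ennreal ((norm (c i s t x))^2)) < \<infinity>" .
 qed auto
qed

lemma evolution_c:
 assumes "s \<in> T" "t \<in> T" "s < t" "test_function (ball x0 \<rho>) \<phi>"
 shows "(LBINT x. (U i (x, t) - U i (x, s)) * \<phi> x) = - (LBINT x. c i s t x \<bullet> grad \<phi> x)"
proof -
 obtain C where C: "\<And>x. x \<in> cball x0 \<rho> ==> norm (grad \<phi> x) <= C"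
  using grad_bounded[OF assms(4)] by blast
 have [measurable]: "grad \<phi> \<in> borel_measurable borel"
  using assms(4) by (intro borel_measurable_continuous_onI continuous_grad) (simp add: test_function_def)
 let ?P = "\<lambda>z. indicator {s<..<t} (snd z) *\<^sub>R B i z"
 have i: "integrable lborel (\<lambda>z. ?P z \<bullet> grad \<phi> (fst z))"
 proof (rule bochner_bound)
  show "integrable lborel (\<lambda>z. C * norm (?P z))"
   by (intro Bochner_Integration.integrable_mult_right integrable_norm tB_int)
  show "AE z in lborel. norm (?P z \<bullet> grad \<phi> (fst z)) <= norm (C * norm (?P z))"
  proof (rule AE_I2)
   fix z
   show "norm (?P z \<bullet> grad \<phi> (fst z)) <= norm (C * norm (?P z))"
   proof (cases "z \<in> Q")
    case True
    then have "fst z \<in> cball x0 \<rho>" by auto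
    from C[OF this] have "norm (?P z) * norm (grad \<phi> (fst z)) <= norm (?P z) * C" "0 <= C"
     by (auto intro: mult_left_mono order_trans[OF norm_ge_zero])
    then show ?thesis using Cauchy_Schwarz_ineq2[of "?P z" "grad \<phi> (fst z)"] by (simp add: abs_mult mult.commute)
   qed (simp add: B_outside)
  qed
 qed measurable
 have "(LBINT z. indicator {s<..<t} (snd z) * ((A i z + F i z) \<bullet> grad \<phi> (fst z))) = (LBINT z. ?P z \<bullet> grad \<phi> (fst z))"
  by (simp add: B_def)
 also have "... = (LBINT x. c i s t x \<bullet> grad \<phi> x)"
  using integral_inner_fst[OF tB_int[of s t i] _ i] by (simp add: c_def)
 finally show ?thesis using evolution[OF assms, of i] by simp
qed

end

context energy_setup
begin

lemma HT_L2:
 assumes "t \<in> T" shows "integrable lborel (\<lambda>x. (norm (H i (x, t)))^2)"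
proof -
 define C1 where "C1 = M powr m * (4 * b * R)"
 define C2 where "C2 = 4 / \<Delta> * (real k * (M powr m * M powr m)) + 1"
 have bd: "(norm (H i z))^2 <= 2 * C1^2 * indicator (ball x0 \<rho>) (fst z) + 2 * C2^2 * (real k * (\<Sum>j<k. (norm (G j z))^2))" for z
 proof (cases "z \<in> Q \<and> i < k")
  case True
  obtain x t where z: "z = (x, t)" by (cases z)
  have "norm (H i z) <= C1 + C2 * (\<Sum>j<k. norm (G j z))"
   unfolding z H_DP C1_def C2_def
   by (rule DP_norm[OF b0 R0 \<Delta>]) (use True V_bound in \<open>auto intro: member_le_sum\<close>)
  then have "(norm (H i z))^2 <= (C1 + C2 * (\<Sum>j<k. norm (G j z)))^2" by (rule power_mono) simp
  also have "... <= 2 * C1^2 + 2 * (C2 * (\<Sum>j<k. norm (G j z)))^2" by (rule sq_add_le)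
  also have "(C2 * (\<Sum>j<k. norm (G j z)))^2 <= C2^2 * (real k * (\<Sum>j<k. (norm (G j z))^2))"
   unfolding power_mult_distrib
   using sum_squared_le_sum_of_squares[of "\<lambda>j. norm (G j z)" "{..<k}"]
   by (intro mult_left_mono) (simp_all add: mult.commute)
  finally show ?thesis using True by (simp add: mult.assoc mem_Times_iff)
 next
  case False
  then have "H i z = 0" using H_outside[of z i] by auto
  then show ?thesis by (simp add: sum_nonneg)
 qed
 show ?thesis
 proof (rule bochner_bound)
  show "integrable lborel (\<lambda>x. 2 * C1^2 * indicator (ball x0 \<rho>) x + 2 * C2^2 * (real k * (\<Sum>j<k. (norm (G j (x, t)))^2)))"
   using slice_L2[OF assms] by (simp add: integrable_indicator_ball)
  show "AE x in lborel. norm ((norm (H i (x, t)))^2) <=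
    norm (2 * C1^2 * indicator (ball x0 \<rho>) x + 2 * C2^2 * (real k * (\<Sum>j<k. (norm (G j (x, t)))^2)))"
  proof (rule AE_I2)
   fix x
   from bd[of "(x, t)"] show "norm ((norm (H i (x, t)))^2) <=
    norm (2 * C1^2 * indicator (ball x0 \<rho>) x + 2 * C2^2 * (real k * (\<Sum>j<k. (norm (G j (x, t)))^2)))"
    by simp
  qed
 qed measurable
qed

text \<open>The increment from s to t is tested with w v at the later time t, for which
  \<open>convexity_pointwise\<close> has the right direction. On the right the flux runs over (s,
  t), while the gradient of the test function stays frozen at t.\<close>

lemma slice_energy:
 assumes st: "s \<in> T" "t \<in> T" "s < t"
 shows "En t - En s <= - (LBINT z. indicator {s<..<t} (snd z) * (\<Sum>i<k. B i z \<bullet> H i (fst z, t)))"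
  and "\<And>i. integrable lborel (\<lambda>z. indicator {s<..<t} (snd z) * (B i z \<bullet> H i (fst z, t)))"
proof -
 interpret sl: slice k x0 \<rho> "M powr m" "\<lambda>i x. V i (x, t)" "\<lambda>i x. G i (x, t)" by (rule slice_at[OF st(2)])
 let ?P = "\<lambda>i z. indicator {s<..<t} (snd z) *\<^sub>R B i z"
 have iPH: "integrable lborel (\<lambda>z. ?P i z \<bullet> H i (fst z, t))" for i
 proof -
  have 1: "integrable lborel (\<lambda>z. (norm (?P i z))^2)"
  proof (rule bochner_bound[OF B_L2[of i]])
   show "AE z in lborel. norm ((norm (?P i z))^2) <= norm ((norm (B i z))^2)"
    by (intro AE_I2) (simp split: split_indicator)
  qed measurable
  have 2: "integrable lborel (\<lambda>z. (norm (H i (fst z, t)))^2 * indicator {s<..<t} (snd z))"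
   by (rule integrable_mult_fst_snd[OF HT_L2[OF st(2)]]) (use st in \<open>simp add: integrable_indicator_iff\<close>)
  have 3: "integrable lborel (\<lambda>z. (norm (indicator {s<..<t} (snd z) *\<^sub>R H i (fst z, t)))^2)"
   by (rule Bochner_Integration.integrable_cong[THEN iffD1, OF refl _ 2]) (simp split: split_indicator)
  have "integrable lborel (\<lambda>z. ?P i z \<bullet> (indicator {s<..<t} (snd z) *\<^sub>R H i (fst z, t)))"
   by (rule integrable_inner_L2[OF _ _ 1 3]) measurable
  then show ?thesis
   by (rule Bochner_Integration.integrable_cong[THEN iffD1, OF refl, rotated]) (simp split: split_indicator)
 qed
 then show "integrable lborel (\<lambda>z. indicator {s<..<t} (snd z) * (B i z \<bullet> H i (fst z, t)))" for i by simp
 let ?d = "\<lambda>i x. U i (x, t) - U i (x, s)"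
 let ?W = "\<lambda>x. W k x0 R b \<kappa> \<Delta> (\<lambda>i x. V i (x, t)) x"
 have d_int: "integrable lborel (?d i)" for i
 proof (rule integrable_bounded_ball)
  show "\<bar>U i (x, t) - U i (x, s)\<bar> <= 2 * M" for x
   using U_le_S[of i "(x, t)"] U_le_S[of i "(x, s)"] S_bound[of "(x, t)"] S_bound[of "(x, s)"] by simp
  show "U i (x, t) - U i (x, s) = 0" if "x \<notin> ball x0 \<rho>" for x
   using outside[of "(x, t)" i] outside[of "(x, s)" i] that by simp
 qed measurable
 \<comment> \<open>\<open>test_identity_extends\<close> with the increment of u_i in the role of d
   and the time-integrated flux as c.\<close>
 have test: "(LBINT x. ?d i x * (?W x * V i (x, t))) = - (LBINT z. ?P i z \<bullet> H i (fst z, t))"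
  if i: "i < k" for i
 proof -
  have "(LBINT x. ?d i x * (?W x * V i (x, t))) =
    - (LBINT x. c i s t x \<bullet> DP k x0 R b \<kappa> \<Delta> (\<lambda>i x. V i (x, t)) (\<lambda>i x. G i (x, t)) i x)"
   by (rule sl.test_identity_extends[OF d_int c_meas c_L2[OF st(3)] evolution_c[OF st] R b0 \<Delta> i])
  also have "(LBINT x. c i s t x \<bullet> DP k x0 R b \<kappa> \<Delta> (\<lambda>i x. V i (x, t)) (\<lambda>i x. G i (x, t)) i x) =
    (LBINT x. c i s t x \<bullet> H i (x, t))" by (simp add: H_DP)
  also have "... = (LBINT z. ?P i z \<bullet> H i (fst z, t))"
   using integral_inner_fst[OF tB_int[of s t i] _ iPH[of i]] by (simp add: c_def)
  finally show ?thesis .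
 qed
 have dW_int: "integrable lborel (\<lambda>x. ?d i x * (?W x * V i (x, t)))" for i
 proof (rule bochner_bound)
  show "integrable lborel (\<lambda>x. (M powr m) * ?d i x)" by (intro Bochner_Integration.integrable_mult_right d_int)
  note [measurable] = borel_measurable_W
  show "(\<lambda>x. ?d i x * (?W x * V i (x, t))) \<in> borel_measurable lborel" by measurable
  show "AE x in lborel. norm (?d i x * (?W x * V i (x, t))) <= norm ((M powr m) * ?d i x)"
  proof (rule AE_I2)
   fix x
   have "\<bar>?W x\<bar> * \<bar>V i (x, t)\<bar> <= 1 * (M powr m)"
    using W_bounds[of k x0 R b \<kappa> \<Delta> "\<lambda>i x. V i (x, t)" x] V_bound[of i "(x, t)"] by (intro mult_mono) auto
   then have "\<bar>?d i x\<bar> * (\<bar>?W x\<bar> * \<bar>V i (x, t)\<bar>) <= \<bar>?d i x\<bar> * (M powr m)" by (intro mult_left_mono) auto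
   then show "norm (?d i x * (?W x * V i (x, t))) <= norm ((M powr m) * ?d i x)" by (simp add: abs_mult mult.commute)
  qed
 qed
 have "En t - En s = (LBINT x. cutoff x0 R b x * Psi m \<kappa> \<Delta> (S (x, t)) - cutoff x0 R b x * Psi m \<kappa> \<Delta> (S (x, s)))"
  unfolding En_def by (rule bochner_diff[symmetric]) (rule En_int_x)+
 also have "... <= (LBINT x. (\<Sum>i<k. ?d i x * (?W x * V i (x, t))))"
 proof (rule integral_mono)
  show "integrable lborel (\<lambda>x. cutoff x0 R b x * Psi m \<kappa> \<Delta> (S (x, t)) - cutoff x0 R b x * Psi m \<kappa> \<Delta> (S (x, s)))"
   by (intro Bochner_Integration.integrable_diff En_int_x)
  show "integrable lborel (\<lambda>x. \<Sum>i<k. ?d i x * (?W x * V i (x, t)))"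
   by (intro Bochner_Integration.integrable_sum dW_int)
  fix x
  have "cutoff x0 R b x * (Psi m \<kappa> \<Delta> (S (x, t)) - Psi m \<kappa> \<Delta> (S (x, s))) <=
    cutoff x0 R b x * (lev \<kappa> \<Delta> (sqn k V (x, t)) * (\<Sum>i<k. V i (x, t) * ?d i x))"
   by (intro mult_left_mono convexity_pointwise cut_bounds)
  also have "... = (\<Sum>i<k. ?d i x * (?W x * V i (x, t)))"
   by (simp add: W_def sqn_section sum_distrib_left mult_ac)
  finally show "cutoff x0 R b x * Psi m \<kappa> \<Delta> (S (x, t)) - cutoff x0 R b x * Psi m \<kappa> \<Delta> (S (x, s)) <=
    (\<Sum>i<k. ?d i x * (?W x * V i (x, t)))" by (simp add: right_diff_distrib)
 qed
 also have "... = (\<Sum>i<k. (LBINT x. ?d i x * (?W x * V i (x, t))))"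
  by (rule Bochner_Integration.integral_sum) (rule dW_int)
 also have "... = (\<Sum>i<k. - (LBINT z. ?P i z \<bullet> H i (fst z, t)))"
  by (rule sum.cong[OF refl]) (simp only: test lessThan_iff)
 also have "... = - (LBINT z. (\<Sum>i<k. ?P i z \<bullet> H i (fst z, t)))"
  by (subst Bochner_Integration.integral_sum) (use iPH in \<open>simp_all add: sum_negf\<close>)
 also have "(LBINT z. (\<Sum>i<k. ?P i z \<bullet> H i (fst z, t))) =
   (LBINT z. indicator {s<..<t} (snd z) * (\<Sum>i<k. B i z \<bullet> H i (fst z, t)))"
  by (simp add: sum_distrib_left)
 finally show "En t - En s <= - (LBINT z. indicator {s<..<t} (snd z) * (\<Sum>i<k. B i z \<bullet> H i (fst z, t)))" .
qed

end

text \<open>Only an inequality for integrands of either sign, because \<open>ennreal\<close> cuts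
  off negative values.\<close>

lemma ennreal_integral_le:
 fixes f :: "'a => real"
 assumes f: "integrable M f" shows "ennreal (\<integral>x. f x \<partial>M) <= (\<integral>\<^sup>+x. ennreal (f x) \<partial>M)"
proof -
 have i: "integrable M (\<lambda>x. max 0 (f x))" using f by simp
 have "ennreal (\<integral>x. f x \<partial>M) <= ennreal (\<integral>x. max 0 (f x) \<partial>M)"
  by (intro ennreal_leI integral_mono f i) simp
 also have "... = (\<integral>\<^sup>+x. ennreal (max 0 (f x)) \<partial>M)"
  by (rule nn_integral_eq_integral[OF i, symmetric]) simp
 also have "... = (\<integral>\<^sup>+x. ennreal (f x) \<partial>M)"
  by (intro nn_integral_cong) (simp add: max_def ennreal_neg)
 finally show ?thesis .
qed

lemma ennreal_lincomb:
 assumes "a \<ge> 0" "p \<ge> 0" "c \<ge> 0" "q \<ge> 0"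
 shows "ennreal (a * p + c * q) = ennreal a * ennreal p + ennreal c * ennreal q"
 using assms by (simp add: ennreal_plus ennreal_mult)

lemma integral_mult_fst_snd:
 fixes f :: "'a::euclidean_space => real" and g :: "'b::euclidean_space => real"
 assumes f: "integrable lborel f" and g: "integrable lborel g"
 shows "(LBINT z. f (fst z) * g (snd z)) = (LBINT x. f x) * (LBINT t. g t)"
 using integral_lborel_prod(1)[OF integrable_mult_fst_snd[OF f g]] by simp

section \<open>From increments to the energy inequality\<close>

context energy_setup
begin

definition BH where "BH z = (\<Sum>i<k. B i z \<bullet> H i z)"

lemma BH_int: "integrable lborel BH"
 unfolding BH_def by (intro Bochner_Integration.integrable_sum integrable_inner_L2 B_L2 H_L2) measurable

lemma BH_meas[measurable]: "BH \<in> borel_measurable borel"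
 unfolding BH_def by measurable

text \<open>Bounds the error made by taking the flux at a time \<sigma> earlier than the gradient of
  the test function.\<close>

definition err where "err \<sigma> z = (\<Sum>i<k. norm (B i (fst z, snd z - \<sigma>) - B i z) * norm (H i z))"

text \<open>Young's inequality with a weight: the shift of the flux is small by continuity of
  translations in L^2, and the square integral of H is a fixed number that receives a small
  weight.\<close>

lemma err_small:
 assumes e: "e > 0"
 shows "\<exists>d>0. \<forall>\<sigma>. \<bar>\<sigma>\<bar> < d --> (NNI z. ennreal (err \<sigma> z)) <= ennreal e"
proof -
 define K where "K = (\<Sum>i<k. (LBINT z. (norm (H i z))^2)) + 1"
 have K: "K > 0" unfolding K_def by (intro add_nonneg_pos sum_nonneg) simp_all
 define \<eta> where "\<eta> = e / K"
 have \<eta>: "\<eta> > 0" using e K by (simp add: \<eta>_def)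
 \<comment> \<open>\<open>\<eta>\<close> and \<open>e'\<close> are such that each of the two terms
   of Young's inequality contributes at most e/2.\<close>
 define e' where "e' = e * \<eta> / (real k + 1)"
 have e': "e' > 0" using e \<eta> by (simp add: e'_def)
 have "\<exists>d>0. \<forall>h. norm h < d --> (NNI z. ennreal ((norm (B i (z + h) - B i z))^2)) <= ennreal e'" for i
  by (rule translation_continuous_L2_vec[OF B_meas B_L2 e'])
 from choice[OF allI[OF this]] obtain d where d: "\<forall>i. d i > 0 \<and> (\<forall>h. norm h < d i -->
   (NNI z. ennreal ((norm (B i (z + h) - B i z))^2)) <= ennreal e')" ..
 define d0 where "d0 = Min (insert 1 (d ` {..<k}))"
 have d0: "d0 > 0" "\<And>i. i < k ==> d0 <= d i" using d by (auto simp: d0_def)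
 show ?thesis
 proof (rule exI[of _ d0], intro conjI allI impI)
  fix \<sigma> :: real assume \<sigma>: "\<bar>\<sigma>\<bar> < d0"
  have tr: "(NNI z. ennreal ((norm (B i (fst z, snd z - \<sigma>) - B i z))^2)) <= ennreal e'" if i: "i < k" for i
  proof -
   have "norm ((0, - \<sigma>) :: (real ^ 'n) \<times> real) < d i" using \<sigma> d0(2)[OF i] by (simp add: norm_Pair)
   then have "(NNI z. ennreal ((norm (B i (z + (0, - \<sigma>)) - B i z))^2)) <= ennreal e'" using d by blast
   moreover have "z + (0, - \<sigma>) = (fst z, snd z - \<sigma>)" for z :: "(real ^ 'n) \<times> real" by (simp add: prod_eq_iff)
   ultimately show ?thesis by simp
  qed
  have "(NNI z. ennreal (err \<sigma> z)) <=
   (NNI z. (\<Sum>i<k. ennreal (1 / (2 * \<eta>)) * ennreal ((norm (B i (fst z, snd z - \<sigma>) - B i z))^2) +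
    ennreal (\<eta> / 2) * ennreal ((norm (H i z))^2)))"
  proof (rule nn_integral_mono)
   fix z
   have y: "p * q <= 1 / (2 * \<eta>) * p^2 + \<eta> / 2 * q^2" for p q :: real
   proof -
    have "0 <= (p / \<eta> - q)^2 * (\<eta> / 2)" using \<eta> by simp
    also have "... = 1 / (2 * \<eta>) * p^2 + \<eta> / 2 * q^2 - p * q"
     using \<eta> by (simp add: power2_eq_square field_simps)
    finally show ?thesis by simp
   qed
   have "ennreal (err \<sigma> z) <= ennreal (\<Sum>i<k. 1 / (2 * \<eta>) * (norm (B i (fst z, snd z - \<sigma>) - B i z))^2 + \<eta> / 2 * (norm (H i z))^2)"
    unfolding err_def by (intro ennreal_leI sum_mono y)
   also have "... = (\<Sum>i<k. ennreal (1 / (2 * \<eta>)) * ennreal ((norm (B i (fst z, snd z - \<sigma>) - B i z))^2) +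
    ennreal (\<eta> / 2) * ennreal ((norm (H i z))^2))"
    using \<eta> by (subst sum_ennreal[symmetric], simp, intro sum.cong refl ennreal_lincomb) simp_all
   finally show "ennreal (err \<sigma> z) <= (\<Sum>i<k. ennreal (1 / (2 * \<eta>)) * ennreal ((norm (B i (fst z, snd z - \<sigma>) - B i z))^2) +
    ennreal (\<eta> / 2) * ennreal ((norm (H i z))^2))" .
  qed
  also have "... = (\<Sum>i<k. ennreal (1 / (2 * \<eta>)) * (NNI z. ennreal ((norm (B i (fst z, snd z - \<sigma>) - B i z))^2)) +
    ennreal (\<eta> / 2) * (NNI z. ennreal ((norm (H i z))^2)))"
   by (simp add: nn_integral_sum nn_integral_add nn_integral_cmult)
  also have "... <= (\<Sum>i<k. ennreal (1 / (2 * \<eta>)) * ennreal e' + ennreal (\<eta> / 2) * ennreal (LBINT z. (norm (H i z))^2))"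
   using nn_integral_eq_integral[OF H_L2] by (intro sum_mono add_mono mult_left_mono) (simp_all add: tr)
  also have "... = (\<Sum>i<k. ennreal (1 / (2 * \<eta>) * e' + \<eta> / 2 * (LBINT z. (norm (H i z))^2)))"
   using \<eta> e' by (intro sum.cong refl ennreal_lincomb[symmetric]) simp_all
  also have "... = ennreal (\<Sum>i<k. 1 / (2 * \<eta>) * e' + \<eta> / 2 * (LBINT z. (norm (H i z))^2))"
   using \<eta> e' by (intro sum_ennreal) simp
  also have "... <= ennreal e"
  proof (rule ennreal_leI)
   have "(\<Sum>i<k. 1 / (2 * \<eta>) * e' + \<eta> / 2 * (LBINT z. (norm (H i z))^2)) =
    real k * (1 / (2 * \<eta>) * e') + \<eta> / 2 * (K - 1)"
    unfolding K_def sum.distrib sum_distrib_left[symmetric] by simp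
   also have "real k * (1 / (2 * \<eta>) * e') = e / 2 * (real k / (real k + 1))"
    using \<eta> by (simp add: e'_def field_simps)
   also have "... <= e / 2 * 1" using e by (intro mult_left_mono) auto
   also have "\<eta> / 2 * (K - 1) <= \<eta> / 2 * K" using \<eta> by simp
   also have "\<eta> / 2 * K = e / 2" using K by (simp add: \<eta>_def)
   finally show "(\<Sum>i<k. 1 / (2 * \<eta>) * e' + \<eta> / 2 * (LBINT z. (norm (H i z))^2)) <= e" by simp
  qed
  finally show "(NNI z. ennreal (err \<sigma> z)) <= ennreal e" .
 qed (rule d0(1))
qed

text \<open>The substitution \<tau> = t - \<sigma> turns the mismatch over (t - h, t) into
  \<open>err \<sigma>\<close>. After Fubini each lag \<sigma> in (0, h) costs at most e, and since e
  is arbitrary the bound h e survives a division by h.\<close>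

lemma err_integrated:
 assumes h: "h > 0" and e: "e > 0"
  and small: "\<And>\<sigma>. 0 < \<sigma> ==> \<sigma> < h ==> (NNI z. ennreal (err \<sigma> z)) <= ennreal e"
 shows "(NNI t. (NNI z. ennreal (indicator {t - h<..<t} (snd z) *
   (\<Sum>i<k. norm (B i z - B i (fst z, t)) * norm (H i (fst z, t)))))) <= ennreal (h * e)"
proof -
 let ?g = "\<lambda>x \<sigma> t. ennreal (indicator {0<..<h} \<sigma> * err \<sigma> (x, t))"
 have [measurable]: "(\<lambda>p. err (fst p) (snd p)) \<in> borel_measurable borel"
  unfolding err_def by measurable
 have "(NNI z. ennreal (indicator {t - h<..<t} (snd z) *
   (\<Sum>i<k. norm (B i z - B i (fst z, t)) * norm (H i (fst z, t))))) =
   (NNI \<sigma>. (NNI x. ?g x \<sigma> t))" for t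
 proof -
  have "(NNI z. ennreal (indicator {t - h<..<t} (snd z) *
   (\<Sum>i<k. norm (B i z - B i (fst z, t)) * norm (H i (fst z, t))))) =
   (NNI \<tau>. (NNI x. ennreal (indicator {t - h<..<t} \<tau> *
   (\<Sum>i<k. norm (B i (x, \<tau>) - B i (x, t)) * norm (H i (x, t))))))"
   by (subst nn_integral_lborel_prod(1)) simp_all
  also have "... = (NNI \<sigma>. (NNI x. ennreal (indicator {t - h<..<t} (t - \<sigma>) *
   (\<Sum>i<k. norm (B i (x, t - \<sigma>) - B i (x, t)) * norm (H i (x, t))))))"
   by (rule nn_integral_reflect[symmetric]) measurable
  also have "... = (NNI \<sigma>. (NNI x. ?g x \<sigma> t))"
   by (intro nn_integral_cong) (simp add: err_def split: split_indicator)
  finally show ?thesis .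
 qed
 then have "(NNI t. (NNI z. ennreal (indicator {t - h<..<t} (snd z) *
   (\<Sum>i<k. norm (B i z - B i (fst z, t)) * norm (H i (fst z, t)))))) =
   (NNI t. (NNI \<sigma>. (NNI x. ?g x \<sigma> t)))" by simp
 also have "... = (NNI \<sigma>. (NNI t. (NNI x. ?g x \<sigma> t)))"
 proof (rule lborel_pair.Fubini')
  have "(\<lambda>p. err (fst (fst p)) (snd p, snd (fst p))) \<in> borel_measurable (borel :: ((real \<times> real) \<times> (real ^ 'n)) measure)"
   unfolding err_def by measurable
  then show "(\<lambda>(\<sigma>, t). NNI x. ?g x \<sigma> t) \<in> borel_measurable (lborel \<Otimes>\<^sub>M lborel)"
   unfolding err_def by measurable
 qed
 also have "... = (NNI \<sigma>. indicator {0<..<h} \<sigma> * (NNI z. ennreal (err \<sigma> z)))"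
 proof (rule nn_integral_cong)
  fix \<sigma> :: real
  have m: "(\<lambda>z. ennreal (err \<sigma> z)) \<in> borel_measurable borel" unfolding err_def by measurable
  show "(NNI t. (NNI x. ?g x \<sigma> t)) = indicator {0<..<h} \<sigma> * (NNI z. ennreal (err \<sigma> z))"
   by (subst nn_integral_lborel_prod(1)[OF m]) (simp split: split_indicator)
 qed
 also have "... <= (NNI \<sigma>. indicator {0<..<h} \<sigma> * ennreal e)"
  by (intro nn_integral_mono) (simp add: small split: split_indicator)
 also have "... = ennreal h * ennreal e"
  using h by (subst nn_integral_multc) simp_all
 also have "... = ennreal (h * e)" using h e by (simp add: ennreal_mult)
 finally show ?thesis .
qed

text \<open>\<open>slice_energy\<close> with lag h, in which the flux at times in (t - h, t) is
  replaced by the flux at time t; the right-hand side is the price.\<close>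

lemma steklov_step:
 assumes t: "t \<in> T" "t - h \<in> T" and h: "h > 0" and BHt: "integrable lborel (\<lambda>x. BH (x, t))"
 shows "ennreal (En t - En (t - h) + h * (LBINT x. BH (x, t))) <=
  (NNI z. ennreal (indicator {t - h<..<t} (snd z) *
   (\<Sum>i<k. norm (B i z - B i (fst z, t)) * norm (H i (fst z, t)))))"
proof -
 have lt: "t - h < t" using h by simp
 let ?I = "\<lambda>z. indicator {t - h<..<t} (snd z) :: real"
 have i1: "integrable lborel (\<lambda>z. ?I z * (\<Sum>i<k. B i z \<bullet> H i (fst z, t)))"
  unfolding sum_distrib_left by (intro Bochner_Integration.integrable_sum slice_energy(2)[OF t(2,1) lt])
 have ind: "integrable lborel (indicator {t - h<..<t} :: real => real)"
  using h by (simp add: integrable_indicator_iff)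
 have i2: "integrable lborel (\<lambda>z. ?I z * BH (fst z, t))"
  using integrable_mult_fst_snd[OF BHt ind] by (simp add: mult.commute)
 have v2: "(LBINT z. ?I z * BH (fst z, t)) = h * (LBINT x. BH (x, t))"
  using integral_mult_fst_snd[OF BHt ind] h by (simp add: mult.commute)
 have "En t - En (t - h) + h * (LBINT x. BH (x, t)) <=
  (LBINT z. ?I z * BH (fst z, t)) - (LBINT z. ?I z * (\<Sum>i<k. B i z \<bullet> H i (fst z, t)))"
  using slice_energy(1)[OF t(2,1) lt] v2 by linarith
 also have "... = (LBINT z. ?I z * BH (fst z, t) - ?I z * (\<Sum>i<k. B i z \<bullet> H i (fst z, t)))"
  by (rule bochner_diff[OF i2 i1, symmetric])
 finally have "ennreal (En t - En (t - h) + h * (LBINT x. BH (x, t))) <=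
   ennreal (LBINT z. ?I z * BH (fst z, t) - ?I z * (\<Sum>i<k. B i z \<bullet> H i (fst z, t)))"
  by (rule ennreal_leI)
 also have "... <= (NNI z. ennreal (?I z * BH (fst z, t) - ?I z * (\<Sum>i<k. B i z \<bullet> H i (fst z, t))))"
  by (rule ennreal_integral_le[OF Bochner_Integration.integrable_diff[OF i2 i1]])
 also have "... <= (NNI z. ennreal (?I z * (\<Sum>i<k. norm (B i z - B i (fst z, t)) * norm (H i (fst z, t)))))"
 proof (intro nn_integral_mono ennreal_leI)
  fix z
  have "?I z * BH (fst z, t) - ?I z * (\<Sum>i<k. B i z \<bullet> H i (fst z, t)) =
    ?I z * (\<Sum>i<k. (B i (fst z, t) - B i z) \<bullet> H i (fst z, t))"
   by (simp add: BH_def inner_diff_left sum_subtractf right_diff_distrib)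
  also have "... <= ?I z * (\<Sum>i<k. norm (B i z - B i (fst z, t)) * norm (H i (fst z, t)))"
  proof (intro mult_left_mono sum_mono)
   fix i
   show "(B i (fst z, t) - B i z) \<bullet> H i (fst z, t) <= norm (B i z - B i (fst z, t)) * norm (H i (fst z, t))"
    using norm_cauchy_schwarz[of "B i (fst z, t) - B i z" "H i (fst z, t)"] by (simp add: norm_minus_commute)
  qed simp
  finally show "?I z * BH (fst z, t) - ?I z * (\<Sum>i<k. B i z \<bullet> H i (fst z, t)) <=
    ?I z * (\<Sum>i<k. norm (B i z - B i (fst z, t)) * norm (H i (fst z, t)))" .
 qed
 finally show ?thesis .
qed

text \<open>Integrate \<open>steklov_step\<close> over t in (\<alpha>, \<beta>). The energy
  increments over the lag h telescope to integrals of \<open>En\<close> over (\<beta> - h, \<beta>)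
  and (\<alpha> - h, \<alpha>), which are close to h En(\<beta>) and h En(\<alpha>) by continuity
  along good times. Every term is of order h, and the mismatch is h times an arbitrarily small
  number.\<close>

proposition energy_distributional:
 assumes \<alpha>\<beta>: "\<alpha> \<in> T" "\<beta> \<in> T" "\<alpha> < \<beta>"
 shows "En \<beta> - En \<alpha> <= - (LBINT z. indicator {\<alpha><..<\<beta>} (snd z) * BH z)" (is "_ <= - ?X")
proof (rule field_le_epsilon)
 fix e0 :: real assume "e0 > 0"
 define e where "e = e0 / 3"
 have e: "e > 0" using \<open>e0 > 0\<close> by (simp add: e_def)
 from En_continuous[OF \<alpha>\<beta>(1) e] obtain d1 where d1: "d1 > 0" "\<forall>t\<in>T. \<bar>t - \<alpha>\<bar> < d1 --> \<bar>En t - En \<alpha>\<bar> < e"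
  by (elim exE conjE)
 from En_continuous[OF \<alpha>\<beta>(2) e] obtain d2 where d2: "d2 > 0" "\<forall>t\<in>T. \<bar>t - \<beta>\<bar> < d2 --> \<bar>En t - En \<beta>\<bar> < e"
  by (elim exE conjE)
 from err_small[OF e] obtain d3 where d3: "d3 > 0" "\<forall>\<sigma>. \<bar>\<sigma>\<bar> < d3 --> (NNI z. ennreal (err \<sigma> z)) <= ennreal e"
  by (elim exE conjE)
 have \<alpha>: "\<alpha> > t1" "\<beta> < t2" using \<alpha>\<beta> T_sub by auto
 \<comment> \<open>The lag is shorter than the three moduli of continuity, and shorter than \<alpha>
   - t1 so that shifted times stay inside (t1, t2).\<close>
 define h where "h = min (min d1 d2) (min d3 (\<alpha> - t1)) / 2"
 have h: "h > 0" "h < d1" "h < d2" "h < d3" "h < \<alpha> - t1"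
  using d1(1) d2(1) d3(1) \<alpha> by (auto simp: h_def min_def)
 let ?D = "\<lambda>t. LBINT x. BH (x, t)"
 let ?ind = "indicator {\<alpha><..<\<beta>} :: real => real"
 have iD: "integrable lborel ?D" using integral_lborel_prod(3)[OF BH_int] by simp
 have iEs: "integrable lborel (\<lambda>t. En (t - h))" using integrable_shift[OF En_int, of "- h"] by simp
 have im: "integrable lborel (\<lambda>t. ?ind t * f t)" if "integrable lborel f" for f :: "real => real"
  using integrable_mult_indicator[OF _ that, of "{\<alpha><..<\<beta>}"] by simp
 define f where "f t = ?ind t * En t - ?ind t * En (t - h) + h * (?ind t * ?D t)" for t
 have fi: "integrable lborel f"
  unfolding f_def
  by (intro Bochner_Integration.integrable_add Bochner_Integration.integrable_diff
    Bochner_Integration.integrable_mult_right im En_int iEs iD)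
 have T1: "AE t in lborel. t1 < t \<and> t < t2 --> t \<in> T" using T_full by simp
 have T2: "AE t in lborel. t1 < t - h \<and> t - h < t2 --> t - h \<in> T" using AE_lborel_shift[OF T1, of "- h"] by simp
 have "ennreal (LBINT t. f t) <= (NNI t. ennreal (f t))" by (rule ennreal_integral_le[OF fi])
 also have "... <= (NNI t. (NNI z. ennreal (indicator {t - h<..<t} (snd z) *
   (\<Sum>i<k. norm (B i z - B i (fst z, t)) * norm (H i (fst z, t))))))"
 proof (rule nn_integral_mono_AE)
  show "AE t in lborel. ennreal (f t) <= (NNI z. ennreal (indicator {t - h<..<t} (snd z) *
   (\<Sum>i<k. norm (B i z - B i (fst z, t)) * norm (H i (fst z, t)))))"
   using T1 T2 integral_lborel_prod(5)[OF BH_int]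
  proof eventually_elim
   case (elim t)
   show ?case
   proof (cases "t \<in> {\<alpha><..<\<beta>}")
    case True
    then have "t \<in> T" "t - h \<in> T" using elim(1,2) \<alpha> h by auto
    from steklov_step[OF this h(1) elim(3)] show ?thesis using True by (simp add: f_def)
   next
    case False
    then show ?thesis by (simp add: f_def)
   qed
  qed
 qed
 also have "... <= ennreal (h * e)"
  by (rule err_integrated[OF h(1) e]) (use d3(2) h in auto)
 finally have "(LBINT t. f t) <= h * e" using h e by (simp add: ennreal_le_iff)
 moreover have "(LBINT t. f t) = (LBINT t. ?ind t * En t) - (LBINT t. ?ind t * En (t - h)) + h * ?X"
 proof -
  have "?X = (LBINT t. ?ind t * ?D t)"
  proof -
   have "integrable lborel (\<lambda>z. ?ind (snd z) * BH z)"
    by (rule bochner_bound[OF BH_int]) (auto split: split_indicator)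
   from integral_lborel_prod(1)[OF this] show ?thesis by simp
  qed
  then show ?thesis
   unfolding f_def using im[OF En_int] im[OF iEs] im[OF iD] by simp
 qed
 moreover have "h * (En \<beta> - En \<alpha> - 2 * e) <= (LBINT t. ?ind t * En t) - (LBINT t. ?ind t * En (t - h))"
 proof -
  let ?ih = "\<lambda>a. indicator {a - h<..<a} :: real => real"
  have ci: "integrable lborel (\<lambda>t. ?ih a t * f t)" if "integrable lborel f" for f :: "real => real" and a
   using integrable_mult_indicator[OF _ that, of "{a - h<..<a}"] by simp
  have cc: "integrable lborel (\<lambda>t. ?ih a t * c)" "(LBINT t. ?ih a t * c) = h * c" for a c :: real
   using h by (simp_all add: integrable_indicator_iff)
  have sh: "(LBINT t. ?ind t * En (t - h)) = (LBINT t. indicator {\<alpha> - h<..<\<beta> - h} t * En t)"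
  proof -
   have [measurable]: "En \<in> borel_measurable borel" using En_int by auto
   have "(LBINT t. ?ind (t + h) * En (t + h - h)) = (LBINT t. ?ind t * En (t - h))"
    by (rule integral_shift) measurable
   moreover have "?ind (t + h) = indicator {\<alpha> - h<..<\<beta> - h} t" for t by (auto split: split_indicator)
   ultimately show ?thesis by simp
  qed
  have i3: "integrable lborel (\<lambda>t. indicator {\<alpha> - h<..<\<beta> - h} t * En t)"
   using integrable_mult_indicator[OF _ En_int, of "{\<alpha> - h<..<\<beta> - h}"] by simp
  have "(LBINT t. ?ind t * En t) - (LBINT t. indicator {\<alpha> - h<..<\<beta> - h} t * En t) =
    (LBINT t. ?ind t * En t - indicator {\<alpha> - h<..<\<beta> - h} t * En t)"
   by (rule bochner_diff[OF im[OF En_int] i3, symmetric])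
  \<comment> \<open>The two differences of indicators agree except at \<alpha> and \<beta> -
    h.\<close>
  also have "... = (LBINT t. ?ih \<beta> t * En t - ?ih \<alpha> t * En t)"
  proof (rule integral_cong_AE)
   have "AE t in lborel. t \<noteq> \<alpha> \<and> t \<noteq> \<beta> - h"
    using AE_lborel_singleton[of \<alpha>] AE_lborel_singleton[of "\<beta> - h"] by eventually_elim simp
   then show "AE t in lborel. ?ind t * En t - indicator {\<alpha> - h<..<\<beta> - h} t * En t = ?ih \<beta> t * En t - ?ih \<alpha> t * En t"
    by eventually_elim (use \<alpha>\<beta>(3) h(1) in \<open>auto split: split_indicator\<close>)
   have [measurable]: "En \<in> borel_measurable borel" using En_int by auto
   show "(\<lambda>t. ?ind t * En t - indicator {\<alpha> - h<..<\<beta> - h} t * En t) \<in> borel_measurable lborel"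
    "(\<lambda>t. ?ih \<beta> t * En t - ?ih \<alpha> t * En t) \<in> borel_measurable lborel" by measurable
  qed
  also have "... = (LBINT t. ?ih \<beta> t * En t) - (LBINT t. ?ih \<alpha> t * En t)"
   by (rule bochner_diff[OF ci[OF En_int] ci[OF En_int]])
  also have "... \<ge> h * (En \<beta> - e) - h * (En \<alpha> + e)"
  proof (rule diff_mono)
   have "(LBINT t. ?ih \<beta> t * (En \<beta> - e)) <= (LBINT t. ?ih \<beta> t * En t)"
   proof (rule integral_mono_AE[OF cc(1) ci[OF En_int]])
    show "AE t in lborel. ?ih \<beta> t * (En \<beta> - e) <= ?ih \<beta> t * En t"
     using T1
    proof eventually_elim
     case (elim t)
     show ?case
     proof (cases "t \<in> {\<beta> - h<..<\<beta>}")
      case True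
      then have "t \<in> T" "\<bar>t - \<beta>\<bar> < d2" using elim \<alpha> \<alpha>\<beta>(3) h by auto
      then have "\<bar>En t - En \<beta>\<bar> < e" using d2(2) by blast
      then show ?thesis using True by (simp add: abs_less_iff)
     qed simp
    qed
   qed
   then show "h * (En \<beta> - e) <= (LBINT t. ?ih \<beta> t * En t)" by (simp only: cc(2))
   have "(LBINT t. ?ih \<alpha> t * En t) <= (LBINT t. ?ih \<alpha> t * (En \<alpha> + e))"
   proof (rule integral_mono_AE[OF ci[OF En_int] cc(1)])
    show "AE t in lborel. ?ih \<alpha> t * En t <= ?ih \<alpha> t * (En \<alpha> + e)"
     using T1
    proof eventually_elim
     case (elim t)
     show ?case
     proof (cases "t \<in> {\<alpha> - h<..<\<alpha>}")
      case True
      then have "t \<in> T" "\<bar>t - \<alpha>\<bar> < d1" using elim \<alpha> \<alpha>\<beta>(3) h by auto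
      then have "\<bar>En t - En \<alpha>\<bar> < e" using d1(2) by blast
      then show ?thesis using True by (simp add: abs_less_iff)
     qed simp
    qed
   qed
   then show "(LBINT t. ?ih \<alpha> t * En t) <= h * (En \<alpha> + e)" by (simp only: cc(2))
  qed
  finally show ?thesis unfolding sh by (simp add: algebra_simps)
 qed
 ultimately have "h * (En \<beta> - En \<alpha> - 2 * e) + h * ?X <= h * e" by linarith
 then have "h * (En \<beta> - En \<alpha> + ?X) <= h * (3 * e)" by (simp add: algebra_simps)
 then have "En \<beta> - En \<alpha> + ?X <= 3 * e" using h(1) by simp
 then show "En \<beta> - En \<alpha> <= - ?X + e0" by (simp add: e_def)
qed

end

section \<open>The pointwise lower bound for the flux term and the energy estimate\<close>

lemma young_sq:
 fixes p X Y \<theta> :: real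
 assumes "p^2 <= X * Y" "X \<ge> 0" "Y \<ge> 0" "\<theta> > 0"
 shows "p <= \<theta> * X + Y / (4 * \<theta>)"
proof (rule power2_le_imp_le)
 have "(\<theta> * X + Y / (4 * \<theta>))^2 = (\<theta> * X - Y / (4 * \<theta>))^2 + X * Y"
  using assms(4) by (simp add: power2_eq_square field_simps)
 then show "p^2 <= (\<theta> * X + Y / (4 * \<theta>))^2"
  using assms(1) zero_le_power2[of "\<theta> * X - Y / (4 * \<theta>)"] by linarith
 show "0 <= \<theta> * X + Y / (4 * \<theta>)" using assms by simp
qed

lemma norm_sum_scaleR_sq:
 fixes X :: "nat => 'a::real_normed_vector"
 shows "(norm (\<Sum>i<k. v i *\<^sub>R X i))^2 <= (\<Sum>i<k. (v i)^2) * (\<Sum>i<k. (norm (X i))^2)"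
proof -
 have "norm (\<Sum>i<k. v i *\<^sub>R X i) <= (\<Sum>i<k. \<bar>v i\<bar> * \<bar>norm (X i)\<bar>)"
  by (rule order_trans[OF norm_sum]) simp
 also have "... <= L2_set v {..<k} * L2_set (\<lambda>i. norm (X i)) {..<k}" by (rule L2_set_mult_ineq)
 finally have "(norm (\<Sum>i<k. v i *\<^sub>R X i))^2 <= (L2_set v {..<k} * L2_set (\<lambda>i. norm (X i)) {..<k})^2"
  by (rule power_mono) simp
 then show ?thesis by (simp add: power_mult_distrib L2_set_def sum_nonneg)
qed

text \<open>Bookkeeping: ellipticity supplies six copies of Y, Young's inequality spends one in each
  of three terms, and three remain. Abstract variables keep the large expressions out of the linear
  arithmetic.\<close>

lemma combine_lower_bounds:
 fixes Y P1 P2 P3 P4 P5 b1 b2 b3 b4 b5 b6 d1 d2 t :: real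
 assumes "- (Y + P1) <= b1" "- (P5 + P2) <= b3" "- (Y + P3) <= b4" "- (Y + P4) <= b6"
  and "d1 = P1 + P2" "d2 = P3 + P4 + P5" "6 * Y <= b5" "0 <= b2" "t = b1 + b2 + b3 + b4 + b5 + b6"
 shows "3 * Y - (d1 + d2) <= t"
 using assms by linarith

context local_solution
begin

definition \<gamma>2 where "\<gamma>2 z = (\<Sum>i<k. (norm (G i z))^2)"
definition \<phi>2 where "\<phi>2 z = (\<Sum>i<k. (norm (F i z))^2)"

lemma \<gamma>2_meas[measurable]: "\<gamma>2 \<in> borel_measurable borel" and \<phi>2_meas[measurable]: "\<phi>2 \<in> borel_measurable borel"
 unfolding \<gamma>2_def \<phi>2_def by measurable

lemma \<gamma>2_int: "integrable lborel \<gamma>2" and \<phi>2_int: "integrable lborel \<phi>2"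
 unfolding \<gamma>2_def \<phi>2_def using G_L2 F_L2 by simp_all

lemma \<gamma>2_nonneg: "0 <= \<gamma>2 z" and \<phi>2_nonneg: "0 <= \<phi>2 z"
 unfolding \<gamma>2_def \<phi>2_def by (simp_all add: sum_nonneg)

text \<open>The three constants collect the losses of Young's inequality in \<open>BH_lower\<close>:
  those from the gradient of the cutoff, those from the source against the derivative of h, and
  those from the remaining source terms. They depend on \<nu> and L only.\<close>

definition C1 where "C1 = 3 / (2 * \<nu>) * L^2 + 1 / 2"
definition C2 where "C2 = 6 / \<nu>"
definition C3 where "C3 = 3 / (2 * \<nu>) + 1 / 2"

lemma C_pos: "C1 > 0" "C2 > 0" "C3 > 0"
 using \<nu> L unfolding C1_def C2_def C3_def by (simp_all add: add_nonneg_pos)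

end

context energy_setup
begin

text \<open>Marks where the test function can be alive; it confines the right-hand side of the
  energy estimate to a superlevel set of |u|.\<close>

definition \<zeta> :: "(real ^ 'n) \<times> real => real" where
 "\<zeta> z = (if norm (fst z - x0) < R \<and> \<kappa> < sqn k V z then 1 else 0)"

text \<open>K1 and K2 are the factors in |D\<eta>|^2 <= K1 \<eta> and h'^2 <= K2 h, see
  \<open>Dcut_sq\<close> and \<open>Dlev_sq\<close>.\<close>

definition K1 where "K1 = 96 * b^2 * R^2"
definition K2 where "K2 = 24 / \<Delta>^2"

lemma \<zeta>_meas[measurable]: "\<zeta> \<in> borel_measurable borel"
 unfolding \<zeta>_def by measurable

lemma \<zeta>_zero:
 assumes "\<zeta> z = 0" shows "w z = 0" "H i z = 0"
proof -
 have "w z = 0 \<and> H i z = 0"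
 proof (cases "norm (fst z - x0) < R")
  case True
  then have "sqn k V z <= \<kappa>" using assms by (simp add: \<zeta>_def split: if_splits)
  then have "lev \<kappa> \<Delta> (sqn k V z) = 0" "Dlev \<kappa> \<Delta> (sqn k V z) = 0" using lev_zero[OF \<Delta>] by auto
  then show ?thesis by (simp add: w_def H_def)
 next
  case False
  then have "cutoff x0 R b (fst z) = 0" "Dcutoff x0 R b (fst z) = 0" using cut_zero[OF b0 R0, of "fst z" x0] by auto
  then show ?thesis by (simp add: w_def H_def)
 qed
 then show "w z = 0" "H i z = 0" by auto
qed

lemma w_bounds: "0 <= w z" "w z <= 1"
 using cut_bounds[of x0 R b "fst z"] lev_bounds[of \<kappa> \<Delta> "sqn k V z"] by (simp_all add: w_def mult_le_one)

text \<open>Ellipticity gives \<nu> \<eta> h |Dv|^2, and the term of the field with h' has a sign.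
  Every other term contains D\<eta>, h' or F; as |D\<eta>|^2 and h'^2 are controlled by \<eta> and
  h, Young's inequality charges only half of the good term.\<close>

lemma BH_lower: "\<nu> / 2 * (w z * \<gamma>2 z) - \<zeta> z * (C1 * \<Lambda> * K1 + (C2 * \<Lambda>^2 * K2 + C3) * \<phi>2 z) <= BH z"
proof (cases "\<zeta> z = 0")
 case True
 then show ?thesis using \<zeta>_zero[OF True] by (simp add: BH_def)
next
 case False
 then have \<zeta>: "\<zeta> z = 1" by (simp add: \<zeta>_def split: if_splits)
 define l where "l = lev \<kappa> \<Delta> (sqn k V z)"
 define dl where "dl = Dlev \<kappa> \<Delta> (sqn k V z)"
 define c where "c = cutoff x0 R b (fst z)"
 define dc where "dc = Dcutoff x0 R b (fst z)"
 define a where "a = (\<Sum>i<k. V i z *\<^sub>R A i z)"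
 define f where "f = (\<Sum>i<k. V i z *\<^sub>R F i z)"
 define g where "g = (\<Sum>i<k. V i z *\<^sub>R G i z)"
 have l: "0 <= l" "l <= 1" and c: "0 <= c" "c <= 1" and dl: "0 <= dl" "dl^2 <= K2 * l" and dc: "(norm dc)^2 <= K1 * c"
  using lev_bounds cut_bounds Dlev_bounds[OF \<Delta>] Dlev_sq[OF \<Delta>] Dcut_sq[OF b0 R0]
  by (simp_all add: l_def c_def dl_def dc_def K1_def K2_def)
 have K: "K1 \<ge> 0" "K2 \<ge> 0" by (simp_all add: K1_def K2_def)
 have w: "w z = c * l" by (simp add: w_def c_def l_def)
 have sV: "(\<Sum>i<k. (V i z)^2) <= \<Lambda>" using sqn_V_le[of z] by (simp add: sqn_def)
 have na: "(norm a)^2 <= \<Lambda> * (L^2 * \<gamma>2 z)"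
  unfolding a_def using growth[of z] \<Lambda>_pos sV
  by (intro order_trans[OF norm_sum_scaleR_sq] mult_mono) (simp_all add: \<gamma>2_def sum_nonneg)
 have nf: "(norm f)^2 <= \<Lambda> * \<phi>2 z"
  unfolding f_def using \<Lambda>_pos sV
  by (intro order_trans[OF norm_sum_scaleR_sq] mult_mono) (simp_all add: \<phi>2_def sum_nonneg)
 have ng: "(norm g)^2 <= \<Lambda> * \<gamma>2 z"
  unfolding g_def using \<Lambda>_pos sV
  by (intro order_trans[OF norm_sum_scaleR_sq] mult_mono) (simp_all add: \<gamma>2_def sum_nonneg)
 have BHeq: "BH z = l * (a \<bullet> dc) + 2 * c * dl * (a \<bullet> g) + l * (f \<bullet> dc) + 2 * c * dl * (f \<bullet> g) +
   c * l * (\<Sum>i<k. A i z \<bullet> G i z) + c * l * (\<Sum>i<k. F i z \<bullet> G i z)"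
 proof -
  have "B i z \<bullet> H i z = (V i z *\<^sub>R A i z + V i z *\<^sub>R F i z) \<bullet> (l *\<^sub>R dc + (2 * c * dl) *\<^sub>R g) +
    c * l * (A i z \<bullet> G i z) + c * l * (F i z \<bullet> G i z)" for i
   by (simp add: B_def H_def w l_def[symmetric] c_def[symmetric] dl_def[symmetric] dc_def[symmetric]
     g_def[symmetric] inner_add_left inner_add_right distrib_left mult_ac)
  then have "BH z = (\<Sum>i<k. (V i z *\<^sub>R A i z + V i z *\<^sub>R F i z) \<bullet> (l *\<^sub>R dc + (2 * c * dl) *\<^sub>R g)) +
    c * l * (\<Sum>i<k. A i z \<bullet> G i z) + c * l * (\<Sum>i<k. F i z \<bullet> G i z)"
   by (simp add: BH_def sum.distrib sum_distrib_left)
  also have "(\<Sum>i<k. (V i z *\<^sub>R A i z + V i z *\<^sub>R F i z) \<bullet> (l *\<^sub>R dc + (2 * c * dl) *\<^sub>R g)) =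
    (a + f) \<bullet> (l *\<^sub>R dc + (2 * c * dl) *\<^sub>R g)"
   unfolding a_def f_def sum.distrib[symmetric] by (rule inner_sum_left[symmetric])
  finally show ?thesis by (simp add: inner_add_left inner_add_right distrib_left)
 qed
 \<comment> \<open>This is (G3): the two sums of V_i A_i and V_i G_i have nonnegative inner product,
   and \<eta> and h' are nonnegative.\<close>
 have ag: "0 <= 2 * c * dl * (a \<bullet> g)"
  using sign[of z] c dl by (simp add: a_def g_def)
 have AG: "c * l * (\<nu> * \<gamma>2 z) <= c * l * (\<Sum>i<k. A i z \<bullet> G i z)"
  using ellipticity[of z] c l by (intro mult_left_mono) (simp_all add: \<gamma>2_def)
 have t1: "- (norm a * norm dc) <= a \<bullet> dc" "- (norm f * norm dc) <= f \<bullet> dc" "- (norm f * norm g) <= f \<bullet> g"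
  using Cauchy_Schwarz_ineq2[of a dc] Cauchy_Schwarz_ineq2[of f dc] Cauchy_Schwarz_ineq2[of f g]
  by (simp_all add: abs_le_iff)
 have e1: "norm a * norm dc <= \<nu> / 6 * (c * \<gamma>2 z) + 3 / (2 * \<nu>) * L^2 * (\<Lambda> * K1)"
 proof -
  have "(norm a * norm dc)^2 <= (\<Lambda> * (L^2 * \<gamma>2 z)) * (K1 * c)"
   unfolding power_mult_distrib using \<Lambda>_pos \<gamma>2_nonneg[of z] by (intro mult_mono na dc) simp_all
  also have "... = (c * \<gamma>2 z) * (L^2 * (\<Lambda> * K1))" by (simp add: mult_ac)
  finally have "norm a * norm dc <= \<nu> / 6 * (c * \<gamma>2 z) + (L^2 * (\<Lambda> * K1)) / (4 * (\<nu> / 6))"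
   using \<nu> c K \<Lambda>_pos \<gamma>2_nonneg[of z] by (intro young_sq) simp_all
  then show ?thesis by (simp add: field_simps)
 qed
 have e2: "norm f * norm dc <= 1 / 2 * \<phi>2 z + 1 / 2 * (\<Lambda> * K1)"
 proof -
  have "(norm f * norm dc)^2 <= (\<Lambda> * \<phi>2 z) * (K1 * 1)"
   unfolding power_mult_distrib using \<Lambda>_pos \<phi>2_nonneg[of z] c K
   by (intro mult_mono nf order_trans[OF dc] mult_left_mono) simp_all
  also have "... = \<phi>2 z * (\<Lambda> * K1)" by (simp add: mult_ac)
  finally have "norm f * norm dc <= 1 / 2 * \<phi>2 z + (\<Lambda> * K1) / (4 * (1 / 2))"
   using K \<Lambda>_pos \<phi>2_nonneg[of z] by (intro young_sq) simp_all
  then show ?thesis by simp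
 qed
 \<comment> \<open>The only term in which the source meets the derivative of h; it costs K2
   \<Lambda>^2 |F|^2.\<close>
 have e3: "2 * dl * (norm f * norm g) <= \<nu> / 6 * (l * \<gamma>2 z) + 6 / \<nu> * (K2 * \<Lambda>^2 * \<phi>2 z)"
 proof -
  have "(2 * dl * (norm f * norm g))^2 = 4 * (dl^2 * ((norm f)^2 * (norm g)^2))"
   by (simp add: power_mult_distrib)
  also have "... <= 4 * ((K2 * l) * ((\<Lambda> * \<phi>2 z) * (\<Lambda> * \<gamma>2 z)))"
   using \<Lambda>_pos \<phi>2_nonneg[of z] \<gamma>2_nonneg[of z] l K by (intro mult_left_mono mult_mono dl nf ng) simp_all
  also have "... = (l * \<gamma>2 z) * (4 * (K2 * \<Lambda>^2 * \<phi>2 z))" by (simp add: power2_eq_square mult_ac)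
  finally have "2 * dl * (norm f * norm g) <= \<nu> / 6 * (l * \<gamma>2 z) + (4 * (K2 * \<Lambda>^2 * \<phi>2 z)) / (4 * (\<nu> / 6))"
   using \<nu> l K \<Lambda>_pos \<gamma>2_nonneg[of z] \<phi>2_nonneg[of z] by (intro young_sq) simp_all
  then show ?thesis by (simp add: field_simps)
 qed
 have e4: "- (\<nu> / 6 * \<gamma>2 z + 3 / (2 * \<nu>) * \<phi>2 z) <= (\<Sum>i<k. F i z \<bullet> G i z)"
 proof -
  have "- (F i z \<bullet> G i z) <= \<nu> / 6 * (norm (G i z))\<^sup>2 + 3 / (2 * \<nu>) * (norm (F i z))\<^sup>2" for i
  proof -
   have "- (F i z \<bullet> G i z) <= norm (F i z) * norm (G i z)"
    using Cauchy_Schwarz_ineq2[of "F i z" "G i z"] by simp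
   also have "... <= \<nu> / 6 * (norm (G i z))^2 + (norm (F i z))^2 / (4 * (\<nu> / 6))"
    using \<nu> by (intro young_sq) (simp_all add: power_mult_distrib mult.commute)
   finally show ?thesis by (simp add: field_simps)
  qed
  then have "(\<Sum>i<k. - (F i z \<bullet> G i z)) <= (\<Sum>i<k. \<nu> / 6 * (norm (G i z))^2 + 3 / (2 * \<nu>) * (norm (F i z))^2)"
   by (rule sum_mono)
  then show ?thesis
   unfolding sum_negf sum.distrib sum_distrib_left[symmetric] \<gamma>2_def \<phi>2_def by linarith
 qed
 have f1: "l * (a \<bullet> dc) \<ge> - (\<nu> / 6 * (c * l * \<gamma>2 z) + 3 / (2 * \<nu>) * L^2 * (\<Lambda> * K1))"
 proof -
  have "l * - (a \<bullet> dc) <= l * (\<nu> / 6 * (c * \<gamma>2 z) + 3 / (2 * \<nu>) * L^2 * (\<Lambda> * K1))"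
   using t1 e1 l by (intro mult_left_mono) linarith+
  moreover have "l * (3 / (2 * \<nu>) * L^2 * (\<Lambda> * K1)) <= 1 * (3 / (2 * \<nu>) * L^2 * (\<Lambda> * K1))"
   using l \<nu> \<Lambda>_pos K by (intro mult_right_mono) simp_all
  ultimately show ?thesis by (simp add: distrib_left mult_ac)
 qed
 have f2: "l * (f \<bullet> dc) \<ge> - (1 / 2 * \<phi>2 z + 1 / 2 * (\<Lambda> * K1))"
 proof -
  have "l * - (f \<bullet> dc) <= 1 * (1 / 2 * \<phi>2 z + 1 / 2 * (\<Lambda> * K1))"
  proof (rule order_trans[OF mult_left_mono mult_right_mono])
   show "- (f \<bullet> dc) <= 1 / 2 * \<phi>2 z + 1 / 2 * (\<Lambda> * K1)" using t1 e2 by linarith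
   show "0 <= 1 / 2 * \<phi>2 z + 1 / 2 * (\<Lambda> * K1)" using \<phi>2_nonneg[of z] \<Lambda>_pos K by simp
  qed (use l in simp_all)
  then show ?thesis by simp
 qed
 have f3: "2 * c * dl * (f \<bullet> g) \<ge> - (\<nu> / 6 * (c * l * \<gamma>2 z) + 6 / \<nu> * (K2 * \<Lambda>^2 * \<phi>2 z))"
 proof -
  have "2 * dl * - (f \<bullet> g) <= 2 * dl * (norm f * norm g)" using t1 dl by (intro mult_left_mono) linarith+
  then have "c * (2 * dl * - (f \<bullet> g)) <= c * (\<nu> / 6 * (l * \<gamma>2 z) + 6 / \<nu> * (K2 * \<Lambda>^2 * \<phi>2 z))"
   using e3 c by (intro mult_left_mono) linarith+
  moreover have "c * (6 / \<nu> * (K2 * \<Lambda>^2 * \<phi>2 z)) <= 1 * (6 / \<nu> * (K2 * \<Lambda>^2 * \<phi>2 z))"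
   using c \<nu> \<phi>2_nonneg[of z] K by (intro mult_right_mono) simp_all
  ultimately show ?thesis by (simp add: distrib_left mult_ac)
 qed
 have f4: "c * l * (\<Sum>i<k. F i z \<bullet> G i z) \<ge> - (\<nu> / 6 * (c * l * \<gamma>2 z) + 3 / (2 * \<nu>) * \<phi>2 z)"
 proof -
  have "c * l * - (\<Sum>i<k. F i z \<bullet> G i z) <= c * l * (\<nu> / 6 * \<gamma>2 z + 3 / (2 * \<nu>) * \<phi>2 z)"
   using e4 c l by (intro mult_left_mono) (linarith, simp)
  moreover have "c * l * (3 / (2 * \<nu>) * \<phi>2 z) <= 1 * (3 / (2 * \<nu>) * \<phi>2 z)"
   using c l \<nu> \<phi>2_nonneg[of z] by (intro mult_right_mono) (simp_all add: mult_le_one)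
  ultimately show ?thesis by (simp add: distrib_left mult_ac)
 qed
 have d1: "C1 * \<Lambda> * K1 = 3 / (2 * \<nu>) * L^2 * (\<Lambda> * K1) + 1 / 2 * (\<Lambda> * K1)"
  by (simp add: C1_def distrib_right mult.assoc)
 have d2: "(C2 * \<Lambda>^2 * K2 + C3) * \<phi>2 z = 6 / \<nu> * (K2 * \<Lambda>^2 * \<phi>2 z) + 3 / (2 * \<nu>) * \<phi>2 z + 1 / 2 * \<phi>2 z"
  by (simp add: C2_def C3_def algebra_simps)
 have f5: "6 * (\<nu> / 6 * (c * l * \<gamma>2 z)) <= c * l * (\<Sum>i<k. A i z \<bullet> G i z)"
  using AG by (simp add: mult_ac)
 have "3 * (\<nu> / 6 * (c * l * \<gamma>2 z)) - (C1 * \<Lambda> * K1 + (C2 * \<Lambda>^2 * K2 + C3) * \<phi>2 z) <= BH z"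
  using f1 f2 f3 f4 d1 d2 f5 ag BHeq by (rule combine_lower_bounds)
 then show ?thesis unfolding w \<zeta> by simp
qed

proposition energy_estimate:
 assumes \<alpha>\<beta>: "\<alpha> \<in> T" "\<beta> \<in> T" "\<alpha> < \<beta>"
 shows "En \<beta> + \<nu> / 2 * (LBINT z. indicator {\<alpha><..<\<beta>} (snd z) * (w z * \<gamma>2 z)) <=
  En \<alpha> + (LBINT z. indicator {\<alpha><..<\<beta>} (snd z) * (\<zeta> z * (C1 * \<Lambda> * K1 + (C2 * \<Lambda>^2 * K2 + C3) * \<phi>2 z)))"
  and "integrable lborel (\<lambda>z. indicator {\<alpha><..<\<beta>} (snd z) * (w z * \<gamma>2 z))"
proof -
 let ?I = "\<lambda>z. indicator {\<alpha><..<\<beta>} (snd z) :: real"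
 show i1: "integrable lborel (\<lambda>z. ?I z * (w z * \<gamma>2 z))"
 proof (rule bochner_bound[OF \<gamma>2_int])
  show "AE z in lborel. norm (?I z * (w z * \<gamma>2 z)) <= norm (\<gamma>2 z)"
   using w_bounds \<gamma>2_nonneg by (intro AE_I2) (simp add: abs_mult mult_left_le_one_le split: split_indicator)
 qed measurable
 let ?c = "\<lambda>z. C1 * \<Lambda> * K1 + (C2 * \<Lambda>^2 * K2 + C3) * \<phi>2 z"
 have K: "K1 \<ge> 0" "K2 \<ge> 0" by (simp_all add: K1_def K2_def)
 have \<zeta>Q: "\<zeta> z <= indicator Q z" "0 <= \<zeta> z" for z
 proof -
  have "sqn k V z = 0" if "z \<notin> Q" using V_outside[of z] that by (simp add: sqn_def)
  then show "\<zeta> z <= indicator Q z" "0 <= \<zeta> z" using \<kappa> by (auto simp: \<zeta>_def split: split_indicator)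
 qed
 have i2: "integrable lborel (\<lambda>z. ?I z * (\<zeta> z * ?c z))"
 proof (rule bochner_bound)
  show "integrable lborel (\<lambda>z. C1 * \<Lambda> * K1 * indicator Q z + (C2 * \<Lambda>^2 * K2 + C3) * \<phi>2 z)"
   using Q_int \<phi>2_int by simp
  show "AE z in lborel. norm (?I z * (\<zeta> z * ?c z)) <= norm (C1 * \<Lambda> * K1 * indicator Q z + (C2 * \<Lambda>^2 * K2 + C3) * \<phi>2 z)"
  proof (rule AE_I2)
   fix z
   have p: "0 <= C1 * \<Lambda> * K1" "0 <= (C2 * \<Lambda>^2 * K2 + C3) * \<phi>2 z"
    using C_pos \<Lambda>_pos K \<phi>2_nonneg[of z] by simp_all
   have "\<zeta> z * (C1 * \<Lambda> * K1) <= C1 * \<Lambda> * K1 * indicator Q z"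
    using mult_right_mono[OF \<zeta>Q(1)[of z] p(1)] by (simp add: mult.commute)
   moreover have "\<zeta> z * ((C2 * \<Lambda>^2 * K2 + C3) * \<phi>2 z) <= 1 * ((C2 * \<Lambda>^2 * K2 + C3) * \<phi>2 z)"
    using p by (intro mult_right_mono) (simp_all add: \<zeta>_def)
   ultimately have "\<zeta> z * ?c z <= C1 * \<Lambda> * K1 * indicator Q z + (C2 * \<Lambda>^2 * K2 + C3) * \<phi>2 z"
    by (simp add: distrib_left)
   moreover have "0 <= \<zeta> z * ?c z" using \<zeta>Q[of z] p by simp
   ultimately show "norm (?I z * (\<zeta> z * ?c z)) <= norm (C1 * \<Lambda> * K1 * indicator Q z + (C2 * \<Lambda>^2 * K2 + C3) * \<phi>2 z)"
    by (simp split: split_indicator)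
  qed
 qed measurable
 have i3: "integrable lborel (\<lambda>z. ?I z * BH z)"
  by (rule bochner_bound[OF BH_int]) (auto split: split_indicator)
 have "\<nu> / 2 * (LBINT z. ?I z * (w z * \<gamma>2 z)) - (LBINT z. ?I z * (\<zeta> z * ?c z)) =
   (LBINT z. \<nu> / 2 * (?I z * (w z * \<gamma>2 z)) - ?I z * (\<zeta> z * ?c z))"
  using i1 i2 by simp
 also have "... <= (LBINT z. ?I z * BH z)"
 proof (rule integral_mono[OF Bochner_Integration.integrable_diff[OF Bochner_Integration.integrable_mult_right[OF i1] i2] i3])
  fix z
  show "\<nu> / 2 * (?I z * (w z * \<gamma>2 z)) - ?I z * (\<zeta> z * ?c z) <= ?I z * BH z"
   using BH_lower[of z] by (simp split: split_indicator)
 qed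
 finally show "En \<beta> + \<nu> / 2 * (LBINT z. ?I z * (w z * \<gamma>2 z)) <= En \<alpha> + (LBINT z. ?I z * (\<zeta> z * ?c z))"
  using energy_distributional[OF \<alpha>\<beta>] by linarith
qed

end

section \<open>Bounds for superlevel sets and gradients\<close>

lemma powr_less_iff:
 fixes a x y :: real
 assumes "a > 0" "0 <= x" "0 <= y" shows "x powr a < y powr a \<longleftrightarrow> x < y"
 using powr_less_mono2[of a x y] powr_mono2[of a y x] assms by (cases "x < y") auto

context energy_setup
begin

lemma level_iff: "\<kappa> = k0 powr (2 * m) ==> 0 <= k0 ==> \<kappa> < sqn k V z \<longleftrightarrow> k0 < S z"
 unfolding sqn_V using m S_nonneg by (simp add: powr_less_iff)

lemma finite_measure_Q: "X \<in> sets borel ==> X \<subseteq> Q ==> integrable lborel (indicator X :: _ => real)"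
proof -
 assume X: "X \<in> sets borel" "X \<subseteq> Q"
 have "bounded Q" by (intro bounded_Times) auto
 then have "bounded X" using X bounded_subset by blast
 then show ?thesis using X emeasure_bounded_finite[of X] by (simp add: integrable_indicator_iff)
qed

lemma S_pos_Q: "0 <= l ==> l < S z ==> z \<in> Q"
 using S_outside[of z] by force

text \<open>Where |u| > k2, convexity gives Psi >= (k2 - k1) psi(k1), and at k1 the truncation has
  already reached exp(-1). The gap between k1 and k2 is the price for the slow growth of
  \<open>Psi\<close> just above its threshold.\<close>

lemma En_lower:
 assumes k: "0 <= k1" "k1 < k2" "\<kappa> + \<Delta> <= k1 powr (2 * m)" and r: "b * (R^2 - r^2) \<ge> 1"
 shows "exp (- 2) * ((k2 - k1) * k1 powr m) * measure lborel {x. norm (x - x0) < r \<and> k2 < S (x, t)} <= En t"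
proof -
 let ?X = "{x. norm (x - x0) < r \<and> k2 < S (x, t)}"
 have [measurable]: "?X \<in> sets borel" by measurable
 have iX: "integrable lborel (indicator ?X :: _ => real)"
 proof -
  have "?X \<subseteq> ball x0 \<rho>"
  proof
   fix x assume "x \<in> ?X"
   then have "(x, t) \<in> Q" using S_pos_Q[of k2 "(x, t)"] k by auto
   then show "x \<in> ball x0 \<rho>" by simp
  qed
  then have "bounded ?X" by (rule bounded_subset[OF bounded_ball])
  then show ?thesis using emeasure_bounded_finite[of ?X] by (simp add: integrable_indicator_iff)
 qed
 have "exp (- 2) * ((k2 - k1) * k1 powr m) * measure lborel ?X =
   (LBINT x. exp (- 2) * ((k2 - k1) * k1 powr m) * indicator ?X x)" by simp
 also have "... <= En t"
  unfolding En_def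
 proof (rule integral_mono)
  show "integrable lborel (\<lambda>x. exp (- 2) * ((k2 - k1) * k1 powr m) * indicator ?X x)" using iX by simp
  show "integrable lborel (\<lambda>x. cutoff x0 R b x * Psi m \<kappa> \<Delta> (S (x, t)))" by (rule En_int_x)
  fix x
  show "exp (- 2) * ((k2 - k1) * k1 powr m) * indicator ?X x <= cutoff x0 R b x * Psi m \<kappa> \<Delta> (S (x, t))"
  proof (cases "x \<in> ?X")
   case True
   have c: "cutoff x0 R b x \<ge> exp (- 1)" using True by (intro cut_ge[OF r b0]) auto
   have "k1 > 0"
   proof (rule ccontr)
    assume "\<not> k1 > 0"
    then have "k1 = 0" using k by simp
    then show False using k(3) \<kappa> \<Delta> m by simp
   qed
   have p: "psi m \<kappa> \<Delta> k1 \<ge> exp (- 1) * k1 powr m"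
    using lev_ge[OF \<Delta> k(3)] \<open>k1 > 0\<close> by (simp add: psi_def mult.commute mult_left_mono)
   have "exp (- 1) * ((k2 - k1) * k1 powr m) <= (S (x, t) - k1) * psi m \<kappa> \<Delta> k1"
   proof -
    have "(k2 - k1) * (exp (- 1) * k1 powr m) <= (S (x, t) - k1) * psi m \<kappa> \<Delta> k1"
     using True k p by (intro mult_mono) auto
    then show ?thesis by (simp add: mult_ac)
   qed
   also have "... <= Psi m \<kappa> \<Delta> (S (x, t))" using True k by (intro Psi_ge m \<Delta>) auto
   finally have P: "exp (- 1) * ((k2 - k1) * k1 powr m) <= Psi m \<kappa> \<Delta> (S (x, t))" .
   have "exp (- 1) * (exp (- 1) * ((k2 - k1) * k1 powr m)) <= cutoff x0 R b x * Psi m \<kappa> \<Delta> (S (x, t))"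
    using k by (intro mult_mono c P cut_bounds) simp_all
   moreover have "exp (- 1) * (exp (- 1) * ((k2 - k1) * k1 powr m)) = exp (- 2) * ((k2 - k1) * k1 powr m)"
    by (simp add: mult.assoc[symmetric] exp_add[symmetric] del: mult.assoc)
   ultimately show ?thesis using True by simp
  next
   case False
   then show ?thesis using cut_bounds[of x0 R b x] Psi_nonneg by simp
  qed
 qed
 finally show ?thesis .
qed

lemma En_upper:
 assumes k0: "\<kappa> = k0 powr (2 * m)" "0 <= k0"
 shows "En t <= M powr (1 + m) * measure lborel {x. norm (x - x0) < R \<and> k0 < S (x, t)}"
  and "integrable lborel (indicator {x. norm (x - x0) < R \<and> k0 < S (x, t)} :: _ => real)"
proof -
 let ?X = "{x. norm (x - x0) < R \<and> k0 < S (x, t)}"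
 have [measurable]: "?X \<in> sets borel" by measurable
 show iX: "integrable lborel (indicator ?X :: _ => real)"
 proof -
  have "?X \<subseteq> ball x0 R" by (auto simp: dist_norm norm_minus_commute)
  then have "bounded ?X" by (rule bounded_subset[OF bounded_ball])
  then show ?thesis using emeasure_bounded_finite[of ?X] by (simp add: integrable_indicator_iff)
 qed
 have "En t <= (LBINT x. M powr (1 + m) * indicator ?X x)"
  unfolding En_def
 proof (rule integral_mono)
  show "integrable lborel (\<lambda>x. cutoff x0 R b x * Psi m \<kappa> \<Delta> (S (x, t)))" by (rule En_int_x)
  show "integrable lborel (\<lambda>x. M powr (1 + m) * indicator ?X x)" using iX by simp
  fix x
  show "cutoff x0 R b x * Psi m \<kappa> \<Delta> (S (x, t)) <= M powr (1 + m) * indicator ?X x"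
  proof (cases "x \<in> ?X")
   case True
   have "cutoff x0 R b x * Psi m \<kappa> \<Delta> (S (x, t)) <= 1 * (M * M powr m)"
    using cut_bounds PsiS_bound Psi_nonneg by (intro mult_mono) auto
   also have "... = M powr (1 + m)" using M by (simp add: powr_add)
   finally show ?thesis using True by simp
  next
   case False
   then consider "norm (x - x0) \<ge> R" | "S (x, t) <= k0" by force
   then show ?thesis
   proof cases
    case 1
    then show ?thesis using cut_zero(1)[OF b0 R0 1] False by simp
   next
    case 2
    then have "lev \<kappa> \<Delta> (S (x, t) powr (2 * m)) = 0"
     unfolding k0(1) using m S_nonneg \<Delta> by (intro lev_zero powr_mono2) auto
    then have "psi m \<kappa> \<Delta> (S (x, t)) = 0" by (simp add: psi_def)
    then have "Psi m \<kappa> \<Delta> (S (x, t)) <= 0" using Psi_le[OF m(1) \<Delta> S_nonneg, of \<kappa> "(x, t)"] by simp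
    then show ?thesis using False cut_bounds[of x0 R b x] by (simp add: mult_nonneg_nonpos)
   qed
  qed
 qed
 then show "En t <= M powr (1 + m) * measure lborel ?X" by simp
qed

text \<open>The estimate starts at a good time \<alpha> in (ta, tb) at which the slice of A0 does
  not exceed its mean over this interval; this is the origin of the factor 1 / (tb - ta). The number
  E0 then bounds the energy at every good time after tb, and hence also the gradient up to
  t2.\<close>

lemma energy_sup:
 assumes ts: "t1 <= ta" "ta < tb" "tb < t2" and r: "b * (R^2 - r^2) \<ge> 1"
  and k: "0 <= k0" "k0 < k1" "k1 < k2" "\<kappa> = k0 powr (2 * m)" "\<kappa> + \<Delta> = k1 powr (2 * m)"
  and A_def: "A0 = {z. norm (fst z - x0) < R \<and> ta < snd z \<and> snd z < t2 \<and> k0 < S z}"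
  and E0: "M powr (1 + m) * measure lborel A0 / (tb - ta) + C1 * \<Lambda> * K1 * measure lborel A0 +
   (C2 * \<Lambda>^2 * K2 + C3) * (LBINT z. indicator A0 z * \<phi>2 z) <= E0"
 shows "\<And>\<beta>. \<beta> \<in> T ==> tb < \<beta> ==>
   exp (- 2) * ((k2 - k1) * k1 powr m) * measure lborel {x. norm (x - x0) < r \<and> k2 < S (x, \<beta>)} <= E0"
  and "(LBINT z. indicator {z. norm (fst z - x0) < r \<and> tb < snd z \<and> snd z < t2 \<and> k1 < S z} z * \<gamma>2 z)
   <= 2 / \<nu> * exp 2 * E0"
proof -
 have [measurable]: "A0 \<in> sets borel" unfolding A_def by measurable
 have iA: "integrable lborel (indicator A0 :: _ => real)"
  by (rule finite_measure_Q) (use S_pos_Q[OF k(1)] in \<open>auto simp: A_def\<close>)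
 have K: "K1 \<ge> 0" "K2 \<ge> 0" by (simp_all add: K1_def K2_def)
 let ?sl = "\<lambda>t. {x. norm (x - x0) < R \<and> k0 < S (x, t)}"
 define sA where "sA t = (LBINT x. indicator A0 (x, t) :: real)" for t
 have sA: "sA t = measure lborel (?sl t)" if "ta < t" "t < t2" for t
 proof -
  have "sA t = (LBINT x. indicator (?sl t) x)"
   unfolding sA_def by (rule bochner_cong) (use that in \<open>auto simp: A_def split: split_indicator\<close>)
  then show ?thesis by simp
 qed
 have isA: "integrable lborel sA" "(LBINT t. sA t) = measure lborel A0"
  using integral_lborel_prod(1,3)[OF iA] by (simp_all add: sA_def[abs_def])
 have sA0: "0 <= sA t" for t unfolding sA_def by (rule bochner_nonneg) simp
 \<comment> \<open>If every good time had a slice above the mean, integration over (ta, tb) would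
   exceed the measure of A0.\<close>
 have "\<exists>\<alpha>\<in>T. ta < \<alpha> \<and> \<alpha> < tb \<and> (tb - ta) * sA \<alpha> <= measure lborel A0"
 proof (rule ccontr)
  assume no: "\<not> ?thesis"
  define c where "c = measure lborel A0 / (tb - ta)"
  have ii: "integrable lborel (\<lambda>t. indicator {ta<..<tb} t * f t)" if "integrable lborel f" for f :: "real => real"
   using integrable_mult_indicator[OF _ that, of "{ta<..<tb}"] by simp
  have gt: "AE t in lborel. t \<in> {ta<..<tb} --> c < sA t"
   using T_full
  proof eventually_elim
   case (elim t)
   show ?case
   proof
    assume t: "t \<in> {ta<..<tb}"
    then have "t \<in> T" using elim ts by auto
    then have "measure lborel A0 < (tb - ta) * sA t" using no t by (metis greaterThanLessThan_iff not_le)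
    then show "c < sA t" using ts by (simp add: c_def pos_divide_less_eq mult.commute)
   qed
  qed
  let ?f = "\<lambda>t. indicator {ta<..<tb} t * (sA t - c)"
  have ic: "integrable lborel (\<lambda>t. indicator {ta<..<tb} t * c)" "(LBINT t. indicator {ta<..<tb} t * c) = (tb - ta) * c"
   using ts by (simp_all add: integrable_indicator_iff)
  have fi: "integrable lborel ?f"
   unfolding right_diff_distrib using ii[OF isA(1)] ic by simp
  have nn: "AE t in lborel. 0 <= ?f t"
   using gt by eventually_elim (auto split: split_indicator)
  have "(LBINT t. ?f t) = (LBINT t. indicator {ta<..<tb} t * sA t) - (tb - ta) * c"
   unfolding right_diff_distrib using ii[OF isA(1)] ic by simp
  also have "(LBINT t. indicator {ta<..<tb} t * sA t) <= (LBINT t. sA t)"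
   by (rule integral_mono[OF ii[OF isA(1)] isA(1)]) (simp add: sA0 split: split_indicator)
  also have "... - (tb - ta) * c = 0" using ts isA by (simp add: c_def)
  finally have "(LBINT t. ?f t) <= 0" by simp
  then have "(LBINT t. ?f t) = 0" using integral_nonneg_AE[OF nn] by simp
  then have "AE t in lborel. ?f t = 0" using integral_nonneg_eq_0_iff_AE[OF fi nn] by simp
  then have "AE t in lborel. t \<notin> {ta<..<tb}"
   using gt by eventually_elim (auto split: split_indicator_asm)
  then have "{ta<..<tb} \<in> null_sets lborel" by (simp add: AE_iff_null_sets)
  then show False using ts by (auto simp: null_sets_def)
 qed
 then obtain \<alpha> where \<alpha>: "\<alpha> \<in> T" "ta < \<alpha>" "\<alpha> < tb" "(tb - ta) * sA \<alpha> <= measure lborel A0" by blast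
 have E\<alpha>: "En \<alpha> <= M powr (1 + m) * measure lborel A0 / (tb - ta)"
 proof -
  have "En \<alpha> <= M powr (1 + m) * sA \<alpha>" using En_upper(1)[OF k(4,1), of \<alpha>] sA[of \<alpha>] \<alpha> ts by simp
  also have "... <= M powr (1 + m) * (measure lborel A0 / (tb - ta))"
   using \<alpha>(4) ts by (intro mult_left_mono) (simp_all add: pos_le_divide_eq mult.commute)
  finally show ?thesis by simp
 qed
 have i\<phi>: "integrable lborel (\<lambda>z. indicator A0 z * \<phi>2 z)"
  using integrable_mult_indicator[OF _ \<phi>2_int, of A0] by simp
 have main: "En \<beta> + \<nu> / 2 * (LBINT z. indicator {\<alpha><..<\<beta>} (snd z) * (w z * \<gamma>2 z)) <= E0"
  if \<beta>: "\<beta> \<in> T" "tb < \<beta>" for \<beta>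
 proof -
  have \<beta>2: "\<beta> < t2" using \<beta> T_sub by auto
  have "(LBINT z. indicator {\<alpha><..<\<beta>} (snd z) * (\<zeta> z * (C1 * \<Lambda> * K1 + (C2 * \<Lambda>^2 * K2 + C3) * \<phi>2 z))) <=
   (LBINT z. C1 * \<Lambda> * K1 * indicator A0 z + (C2 * \<Lambda>^2 * K2 + C3) * (indicator A0 z * \<phi>2 z))"
  proof (rule integral_mono_AE')
   show "integrable lborel (\<lambda>z. C1 * \<Lambda> * K1 * indicator A0 z + (C2 * \<Lambda>^2 * K2 + C3) * (indicator A0 z * \<phi>2 z))"
    using iA i\<phi> by simp
   have p: "0 <= C1 * \<Lambda> * K1" "0 <= (C2 * \<Lambda>^2 * K2 + C3) * \<phi>2 z" for z
    using C_pos \<Lambda>_pos K \<phi>2_nonneg[of z] by simp_all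
   have "indicator {\<alpha><..<\<beta>} (snd z) * \<zeta> z <= indicator A0 z" for z
    using \<alpha> \<beta>2 level_iff[OF k(4,1)] by (auto simp: \<zeta>_def A_def split: split_indicator)
   then have "(indicator {\<alpha><..<\<beta>} (snd z) * \<zeta> z) * (C1 * \<Lambda> * K1 + (C2 * \<Lambda>^2 * K2 + C3) * \<phi>2 z) <=
     indicator A0 z * (C1 * \<Lambda> * K1 + (C2 * \<Lambda>^2 * K2 + C3) * \<phi>2 z)" for z
    using p by (intro mult_right_mono add_nonneg_nonneg) auto
   then show "AE z in lborel. indicator {\<alpha><..<\<beta>} (snd z) * (\<zeta> z * (C1 * \<Lambda> * K1 + (C2 * \<Lambda>^2 * K2 + C3) * \<phi>2 z)) <=
     C1 * \<Lambda> * K1 * indicator A0 z + (C2 * \<Lambda>^2 * K2 + C3) * (indicator A0 z * \<phi>2 z)"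
    by (intro AE_I2) (simp add: distrib_left mult_ac)
   show "AE z in lborel. 0 <= C1 * \<Lambda> * K1 * indicator A0 z + (C2 * \<Lambda>^2 * K2 + C3) * (indicator A0 z * \<phi>2 z)"
    using p by (intro AE_I2) (simp split: split_indicator)
  qed
  also have "... = C1 * \<Lambda> * K1 * measure lborel A0 + (C2 * \<Lambda>^2 * K2 + C3) * (LBINT z. indicator A0 z * \<phi>2 z)"
   using iA i\<phi> by simp
  finally show ?thesis using energy_estimate(1)[OF \<alpha>(1) \<beta>(1)] \<alpha>(3) \<beta>(2) E\<alpha> E0 by linarith
 qed
 have En0: "En t \<ge> 0" for t
  unfolding En_def by (rule bochner_nonneg) (simp add: cut_bounds Psi_nonneg)
 have w\<gamma>0: "0 <= (LBINT z. indicator {\<alpha><..<\<beta>} (snd z) * (w z * \<gamma>2 z))" for \<beta>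
  by (rule bochner_nonneg) (simp add: w_bounds \<gamma>2_nonneg)
 show "exp (- 2) * ((k2 - k1) * k1 powr m) * measure lborel {x. norm (x - x0) < r \<and> k2 < S (x, \<beta>)} <= E0"
  if \<beta>: "\<beta> \<in> T" "tb < \<beta>" for \<beta>
 proof -
  have "0 <= \<nu> / 2 * (LBINT z. indicator {\<alpha><..<\<beta>} (snd z) * (w z * \<gamma>2 z))" using w\<gamma>0 \<nu> by simp
  then show ?thesis using main[OF \<beta>] En_lower[of k1 k2 r \<beta>] k r by linarith
 qed
 let ?Y = "{z. norm (fst z - x0) < r \<and> tb < snd z \<and> snd z < t2 \<and> k1 < S z}"
 have [measurable]: "?Y \<in> sets borel" by measurable
 \<comment> \<open>Cutoff and truncation are both at least exp(-1) on \<open>?Y\<close>; this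
   produces the factor \<open>exp 2\<close> of the claim.\<close>
 have wY: "exp (- 2) * indicator {z \<in> ?Y. snd z < \<beta>} z <= indicator {\<alpha><..<\<beta>} (snd z) * w z" for z \<beta>
 proof (cases "z \<in> ?Y \<and> snd z < \<beta>")
  case True
  have c: "cutoff x0 R b (fst z) \<ge> exp (- 1)" using True by (intro cut_ge[OF r b0]) auto
  have "k1 powr (2 * m) <= S z powr (2 * m)" using True k m by (intro powr_mono2) auto
  then have l: "lev \<kappa> \<Delta> (sqn k V z) \<ge> exp (- 1)"
   unfolding sqn_V using k(5) by (intro lev_ge[OF \<Delta>]) simp
  have "exp (- 1) * exp (- 1) <= w z" unfolding w_def by (intro mult_mono c l cut_bounds) simp
  then show ?thesis using True \<alpha> by (simp flip: exp_add)
 next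
  case False
  then have "indicator {z \<in> ?Y. snd z < \<beta>} z = (0 :: real)" by auto
  then show ?thesis using w_bounds by simp
 qed
 have i\<gamma>: "integrable lborel (\<lambda>z. indicator Z z * \<gamma>2 z)" if "Z \<in> sets borel" for Z
  using integrable_mult_indicator[OF _ \<gamma>2_int, of Z] that by simp
 have bd: "(LBINT z. indicator {z \<in> ?Y. snd z < \<beta>} z * \<gamma>2 z) <= 2 / \<nu> * exp 2 * E0"
  if \<beta>: "\<beta> \<in> T" "tb < \<beta>" for \<beta>
 proof -
  have [measurable]: "{z \<in> ?Y. snd z < \<beta>} \<in> sets borel" by measurable
  have "exp (- 2) * (LBINT z. indicator {z \<in> ?Y. snd z < \<beta>} z * \<gamma>2 z) =
    (LBINT z. exp (- 2) * indicator {z \<in> ?Y. snd z < \<beta>} z * \<gamma>2 z)" by (simp add: mult.assoc)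
  also have "... <= (LBINT z. indicator {\<alpha><..<\<beta>} (snd z) * (w z * \<gamma>2 z))"
  proof (rule integral_mono)
   show "integrable lborel (\<lambda>z. exp (- 2) * indicator {z \<in> ?Y. snd z < \<beta>} z * \<gamma>2 z)"
    using i\<gamma>[of "{z \<in> ?Y. snd z < \<beta>}"] by (simp add: mult.assoc)
   show "integrable lborel (\<lambda>z. indicator {\<alpha><..<\<beta>} (snd z) * (w z * \<gamma>2 z))"
    using energy_estimate(2)[OF \<alpha>(1) \<beta>(1)] \<alpha> \<beta> by simp
   show "exp (- 2) * indicator {z \<in> ?Y. snd z < \<beta>} z * \<gamma>2 z <= indicator {\<alpha><..<\<beta>} (snd z) * (w z * \<gamma>2 z)" for z
    using mult_right_mono[OF wY[of \<beta> z] \<gamma>2_nonneg[of z]] by (simp add: mult.assoc)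
  qed
  also have "... <= 2 / \<nu> * E0"
   using main[OF \<beta>] En0[of \<beta>] \<nu> by (simp add: field_simps)
  finally have "exp 2 * (exp (- 2) * (LBINT z. indicator {z \<in> ?Y. snd z < \<beta>} z * \<gamma>2 z)) <= exp 2 * (2 / \<nu> * E0)"
   by (rule mult_left_mono) simp
  moreover have "exp 2 * (exp (- 2) * y) = y" for y :: real by (simp add: exp_minus)
  moreover have "exp 2 * (2 / \<nu> * E0) = 2 / \<nu> * exp 2 * E0" by simp
  ultimately show ?thesis by (simp only:)
 qed
 \<comment> \<open>Good times lie strictly before t2, so the gradient estimate up to t2 is the limit
   of those up to good times \<beta> n tending to t2.\<close>
 have ex\<beta>: "\<exists>\<beta>. \<beta> \<in> T \<and> max tb (t2 - 1 / (real n + 1)) < \<beta>" for n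
 proof (rule ccontr)
  assume no: "\<not> ?thesis"
  define p where "p = max tb (t2 - 1 / (real n + 1))"
  have "0 < 1 / (real n + 1)" by simp
  then have p: "p < t2" "t1 <= p" "tb <= p" using ts unfolding p_def by linarith+
  have "AE t in lborel. t \<notin> {p<..<t2}"
   using T_full
  proof eventually_elim
   case (elim t)
   show ?case
   proof
    assume t: "t \<in> {p<..<t2}"
    then have "t \<in> T" using elim p by auto
    then show False using no t unfolding p_def[symmetric] by auto
   qed
  qed
  then have "{p<..<t2} \<in> null_sets lborel" by (simp add: AE_iff_null_sets)
  then show False using p by (auto simp: null_sets_def)
 qed
 from choice[OF allI[OF ex\<beta>]] obtain \<beta> where
  "\<forall>n. \<beta> n \<in> T \<and> max tb (t2 - 1 / (real n + 1)) < \<beta> n" ..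
 then have \<beta>: "\<beta> n \<in> T" "max tb (t2 - 1 / (real n + 1)) < \<beta> n" for n by auto
 have "(\<lambda>n. LBINT z. indicator {z \<in> ?Y. snd z < \<beta> n} z * \<gamma>2 z) \<longlonglongrightarrow> (LBINT z. indicator ?Y z * \<gamma>2 z)"
 proof (rule integral_dominated_convergence[OF _ _ \<gamma>2_int])
  show "AE z in lborel. (\<lambda>n. indicator {z \<in> ?Y. snd z < \<beta> n} z * \<gamma>2 z) \<longlonglongrightarrow> indicator ?Y z * \<gamma>2 z"
  proof (rule AE_I2)
   fix z
   have "\<forall>\<^sub>F n in sequentially. indicator {z \<in> ?Y. snd z < \<beta> n} z * \<gamma>2 z = indicator ?Y z * \<gamma>2 z"
   proof (cases "snd z < t2")
    case True
    then obtain n0 :: nat where n0: "1 / (real n0 + 1) < t2 - snd z"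
     using reals_Archimedean[of "t2 - snd z"] by (auto simp: inverse_eq_divide add.commute)
    have "indicator {z \<in> ?Y. snd z < \<beta> n} z * \<gamma>2 z = indicator ?Y z * \<gamma>2 z" if "n \<ge> n0" for n
    proof -
     have "1 / (real n + 1) <= 1 / (real n0 + 1)" using that by (intro divide_left_mono) auto
     then have "snd z < \<beta> n" using n0 \<beta>(2)[of n] by simp
     then show ?thesis by (auto split: split_indicator)
    qed
    then show ?thesis by (auto simp: eventually_sequentially)
   next
    case False
    then show ?thesis by (auto split: split_indicator)
   qed
   then show "(\<lambda>n. indicator {z \<in> ?Y. snd z < \<beta> n} z * \<gamma>2 z) \<longlonglongrightarrow> indicator ?Y z * \<gamma>2 z"
    by (rule tendsto_eventually)
  qed
  show "AE z in lborel. norm (indicator {z \<in> ?Y. snd z < \<beta> n} z * \<gamma>2 z) <= \<gamma>2 z" for n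
   using \<gamma>2_nonneg by (intro AE_I2) (auto split: split_indicator)
  show "(\<lambda>z. indicator {z \<in> ?Y. snd z < \<beta> n} z * \<gamma>2 z) \<in> borel_measurable lborel" for n by measurable
  show "(\<lambda>z. indicator ?Y z * \<gamma>2 z) \<in> borel_measurable lborel" by measurable
 qed
 then show "(LBINT z. indicator ?Y z * \<gamma>2 z) <= 2 / \<nu> * exp 2 * E0"
  by (rule LIMSEQ_le_const2) (use bd \<beta> in auto)
qed

end

section \<open>The De Giorgi iteration\<close>

context energy_setup
begin

text \<open>On each good slice the support of w has measure at most s, so \<open>faber_krahn\<close>
  applies with one radius l for all of them. Integration over time compares the smaller superlevel
  set, on which w >= exp(-2), with the gradient of w.\<close>

lemma fk_slab:
 assumes ts: "t1 <= tb" "tb < t2" and r: "b * (R^2 - r^2) \<ge> 1"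
  and k: "0 <= k2" "k2 < k3" "\<kappa> = k2 powr (2 * m)" "\<kappa> + \<Delta> = k3 powr (2 * m)"
  and s: "\<And>\<beta>. \<beta> \<in> T ==> tb < \<beta> ==> measure lborel {x. norm (x - x0) < R \<and> k2 < S (x, \<beta>)} <= s"
  and l: "l > 0" "2 * s <= measure lborel (ball (0 :: real ^ 'n) l)"
  and A_def: "A2 = {z. norm (fst z - x0) < R \<and> tb < snd z \<and> snd z < t2 \<and> k2 < S z}"
 shows "exp (- 4) * measure lborel {z. norm (fst z - x0) < r \<and> tb < snd z \<and> snd z < t2 \<and> k3 < S z} <=
  2 * l^2 * (2 * K1 * measure lborel A2 + 8 * \<Lambda> * K2 * (LBINT z. indicator A2 z * \<gamma>2 z))"
proof -
 have [measurable]: "A2 \<in> sets borel" unfolding A_def by measurable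
 have iA: "integrable lborel (indicator A2 :: _ => real)"
  by (rule finite_measure_Q) (use S_pos_Q[OF k(1)] in \<open>auto simp: A_def\<close>)
 have K: "K1 \<ge> 0" "K2 \<ge> 0" by (simp_all add: K1_def K2_def)
 define D where "D z = lev \<kappa> \<Delta> (sqn k V z) *\<^sub>R Dcutoff x0 R b (fst z) +
  (2 * cutoff x0 R b (fst z) * Dlev \<kappa> \<Delta> (sqn k V z)) *\<^sub>R (\<Sum>j<k. V j z *\<^sub>R G j z)" for z
 have [measurable]: "D \<in> borel_measurable borel" unfolding D_def by measurable
 have D_DW: "D (x, t) = DW k x0 R b \<kappa> \<Delta> (\<lambda>i x. V i (x, t)) (\<lambda>i x. G i (x, t)) x" for x t
  by (simp add: D_def DW_def sqn_section)
 let ?c = "\<lambda>z. 2 * K1 + 8 * \<Lambda> * K2 * \<gamma>2 z"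
 have c0: "0 <= ?c z" for z using K \<Lambda>_pos \<gamma>2_nonneg[of z] by simp
 have D_bound: "(norm (D z))^2 <= indicator A2 z * ?c z" if z: "tb < snd z" "snd z < t2" for z
 proof (cases "z \<in> A2")
  case False
  then have "\<not> (norm (fst z - x0) < R \<and> \<kappa> < sqn k V z)" using z level_iff[OF k(3,1)] by (auto simp: A_def)
  then have "D z = 0"
   using cut_zero[OF b0 R0, of "fst z" x0] lev_zero[OF \<Delta>, of "sqn k V z" \<kappa>]
   by (cases "norm (fst z - x0) < R") (auto simp: D_def)
  then show ?thesis using False by simp
 next
  case True
  let ?g = "\<Sum>j<k. V j z *\<^sub>R G j z"
  let ?l = "lev \<kappa> \<Delta> (sqn k V z)" and ?dl = "Dlev \<kappa> \<Delta> (sqn k V z)" and ?cu = "cutoff x0 R b (fst z)"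
  have g: "(norm ?g)^2 <= \<Lambda> * \<gamma>2 z"
   using sqn_V_le[of z] \<Lambda>_pos
   by (intro order_trans[OF norm_sum_scaleR_sq] mult_mono) (simp_all add: \<gamma>2_def sqn_def sum_nonneg)
  have "(norm (D z))^2 <= (norm (?l *\<^sub>R Dcutoff x0 R b (fst z)) + norm ((2 * ?cu * ?dl) *\<^sub>R ?g))^2"
   unfolding D_def by (intro power_mono norm_triangle_ineq) simp
  also have "... <= 2 * (norm (?l *\<^sub>R Dcutoff x0 R b (fst z)))^2 + 2 * (norm ((2 * ?cu * ?dl) *\<^sub>R ?g))^2"
   by (rule sq_add_le)
  also have "(norm (?l *\<^sub>R Dcutoff x0 R b (fst z)))^2 <= K1"
  proof -
   have "(norm (?l *\<^sub>R Dcutoff x0 R b (fst z)))^2 = ?l^2 * (norm (Dcutoff x0 R b (fst z)))^2"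
    by (simp add: power_mult_distrib)
   also have "... <= 1 * (K1 * 1)"
   proof (rule mult_mono)
    show "?l^2 <= 1" using lev_bounds[of \<kappa> \<Delta> "sqn k V z"] by (simp add: power_le_one)
    have "K1 * ?cu <= K1 * 1" using K cut_bounds by (intro mult_left_mono)
    then show "(norm (Dcutoff x0 R b (fst z)))^2 <= K1 * 1"
     using Dcut_sq[OF b0 R0, of x0 "fst z"] unfolding K1_def by linarith
   qed simp_all
   finally show ?thesis by simp
  qed
  also have "(norm ((2 * ?cu * ?dl) *\<^sub>R ?g))^2 <= 4 * K2 * (\<Lambda> * \<gamma>2 z)"
  proof -
   have "(norm ((2 * ?cu * ?dl) *\<^sub>R ?g))^2 = 4 * (?cu^2 * ?dl^2) * (norm ?g)^2"
    by (simp add: power_mult_distrib)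
   also have "... <= 4 * (1 * K2) * (\<Lambda> * \<gamma>2 z)"
   proof (intro mult_mono g mult_left_mono)
    show "?cu^2 <= 1" using cut_bounds[of x0 R b "fst z"] by (simp add: power_le_one)
    have "K2 * ?l <= K2 * 1" using K lev_bounds by (intro mult_left_mono)
    then show "?dl^2 <= K2" using Dlev_sq[OF \<Delta>, of \<kappa> "sqn k V z"] unfolding K2_def by linarith
   qed (use K in simp_all)
   finally show ?thesis by simp
  qed
  finally show ?thesis using True by (simp add: mult_ac)
 qed
 let ?N = "{z. norm (fst z - x0) < r \<and> tb < snd z \<and> snd z < t2 \<and> k3 < S z}"
 have [measurable]: "?N \<in> sets borel" by measurable
 have iN: "integrable lborel (indicator ?N :: _ => real)"
  by (rule finite_measure_Q) (use S_pos_Q[of k3] k in auto)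
 have wN: "exp (- 4) * indicator ?N z <= indicator {tb<..<t2} (snd z) * (w z)\<^sup>2" for z
 proof (cases "z \<in> ?N")
  case True
  have c: "cutoff x0 R b (fst z) \<ge> exp (- 1)" using True by (intro cut_ge[OF r b0]) auto
  have "k3 powr (2 * m) <= S z powr (2 * m)" using True k m by (intro powr_mono2) auto
  then have l: "lev \<kappa> \<Delta> (sqn k V z) \<ge> exp (- 1)"
   unfolding sqn_V using k(4) by (intro lev_ge[OF \<Delta>]) simp
  have "exp (- 1) * exp (- 1) <= w z" unfolding w_def by (intro mult_mono c l cut_bounds) simp
  then have "(exp (- 1) * exp (- 1))\<^sup>2 <= (w z)\<^sup>2" by (rule power_mono) simp
  moreover have "(exp (- 1) * exp (- 1))\<^sup>2 = exp (- 4 :: real)"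
   by (simp add: power2_eq_square flip: exp_add)
  ultimately show ?thesis using True by simp
 qed simp
 have sl: "(NNI x. ennreal ((w (x, t))^2)) <= ennreal (2 * l^2) * (NNI x. ennreal (indicator A2 (x, t) * ?c (x, t)))"
  if t: "t \<in> T" "tb < t" for t
 proof -
  interpret sl: slice k x0 \<rho> "M powr m" "\<lambda>i x. V i (x, t)" "\<lambda>i x. G i (x, t)" by (rule slice_at[OF t(1)])
  have t2: "t < t2" using t T_sub by auto
  have "(NNI x. ennreal ((w (x, t))^2)) <= ennreal (2 * l^2) * (NNI x. ennreal ((norm (D (x, t)))^2))"
  proof (rule faber_krahn[where a=s])
   show "(NNI x. ennreal ((w (x + y, t) - w (x, t))^2)) <=
     ennreal ((norm y)^2) * (NNI x. ennreal ((norm (D (x, t)))^2))" for y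
    unfolding w_W D_DW by (rule sl.translation_W[OF R b0 \<Delta>])
   let ?X = "{x. norm (x - x0) < R \<and> k2 < S (x, t)}"
   have [measurable]: "?X \<in> sets borel" by measurable
   have "{x. w (x, t) \<noteq> 0} \<subseteq> ?X"
   proof
    fix x assume "x \<in> {x. w (x, t) \<noteq> 0}"
    then have "\<zeta> (x, t) \<noteq> 0" using \<zeta>_zero(1) by auto
    then show "x \<in> ?X" using level_iff[OF k(3,1)] by (auto simp: \<zeta>_def split: if_splits)
   qed
   then have "emeasure lborel {x. w (x, t) \<noteq> 0} <= emeasure lborel ?X" by (rule emeasure_mono) simp
   also have "... = ennreal (measure lborel ?X)"
   proof (rule emeasure_eq_ennreal_measure)
    have "?X \<subseteq> ball x0 R" by (auto simp: dist_norm norm_minus_commute)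
    then have "bounded ?X" by (rule bounded_subset[OF bounded_ball])
    then show "emeasure lborel ?X \<noteq> top" using emeasure_bounded_finite[of ?X] by simp
   qed
   also have "... <= ennreal s" by (intro ennreal_leI s t)
   finally show "emeasure lborel {x. w (x, t) \<noteq> 0} <= ennreal s" .
  qed (use l in \<open>auto\<close>)
  also have "(NNI x. ennreal ((norm (D (x, t)))^2)) <= (NNI x. ennreal (indicator A2 (x, t) * ?c (x, t)))"
   using t t2 by (intro nn_integral_mono ennreal_leI D_bound) simp_all
  finally show ?thesis by (simp add: mult_left_mono)
 qed
 have ic: "integrable lborel (\<lambda>z. indicator A2 z * ?c z)"
 proof -
  have "integrable lborel (\<lambda>z. indicator A2 z * \<gamma>2 z)"
   using integrable_mult_indicator[OF _ \<gamma>2_int, of A2] by simp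
  then have "integrable lborel (\<lambda>z. 2 * K1 * indicator A2 z + 8 * \<Lambda> * K2 * (indicator A2 z * \<gamma>2 z))"
   using iA by simp
  then show ?thesis
   by (rule Bochner_Integration.integrable_cong[THEN iffD1, OF refl, rotated]) (simp add: distrib_left mult_ac)
 qed
 have "ennreal (exp (- 4) * measure lborel ?N) = (NNI z. ennreal (exp (- 4) * indicator ?N z))"
  using iN by (subst nn_integral_eq_integral) auto
 also have "... <= (NNI z. ennreal (indicator {tb<..<t2} (snd z) * (w z)^2))"
  by (intro nn_integral_mono ennreal_leI wN)
 also have "... = (NNI t. (NNI x. ennreal (indicator {tb<..<t2} t * (w (x, t))^2)))"
  by (subst nn_integral_lborel_prod(1)) simp_all
 also have "... <= (NNI t. ennreal (2 * l^2) * (NNI x. ennreal (indicator A2 (x, t) * ?c (x, t))))"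
 proof (rule nn_integral_mono_AE)
  show "AE t in lborel. (NNI x. ennreal (indicator {tb<..<t2} t * (w (x, t))^2)) <=
    ennreal (2 * l^2) * (NNI x. ennreal (indicator A2 (x, t) * ?c (x, t)))"
   using T_full
  proof eventually_elim
   case (elim t)
   show ?case
   proof (cases "t \<in> {tb<..<t2}")
    case True
    then have "t \<in> T" "tb < t" using elim ts by auto
    from sl[OF this] show ?thesis using True by simp
   qed simp
  qed
 qed
 also have "... = ennreal (2 * l^2) * (NNI t. (NNI x. ennreal (indicator A2 (x, t) * ?c (x, t))))"
  by (rule nn_integral_cmult) measurable
 also have "(NNI t. (NNI x. ennreal (indicator A2 (x, t) * ?c (x, t)))) =
   (NNI z. ennreal (indicator A2 z * ?c z))"
  by (rule nn_integral_lborel_prod(1)[symmetric]) measurable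
 also have "... = ennreal (LBINT z. indicator A2 z * ?c z)"
  by (rule nn_integral_eq_integral[OF ic]) (simp add: c0)
 also have "ennreal (2 * l^2) * ... = ennreal (2 * l^2 * (LBINT z. indicator A2 z * ?c z))"
  by (rule ennreal_mult[symmetric]) (auto intro!: bochner_nonneg simp: c0)
 finally have "exp (- 4) * measure lborel ?N <= 2 * l\<^sup>2 * (LBINT z. indicator A2 z * ?c z)"
  by (subst (asm) ennreal_le_iff) (auto intro!: mult_nonneg_nonneg bochner_nonneg simp: c0)
 also have "(LBINT z. indicator A2 z * ?c z) =
   (LBINT z. 2 * K1 * indicator A2 z + 8 * \<Lambda> * K2 * (indicator A2 z * \<gamma>2 z))"
  by (rule bochner_cong) (simp_all add: distrib_left mult_ac)
 also have "... = 2 * K1 * measure lborel A2 + 8 * \<Lambda> * K2 * (LBINT z. indicator A2 z * \<gamma>2 z)"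
  using iA integrable_mult_indicator[OF _ \<gamma>2_int, of A2] by simp
 finally show ?thesis .
qed

end

context local_solution
begin

text \<open>One step of the iteration: the energy estimate between the levels \<open>k0 < k1 < k2\<close> bounds the
 superlevel sets and the gradient, the Faber--Krahn inequality is applied between \<open>k2 < k3\<close>.\<close>

lemma de_giorgi_step:
 assumes radii: "0 < r" "r < R'" "R' < R" "R < \<rho>" and ts: "t1 <= ta" "ta < tb" "tb < t2"
  and b: "b > 0" "b * (R^2 - R'^2) \<ge> 1" "b * (R'^2 - r^2) \<ge> 1"
  and k: "0 <= k0" "k0 < k1" "k1 < k2" "k2 < k3"
  and K1: "K1 = 96 * b^2 * R^2" and K2: "K2 = 24 / (k1 powr (2 * m) - k0 powr (2 * m))^2"
  and K3: "K3 = 24 / (k3 powr (2 * m) - k2 powr (2 * m))^2"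
  and A_def: "A0 = {z. norm (fst z - x0) < R \<and> ta < snd z \<and> snd z < t2 \<and> k0 < S z}"
  and E0: "M powr (1 + m) * measure lborel A0 / (tb - ta) + C1 * \<Lambda> * K1 * measure lborel A0 +
   (C2 * \<Lambda>^2 * K2 + C3) * (LBINT z. indicator A0 z * \<phi>2 z) <= E0"
  and l: "l > 0" "2 * (exp 2 * E0 / ((k2 - k1) * k1 powr m)) <= measure lborel (ball (0 :: real ^ 'n) l)"
 shows "exp (- 4) * measure lborel {z. norm (fst z - x0) < r \<and> tb < snd z \<and> snd z < t2 \<and> k3 < S z} <=
  2 * l^2 * (2 * K1 * measure lborel A0 + 8 * \<Lambda> * K3 * (2 / \<nu> * exp 2 * E0))"
proof -
 have S_eq: "sqrt (sqn k U z) = S z" for z by (simp add: S_def)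
 have k1: "k1 > 0" using k by simp
 have d1: "k1 powr (2 * m) - k0 powr (2 * m) > 0" using k m by (simp add: powr_less_mono2)
 have d3: "k3 powr (2 * m) - k2 powr (2 * m) > 0" using k m by (simp add: powr_less_mono2)
 \<comment> \<open>Two instances with the same steepness b: the ball of radius R serves the energy
   estimate, the ball of radius R' the Faber--Krahn inequality. The bounds from the first hold
   wherever the second cutoff is nonzero.\<close>
 have e1: "energy_setup k m \<nu> L M \<rho> t1 t2 U G A F T x0 R b (k0 powr (2 * m)) (k1 powr (2 * m) - k0 powr (2 * m))"
  by (intro energy_setup.intro local_solution_axioms energy_setup_axioms.intro) (use radii b d1 in auto)
 have e3: "energy_setup k m \<nu> L M \<rho> t1 t2 U G A F T x0 R' b (k2 powr (2 * m)) (k3 powr (2 * m) - k2 powr (2 * m))"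
  by (intro energy_setup.intro local_solution_axioms energy_setup_axioms.intro) (use radii b d3 in auto)
 have k1k2: "(k2 - k1) * k1 powr m > 0" using k k1 by simp
 have K1': "energy_setup.K1 R b = K1" "energy_setup.K2 (k1 powr (2 * m) - k0 powr (2 * m)) = K2"
  "energy_setup.K2 (k3 powr (2 * m) - k2 powr (2 * m)) = K3"
  unfolding energy_setup.K1_def[OF e1] energy_setup.K2_def[OF e1] energy_setup.K2_def[OF e3] K1 K2 K3 by auto
 note en = energy_setup.energy_sup[OF e1 ts b(2) k(1,2,3) refl, unfolded S_eq K1']
 have eq1: "k0 powr (2 * m) + (k1 powr (2 * m) - k0 powr (2 * m)) = k1 powr (2 * m)" by simp
 have sup: "measure lborel {x. norm (x - x0) < R' \<and> k2 < S (x, \<beta>)} <= exp 2 * E0 / ((k2 - k1) * k1 powr m)"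
  if "\<beta> \<in> T" "tb < \<beta>" for \<beta>
  using en(1)[OF eq1 A_def E0 that] k1k2 by (simp add: exp_minus field_simps)
 let ?Y = "{z. norm (fst z - x0) < R' \<and> tb < snd z \<and> snd z < t2 \<and> k1 < S z}"
 have gr: "(LBINT z. indicator ?Y z * \<gamma>2 z) <= 2 / \<nu> * exp 2 * E0"
  by (rule en(2)[OF eq1 A_def E0])
 define A2 where "A2 = {z. norm (fst z - x0) < R' \<and> tb < snd z \<and> snd z < t2 \<and> k2 < S z}"
 have [measurable]: "A0 \<in> sets borel" "A2 \<in> sets borel" "?Y \<in> sets borel" unfolding A_def A2_def by measurable
 have eq3: "k2 powr (2 * m) + (k3 powr (2 * m) - k2 powr (2 * m)) = k3 powr (2 * m)" by simp
 have k2: "0 <= k2" using k by simp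
 have tb: "t1 <= tb" using ts by simp
 have fk: "exp (- 4) * measure lborel {z. norm (fst z - x0) < r \<and> tb < snd z \<and> snd z < t2 \<and> k3 < S z} <=
  2 * l^2 * (2 * energy_setup.K1 R' b * measure lborel A2 + 8 * \<Lambda> * K3 * (LBINT z. indicator A2 z * \<gamma>2 z))"
  by (rule energy_setup.fk_slab[OF e3 tb ts(3) b(3) k2 k(4) refl eq3, unfolded S_eq K1', OF sup l A2_def])
 have AQ: "A0 \<subseteq> Q"
 proof
  fix z assume "z \<in> A0"
  then have "S z > 0" using k(1) by (simp add: A_def)
  then show "z \<in> Q" using energy_setup.S_outside[OF e1, unfolded S_eq, of z] by force
 qed
 have iA: "integrable lborel (indicator A0 :: _ => real)"
  using energy_setup.finite_measure_Q[OF e1 _ AQ] by simp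
 have sub: "A2 \<subseteq> A0" unfolding A2_def A_def using radii ts k by auto
 have iA2: "integrable lborel (indicator A2 :: _ => real)"
  using energy_setup.finite_measure_Q[OF e1 _ order_trans[OF sub AQ]] by simp
 have m: "measure lborel A2 <= measure lborel A0"
 proof -
  have "(LBINT z. indicator A2 z) <= (LBINT z. indicator A0 z :: real)"
   by (rule integral_mono[OF iA2 iA]) (use sub in \<open>auto split: split_indicator\<close>)
  then show ?thesis by simp
 qed
 have i\<gamma>: "integrable lborel (\<lambda>z. indicator X z * \<gamma>2 z)" if "X \<in> sets borel" for X
  using integrable_mult_indicator[OF _ \<gamma>2_int, of X] that by simp
 have "(LBINT z. indicator A2 z * \<gamma>2 z) <= (LBINT z. indicator ?Y z * \<gamma>2 z)"
  by (rule integral_mono[OF i\<gamma> i\<gamma>]) (use k \<gamma>2_nonneg in \<open>auto simp: A2_def split: split_indicator\<close>)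
 then have gr2: "(LBINT z. indicator A2 z * \<gamma>2 z) <= 2 / \<nu> * exp 2 * E0" using gr by linarith
 have "energy_setup.K1 R' b <= K1"
  unfolding energy_setup.K1_def[OF e3] K1 using radii by (intro mult_left_mono power_mono) auto
 then have h1: "2 * energy_setup.K1 R' b * measure lborel A2 <= 2 * K1 * measure lborel A0"
  using m by (intro mult_mono mult_left_mono) (auto simp: K1)
 have h2: "8 * \<Lambda> * K3 * (LBINT z. indicator A2 z * \<gamma>2 z) <= 8 * \<Lambda> * K3 * (2 / \<nu> * exp 2 * E0)"
  using gr2 \<Lambda>_pos by (intro mult_left_mono) (auto simp: K3)
 have "2 * l^2 * (2 * energy_setup.K1 R' b * measure lborel A2 + 8 * \<Lambda> * K3 * (LBINT z. indicator A2 z * \<gamma>2 z)) <=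
   2 * l^2 * (2 * K1 * measure lborel A0 + 8 * \<Lambda> * K3 * (2 / \<nu> * exp 2 * E0))"
  by (rule mult_left_mono[OF add_mono[OF h1 h2]]) simp
 then show ?thesis using fk by linarith
qed

end

text \<open>By the mean value theorem for s^(2m): since 2m - 1 <= 1 and 1/4 <= z <= 1, one has
  z^(2m-1) >= z >= 1/4. The levels of the iteration stay between M/4 and M/2, which is inside this
  range after division by M.\<close>

lemma powr_diff_lower:
 assumes m: "0 < m" "m < 1" and ab: "1 / 4 <= a" "a < b" "b <= (1::real)"
 shows "m / 2 * (b - a) <= b powr (2 * m) - a powr (2 * m)"
proof -
 have "\<exists>z. z > a \<and> z < b \<and> b powr (2 * m) - a powr (2 * m) = (b - a) * (2 * m * z powr (2 * m - 1))"
  by (rule MVT2) (use ab in \<open>auto intro!: derivative_eq_intros\<close>)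
 then obtain z where z: "a < z" "z < b"
  "b powr (2 * m) - a powr (2 * m) = (b - a) * (2 * m * z powr (2 * m - 1))" by blast
 have "z powr 1 <= z powr (2 * m - 1)" using z ab m by (intro powr_mono') auto
 then have "1 / 4 <= z powr (2 * m - 1)" using z ab by simp
 then have "m / 2 <= 2 * m * z powr (2 * m - 1)" using m by (simp add: field_simps)
 then have "(b - a) * (m / 2) <= (b - a) * (2 * m * z powr (2 * m - 1))" using ab by (intro mult_left_mono) auto
 then show ?thesis using z(3) by (simp add: mult.commute)
qed

text \<open>By induction y_n <= y_0 q^n with q = B^(-1/d): the superlinear power supplies (q^n)^d =
  B^(-n), which cancels the growth B^n, and the smallness of y_0 supplies one more factor q.\<close>

lemma fast_convergence:
 fixes y :: "nat => real"
 assumes C: "C > 0" and B: "B > 1" and d: "d > 0" and y0: "\<And>n. y n \<ge> 0"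
  and rec: "\<And>n. y (Suc n) <= C * B ^ n * y n powr (1 + d)"
  and small: "y 0 <= C powr (- 1 / d) * B powr (- 1 / d\<^sup>2)"
 shows "y \<longlonglongrightarrow> 0"
proof -
 define q where "q = B powr (- 1 / d)"
 have q: "0 < q" "q < 1" using B d by (simp_all add: q_def powr_less_one)
 have s: "C * (y 0 powr d) <= q"
 proof -
  have "y 0 powr d <= (C powr (- 1 / d) * B powr (- 1 / d\<^sup>2)) powr d"
   using small y0 d by (intro powr_mono2) auto
  also have "... = (C powr (- 1 / d)) powr d * (B powr (- 1 / d\<^sup>2)) powr d"
   using C B by (simp add: powr_mult)
  also have "... = C powr (- 1) * q"
   using d by (simp add: powr_powr q_def power2_eq_square)
  finally have "C * (y 0 powr d) <= C * (C powr (- 1) * q)" using C by (intro mult_left_mono) auto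
  moreover have "C * (C powr (- 1) * q) = q" using C by (simp add: powr_minus)
  ultimately show ?thesis by simp
 qed
 have bd: "y n <= y 0 * q ^ n" for n
 proof (induction n)
  case (Suc n)
  have qd: "B ^ n * (q ^ n) powr d = 1"
  proof -
   have "(q ^ n) powr d = q powr (real n * d)" using q by (simp add: powr_powr flip: powr_realpow)
   also have "... = B powr (- real n)" using d by (simp add: q_def powr_powr)
   also have "... = 1 / B ^ n" using B by (simp add: powr_minus powr_realpow inverse_eq_divide)
   finally show ?thesis using B by simp
  qed
  have "y (Suc n) <= C * B ^ n * y n powr (1 + d)" by (rule rec)
  also have "... = C * B ^ n * (y n * y n powr d)"
   using y0[of n] by (cases "y n = 0") (simp_all add: powr_add)
  also have "... <= C * B ^ n * ((y 0 * q ^ n) * (y 0 * q ^ n) powr d)"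
   using Suc y0 q C B d by (intro mult_left_mono mult_mono powr_mono2) auto
  also have "(y 0 * q ^ n) powr d = y 0 powr d * (q ^ n) powr d"
   using y0 q by (simp add: powr_mult)
  also have "C * B ^ n * (y 0 * q ^ n * (y 0 powr d * (q ^ n) powr d)) = (y 0 * q ^ n) * (C * y 0 powr d) * (B ^ n * (q ^ n) powr d)"
   by simp
  also have "... <= (y 0 * q ^ n) * q * 1"
   unfolding qd using s y0 q by (intro mult_left_mono mult_right_mono) auto
  finally show ?case by (simp add: mult_ac)
 qed simp
 have "(\<lambda>n. y 0 * q ^ n) \<longlonglongrightarrow> y 0 * 0"
  by (rule tendsto_mult[OF tendsto_const LIMSEQ_power_zero]) (use q in simp)
 then have "(\<lambda>n. y 0 * q ^ n) \<longlonglongrightarrow> 0" by simp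
 then show ?thesis
  by (rule tendsto_sandwich[OF always_eventually always_eventually tendsto_const, rotated 2]) (use y0 bd in blast)+
qed

text \<open>A pointwise form of Hoelder's inequality: above l the power X^p pays for X, below l the
  constant does. The choice of l in \<open>holder_level\<close> recovers the Hoelder
  exponent.\<close>

lemma young_powr:
 fixes X l p :: real
 assumes "X \<ge> 0" "l > 0" "p > 1" shows "X <= l powr (1 - p) * X powr p + l"
proof (cases "X <= l")
 case True
 then show ?thesis using assms by (simp add: add_increasing)
next
 case False
 then have "X powr (1 - p) <= l powr (1 - p)" using assms by (intro powr_mono2') auto
 then have "X powr (1 - p) * X powr p <= l powr (1 - p) * X powr p" by (intro mult_right_mono) auto
 moreover have "X powr (1 - p) * X powr p = X" using False assms by (simp flip: powr_add)
 ultimately show ?thesis using assms by simp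
qed

lemma measure_cylinder:
 fixes x0 :: "real ^ 'n"
 assumes "\<rho> \<ge> 0" "t1 <= t2"
 shows "measure lborel (ball x0 \<rho> \<times> {t1<..<t2}) = measure lborel (ball (0 :: real ^ 'n) 1) * \<rho> ^ CARD('n) * (t2 - t1)"
proof -
 have "emeasure lborel (ball x0 \<rho> \<times> {t1<..<t2}) = emeasure lborel (ball x0 \<rho>) * emeasure lborel {t1<..<t2}"
  by (subst lborel_prod[symmetric]) (simp add: lborel.emeasure_pair_measure_Times)
 then have "measure lborel (ball x0 \<rho> \<times> {t1<..<t2}) = measure lborel (ball x0 \<rho>) * measure lborel {t1<..<t2}"
  by (simp add: measure_def enn2real_mult)
 then show ?thesis using assms by (simp add: content_ball)
qed

section \<open>The recursion for the superlevel sets\<close>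

context local_solution
begin

text \<open>\<open>Ce\<close>, \<open>Cf\<close> and \<open>Cg\<close> are the constants of the
  energy bound E0, of the right-hand side of one step, and of the recursion. They depend on m,
  \<nu>, L and the dimension, but not on k, M, \<rho> or the solution.\<close>

definition Ce where "Ce = 1 + 384 * C1 + 2 * (1536 * C2 / m^2 + C3)"

definition Cf where "Cf = 768 + 8 * 1536 * (2 / \<nu>) * exp 2 / m^2 * Ce"

definition Cg where "Cg = 2 * exp 4 * Cf * (32 * exp 2 * Ce) powr (2 / CARD('n)) * 2 ^ 30"

text \<open>Radius and length shrink from 3/4 to 1/2 of those of Q, while the level rises from M/4
  to M/2. Starting at 3/4 keeps the cutoffs strictly inside Q; levels of at least M/4 keep the
  truncations away from the singularity at zero.\<close>

definition lset :: "nat => ((real ^ 'n) \<times> real) set" where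
 "lset n = {z. norm (fst z - x0) < \<rho> * (1 / 2 + 2 * (1 / 2) ^ (n + 3)) \<and>
  t2 - (t2 - t1) * (1 / 2 + 2 * (1 / 2) ^ (n + 3)) < snd z \<and> snd z < t2 \<and> M * (1 / 2 - 2 * (1 / 2) ^ (n + 3)) < S z}"

lemma Q_measure: "measure lborel Q = measure lborel (ball (0 :: real ^ 'n) 1) * \<rho> ^ CARD('n) * (t2 - t1)"
 using \<rho> t12 by (intro measure_cylinder) auto

lemma Q_pos: "measure lborel Q > 0"
 unfolding Q_measure using \<rho> t12 by simp

lemma Ce_ge: "Ce \<ge> 1"
 using C_pos by (simp add: Ce_def)

lemma Cf_pos: "Cf > 0"
 using Ce_ge m \<nu> unfolding Cf_def by (intro add_pos_nonneg) auto

lemma Cg_pos: "Cg > 0"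
 using Cf_pos Ce_ge unfolding Cg_def by (intro mult_pos_pos) auto

lemma integrable_indicator_sub:
 assumes "X \<subseteq> Q" "X \<in> sets borel" shows "integrable lborel (indicator X :: _ => real)"
proof -
 have "bounded X" by (rule bounded_subset[OF _ assms(1)]) (intro bounded_Times; simp)
 then show ?thesis using assms emeasure_bounded_finite[of X] by (simp add: integrable_indicator_iff)
qed

lemma measure_mono_Q:
 assumes "X \<subseteq> X'" "X' \<subseteq> Q" "X \<in> sets borel" "X' \<in> sets borel"
 shows "measure lborel X <= measure lborel X'"
proof -
 have "X \<subseteq> Q" using assms(1,2) by (rule order_trans)
 then have "(LBINT z. indicator X z) <= (LBINT z. indicator X' z :: real)"
  using assms by (intro integral_mono integrable_indicator_sub) (auto split: split_indicator)
 then show ?thesis using assms by simp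
qed

text \<open>\<open>young_powr\<close> with l = y^(-1/p), where y is the fraction of Q filled by X;
  both terms then become y^(1 - 1/p).\<close>

lemma holder_level:
 assumes p: "p > 1" and \<theta>: "t2 - t1 = M powr (1 - m) * \<rho>^2"
  and Fi: "integrable lborel (\<lambda>z. (\<rho>^2 * \<phi>2 z / \<Lambda>) powr p)"
  and Fb: "(LBINT z. (\<rho>^2 * \<phi>2 z / \<Lambda>) powr p) <= measure lborel Q"
  and X: "X \<in> sets borel" "integrable lborel (indicator X :: _ => real)" and y: "measure lborel X = y * measure lborel Q" "y > 0"
 shows "(LBINT z. indicator X z * \<phi>2 z) <= \<Lambda> / \<rho>^2 * (2 * measure lborel Q * y powr (1 - 1 / p))"
proof -
 define l where "l = y powr (- 1 / p)"
 have l: "l > 0" using y by (simp add: l_def)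
 have l1: "l powr (1 - p) = y powr (1 - 1 / p)"
 proof -
  have "- 1 / p * (1 - p) = 1 - 1 / p" using p by (simp add: field_simps)
  then show ?thesis unfolding l_def powr_powr by simp
 qed
 have l2: "l * y = y powr (1 - 1 / p)"
 proof -
  have "l * y = y powr (- 1 / p) * y powr 1" using y by (simp add: l_def)
  also have "... = y powr (1 - 1 / p)" by (subst powr_add[symmetric]) simp
  finally show ?thesis .
 qed
 let ?X = "\<lambda>z. \<rho>^2 * \<phi>2 z / \<Lambda>"
 have X0: "?X z \<ge> 0" for z using \<phi>2_nonneg[of z] \<Lambda>_pos by simp
 have i1: "integrable lborel (\<lambda>z. indicator X z * ?X z)"
  using integrable_mult_indicator[of X lborel ?X] X \<phi>2_int by simp
 have "(LBINT z. indicator X z * ?X z) <= (LBINT z. l powr (1 - p) * ?X z powr p + l * indicator X z)"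
 proof (rule integral_mono[OF i1])
  show "integrable lborel (\<lambda>z. l powr (1 - p) * ?X z powr p + l * indicator X z)" using Fi X by simp
  show "indicator X z * ?X z <= l powr (1 - p) * ?X z powr p + l * indicator X z" for z
   using young_powr[OF X0[of z] l p] by (simp split: split_indicator)
 qed
 also have "... = l powr (1 - p) * (LBINT z. ?X z powr p) + l * measure lborel X"
  using Fi X by simp
 also have "... <= l powr (1 - p) * measure lborel Q + l * (y * measure lborel Q)"
  unfolding y(1) by (intro add_mono[OF mult_left_mono[OF Fb] order_refl]) simp
 also have "... = 2 * measure lborel Q * y powr (1 - 1 / p)"
  unfolding l1 mult.assoc[symmetric] l2 by simp
 finally have "(LBINT z. indicator X z * ?X z) <= 2 * measure lborel Q * y powr (1 - 1 / p)" .
 then have "\<Lambda> / \<rho>^2 * (LBINT z. indicator X z * ?X z) <= \<Lambda> / \<rho>^2 * (2 * measure lborel Q * y powr (1 - 1 / p))"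
  using \<Lambda>_pos by (intro mult_left_mono) auto
 moreover have eq: "(\<lambda>z. indicator X z * \<phi>2 z) = (\<lambda>z. \<Lambda> / \<rho>^2 * (indicator X z * ?X z))"
  using \<rho> \<Lambda>_pos by (intro ext) simp
 have "(LBINT z. indicator X z * \<phi>2 z) = \<Lambda> / \<rho>^2 * (LBINT z. indicator X z * ?X z)"
  unfolding eq by (rule integral_mult_right_zero)
 ultimately show ?thesis by linarith
qed

text \<open>On an intrinsic cylinder M^(1+m) / (t2 - t1) = \<Lambda> / \<rho>^2, so the parabolic,
  the cutoff and the source terms have one common size and only the fraction y of Q remains. The
  source replaces y by Y = y^(1 - 1/p), and the Faber--Krahn radius contributes Y^(2/N); together
  this is the exponent (1 - 1/p)(1 + 2/N).\<close>

lemma de_giorgi_recursion: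
 assumes p: "p > 1" and \<theta>: "t2 - t1 = M powr (1 - m) * \<rho>^2"
  and Fi: "integrable lborel (\<lambda>z. (\<rho>^2 * \<phi>2 z / \<Lambda>) powr p)"
  and Fb: "(LBINT z. (\<rho>^2 * \<phi>2 z / \<Lambda>) powr p) <= measure lborel Q"
  and n1: "CARD('n) \<ge> 1"
 shows "measure lborel (lset (Suc n)) / measure lborel Q <=
  Cg * 1024 ^ n * (measure lborel (lset n) / measure lborel Q) powr ((1 - 1 / p) * (1 + 2 / CARD('n)))"
proof -
 define g :: real where "g = (1 / 2) ^ (n + 3)"
 have g: "0 < g" "g <= 1 / 8"
  using power_decreasing[of 3 "n + 3" "1/2 :: real"] by (simp_all add: g_def power_divide)
 have gS: "(1 / 2) ^ (Suc n + 3) = g / 2" unfolding g_def add_Suc power_Suc by simp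
 define N where "N = real CARD('n)"
 have N: "N \<ge> 1" using n1 by (simp add: N_def)
 define q where "q = measure lborel Q"
 have q: "q > 0" using Q_pos by (simp add: q_def)
 define y where "y = measure lborel (lset n) / q"
 define Y where "Y = y powr (1 - 1 / p)"
 have lsQ: "lset i \<subseteq> Q" for i
 proof
  fix z assume "z \<in> lset i"
  then have "M * (1 / 2 - 2 * (1 / 2) ^ (i + 3)) < S z" by (simp add: lset_def)
  moreover have "(1 / 2) ^ (i + 3) <= (1 / 8 :: real)"
   using power_decreasing[of 3 "i + 3" "1/2 :: real"] by (simp add: power_divide)
  then have "0 <= M * (1 / 2 - 2 * (1 / 2) ^ (i + 3))" using M by simp
  ultimately have "S z > 0" by linarith
  moreover have "S z = 0" if "z \<notin> Q"
   using outside[of z] that unfolding S_def sqn_def by simp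
  ultimately show "z \<in> Q" by (cases "z \<in> Q") auto
 qed
 have lsm[measurable]: "lset i \<in> sets borel" for i unfolding lset_def by measurable
 note lsi = integrable_indicator_sub[OF lsQ lsm]
 have y01: "0 <= y" "y <= 1" using measure_mono_Q[OF lsQ order_refl lsm Q_meas] q by (simp_all add: y_def q_def)
 have sub: "lset (Suc n) \<subseteq> lset n"
 proof
  fix z assume z: "z \<in> lset (Suc n)"
  have "\<rho> * (1 / 2 + 2 * (g / 2)) <= \<rho> * (1 / 2 + 2 * g)" "(t2 - t1) * (1 / 2 + 2 * (g / 2)) <= (t2 - t1) * (1 / 2 + 2 * g)"
   "M * (1 / 2 - 2 * g) <= M * (1 / 2 - 2 * (g / 2))"
   using \<rho> t12 M g by (intro mult_left_mono; simp)+
  then show "z \<in> lset n" using z unfolding lset_def gS by (simp add: g_def[symmetric])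
 qed
 show ?thesis
 \<comment> \<open>\<open>holder_level\<close> works with a negative power of y and requires y >
   0.\<close>
 proof (cases "y = 0")
  case True
  then have "measure lborel (lset (Suc n)) <= 0" using measure_mono_Q[OF sub lsQ lsm lsm] q by (simp add: y_def)
  then have "measure lborel (lset (Suc n)) = 0" by (simp add: measure_le_0_iff)
  then have "measure lborel (lset (Suc n)) / q = 0" by simp
  moreover have "0 <= Cg * 1024 ^ n * y powr ((1 - 1 / p) * (1 + 2 / CARD('n)))" using Cg_pos by simp
  ultimately show ?thesis unfolding y_def q_def by linarith
 next
  case False
  then have y: "y > 0" using y01 by simp
  have Y: "Y > 0" "y <= Y" using y y01 p powr_mono'[of "1 - 1 / p" 1 y] by (simp_all add: Y_def)
  have a: "measure lborel (lset n) = y * q" using q by (simp add: y_def)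
  note Ce = Ce_ge
  \<comment> \<open>Radii, times and levels interpolate between \<open>lset n\<close> (offset 2 g)
    and \<open>lset (Suc n)\<close> (offset g). The gaps next to 2 g serve the energy estimate,
    those next to g the Faber--Krahn inequality.\<close>
  define R where "R = \<rho> * (1 / 2 + 2 * g)"
  define R' where "R' = \<rho> * (1 / 2 + 3 / 2 * g)"
  define r where "r = \<rho> * (1 / 2 + g)"
  define ta where "ta = t2 - (t2 - t1) * (1 / 2 + 2 * g)"
  define tb where "tb = t2 - (t2 - t1) * (1 / 2 + g)"
  define k0 where "k0 = M * (1 / 2 - 2 * g)"
  define k1 where "k1 = M * (1 / 2 - 7 / 4 * g)"
  define k2 where "k2 = M * (1 / 2 - 3 / 2 * g)"
  define k3 where "k3 = M * (1 / 2 - g)"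
  \<comment> \<open>Consecutive radii differ by g \<rho> / 2, so their squares differ by at least g
    \<rho>^2 / 2, and this steepness is enough for both cutoffs.\<close>
  define b where "b = 2 / (g * \<rho>^2)"
  define K1 where "K1 = 96 * b^2 * R^2"
  define K2 where "K2 = 24 / (k1 powr (2 * m) - k0 powr (2 * m))^2"
  define K3 where "K3 = 24 / (k3 powr (2 * m) - k2 powr (2 * m))^2"
  define E0 where "E0 = \<Lambda> / \<rho>^2 * (q * Y) * (Ce / g^2)"
  \<comment> \<open>The ball of radius l has exactly the volume that bounds twice the slice measure
    in the first \<open>l2\<close> below.\<close>
  define l where "l = \<rho> * (32 * exp 2 * Ce / g ^ 3 * Y) powr (1 / N)"
  have radii: "0 < r" "r < R'" "R' < R" "R < \<rho>" using \<rho> g by (simp_all add: r_def R'_def R_def)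
  have ts: "t1 <= ta" "ta < tb" "tb < t2"
  proof -
   have "(t2 - t1) * (1 / 2 + 2 * g) <= (t2 - t1) * 1" using t12 g by (intro mult_left_mono) auto
   then show "t1 <= ta" by (simp add: ta_def)
   have "(t2 - t1) * (1 / 2 + g) < (t2 - t1) * (1 / 2 + 2 * g)" using t12 g by (intro mult_strict_left_mono) auto
   then show "ta < tb" by (simp add: ta_def tb_def)
   show "tb < t2" using t12 g by (simp add: tb_def)
  qed
  have b0: "b > 0" using g \<rho> by (simp add: b_def)
  have bR: "b * (R^2 - R'^2) \<ge> 1" "b * (R'^2 - r^2) \<ge> 1"
  proof -
   have "b * (R^2 - R'^2) = 1 + 7 / 2 * g"
    using g \<rho> by (simp add: b_def R_def R'_def power2_eq_square field_simps)
   then show "b * (R^2 - R'^2) \<ge> 1" using g by simp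
   have "b * (R'^2 - r^2) = 1 + 5 / 2 * g"
    using g \<rho> by (simp add: b_def r_def R'_def power2_eq_square field_simps)
   then show "b * (R'^2 - r^2) \<ge> 1" using g by simp
  qed
  have ks: "0 <= k0" "k0 < k1" "k1 < k2" "k2 < k3" using M g by (simp_all add: k0_def k1_def k2_def k3_def)
  have K1b: "K1 <= 384 / (g^2 * \<rho>^2)"
  proof -
   have "R^2 <= \<rho>^2" using radii by (intro power_mono) auto
   then have "K1 <= 96 * b^2 * \<rho>^2" unfolding K1_def by (intro mult_left_mono) auto
   also have "... = 384 / (g^2 * \<rho>^2)" using \<rho> g by (simp add: b_def power2_eq_square field_simps)
   finally show ?thesis .
  qed
  have Mp: "(M * c) powr (2 * m) = \<Lambda> * c powr (2 * m)" if "c \<ge> 0" for c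
   using that M by (simp add: \<Lambda>_def powr_mult)
  \<comment> \<open>Both truncations have a gap of at least g/4 relative to M, which
    \<open>powr_diff_lower\<close> converts into a gap for |v|^2.\<close>
  have kd: "24 / ((M * d) powr (2 * m) - (M * c) powr (2 * m))^2 <= 1536 / (m^2 * g^2 * \<Lambda>^2)"
   if cd: "1 / 4 <= c" "c + g / 4 <= d" "d <= 1" for c d
  proof -
   have "m / 2 * (g / 4) <= m / 2 * (d - c)" using cd m by (intro mult_left_mono) auto
   then have "m * g / 8 <= m / 2 * (d - c)" by simp
   also have "... <= d powr (2 * m) - c powr (2 * m)" using cd m g by (intro powr_diff_lower) auto
   finally have "\<Lambda> * (m * g / 8) <= \<Lambda> * (d powr (2 * m) - c powr (2 * m))" using \<Lambda>_pos by (intro mult_left_mono) auto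
   then have 1: "\<Lambda> * (m * g / 8) <= (M * d) powr (2 * m) - (M * c) powr (2 * m)"
    using cd g by (simp add: Mp right_diff_distrib)
   have 0: "0 < \<Lambda> * (m * g / 8)" using \<Lambda>_pos m g by simp
   have "(\<Lambda> * (m * g / 8))^2 <= ((M * d) powr (2 * m) - (M * c) powr (2 * m))^2" using 1 0 by (intro power_mono) auto
   then have "24 / ((M * d) powr (2 * m) - (M * c) powr (2 * m))^2 <= 24 / (\<Lambda> * (m * g / 8))^2"
    using zero_less_power[OF 0, of 2] zero_less_power[OF less_le_trans[OF 0 1], of 2]
    by (intro divide_left_mono mult_pos_pos) auto
   also have "... = 1536 / (m^2 * g^2 * \<Lambda>^2)" by (simp add: power2_eq_square mult_ac)
   finally show ?thesis .
  qed
  have K2b: "K2 <= 1536 / (m^2 * g^2 * \<Lambda>^2)"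
   unfolding K2_def k1_def k0_def using g by (intro kd) auto
  have K3b: "K3 <= 1536 / (m^2 * g^2 * \<Lambda>^2)"
   unfolding K3_def k3_def k2_def using g by (intro kd) auto
  have K0: "0 <= K1" "0 <= K2" "0 <= K3" by (simp_all add: K1_def K2_def K3_def)
  have lsn: "lset n = {z. norm (fst z - x0) < R \<and> ta < snd z \<and> snd z < t2 \<and> k0 < S z}"
   by (simp add: lset_def R_def ta_def k0_def g_def)
  have M\<theta>: "M powr (1 + m) / (t2 - t1) = \<Lambda> / \<rho>^2"
  proof -
   have "M powr (1 + m) / M powr (1 - m) = \<Lambda>" unfolding \<Lambda>_def by (simp flip: powr_diff)
   then show ?thesis unfolding \<theta> by (metis divide_divide_eq_left)
  qed
  have E0: "M powr (1 + m) * measure lborel (lset n) / (tb - ta) + C1 * \<Lambda> * K1 * measure lborel (lset n) +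
   (C2 * \<Lambda>^2 * K2 + C3) * (LBINT z. indicator (lset n) z * \<phi>2 z) <= E0"
  proof -
   let ?u = "\<Lambda> / \<rho>^2 * (q * Y)"
   have u: "?u > 0" using \<Lambda>_pos \<rho> q Y by simp
   have yu: "\<Lambda> / \<rho>^2 * (y * q) <= ?u" using Y q \<Lambda>_pos by (intro mult_left_mono) auto
   \<comment> \<open>All powers of 1/g are raised to the highest one, which is possible as g <=
     1.\<close>
   have g1: "1 / g <= 1 / g^2" using g by (simp add: power2_eq_square field_simps)
   have g2: "1 <= 1 / g^2" using g power_le_one[of g 2] by (simp add: field_simps)
   have "tb - ta = (t2 - t1) * g" by (simp add: ta_def tb_def algebra_simps)
   then have "M powr (1 + m) * measure lborel (lset n) / (tb - ta) = (M powr (1 + m) / (t2 - t1)) * (y * q) * (1 / g)"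
    by (simp add: a)
   also have "... = \<Lambda> / \<rho>^2 * (y * q) * (1 / g)" unfolding M\<theta> ..
   also have "... <= ?u * (1 / g^2)" by (rule mult_mono[OF yu g1 less_imp_le[OF u]]) (use g in simp)
   finally have e1: "M powr (1 + m) * measure lborel (lset n) / (tb - ta) <= ?u * (1 / g^2)" .
   have "C1 * \<Lambda> * K1 * measure lborel (lset n) <= C1 * \<Lambda> * (384 / (g^2 * \<rho>^2)) * (y * q)"
    unfolding a using K1b C_pos \<Lambda>_pos y01 q by (intro mult_right_mono mult_left_mono) auto
   also have "... = 384 * C1 * (1 / g^2) * (\<Lambda> / \<rho>^2 * (y * q))" by simp
   also have "... <= 384 * C1 * (1 / g^2) * ?u" by (rule mult_left_mono[OF yu]) (use C_pos in simp)
   finally have e2: "C1 * \<Lambda> * K1 * measure lborel (lset n) <= 384 * C1 * (1 / g^2) * ?u" .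
   have F0: "0 <= (LBINT z. indicator (lset n) z * \<phi>2 z)"
    by (rule bochner_nonneg) (simp add: \<phi>2_nonneg)
   have c23: "C2 * \<Lambda>^2 * K2 + C3 <= (1536 * C2 / m^2 + C3) * (1 / g^2)"
   proof -
    have "C2 * \<Lambda>^2 * K2 <= C2 * \<Lambda>^2 * (1536 / (m^2 * g^2 * \<Lambda>^2))" using K2b C_pos by (intro mult_left_mono) auto
    also have "... = 1536 * C2 / m^2 * (1 / g^2)" using \<Lambda>_pos by simp
    finally have "C2 * \<Lambda>^2 * K2 <= 1536 * C2 / m^2 * (1 / g^2)" .
    moreover have "C3 * 1 <= C3 * (1 / g^2)" using g2 C_pos by (intro mult_left_mono) auto
    ultimately show ?thesis unfolding distrib_right[of "1536 * C2 / m^2"] by linarith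
   qed
   have F1: "(LBINT z. indicator (lset n) z * \<phi>2 z) <= \<Lambda> / \<rho>^2 * (2 * q * Y)"
    unfolding q_def Y_def by (rule holder_level[OF p \<theta> Fi Fb lsm lsi _ y]) (simp add: a flip: q_def)
   have "(C2 * \<Lambda>^2 * K2 + C3) * (LBINT z. indicator (lset n) z * \<phi>2 z) <=
     ((1536 * C2 / m^2 + C3) * (1 / g^2)) * (\<Lambda> / \<rho>^2 * (2 * q * Y))"
    using c23 F0 F1 C_pos by (intro mult_mono) auto
   also have "... = 2 * (1536 * C2 / m^2 + C3) * (1 / g^2) * ?u" by simp
   finally have e3: "(C2 * \<Lambda>^2 * K2 + C3) * (LBINT z. indicator (lset n) z * \<phi>2 z) <=
     2 * (1536 * C2 / m^2 + C3) * (1 / g^2) * ?u" .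
   have "E0 = ?u * (1 / g^2) + 384 * C1 * (1 / g^2) * ?u + 2 * (1536 * C2 / m^2 + C3) * (1 / g^2) * ?u"
    unfolding E0_def Ce_def by (simp only: divide_inverse distrib_left distrib_right mult_1_left mult_ac)
   then show ?thesis using e1 e2 e3 by linarith
  qed
  have E0p: "E0 > 0" using \<Lambda>_pos \<rho> q Y Ce g by (simp add: E0_def)
  have l: "l > 0" using \<rho> Ce g Y by (simp add: l_def)
  have l2: "2 * (exp 2 * E0 / ((k2 - k1) * k1 powr m)) <= measure lborel (ball (0 :: real ^ 'n) l)"
  proof -
   define om where "om = measure lborel (ball (0 :: real ^ 'n) 1)"
   have om: "om > 0" by (simp add: om_def)
   have q': "q = om * \<rho> ^ CARD('n) * (t2 - t1)" by (simp add: q_def Q_measure om_def)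
   have "M powr m / 4 <= k1 powr m"
   proof -
    have "(1 / 4) powr 1 <= (1 / 4 :: real) powr m" using m by (intro powr_mono') auto
    then have "M powr m * (1 / 4) <= M powr m * (1 / 4) powr m" by (intro mult_left_mono) auto
    also have "... = (M * (1 / 4)) powr m" by (rule powr_mult[symmetric])
    also have "... <= k1 powr m" unfolding k1_def using M g m by (intro powr_mono2 mult_left_mono) auto
    finally show ?thesis by simp
   qed
   then have "(M * g / 4) * (M powr m / 4) <= (k2 - k1) * k1 powr m"
    using M g ks by (intro mult_mono) (auto simp: k1_def k2_def algebra_simps)
   moreover have "(M * g / 4) * (M powr m / 4) = M powr (1 + m) * (g / 16)"
    using M by (simp add: powr_add)
   ultimately have den: "M powr (1 + m) * (g / 16) <= (k2 - k1) * k1 powr m" by linarith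
   have "2 * (exp 2 * E0 / ((k2 - k1) * k1 powr m)) <= 2 * (exp 2 * E0 / (M powr (1 + m) * (g / 16)))"
   proof -
    have D: "0 < M powr (1 + m) * (g / 16)" using M g by simp
    have "exp 2 * E0 / ((k2 - k1) * k1 powr m) <= exp 2 * E0 / (M powr (1 + m) * (g / 16))"
     by (rule divide_left_mono[OF den _ mult_pos_pos[OF less_le_trans[OF D den] D]]) (use E0p in simp)
    then show ?thesis by simp
   qed
   also have "... = 32 * exp 2 * Ce / g ^ 3 * Y * (\<Lambda> / \<rho>^2 / M powr (1 + m)) * q"
    using g by (simp add: E0_def power2_eq_square power3_eq_cube mult_ac)
   also have "\<Lambda> / \<rho>^2 / M powr (1 + m) = 1 / (t2 - t1)" using M\<theta>[symmetric] M t12 by simp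
   also have "32 * exp 2 * Ce / g ^ 3 * Y * (1 / (t2 - t1)) * q = 32 * exp 2 * Ce / g ^ 3 * Y * (om * \<rho> ^ CARD('n))"
    using t12 unfolding q' by simp
   also have "... = om * l ^ CARD('n)"
   proof -
    define B where "B = 32 * exp 2 * Ce / g ^ 3 * Y"
    have B: "B > 0" using Ce g Y by (simp add: B_def)
    have "(B powr (1 / N)) ^ CARD('n) = (B powr (1 / N)) powr N"
     using B by (simp add: N_def powr_realpow)
    also have "... = B" using B N by (simp add: powr_powr)
    finally have "l ^ CARD('n) = \<rho> ^ CARD('n) * B" unfolding l_def power_mult_distrib B_def by simp
    then show ?thesis unfolding B_def[symmetric] by simp
   qed
   also have "... = measure lborel (ball (0 :: real ^ 'n) l)" using l by (simp add: om_def content_ball)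
   finally show ?thesis .
  qed
  have step: "exp (- 4) * measure lborel {z. norm (fst z - x0) < r \<and> tb < snd z \<and> snd z < t2 \<and> k3 < S z} <=
   2 * l^2 * (2 * K1 * measure lborel (lset n) + 8 * \<Lambda> * K3 * (2 / \<nu> * exp 2 * E0))"
   by (rule de_giorgi_step[OF radii ts b0 bR ks K1_def K2_def K3_def lsn E0 l l2])
  have lsS: "lset (Suc n) = {z. norm (fst z - x0) < r \<and> tb < snd z \<and> snd z < t2 \<and> k3 < S z}"
   unfolding lset_def gS by (simp add: r_def tb_def k3_def)
  have rhs: "2 * K1 * measure lborel (lset n) + 8 * \<Lambda> * K3 * (2 / \<nu> * exp 2 * E0) <= q * Y / \<rho>^2 * (Cf / g ^ 4)"
  proof -
   have g4: "1 / g^2 <= 1 / g ^ 4" using g power_decreasing[of 2 4 g] by (intro divide_left_mono) auto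
   have "2 * K1 * measure lborel (lset n) <= 2 * (384 / (g^2 * \<rho>^2)) * (Y * q)"
    unfolding a using K1b K0 Y y01 q by (intro mult_mono) auto
   also have "... = q * Y / \<rho>^2 * (768 * (1 / g^2))" by (simp add: mult_ac)
   also have "... <= q * Y / \<rho>^2 * (768 * (1 / g ^ 4))" using g4 q Y by (intro mult_left_mono) auto
   finally have 1: "2 * K1 * measure lborel (lset n) <= q * Y / \<rho>^2 * (768 * (1 / g ^ 4))" .
   have "8 * \<Lambda> * K3 * (2 / \<nu> * exp 2 * E0) <= 8 * \<Lambda> * (1536 / (m^2 * g^2 * \<Lambda>^2)) * (2 / \<nu> * exp 2 * E0)"
    using K3b \<Lambda>_pos \<nu> E0p by (intro mult_right_mono mult_left_mono) auto
   also have "... = q * Y / \<rho>^2 * (8 * 1536 * (2 / \<nu>) * exp 2 / m^2 * Ce * (1 / (g^2 * g^2)))"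
    using \<Lambda>_pos by (simp add: E0_def power2_eq_square mult_ac)
   also have "g^2 * g^2 = g ^ 4" by (simp flip: power_add)
   finally have 2: "8 * \<Lambda> * K3 * (2 / \<nu> * exp 2 * E0) <= q * Y / \<rho>^2 * (8 * 1536 * (2 / \<nu>) * exp 2 / m^2 * Ce * (1 / g ^ 4))" .
   have "q * Y / \<rho>^2 * (Cf / g ^ 4) = q * Y / \<rho>^2 * (768 * (1 / g ^ 4)) + q * Y / \<rho>^2 * (8 * 1536 * (2 / \<nu>) * exp 2 / m^2 * Ce * (1 / g ^ 4))"
    unfolding Cf_def by (simp only: divide_inverse distrib_left distrib_right mult_1_left mult_ac)
   then show ?thesis using 1 2 by linarith
  qed
  note Cf = Cf_pos
  have "exp (- 4) * measure lborel (lset (Suc n)) <= 2 * l\<^sup>2 * (q * Y / \<rho>\<^sup>2 * (Cf / g ^ 4))"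
   using step rhs unfolding lsS by (rule_tac order_trans[OF _ mult_left_mono]) auto
  note st = this
  define a where "a = (32 * exp 2 * Ce) powr (2 / N)"
  have l2: "l^2 = \<rho>^2 * (a * (1 / g ^ 3) powr (2 / N) * Y powr (2 / N))"
  proof -
   have "((32 * exp 2 * Ce / g ^ 3 * Y) powr (1 / N))^2 = (32 * exp 2 * Ce / g ^ 3 * Y) powr (2 / N)"
    using Ce g Y by (simp add: power2_eq_square flip: powr_add)
   also have "... = (32 * exp 2 * Ce * (1 / g ^ 3) * Y) powr (2 / N)" by simp
   also have "... = a * (1 / g ^ 3) powr (2 / N) * Y powr (2 / N)"
    unfolding a_def powr_mult ..
   finally show ?thesis by (simp add: l_def power_mult_distrib)
  qed
  \<comment> \<open>As 1 / g^3 >= 1 and N >= 1, the exponent 2/N may be enlarged to 2, which makes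
    the power of g independent of the dimension.\<close>
  have "g ^ 3 <= 1" using g by (simp add: power_le_one)
  then have "(1 / g ^ 3) powr (2 / N) <= (1 / g ^ 3) powr 2"
   using g N by (intro powr_mono) (auto simp: field_simps)
  also have "... = 1 / g ^ 6" using g by (simp add: power_divide flip: power_mult)
  finally have "l^2 <= \<rho>^2 * (a * (1 / g ^ 6) * Y powr (2 / N))"
   unfolding l2 by (intro mult_left_mono mult_right_mono) (simp_all add: a_def)
  then have "2 * l^2 * (q * Y / \<rho>^2 * (Cf / g ^ 4)) <= 2 * (\<rho>^2 * (a * (1 / g ^ 6) * Y powr (2 / N))) * (q * Y / \<rho>^2 * (Cf / g ^ 4))"
   using q Y Cf g by (intro mult_right_mono mult_left_mono) auto
  also have "... = 2 * a * Cf * (1 / g ^ 6 * (1 / g ^ 4)) * (Y * Y powr (2 / N)) * q"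
   using \<rho> by simp
  \<comment> \<open>Since g = 2^(-(n+3)), the power g^(-10) equals 2^30 times 1024^n: this is the
    base of the recursion and the factor 2^30 in \<open>Cg\<close>.\<close>
  also have "1 / g ^ 6 * (1 / g ^ 4) = 2 ^ 30 * 1024 ^ n"
  proof -
   have "1 / g ^ 6 * (1 / g ^ 4) = (1 / g) ^ 10" by (simp add: power_divide flip: power_add)
   also have "1 / g = 2 ^ (n + 3)" by (simp add: g_def power_divide)
   also have "(2 ^ (n + 3)) ^ 10 = (2 :: real) ^ ((n + 3) * 10)" by (rule power_mult[symmetric])
   also have "(n + 3) * 10 = 30 + 10 * n" by simp
   also have "(2 :: real) ^ (30 + 10 * n) = 2 ^ 30 * (2 ^ 10) ^ n" by (simp only: power_add power_mult)
   finally show ?thesis by simp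
  qed
  also have "Y * Y powr (2 / N) = y powr ((1 - 1 / p) * (1 + 2 / N))"
  proof -
   have "Y * Y powr (2 / N) = Y powr (1 + 2 / N)" using Y by (simp add: powr_add)
   then show ?thesis unfolding Y_def powr_powr .
  qed
  finally have "exp (- 4) * measure lborel (lset (Suc n)) <=
    2 * a * Cf * (2 ^ 30 * 1024 ^ n) * y powr ((1 - 1 / p) * (1 + 2 / N)) * q"
   using st by linarith
  then have "exp 4 * (exp (- 4) * measure lborel (lset (Suc n))) <=
    exp 4 * (2 * a * Cf * (2 ^ 30 * 1024 ^ n) * y powr ((1 - 1 / p) * (1 + 2 / N)) * q)"
   by (intro mult_left_mono) auto
  moreover have "exp 4 * (exp (- 4) * measure lborel (lset (Suc n))) = measure lborel (lset (Suc n))"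
   by (simp add: exp_minus)
  moreover have "exp 4 * (2 * a * Cf * (2 ^ 30 * 1024 ^ n) * y powr ((1 - 1 / p) * (1 + 2 / N)) * q) =
    Cg * 1024 ^ n * y powr ((1 - 1 / p) * (1 + 2 / N)) * q"
   unfolding Cg_def a_def N_def by (simp only: mult_ac)
  ultimately have "measure lborel (lset (Suc n)) <= Cg * 1024 ^ n * y powr ((1 - 1 / p) * (1 + 2 / N)) * q" by linarith
  then have "measure lborel (lset (Suc n)) / q <= Cg * 1024 ^ n * y powr ((1 - 1 / p) * (1 + 2 / N))"
   using q by (simp add: pos_divide_le_eq)
  then show ?thesis unfolding y_def q_def N_def .
 qed
qed

lemma lset_0: "lset 0 \<subseteq> {z \<in> Q. M / 4 < S z}"
proof
 fix z assume z: "z \<in> lset 0"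
 then have "S z > M / 4" by (simp add: lset_def field_simps)
 moreover have "z \<in> Q" if "S z > M / 4"
  using that M outside[of z] unfolding S_def sqn_def by (cases "z \<in> Q") auto
 ultimately show "z \<in> {z \<in> Q. M / 4 < S z}" by simp
qed

text \<open>Here d is the excess of the recursion exponent over one. The part of the half cylinder
  where |u| > M/2 lies in every \<open>lset n\<close> and is therefore null.\<close>

lemma de_giorgi:
 assumes p: "p > 1" and d: "d = (1 - 1 / p) * (1 + 2 / CARD('n)) - 1" "d > 0"
  and \<theta>: "t2 - t1 = M powr (1 - m) * \<rho>^2"
  and Fi: "integrable lborel (\<lambda>z. (\<rho>^2 * \<phi>2 z / \<Lambda>) powr p)"
  and Fb: "(LBINT z. (\<rho>^2 * \<phi>2 z / \<Lambda>) powr p) <= measure lborel Q"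
  and small: "measure lborel {z \<in> Q. M / 4 < S z} <= Cg powr (- 1 / d) * 1024 powr (- 1 / d\<^sup>2) * measure lborel Q"
 shows "AE z in lborel. norm (fst z - x0) < \<rho> / 2 --> t2 - (t2 - t1) / 2 < snd z --> snd z < t2 --> S z <= M / 2"
proof -
 define y where "y n = measure lborel (lset n) / measure lborel Q" for n
 have [measurable]: "lset n \<in> sets borel" for n unfolding lset_def by measurable
 have dec: "lset n \<subseteq> {z \<in> Q. M / 4 < S z}" for n
 proof -
  have "(1 / 2) ^ (n + 3) <= (1 / 2 :: real) ^ (0 + 3)" by (rule power_decreasing) auto
  then have "\<rho> * (1 / 2 + 2 * (1 / 2) ^ (n + 3)) <= \<rho> * (1 / 2 + 2 * (1 / 2) ^ (0 + 3))"
   "(t2 - t1) * (1 / 2 + 2 * (1 / 2) ^ (n + 3)) <= (t2 - t1) * (1 / 2 + 2 * (1 / 2) ^ (0 + 3))"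
   "M * (1 / 2 - 2 * (1 / 2) ^ (0 + 3)) <= M * (1 / 2 - 2 * (1 / 2) ^ (n + 3))"
   using \<rho> t12 M by (intro mult_left_mono; linarith)+
  then have "lset n \<subseteq> lset 0" unfolding lset_def by fastforce
  then show ?thesis using lset_0 by (rule order_trans)
 qed
 have Sm: "{z \<in> Q. M / 4 < S z} \<in> sets borel" using Q_meas by measurable
 have y: "y \<longlonglongrightarrow> 0"
 proof (rule fast_convergence[OF Cg_pos _ d(2)])
  show "y (Suc n) <= Cg * 1024 ^ n * y n powr (1 + d)" for n
   using de_giorgi_recursion[OF p \<theta> Fi Fb, of n] unfolding y_def d(1) by simp
  have "measure lborel (lset 0) <= Cg powr (- 1 / d) * 1024 powr (- 1 / d\<^sup>2) * measure lborel Q"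
   by (rule order_trans[OF measure_mono_Q[OF dec _ _ Sm] small]) auto
  then show "y 0 <= Cg powr (- 1 / d) * 1024 powr (- 1 / d\<^sup>2)"
   unfolding y_def using Q_pos by (simp only: pos_divide_le_eq)
 qed (use Q_pos in \<open>simp_all add: y_def\<close>)
 define X where "X = {z. norm (fst z - x0) < \<rho> / 2 \<and> t2 - (t2 - t1) / 2 < snd z \<and> snd z < t2 \<and> M / 2 < S z}"
 have Xm: "X \<in> sets borel" unfolding X_def by measurable
 have XL: "X \<subseteq> lset n" for n
 proof -
  have "\<rho> * (1 / 2) <= \<rho> * (1 / 2 + 2 * (1 / 2) ^ (n + 3))" "(t2 - t1) * (1 / 2) <= (t2 - t1) * (1 / 2 + 2 * (1 / 2) ^ (n + 3))"
   "M * (1 / 2 - 2 * (1 / 2) ^ (n + 3)) <= M * (1 / 2)"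
   using \<rho> t12 M by (intro mult_left_mono; simp)+
  then show ?thesis unfolding X_def lset_def by (auto; linarith)
 qed
 have "measure lborel X / measure lborel Q <= y n" for n
  unfolding y_def using measure_mono_Q[OF XL _ Xm] dec by (intro divide_right_mono) auto
 then have "measure lborel X / measure lborel Q <= 0"
  by (intro tendsto_lowerbound[OF y]) auto
 then have "measure lborel X <= 0" using Q_pos by (simp add: divide_le_0_iff)
 then have "measure lborel X = 0" by (simp add: measure_le_0_iff)
 moreover have XQ: "X \<subseteq> Q" using XL[of 0] dec[of 0] by auto
 have "emeasure lborel X \<noteq> \<infinity>" using integrable_indicator_sub[OF XQ Xm] Xm by (simp add: integrable_indicator_iff)
 ultimately have "emeasure lborel X = 0" by (simp add: measure_def enn2real_eq_0_iff)
 then have "AE z in lborel. z \<notin> X" using Xm by (intro AE_not_in) (simp add: null_sets_def)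
 then show ?thesis by eventually_elim (auto simp: X_def)
qed

end

section \<open>Borel representatives and the passage to local solutions\<close>

text \<open>The definitions integrate over \<open>lebesgue\<close>, the analysis uses Borel
  functions and \<open>lborel\<close>. On the exceptional null set f is arbitrary; completeness of
  \<open>lebesgue\<close> makes it measurable nevertheless.\<close>

lemma lebesgue_AE_borel:
 fixes f g :: "'a::euclidean_space => 'b::euclidean_space"
 assumes g: "g \<in> borel_measurable borel" and ae: "AE z in lborel. f z = g z"
 shows lebesgue_AE_borel_measurable: "f \<in> borel_measurable lebesgue"
  and lebesgue_AE_borel_integral: "integral\<^sup>L lebesgue f = integral\<^sup>L lborel g"
  and lebesgue_AE_borel_integrable: "integrable lebesgue f \<longleftrightarrow> integrable lborel g"
proof -
 obtain N where N: "{z \<in> space lborel. f z \<noteq> g z} \<subseteq> N" "emeasure lborel N = 0" "N \<in> sets lborel"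
  using ae by (rule AE_E)
 have n: "N \<in> null_sets lborel" using N by auto
 have gl: "g \<in> borel_measurable lebesgue" using g by (intro measurable_completion) simp
 show fm: "f \<in> borel_measurable lebesgue"
 proof (rule measurableI)
  fix X :: "'b set" assume X: "X \<in> sets borel"
  have s: "f -` X \<inter> N \<in> sets lebesgue" using n by (intro null_sets_completion[of N]) auto
  have e: "f -` X \<inter> space lebesgue = (g -` X \<inter> space lebesgue - N) \<union> (f -` X \<inter> N)" using N(1) by auto
  have "g -` X \<inter> space lebesgue \<in> sets lebesgue" by (rule measurable_sets[OF gl X])
  moreover have "N \<in> sets lebesgue" using N(3) by simp
  ultimately show "f -` X \<inter> space lebesgue \<in> sets lebesgue"
   unfolding e using s by (intro sets.Un sets.Diff)
 qed simp
 have ae': "AE z in lebesgue. f z = g z" using ae by (rule AE_completion)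
 have "integral\<^sup>L lebesgue f = integral\<^sup>L lebesgue g" by (rule integral_cong_AE[OF fm gl ae'])
 also have "... = integral\<^sup>L lborel g" by (rule integral_completion) (use g in simp)
 finally show "integral\<^sup>L lebesgue f = integral\<^sup>L lborel g" .
 have "integrable lebesgue f \<longleftrightarrow> integrable lebesgue g" by (rule integrable_cong_AE[OF fm gl ae'])
 also have "... \<longleftrightarrow> integrable lborel g" by (rule integrable_completion) (use g in simp)
 finally show "integrable lebesgue f \<longleftrightarrow> integrable lborel g" .
qed

lemma borel_version:
 fixes f :: "'a::euclidean_space => real"
 assumes f: "f \<in> borel_measurable (lebesgue_on D)" and Q: "Q \<in> sets borel" "Q \<subseteq> D"
 shows "\<exists>g. g \<in> borel_measurable borel \<and> (AE z in lborel. z \<in> Q --> f z = g z)"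
proof -
 have "f \<in> borel_measurable (lebesgue_on Q)" by (rule measurable_restrict_mono[OF f Q(2)])
 then have "(\<lambda>z. indicator Q z *\<^sub>R f z) \<in> borel_measurable lebesgue"
  by (subst (asm) borel_measurable_restrict_space_iff) (use Q in auto)
 from completion_ex_borel_measurable_real[OF this]
 obtain g where g: "g \<in> borel_measurable lborel" "AE z in lborel. indicator Q z *\<^sub>R f z = g z" by blast
 from g(2) have "AE z in lborel. z \<in> Q --> f z = g z" by eventually_elim auto
 then show ?thesis using g(1) by (intro exI[of _ g]) simp
qed

lemma borel_version_vec:
 fixes f :: "'a::euclidean_space => real ^ 'n"
 assumes f: "f \<in> borel_measurable (lebesgue_on D)" and Q: "Q \<in> sets borel" "Q \<subseteq> D"
 shows "\<exists>g. g \<in> borel_measurable borel \<and> (AE z in lborel. z \<in> Q --> f z = g z)"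
proof -
 have "\<exists>g. g \<in> borel_measurable borel \<and> (AE z in lborel. z \<in> Q --> f z $ \<alpha> = g z)" for \<alpha>
 proof -
  have "(\<lambda>z. f z $ \<alpha>) \<in> borel_measurable (lebesgue_on D)"
   by (rule borel_measurable_vec_component[OF f])
  from borel_version[OF this Q] show ?thesis .
 qed
 from choice[OF allI[OF this]] obtain h where
  "\<forall>\<alpha>. h \<alpha> \<in> borel_measurable borel \<and> (AE z in lborel. z \<in> Q --> f z $ \<alpha> = h \<alpha> z)" ..
 then have h: "\<And>\<alpha>. h \<alpha> \<in> borel_measurable borel" "\<And>\<alpha>. AE z in lborel. z \<in> Q --> f z $ \<alpha> = h \<alpha> z"
  by simp_all
 have "AE z in lborel. \<forall>\<alpha>. z \<in> Q --> f z $ \<alpha> = h \<alpha> z"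
  by (subst AE_all_countable) (use h(2) in blast)
 then have "AE z in lborel. z \<in> Q --> f z = (\<chi> \<alpha>. h \<alpha> z)"
  by eventually_elim (auto simp: vec_eq_iff)
 moreover have "(\<lambda>z. \<chi> \<alpha>. h \<alpha> z) \<in> borel_measurable borel"
  using h(1) by (subst borel_measurable_euclidean_space) (auto simp: Basis_vec_def inner_axis)
 ultimately show ?thesis by (intro exI conjI)
qed

text \<open>A Caratheodory function is measurable along measurable arguments: approximate the argument
 by simple functions.\<close>

lemma caratheodory_measurable:
 fixes a :: "'a => 'p::{metric_space, second_countable_topology} => 'c::metric_space"
 assumes a: "\<And>p. p \<in> P ==> (\<lambda>z. a z p) \<in> borel_measurable M"
  and cont: "\<And>z. z \<in> space M ==> continuous_on P (a z)"
  and w: "w \<in> borel_measurable M" "\<And>z. z \<in> space M ==> w z \<in> P"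
  and \<pi>: "continuous_on UNIV \<pi>" "\<And>p. \<pi> p \<in> P" "\<And>p. p \<in> P ==> \<pi> p = p"
 shows "(\<lambda>z. a z (w z)) \<in> borel_measurable M"
proof -
 obtain F where F: "\<And>n. simple_function M (F n)" "\<And>z. z \<in> space M ==> (\<lambda>n. F n z) \<longlonglongrightarrow> w z"
  using borel_measurable_implies_sequence_metric[OF w(1), of undefined] by blast
 show ?thesis
 proof (rule borel_measurable_LIMSEQ_metric)
  fix n
  \<comment> \<open>The simple approximations of w may leave P; the retraction \<pi> brings them
    back, and each of their finitely many values gives a measurable function.\<close>
  show "(\<lambda>z. a z (\<pi> (F n z))) \<in> borel_measurable M"
  proof (rule measurable_compose_countable'[where f = "\<lambda>p z. a z (\<pi> p)" and I = "F n ` space M"])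
   show "F n \<in> measurable M (count_space (F n ` space M))"
    using F(1)[of n] by (subst measurable_count_space_eq2) (auto simp: simple_function_def)
   show "countable (F n ` space M)" using F(1)[of n] by (simp add: simple_function_def countable_finite)
  qed (use a \<pi> in auto)
 next
  fix z assume z: "z \<in> space M"
  have "(\<lambda>n. \<pi> (F n z)) \<longlonglongrightarrow> \<pi> (w z)"
   using \<pi>(1) F(2)[OF z] by (intro isCont_tendsto_compose[of _ \<pi>]) (auto simp: continuous_on_eq_continuous_at)
  then have "(\<lambda>n. \<pi> (F n z)) \<longlonglongrightarrow> w z" using \<pi>(3) w(2)[OF z] by simp
  then show "(\<lambda>n. a z (\<pi> (F n z))) \<longlonglongrightarrow> a z (w z)"
   by (rule continuous_on_tendsto_compose[OF cont[OF z]]) (use w(2)[OF z] \<pi>(2) in auto)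
 qed
qed

section \<open>Weak solutions and their restriction to cylinders\<close>

lemma fnorm_sq: "(fnorm k v)^2 = (\<Sum>i<k. (norm (v i))^2)"
 by (simp add: fnorm_def L2_set_def sum_nonneg)

lemma fnorm_nonneg: "0 <= fnorm k v"
 by (simp add: fnorm_def)

lemma norm_le_fnorm: "i < k ==> norm (v i) <= fnorm k v"
 unfolding fnorm_def by (rule member_le_L2_set) auto

lemma fnorm_triangle: "fnorm k (\<lambda>i. v i - w i) <= fnorm k v + fnorm k w"
proof -
 have "fnorm k (\<lambda>i. v i - w i) <= L2_set (\<lambda>i. norm (v i) + norm (w i)) {..<k}"
  unfolding fnorm_def by (rule L2_set_mono) (auto intro: norm_triangle_ineq4)
 also have "... <= fnorm k v + fnorm k w" unfolding fnorm_def by (rule L2_set_triangle_ineq)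
 finally show ?thesis .
qed

lemma borel_measurable_fnorm:
 fixes f :: "'a => nat => 'b::euclidean_space"
 assumes "\<And>i. i < k ==> (\<lambda>z. f z i) \<in> borel_measurable M"
 shows "(\<lambda>z. fnorm k (f z)) \<in> borel_measurable M"
proof -
 have "(\<lambda>z. \<Sum>i<k. (norm (f z i))^2) \<in> borel_measurable M"
  by (rule borel_measurable_sum) (use assms in simp)
 then show ?thesis unfolding fnorm_def L2_set_def by measurable
qed

text \<open>The definition of a weak solution unpacked, with one weak gradient g of v fixed for all
  that follows.\<close>

locale weak_sol =
 fixes k :: nat and m \<nu> L :: real and \<Omega> :: "(real ^ 'n) set" and Tf :: real and a :: "'n vfield"
  and f g :: "(real ^ 'n) \<times> real => nat => real ^ 'n" and u :: "(real ^ 'n) \<times> real => nat => real"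
 assumes m: "0 < m" "m < 1" and \<nu>: "\<nu> > 0" and L: "L > 0" and \<Omega>: "open \<Omega>"
  and car: "caratheodory k \<Omega> Tf a" and G1: "G1 k \<Omega> Tf \<nu> a" and G2: "G2 k \<Omega> Tf L a" and G3: "G3 k m \<Omega> Tf a"
  and f2: "in_Lp 2 k (\<Omega> \<times> {0<..Tf}) f"
  and u_fvec: "\<And>z. z \<in> \<Omega> \<times> {0<..Tf} ==> u z \<in> fvec k"
  and u_meas: "\<And>i. i < k ==> (\<lambda>z. u z i) \<in> borel_measurable (lebesgue_on (\<Omega> \<times> {0<..Tf}))"
  and u_C0: "in_C0_Lp (1 + m) k \<Omega> Tf u"
  and g: "has_L2_W12_gradient k \<Omega> Tf (\<lambda>z. signed_pow k m (u z)) g"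
  and weak: "\<And>\<phi>. (\<And>i. i < k ==> test_function (\<Omega> \<times> {0<..<Tf}) (\<phi> i)) ==>
     (LINT z:\<Omega> \<times> {0<..Tf}|lebesgue.
       finner k (u z) (\<lambda>i. Dt (\<phi> i) z) -
       finner k (a z (u z) (g z)) (\<lambda>i. Dx (\<phi> i) z)) =
     (LINT z:\<Omega> \<times> {0<..Tf}|lebesgue. finner k (f z) (\<lambda>i. Dx (\<phi> i) z))"
begin

abbreviation "D \<equiv> \<Omega> \<times> {0<..Tf}"

lemma g2: "in_Lp 2 k D g" and g_slices: "AE t in lebesgue. t \<in> {0<..<Tf} -->
    has_W12_gradient k \<Omega> (\<lambda>x. signed_pow k m (u (x, t))) (\<lambda>x. g (x, t))"
 using g by (auto simp: has_L2_W12_gradient_def)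

end

text \<open>Provides a Borel exceptional set, which can be removed from a cylinder without leaving
  the Borel sets.\<close>

lemma AE_lebesgue_null:
 assumes "AE z in lebesgue. P (z :: 'a::euclidean_space)"
 obtains N where "N \<in> sets borel" "AE z in lborel. z \<notin> N" "\<And>z. z \<notin> N ==> P z"
proof -
 have "AE z in lborel. P z" using assms by (simp add: AE_completion_iff)
 then obtain N where N: "{z \<in> space lborel. \<not> P z} \<subseteq> N" "emeasure lborel N = 0" "N \<in> sets lborel" by (rule AE_E)
 then have "AE z in lborel. z \<notin> N" by (intro AE_not_in) auto
 then show ?thesis using N by (intro that[of N]) auto
qed

text \<open>The continuous retraction of all sequences onto \<open>fvec k\<close>, which serves as
  \<pi> in \<open>caratheodory_measurable\<close>.\<close>

definition trunc :: "nat => (nat => 'a::zero) => nat => 'a" where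
 "trunc k v i = (if i < k then v i else 0)"

lemma trunc_fvec: "trunc k v \<in> fvec k" "v \<in> fvec k ==> trunc k v = v"
 by (auto simp: trunc_def fvec_def fun_eq_iff)

lemma continuous_trunc: "continuous_on S (trunc k :: (nat => 'a::{topological_space, zero}) => _)"
proof (rule continuous_on_coordinatewise_then_product)
 fix i show "continuous_on S (\<lambda>v. trunc k v i :: 'a)"
 proof (cases "i < k")
  case True
  have "continuous_on S (\<lambda>v. v i :: 'a)" by (rule continuous_on_subset[OF continuous_on_product_coordinates]) simp
  then show ?thesis using True by (simp add: trunc_def)
 qed (simp add: trunc_def)
qed

text \<open>An open cylinder on which u is bounded by M almost everywhere. The intrinsic cylinders
  of the halving step are of this kind.\<close>

locale cylinder_sol = weak_sol k m \<nu> L \<Omega> Tf a f g u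
 for k m \<nu> L and \<Omega> :: "(real ^ 'n) set" and Tf a f g u +
 fixes x0 :: "real ^ 'n" and \<rho> t1 t2 M :: real
 assumes \<rho>: "\<rho> > 0" and sub: "ball x0 \<rho> \<subseteq> \<Omega>" and ts: "0 <= t1" "t1 < t2" "t2 <= Tf" and M: "M > 0"
  and bound: "AE z in lebesgue. z \<in> ball x0 \<rho> \<times> {t1<..<t2} --> fnorm k (u z) <= M"
begin

abbreviation "Q \<equiv> ball x0 \<rho> \<times> {t1<..<t2}"

lemma Q_sub: "Q \<subseteq> D" using sub ts by auto

lemma Q_meas: "Q \<in> sets borel" by (intro borel_Times) auto

end

lemma has_real_derivative_frechet:
 fixes f :: "real => real"
 assumes d: "(f has_derivative F) (at x)"
 shows "(f has_real_derivative F 1) (at x)"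
proof -
 have "F h = F 1 * h" for h
  using linear_scale[OF has_derivative_linear[OF d], of h 1] by simp
 then have "F = (*) (F 1)" by (intro ext)
 then show ?thesis unfolding has_field_derivative_def by (rule has_derivative_eq_rhs[OF d])
qed

text \<open>Testing with smoothed indicators of \<open>{s..t}\<close> turns the weak time derivative into an
 increment.\<close>

lemma weak_derivative_increment:
 fixes h b :: "real => real"
 assumes h: "integrable lborel h" and b: "integrable lborel b"
  and weak: "\<And>\<zeta>. test_function {t1<..<t2} \<zeta> ==> (LBINT \<tau>. h \<tau> * deriv \<zeta> \<tau>) = (LBINT \<tau>. b \<tau> * \<zeta> \<tau>)"
  and T: "AE \<tau> in lborel. \<tau> \<in> {t1<..<t2} --> \<tau> \<in> T" "T \<subseteq> {t1<..<t2}"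
  and cont: "\<And>s e. s \<in> T ==> e > 0 ==> \<exists>d>0. \<forall>\<tau>\<in>T. \<bar>\<tau> - s\<bar> < d --> \<bar>h \<tau> - h s\<bar> < e"
  and st: "s \<in> T" "t \<in> T" "s < t"
 shows "h t - h s = - (LBINT \<tau>. indicator {s<..<t} \<tau> * b \<tau>)"
proof -
 have st': "t1 < s" "t < t2" using st T by auto
 \<comment> \<open>The width tends to zero and stays below the distance of [s, t] from t1 and t2, so
   that the smoothed indicators are test functions on (t1, t2).\<close>
 define r where "r n = min (s - t1) (t2 - t) / (real n + 2)" for n
 have mp: "0 < min (s - t1) (t2 - t)" using st' by simp
 have r: "r n > 0" "s - r n > t1" "t + r n < t2" for n
 proof -
  show "r n > 0" using mp by (simp add: r_def)
  have "r n < min (s - t1) (t2 - t) / 1" unfolding r_def by (rule divide_strict_left_mono) (use mp in auto)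
  then show "s - r n > t1" "t + r n < t2" by auto
 qed
 have r0: "r \<longlonglongrightarrow> 0"
 proof -
  have "(\<lambda>n. min (s - t1) (t2 - t) * inverse (real (Suc (Suc n)))) \<longlonglongrightarrow> min (s - t1) (t2 - t) * 0"
   by (intro tendsto_mult tendsto_const LIMSEQ_Suc[OF LIMSEQ_inverse_real_of_nat])
  then show ?thesis by (simp add: r_def[abs_def] divide_inverse add.commute)
 qed
 define J where "J n = (mollifier (r n) :: real => real)" for n
 have J: "C_diff j (J n)" "\<forall>x. r n <= norm x --> J n x = 0" "J n x \<ge> 0" "integrable lborel (J n)" "(LBINT x. J n x) = 1"
  "J n \<in> borel_measurable borel" for n j x
  using mollifier[OF r(1)] unfolding J_def by blast+
 define I where "I = (indicator {s..t} :: real => real)"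
 have I: "integrable lborel I" unfolding I_def by (rule integrable_real_indicator) (use emeasure_bounded_finite[of "{s..t}"] in auto)
 define \<zeta> where "\<zeta> n = conv (J n) I" for n
 have smooth: "C_diff j (\<zeta> n)" for n j unfolding \<zeta>_def by (rule C_diff_conv[OF I J(1,2)])
 have chi_le: "\<bar>\<zeta> n \<tau>\<bar> <= 1" for n \<tau>
  unfolding \<zeta>_def J_def by (rule conv_bound[OF r(1) I]) (simp add: I_def split: split_indicator)
 have chi_0: "\<zeta> n \<tau> = 0" if "\<tau> <= s - r n \<or> t + r n <= \<tau>" for n \<tau>
 proof -
  have "J n (\<tau> - y) * I y = 0" for y
  proof (cases "y \<in> {s..t}")
   case True
   then have "r n <= norm (\<tau> - y)" using that by auto
   then show ?thesis using J(2) by simp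
  qed (simp add: I_def)
  then have "(\<lambda>y. J n (\<tau> - y) * I y) = (\<lambda>_. 0)" by (rule ext)
  then show ?thesis by (simp add: \<zeta>_def conv_def)
 qed
 have chi_1: "\<zeta> n \<tau> = 1" if "s + r n <= \<tau>" "\<tau> <= t - r n" for n \<tau>
 proof -
  have "J n (\<tau> - y) * I y = J n (\<tau> - y)" for y
  proof (cases "y \<in> {s..t}")
   case False
   then have "r n <= norm (\<tau> - y)" using that by auto
   then show ?thesis using J(2) by simp
  qed (simp add: I_def)
  then have "(\<lambda>y. J n (\<tau> - y) * I y) = (\<lambda>y. J n (\<tau> - y))" by (rule ext)
  then have "\<zeta> n \<tau> = (LBINT y. J n (\<tau> - y))" by (simp add: \<zeta>_def conv_def)
  also have "... = 1" using integral_reflect[OF J(6), of n \<tau>] J(5) by simp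
  finally show ?thesis .
 qed
 have tf: "test_function {t1<..<t2} (\<zeta> n)" for n
 proof (rule test_function_cutoff[where ?x0.0 = "(s + t) / 2" and R = "(t - s) / 2 + r n"])
  show "\<zeta> n x = 0" if "x \<notin> cball ((s + t) / 2) ((t - s) / 2 + r n)" for x
   using that by (intro chi_0) (auto simp: dist_real_def field_simps)
  show "cball ((s + t) / 2) ((t - s) / 2 + r n) \<subseteq> {t1<..<t2}"
   using r(2,3)[of n] by (auto simp: dist_real_def field_simps)
 qed (rule smooth)
 have dJ: "(J n has_real_derivative frechet_derivative (J n) (at x) 1) (at x)" for n x
  by (rule has_real_derivative_frechet) (rule C_diff_has_derivative[OF J(1)[of "Suc 0"]])
 \<comment> \<open>The derivative of the smoothed indicator is the kernel centred at s minus the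
   kernel centred at t, so testing compares averages of h near s and near t.\<close>
 have dchi: "deriv (\<zeta> n) \<tau> = J n (\<tau> - s) - J n (\<tau> - t)" for n \<tau>
 proof -
  have "(\<zeta> n has_real_derivative frechet_derivative (\<zeta> n) (at \<tau>) 1) (at \<tau>)"
   by (rule has_real_derivative_frechet) (rule C_diff_has_derivative[OF smooth[of "Suc 0"]])
  then have "deriv (\<zeta> n) \<tau> = frechet_derivative (\<zeta> n) (at \<tau>) 1" by (rule DERIV_imp_deriv)
  also have "... = conv (\<lambda>x. frechet_derivative (J n) (at x) 1) I \<tau>"
   unfolding \<zeta>_def by (rule frechet_conv[OF J(1,2) I]) simp
  also have "... = (LBINT y. frechet_derivative (J n) (at (\<tau> - y)) 1 * indicator {s..t} y)"
   by (simp add: conv_def I_def)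
  also have "... = - J n (\<tau> - t) - (- J n (\<tau> - s))"
  proof (rule integral_FTC_Icc_real)
   show "s <= t" using st by simp
   show "((\<lambda>y. - J n (\<tau> - y)) has_real_derivative frechet_derivative (J n) (at (\<tau> - y)) 1) (at y)" for y
   proof -
    have "((\<lambda>y. J n (\<tau> - y)) has_real_derivative frechet_derivative (J n) (at (\<tau> - y)) 1 * (0 - 1)) (at y)"
     by (rule DERIV_chain2[OF dJ]) (rule derivative_eq_intros refl | simp)+
    from DERIV_minus[OF this] show ?thesis by simp
   qed
   have "C_diff 0 (\<lambda>x. frechet_derivative (J n) (at x) 1)" using J(1)[of "Suc 0" n] by simp
   then have c: "isCont (\<lambda>x. frechet_derivative (J n) (at x) 1) x" for x
    unfolding C_diff.simps(1) continuous_on_eq_continuous_at[OF open_UNIV] by blast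
   show "isCont (\<lambda>y. frechet_derivative (J n) (at (\<tau> - y)) 1) y" for y
    by (rule isCont_o2[OF _ c]) (intro continuous_diff continuous_const continuous_ident)
  qed
  finally show ?thesis by simp
 qed
 have Jb: "\<exists>c. \<forall>x. \<bar>J n x\<bar> <= c" for n
  by (rule smooth_bounded[OF C_diff_continuous[OF J(1)] J(2)]) blast
 have iJ: "integrable lborel (\<lambda>\<tau>. h \<tau> * J n (\<tau> - c))" for n c
 proof -
  obtain C where C: "\<forall>x. \<bar>J n x\<bar> <= C" using Jb by blast
  note [measurable] = J(6)[of n] borel_measurable_integrable[OF h]
  show ?thesis
  proof (rule bochner_bound)
   show "integrable lborel (\<lambda>\<tau>. C * \<bar>h \<tau>\<bar>)" using h by simp
   show "AE \<tau> in lborel. norm (h \<tau> * J n (\<tau> - c)) <= norm (C * \<bar>h \<tau>\<bar>)"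
   proof (rule AE_I2)
    fix \<tau>
    have "\<bar>h \<tau>\<bar> * \<bar>J n (\<tau> - c)\<bar> <= \<bar>h \<tau>\<bar> * C" using C by (intro mult_left_mono) auto
    also have "... <= \<bar>C * \<bar>h \<tau>\<bar>\<bar>" by (simp add: mult.commute)
    finally show "norm (h \<tau> * J n (\<tau> - c)) <= norm (C * \<bar>h \<tau>\<bar>)" by (simp add: abs_mult)
   qed
  qed measurable
 qed
 \<comment> \<open>Continuity of h along T is enough for the averages to converge, because T has
   full measure near c.\<close>
 have lim: "(\<lambda>n. LBINT \<tau>. h \<tau> * J n (\<tau> - c)) \<longlonglongrightarrow> h c" if c: "c \<in> T" "s <= c" "c <= t" for c
 proof (rule LIMSEQ_I)
  fix e :: real assume e: "e > 0"
  obtain d where d: "d > 0" "\<forall>\<tau>\<in>T. \<bar>\<tau> - c\<bar> < d --> \<bar>h \<tau> - h c\<bar> < e / 2" using cont[OF c(1), of "e / 2"] e by auto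
  from LIMSEQ_D[OF r0 d(1)] obtain n0 where n0: "\<And>n. n \<ge> n0 ==> norm (r n - 0) < d" by blast
  have "norm ((LBINT \<tau>. h \<tau> * J n (\<tau> - c)) - h c) < e" if n: "n \<ge> n0" for n
  proof -
   have rd: "r n < d" using n0[OF n] by simp
   have sh: "integrable lborel (\<lambda>\<tau>. J n (\<tau> - c))" "(LBINT \<tau>. J n (\<tau> - c)) = 1"
    using integrable_shift[OF J(4), of n "- c"] integral_shift[OF J(6), of n "- c"] J(5) by simp_all
   have "(LBINT \<tau>. h \<tau> * J n (\<tau> - c)) - h c = (LBINT \<tau>. h \<tau> * J n (\<tau> - c) - h c * J n (\<tau> - c))"
    using iJ[of n c] sh by simp
   moreover have "norm (LBINT \<tau>. h \<tau> * J n (\<tau> - c) - h c * J n (\<tau> - c)) <= (LBINT \<tau>. e / 2 * J n (\<tau> - c))"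
   proof (rule order_trans[OF integral_norm_bound integral_mono_AE])
    show "AE \<tau> in lborel. norm (h \<tau> * J n (\<tau> - c) - h c * J n (\<tau> - c)) <= e / 2 * J n (\<tau> - c)"
     using T(1)
    proof eventually_elim
     case (elim \<tau>)
     show ?case
     proof (cases "\<bar>\<tau> - c\<bar> < r n")
      case True
      then have "\<tau> \<in> {t1<..<t2}" using r(2,3)[of n] c by auto
      then have "\<bar>h \<tau> - h c\<bar> <= e / 2" using elim d(2) True rd by force
      then have "\<bar>h \<tau> - h c\<bar> * J n (\<tau> - c) <= e / 2 * J n (\<tau> - c)" using J(3) by (intro mult_right_mono)
      moreover have "norm (h \<tau> * J n (\<tau> - c) - h c * J n (\<tau> - c)) = \<bar>h \<tau> - h c\<bar> * J n (\<tau> - c)"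
       using J(3) by (simp add: left_diff_distrib[symmetric] abs_mult)
      ultimately show ?thesis by simp
     next
      case False
      then have "J n (\<tau> - c) = 0" using J(2)[of n] by simp
      then show ?thesis by simp
     qed
    qed
   qed (use iJ[of n c] sh in simp_all)
   ultimately show ?thesis using sh e by simp
  qed
  then show "\<exists>no. \<forall>n\<ge>no. norm ((LBINT \<tau>. h \<tau> * J n (\<tau> - c)) - h c) < e" by blast
 qed
 have L: "(\<lambda>n. LBINT \<tau>. h \<tau> * deriv (\<zeta> n) \<tau>) \<longlonglongrightarrow> h s - h t"
 proof -
  have "(LBINT \<tau>. h \<tau> * deriv (\<zeta> n) \<tau>) = (LBINT \<tau>. h \<tau> * J n (\<tau> - s)) - (LBINT \<tau>. h \<tau> * J n (\<tau> - t))" for n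
   unfolding dchi right_diff_distrib by (rule bochner_diff[OF iJ iJ])
  then show ?thesis using tendsto_diff[OF lim[of s] lim[of t]] st by simp
 qed
 have R: "(\<lambda>n. LBINT \<tau>. b \<tau> * \<zeta> n \<tau>) \<longlonglongrightarrow> (LBINT \<tau>. indicator {s<..<t} \<tau> * b \<tau>)"
 proof (rule integral_dominated_convergence[where w = "\<lambda>\<tau>. \<bar>b \<tau>\<bar>"])
  note [measurable] = borel_measurable_integrable[OF b]
  have [measurable]: "\<zeta> n \<in> borel_measurable borel" for n
   by (rule borel_measurable_continuous_onI[OF C_diff_continuous[OF smooth]])
  show "(\<lambda>\<tau>. indicator {s<..<t} \<tau> * b \<tau>) \<in> borel_measurable lborel" "(\<lambda>\<tau>. b \<tau> * \<zeta> n \<tau>) \<in> borel_measurable lborel" for n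
   by measurable
  show "AE \<tau> in lborel. norm (b \<tau> * \<zeta> n \<tau>) <= \<bar>b \<tau>\<bar>" for n
   using chi_le[of n] by (simp add: abs_mult mult_left_le)
  have "AE \<tau> in lborel. \<tau> \<noteq> s \<and> \<tau> \<noteq> t" using AE_lborel_singleton[of s] AE_lborel_singleton[of t] by eventually_elim simp
  then show "AE \<tau> in lborel. (\<lambda>n. b \<tau> * \<zeta> n \<tau>) \<longlonglongrightarrow> indicator {s<..<t} \<tau> * b \<tau>"
  proof eventually_elim
   case (elim \<tau>)
   have ev: "eventually (\<lambda>n. r n < min \<bar>\<tau> - s\<bar> \<bar>\<tau> - t\<bar>) sequentially"
    by (rule order_tendstoD(2)[OF r0]) (use elim in auto)
   have "eventually (\<lambda>n. \<zeta> n \<tau> = indicator {s<..<t} \<tau>) sequentially"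
    using ev
   proof eventually_elim
    case (elim n)
    consider "\<tau> < s" | "t < \<tau>" | "s <= \<tau>" "\<tau> <= t" by linarith
    then show ?case
    proof cases
     case 1
     then show ?thesis using elim st chi_0[of \<tau> n] by auto
    next
     case 2
     then show ?thesis using elim st chi_0[of \<tau> n] by auto
    next
     case 3
     then show ?thesis using elim r(1)[of n] chi_1[of n \<tau>] by auto
    qed
   qed
   then have "(\<lambda>n. \<zeta> n \<tau>) \<longlonglongrightarrow> indicator {s<..<t} \<tau>" by (rule tendsto_eventually)
   from tendsto_mult[OF tendsto_const this, of "b \<tau>"] show ?case by (simp add: mult.commute)
  qed
 qed (use b in simp)
 have "(LBINT \<tau>. h \<tau> * deriv (\<zeta> n) \<tau>) = (LBINT \<tau>. b \<tau> * \<zeta> n \<tau>)" for n by (rule weak[OF tf])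
 then have "h s - h t = (LBINT \<tau>. indicator {s<..<t} \<tau> * b \<tau>)" using LIMSEQ_unique[OF L] R by simp
 then show ?thesis by simp
qed

section \<open>Test functions, their bounds and products\<close>

lemma test_function_vanish:
 fixes \<phi> :: "'a::euclidean_space => real"
 assumes tf: "test_function B \<phi>" and x: "x \<notin> B"
 shows "\<phi> x = 0" "(\<phi> has_derivative (\<lambda>_. 0)) (at x)"
proof -
 let ?K = "closure {x. \<phi> x \<noteq> 0}"
 have K: "x \<notin> ?K" using tf x by (auto simp: test_function_def)
 then show "\<phi> x = 0" using closure_subset[of "{x. \<phi> x \<noteq> 0}"] by blast
 show "(\<phi> has_derivative (\<lambda>_. 0)) (at x)"
 proof (rule has_derivative_transform_within_open[where s = "- ?K" and f = "\<lambda>_. 0"])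
  fix y assume "y \<in> - ?K"
  then have "\<phi> y = 0" using closure_subset[of "{x. \<phi> x \<noteq> 0}"] by blast
  then show "0 = \<phi> y" by (rule sym)
 qed (use K in auto)
qed

lemma test_function_grad_vanish:
 fixes \<phi> :: "real ^ 'n => real"
 assumes "test_function B \<phi>" "x \<notin> B" shows "grad \<phi> x = 0"
 using test_function_vanish(2)[OF assms] by (intro grad_eqI) simp

lemma test_function_deriv_vanish:
 fixes \<phi> :: "real => real"
 assumes "test_function B \<phi>" "x \<notin> B" shows "deriv \<phi> x = 0"
 using has_real_derivative_frechet[OF test_function_vanish(2)[OF assms]] by (rule DERIV_imp_deriv)

lemma bounded_compact_support:
 fixes f :: "'a::euclidean_space => 'b::real_normed_vector"
 assumes "continuous_on UNIV f" "compact K" "\<And>x. x \<notin> K ==> f x = 0"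
 shows "\<exists>C\<ge>0. \<forall>x. norm (f x) <= C"
proof -
 have "compact (f ` K)" using assms(1,2) by (intro compact_continuous_image) (auto intro: continuous_on_subset)
 then have "bounded (f ` K)" by (rule compact_imp_bounded)
 then obtain C where C: "\<forall>y\<in>f ` K. norm y <= C" unfolding bounded_iff ..
 have "norm (f x) <= max C 0" for x
  using C assms(3)[of x] by (cases "x \<in> K") (auto simp: le_max_iff_disj)
 then show ?thesis by (intro exI[of _ "max C 0"]) auto
qed

lemma test_function_support:
 assumes "test_function B \<phi>" shows "test_function (closure {x. \<phi> x \<noteq> 0}) \<phi>"
 using assms by (simp add: test_function_def)

lemma test_function_bounded:
 fixes \<phi> :: "'a::euclidean_space => real"
 assumes tf: "test_function B \<phi>" shows "\<exists>C\<ge>0. \<forall>x. norm (\<phi> x) <= C"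
proof (rule bounded_compact_support[where K = "closure {x. \<phi> x \<noteq> 0}"])
 have "C_diff 0 \<phi>" using tf unfolding test_function_def by blast
 then show "continuous_on UNIV \<phi>" by simp
 show "compact (closure {x. \<phi> x \<noteq> 0})" using tf unfolding test_function_def by blast
 show "\<phi> x = 0" if "x \<notin> closure {x. \<phi> x \<noteq> 0}" for x
  by (rule test_function_vanish(1)[OF test_function_support[OF tf] that])
qed

lemma test_function_grad_bounded:
 fixes \<phi> :: "real ^ 'n => real"
 assumes tf: "test_function B \<phi>" shows "\<exists>C\<ge>0. \<forall>x. norm (grad \<phi> x) <= C"
proof (rule bounded_compact_support[where K = "closure {x. \<phi> x \<noteq> 0}"])
 show "continuous_on UNIV (grad \<phi>)" using tf by (intro continuous_grad) (simp add: test_function_def)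
 show "compact (closure {x. \<phi> x \<noteq> 0})" using tf unfolding test_function_def by blast
 show "grad \<phi> x = 0" if "x \<notin> closure {x. \<phi> x \<noteq> 0}" for x
  by (rule test_function_grad_vanish[OF test_function_support[OF tf] that])
qed

lemma test_function_has_real_derivative:
 fixes \<phi> :: "real => real"
 assumes tf: "test_function B \<phi>"
 shows "(\<phi> has_real_derivative deriv \<phi> x) (at x)" "deriv \<phi> = (\<lambda>x. frechet_derivative \<phi> (at x) 1)"
proof -
 have "C_diff (Suc 0) \<phi>" using tf unfolding test_function_def by blast
 then have d: "(\<phi> has_real_derivative frechet_derivative \<phi> (at x) 1) (at x)" for x
  by (intro has_real_derivative_frechet C_diff_has_derivative)
 show "deriv \<phi> = (\<lambda>x. frechet_derivative \<phi> (at x) 1)" using DERIV_imp_deriv[OF d] by (rule ext)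
 then show "(\<phi> has_real_derivative deriv \<phi> x) (at x)" using d by simp
qed

lemma test_function_deriv_continuous:
 fixes \<phi> :: "real => real"
 assumes tf: "test_function B \<phi>" shows "continuous_on UNIV (deriv \<phi>)"
proof -
 have "C_diff (Suc 0) \<phi>" using tf unfolding test_function_def by blast
 then show ?thesis unfolding test_function_has_real_derivative(2)[OF tf] by simp
qed

lemma test_function_deriv_bounded:
 fixes \<phi> :: "real => real"
 assumes tf: "test_function B \<phi>" shows "\<exists>C\<ge>0. \<forall>x. norm (deriv \<phi> x) <= C"
proof (rule bounded_compact_support[where K = "closure {x. \<phi> x \<noteq> 0}"])
 show "continuous_on UNIV (deriv \<phi>)" by (rule test_function_deriv_continuous[OF tf])
 show "compact (closure {x. \<phi> x \<noteq> 0})" using tf unfolding test_function_def by blast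
 show "deriv \<phi> x = 0" if "x \<notin> closure {x. \<phi> x \<noteq> 0}" for x
  by (rule test_function_deriv_vanish[OF test_function_support[OF tf] that])
qed

lemma test_function_measurable:
 fixes \<phi> :: "'a::euclidean_space => real"
 assumes "test_function B \<phi>" shows "\<phi> \<in> borel_measurable borel"
proof -
 have "C_diff 0 \<phi>" using assms unfolding test_function_def by blast
 then show ?thesis by (simp add: borel_measurable_continuous_onI)
qed

lemma test_function_grad_measurable:
 fixes \<phi> :: "real ^ 'n => real"
 assumes "test_function B \<phi>" shows "grad \<phi> \<in> borel_measurable borel"
 using assms by (intro borel_measurable_continuous_onI continuous_grad) (simp add: test_function_def)

text \<open>The weak formulation is exploited through products of a function of x and a function of
  t only; their support lies in the product of the supports.\<close>

lemma test_function_product: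
 fixes \<phi> :: "'a::euclidean_space => real" and \<zeta> :: "'b::euclidean_space => real"
 assumes \<phi>: "test_function B \<phi>" and \<zeta>: "test_function I \<zeta>" and sub: "B \<times> I \<subseteq> D"
 shows "test_function D (\<lambda>z. \<phi> (fst z) * \<zeta> (snd z))"
proof -
 let ?K = "closure {x. \<phi> x \<noteq> 0} \<times> closure {x. \<zeta> x \<noteq> 0}"
 have "C_diff j (\<lambda>z. \<phi> (fst z) * \<zeta> (snd z))" for j
 proof -
  have "C_diff j \<phi>" "C_diff j \<zeta>" using \<phi> \<zeta> unfolding test_function_def by blast+
  from C_diff_mult[OF C_diff_compose_linear[OF bounded_linear_fst this(1), of 0]
    C_diff_compose_linear[OF bounded_linear_snd this(2), of 0]]
  show ?thesis by simp
 qed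
 moreover have K: "compact ?K" using \<phi> \<zeta> by (intro compact_Times) (simp_all add: test_function_def)
 have sK: "{z. \<phi> (fst z) * \<zeta> (snd z) \<noteq> 0} \<subseteq> ?K"
  using closure_subset[of "{x. \<phi> x \<noteq> 0}"] closure_subset[of "{x. \<zeta> x \<noteq> 0}"] by auto
 then have c: "closure {z. \<phi> (fst z) * \<zeta> (snd z) \<noteq> 0} \<subseteq> ?K"
  by (rule closure_minimal) (use K compact_imp_closed in blast)
 moreover have "compact (closure {z. \<phi> (fst z) * \<zeta> (snd z) \<noteq> 0})"
  unfolding compact_closure by (rule bounded_subset[OF compact_imp_bounded[OF K] sK])
 moreover have "?K \<subseteq> D" using \<phi> \<zeta> sub by (auto simp: test_function_def)
 ultimately show ?thesis unfolding test_function_def by blast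
qed

lemma Dt_product:
 fixes \<phi> :: "real ^ 'n => real"
 assumes "test_function I \<zeta>"
 shows "Dt (\<lambda>z. \<phi> (fst z) * \<zeta> (snd z)) z = \<phi> (fst z) * deriv \<zeta> (snd z)"
 unfolding Dt_def using DERIV_imp_deriv[OF DERIV_cmult[OF test_function_has_real_derivative(1)[OF assms]]] by simp

lemma Dx_product:
 fixes \<phi> :: "real ^ 'n => real"
 assumes \<phi>: "test_function B \<phi>"
 shows "Dx (\<lambda>z. \<phi> (fst z) * \<zeta> (snd z)) z = \<zeta> (snd z) *\<^sub>R grad \<phi> (fst z)"
proof -
 have "C_diff (Suc 0) \<phi>" using \<phi> unfolding test_function_def by blast
 from C_diff_has_grad[OF this] have "((\<lambda>y. \<phi> y * \<zeta> (snd z)) has_derivative (\<lambda>h. (grad \<phi> (fst z) \<bullet> h) * \<zeta> (snd z))) (at (fst z))"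
  by (rule has_derivative_mult_left)
 then have "grad (\<lambda>y. \<phi> y * \<zeta> (snd z)) (fst z) = \<zeta> (snd z) *\<^sub>R grad \<phi> (fst z)"
  by (intro grad_eqI) (simp add: mult.commute)
 then show ?thesis by (simp add: Dx_def)
qed

lemma test_function_zero: "test_function B (\<lambda>_::'a::euclidean_space. 0)"
 by (simp add: test_function_def C_diff_const)

lemma Dt_zero: "Dt (\<lambda>_. 0) z = 0"
 by (simp add: Dt_def)

lemma Dx_zero: "Dx (\<lambda>_. 0) z = 0"
 by (simp add: Dx_def grad_eqI[OF has_derivative_eq_rhs[OF has_derivative_const]])

lemma in_L2_integrable:
 fixes w :: "'a::euclidean_space => nat => 'b::euclidean_space" and W :: "'a => 'c::euclidean_space"
 assumes w: "in_Lp 2 k D w" and W: "W \<in> borel_measurable borel"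
  and b: "\<And>z. norm (W z) <= fnorm k (w z) * indicator D z"
 shows "integrable lborel (\<lambda>z. (norm (W z))^2)"
proof -
 have i: "integrable lebesgue (\<lambda>z. indicator D z *\<^sub>R fnorm k (w z) powr 2)"
  using w by (simp add: in_Lp_def set_integrable_def)
 have Wm: "(\<lambda>z. (norm (W z))^2) \<in> borel_measurable lborel" using W by measurable
 have "integrable lebesgue (\<lambda>z. (norm (W z))^2)"
 proof (rule bochner_bound[OF i])
  show "(\<lambda>z. (norm (W z))^2) \<in> borel_measurable lebesgue" by (rule measurable_completion[OF Wm])
  show "AE z in lebesgue. norm ((norm (W z))^2) <= norm (indicator D z *\<^sub>R fnorm k (w z) powr 2)"
  proof (rule AE_I2)
   fix z
   have "(norm (W z))^2 <= (fnorm k (w z) * indicator D z)^2" by (intro power_mono b) simp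
   also have "... = norm (indicator D z *\<^sub>R fnorm k (w z) powr 2)"
    using fnorm_nonneg[of k "w z"] by (simp add: indicator_def)
   finally show "norm ((norm (W z))^2) <= norm (indicator D z *\<^sub>R fnorm k (w z) powr 2)" by simp
  qed
 qed
 then show ?thesis using integrable_completion[OF Wm] by simp
qed

lemma integrable_bounded_set:
 fixes f :: "'a::euclidean_space => 'b::euclidean_space"
 assumes [measurable]: "f \<in> borel_measurable borel" "X \<in> sets borel" and "bounded X"
  and b: "\<And>x. norm (f x) <= c" "\<And>x. x \<notin> X ==> f x = 0"
 shows "integrable lborel f"
proof (rule bochner_bound)
 show "integrable lborel (\<lambda>x. c * indicator X x)"
  using emeasure_bounded_finite[OF \<open>bounded X\<close>] by (simp add: integrable_indicator_iff)
 show "AE x in lborel. norm (f x) <= norm (c * indicator X x)"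
 proof (rule AE_I2)
  fix x show "norm (f x) <= norm (c * indicator X x)"
   using b(1)[of x] b(2)[of x] by (cases "x \<in> X") auto
 qed
qed measurable

lemma integrable_L2_bounded_set:
 fixes f :: "'a::euclidean_space => 'b::euclidean_space"
 assumes [measurable]: "f \<in> borel_measurable borel" "X \<in> sets borel" and "bounded X"
  and f: "integrable lborel (\<lambda>x. (norm (f x))^2)" "\<And>x. x \<notin> X ==> f x = 0"
 shows "integrable lborel f"
proof (rule bochner_bound)
 show "integrable lborel (\<lambda>x. indicator X x + (norm (f x))^2)"
  using emeasure_bounded_finite[OF \<open>bounded X\<close>] f(1) by (simp add: integrable_indicator_iff)
 have "norm (f x) <= indicator X x + (norm (f x))^2" for x
  using abs_le_one_plus_sq[of "norm (f x)"] f(2)[of x] by (cases "x \<in> X") simp_all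
 then show "AE x in lborel. norm (f x) <= norm (indicator X x + (norm (f x))^2)" by (intro AE_I2) simp
qed measurable

lemma integrable_mult_bounded:
 fixes f :: "'a::euclidean_space => 'b::euclidean_space" and h :: "'a => 'c::euclidean_space" and p :: "'a => 'd::euclidean_space"
 assumes f: "integrable lborel f" and p: "p \<in> borel_measurable borel" "\<And>x. norm (p x) <= c * norm (f x)"
 shows "integrable lborel p"
proof (rule bochner_bound)
 show "integrable lborel (\<lambda>x. c * norm (f x))" using f by simp
 show "AE x in lborel. norm (p x) <= norm (c * norm (f x))"
  using p(2) by (intro AE_I2) (auto intro: order_trans[OF _ abs_ge_self])
qed (use p in simp)

text \<open>Q' is a Borel subset of Q of full measure on which the conditions known almost
  everywhere hold at each point. The representatives are set to zero off Q', where the inequalities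
  hold trivially, so that they become valid everywhere.\<close>

locale cylinder_data = cylinder_sol k m \<nu> L \<Omega> Tf a f g u x0 \<rho> t1 t2 M
 for k m \<nu> L and \<Omega> :: "(real ^ 'n) set" and Tf a f g u x0 \<rho> t1 t2 M +
 fixes U :: "nat => (real ^ 'n) \<times> real => real" and G A F :: "nat => (real ^ 'n) \<times> real => real ^ 'n"
  and Q' :: "((real ^ 'n) \<times> real) set"
 assumes meas[measurable]: "\<And>i. U i \<in> borel_measurable borel" "\<And>i. G i \<in> borel_measurable borel"
  "\<And>i. A i \<in> borel_measurable borel" "\<And>i. F i \<in> borel_measurable borel" "Q' \<in> sets borel"
  and Q': "Q' \<subseteq> Q" "AE z in lborel. z \<in> Q --> z \<in> Q'"
  and eq: "\<And>z i. z \<in> Q' ==> U i z = u z i \<and> G i z = g z i \<and> A i z = a z (u z) (g z) i \<and> F i z = f z i"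
  and zero: "\<And>z i. z \<notin> Q' \<or> i \<ge> k ==> U i z = 0 \<and> G i z = 0 \<and> A i z = 0 \<and> F i z = 0"
  and u_le: "\<And>z. z \<in> Q' ==> fnorm k (u z) <= M"
  and ell: "\<And>z. z \<in> Q' ==> finner k (a z (u z) (g z)) (g z) \<ge> \<nu> * (fnorm k (g z))^2"
  and gro: "\<And>z. z \<in> Q' ==> fnorm k (a z (u z) (g z)) <= L * fnorm k (g z)"
  and sgn: "\<And>z. z \<in> Q' ==> (\<Sum>\<alpha>\<in>UNIV. finner k (column (a z (u z) (g z)) \<alpha>) (signed_pow k m (u z)) *
          finner k (column (g z) \<alpha>) (signed_pow k m (u z))) \<ge> 0"

context cylinder_sol
begin

text \<open>Measurability of the field along the solution rests on its continuity at every point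
  considered. Therefore the exceptional null set N is removed first and
  \<open>caratheodory_measurable\<close> is applied on Q - N; a second null set accounts for the
  Borel representative of the field.\<close>

lemma cylinder_data_exists: "\<exists>U G A F Q'. cylinder_data k m \<nu> L \<Omega> Tf a f g u x0 \<rho> t1 t2 M U G A F Q'"
proof -
 have gm: "(\<lambda>z. g z i) \<in> borel_measurable (lebesgue_on D)" if "i < k" for i
  using g2 that by (auto simp: in_Lp_def)
 have fm: "(\<lambda>z. f z i) \<in> borel_measurable (lebesgue_on D)" if "i < k" for i
  using f2 that by (auto simp: in_Lp_def)
 have fv: "u z \<in> fvec k" "g z \<in> fvec k" "f z \<in> fvec k" "a z (u z) (g z) \<in> fvec k" if "z \<in> D" for z
  using that u_fvec g2 f2 car by (auto simp: in_Lp_def caratheodory_def)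
 have "\<exists>h. h \<in> borel_measurable borel \<and> (i < k --> (AE z in lborel. z \<in> Q --> u z i = h z))" for i
  by (cases "i < k") (simp add: borel_version[OF u_meas Q_meas Q_sub], auto intro: exI[of _ "\<lambda>_. 0"])
 from choice[OF allI[OF this]] obtain hu where
  "\<forall>i. hu i \<in> borel_measurable borel \<and> (i < k --> (AE z in lborel. z \<in> Q --> u z i = hu i z))" ..
 then have hu: "\<And>i. hu i \<in> borel_measurable borel" "\<And>i. i < k ==> AE z in lborel. z \<in> Q --> u z i = hu i z" by simp_all
 have "\<exists>h. h \<in> borel_measurable borel \<and> (i < k --> (AE z in lborel. z \<in> Q --> g z i = h z))" for i
  by (cases "i < k") (simp add: borel_version_vec[OF gm Q_meas Q_sub], auto intro: exI[of _ "\<lambda>_. 0"])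
 from choice[OF allI[OF this]] obtain hg where
  "\<forall>i. hg i \<in> borel_measurable borel \<and> (i < k --> (AE z in lborel. z \<in> Q --> g z i = hg i z))" ..
 then have hg: "\<And>i. hg i \<in> borel_measurable borel" "\<And>i. i < k ==> AE z in lborel. z \<in> Q --> g z i = hg i z" by simp_all
 have "\<exists>h. h \<in> borel_measurable borel \<and> (i < k --> (AE z in lborel. z \<in> Q --> f z i = h z))" for i
  by (cases "i < k") (simp add: borel_version_vec[OF fm Q_meas Q_sub], auto intro: exI[of _ "\<lambda>_. 0"])
 from choice[OF allI[OF this]] obtain hf where
  "\<forall>i. hf i \<in> borel_measurable borel \<and> (i < k --> (AE z in lborel. z \<in> Q --> f z i = hf i z))" ..
 then have hf: "\<And>i. hf i \<in> borel_measurable borel" "\<And>i. i < k ==> AE z in lborel. z \<in> Q --> f z i = hf i z" by simp_all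
 have h_all: "AE z in lborel. \<forall>i\<in>{..<k}. z \<in> Q --> u z i = hu i z \<and> g z i = hg i z \<and> f z i = hf i z"
 proof (subst AE_ball_countable)
  show "\<forall>i\<in>{..<k}. AE z in lborel. z \<in> Q --> u z i = hu i z \<and> g z i = hg i z \<and> f z i = hf i z"
  proof
   fix i assume "i \<in> {..<k}"
   then have i: "i < k" by simp
   show "AE z in lborel. z \<in> Q --> u z i = hu i z \<and> g z i = hg i z \<and> f z i = hf i z"
    using hu(2)[OF i] hg(2)[OF i] hf(2)[OF i] by eventually_elim blast
  qed
 qed simp
 have "AE z in lebesgue. z \<in> Q -->
  ((\<forall>i<k. u z i = hu i z \<and> g z i = hg i z \<and> f z i = hf i z) \<and> fnorm k (u z) <= M \<and>
  (\<forall>i<k. continuous_on (fvec k \<times> fvec k) (\<lambda>(u, \<xi>). a z u \<xi> i)) \<and>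
  (\<forall>u\<in>fvec k. \<forall>\<xi>\<in>fvec k. finner k (a z u \<xi>) \<xi> \<ge> \<nu> * (fnorm k \<xi>)^2) \<and>
  (\<forall>u\<in>fvec k. \<forall>\<xi>\<in>fvec k. fnorm k (a z u \<xi>) <= L * fnorm k \<xi>) \<and>
  (\<forall>u\<in>fvec k. \<forall>\<xi>\<in>fvec k.
    (\<Sum>\<alpha>\<in>UNIV. finner k (column (a z u \<xi>) \<alpha>) (signed_pow k m u) *
          finner k (column \<xi> \<alpha>) (signed_pow k m u)) \<ge> 0))" (is "AE z in lebesgue. z \<in> Q --> ?P z")
  using AE_completion[OF h_all] bound conjunct2[OF conjunct2[OF car[unfolded caratheodory_def]]]
   G1[unfolded G1_def] G2[unfolded G2_def] G3[unfolded G3_def]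
 proof eventually_elim
  case (elim z)
  show ?case
  proof
   assume z: "z \<in> Q"
   then have zD: "z \<in> D" using Q_sub by blast
   show "?P z"
    using elim(1)[rule_format, OF _ z] elim(2)[rule_format, OF z] elim(3)[rule_format, OF zD]
     elim(4)[rule_format, OF zD] elim(5)[rule_format, OF zD] elim(6)[rule_format, OF zD] by blast
  qed
 qed
 from AE_lebesgue_null[OF this] obtain N where N: "N \<in> sets borel" "AE z in lborel. z \<notin> N"
  and N3: "\<And>z. z \<notin> N ==> z \<in> Q --> ?P z" by blast
 have good: "?P z" if "z \<in> Q - N" for z using N3[of z] that by blast
 have QN: "Q - N \<in> sets borel" "Q - N \<subseteq> D" using Q_meas N(1) Q_sub by auto
 have am: "(\<lambda>z. a z (u z) (g z) i) \<in> borel_measurable (lebesgue_on (Q - N))" if i: "i < k" for i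
 proof -
  let ?M = "lebesgue_on (Q - N)"
  have sp: "space ?M = Q - N" by simp
  have "(\<lambda>z. (\<lambda>(u, \<xi>). a z u \<xi> i) (u z, g z)) \<in> borel_measurable ?M"
  proof (rule caratheodory_measurable[where P = "fvec k \<times> fvec k" and \<pi> = "\<lambda>p. (trunc k (fst p), trunc k (snd p))"])
   fix p assume "p \<in> (fvec k :: (nat => real) set) \<times> (fvec k :: (nat => real ^ 'n) set)"
   then have "(\<lambda>z. a z (fst p) (snd p) i) \<in> borel_measurable (lebesgue_on D)"
    using car i by (auto simp: caratheodory_def)
   from measurable_restrict_mono[OF this QN(2)]
   show "(\<lambda>z. (\<lambda>(u, \<xi>). a z u \<xi> i) p) \<in> borel_measurable ?M" by (simp add: case_prod_beta)
  next
   fix z assume "z \<in> space ?M"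
   then show "continuous_on (fvec k \<times> fvec k) (\<lambda>(u, \<xi>). a z u \<xi> i)" using good[of z] i by simp
  next
   have 1: "u \<in> borel_measurable ?M"
   proof (rule measurable_coordinatewise_then_product)
    fix j show "(\<lambda>z. u z j) \<in> borel_measurable ?M"
    proof (cases "j < k")
     case True
     show ?thesis by (rule measurable_restrict_mono[OF u_meas[OF True] QN(2)])
    next
     case False
     then have "u z j = 0" if "z \<in> space ?M" for z using that fv(1)[of z] QN(2) by (auto simp: fvec_def)
     then show ?thesis by (subst measurable_cong[of _ _ "\<lambda>_. 0"]) auto
    qed
   qed
   have 2: "g \<in> borel_measurable ?M"
   proof (rule measurable_coordinatewise_then_product)
    fix j show "(\<lambda>z. g z j) \<in> borel_measurable ?M"
    proof (cases "j < k")
     case True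
     show ?thesis by (rule measurable_restrict_mono[OF gm[OF True] QN(2)])
    next
     case False
     then have "g z j = 0" if "z \<in> space ?M" for z using that fv(2)[of z] QN(2) by (auto simp: fvec_def)
     then show ?thesis by (subst measurable_cong[of _ _ "\<lambda>_. 0"]) auto
    qed
   qed
   show "(\<lambda>z. (u z, g z)) \<in> borel_measurable ?M" by (rule borel_measurable_Pair[OF 1 2])
  next
   fix z assume "z \<in> space ?M"
   then show "(u z, g z) \<in> fvec k \<times> fvec k" using fv QN(2) by auto
  next
   show "continuous_on UNIV (\<lambda>p. (trunc k (fst p) :: nat => real, trunc k (snd p) :: nat => real ^ 'n))"
    by (intro continuous_on_Pair continuous_on_compose2[OF continuous_trunc[of UNIV]] continuous_on_fst continuous_on_snd continuous_on_id) auto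
  qed (auto simp: trunc_fvec)
  then show ?thesis by simp
 qed
 have "\<exists>h. h \<in> borel_measurable borel \<and> (i < k --> (AE z in lborel. z \<in> Q - N --> a z (u z) (g z) i = h z))" for i
  by (cases "i < k") (simp add: borel_version_vec[OF am QN(1) order_refl] del: Diff_iff, auto intro: exI[of _ "\<lambda>_. 0"])
 from choice[OF allI[OF this]] obtain ha where
  "\<forall>i. ha i \<in> borel_measurable borel \<and> (i < k --> (AE z in lborel. z \<in> Q - N --> a z (u z) (g z) i = ha i z))" ..
 then have ha: "\<And>i. ha i \<in> borel_measurable borel" "\<And>i. i < k ==> AE z in lborel. z \<in> Q - N --> a z (u z) (g z) i = ha i z" by simp_all
 have "AE z in lborel. \<forall>i\<in>{..<k}. z \<in> Q - N --> a z (u z) (g z) i = ha i z"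
  using ha(2) by (subst AE_ball_countable) auto
 from AE_lebesgue_null[OF AE_completion[OF this]] obtain N2 where N2: "N2 \<in> sets borel" "AE z in lborel. z \<notin> N2"
  "\<And>z. z \<notin> N2 ==> \<forall>i\<in>{..<k}. z \<in> Q - N --> a z (u z) (g z) i = ha i z" by blast
 define Q' where "Q' = Q - N - N2"
 have Q'm: "Q' \<in> sets borel" using QN N2 by (auto simp: Q'_def)
 have Q': "z \<in> Q - N" "z \<in> D" "z \<notin> N2" if "z \<in> Q'" for z using that Q_sub by (auto simp: Q'_def)
 define U where "U i z = (if z \<in> Q' \<and> i < k then hu i z else 0)" for i z
 define G where "G i z = (if z \<in> Q' \<and> i < k then hg i z else 0)" for i z
 define A where "A i z = (if z \<in> Q' \<and> i < k then ha i z else 0)" for i z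
 define F where "F i z = (if z \<in> Q' \<and> i < k then hf i z else 0)" for i z
 have "cylinder_data k m \<nu> L \<Omega> Tf a f g u x0 \<rho> t1 t2 M U G A F Q'"
 proof (rule cylinder_data.intro[OF cylinder_sol_axioms cylinder_data_axioms.intro])
  have ifm: "(\<lambda>z. if z \<in> Q' \<and> i < k then h i z else 0) \<in> borel_measurable borel" if "h i \<in> borel_measurable borel"
   for i and h :: "nat => (real ^ 'n) \<times> real => 'b::euclidean_space"
  proof (cases "i < k")
   case True
   have "(\<lambda>z. if z \<in> Q' then h i z else 0) \<in> borel_measurable borel"
    using that Q'm by (intro measurable_If_set) auto
   then show ?thesis using True by simp
  qed simp
  show "U i \<in> borel_measurable borel" "G i \<in> borel_measurable borel" "A i \<in> borel_measurable borel" "F i \<in> borel_measurable borel" for i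
   unfolding U_def[abs_def] G_def[abs_def] A_def[abs_def] F_def[abs_def] by (rule ifm, rule hu hg ha hf)+
  show "Q' \<in> sets borel" by (rule Q'm)
  show "Q' \<subseteq> Q" by (auto simp: Q'_def)
  show "AE z in lborel. z \<in> Q --> z \<in> Q'" using N(2) N2(2) by eventually_elim (auto simp: Q'_def)
  fix z
  show "U i z = u z i \<and> G i z = g z i \<and> A i z = a z (u z) (g z) i \<and> F i z = f z i"
   if z: "z \<in> Q'" for i
  proof (cases "i < k")
   case True
   then show ?thesis using z good[OF Q'(1)[OF z]] N2(3)[OF Q'(3)[OF z]] Q'(1)[OF z] by (simp add: U_def G_def A_def F_def)
  next
   case False
   then show ?thesis using fv[OF Q'(2)[OF z]] by (simp add: fvec_def U_def G_def A_def F_def)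
  qed
  assume z: "z \<in> Q'"
  note fvz = fv[OF Q'(2)[OF z]] and gz = good[OF Q'(1)[OF z]]
  show "fnorm k (u z) <= M" using gz by blast
  show "finner k (a z (u z) (g z)) (g z) \<ge> \<nu> * (fnorm k (g z))^2" using gz fvz by blast
  show "fnorm k (a z (u z) (g z)) <= L * fnorm k (g z)" using gz fvz by blast
  show "(\<Sum>\<alpha>\<in>UNIV. finner k (column (a z (u z) (g z)) \<alpha>) (signed_pow k m (u z)) *
          finner k (column (g z) \<alpha>) (signed_pow k m (u z))) \<ge> 0" using gz fvz by blast
 qed (auto simp: U_def G_def A_def F_def)
 then show ?thesis by (intro exI)
qed

end

section \<open>Verification of the properties of a local solution\<close>

context cylinder_data
begin

abbreviation "S z \<equiv> sqrt (sqn k U z)"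
abbreviation "V i z \<equiv> S z powr (m - 1) * U i z"

lemma Q_bdd: "bounded Q"
 by (intro bounded_Times) auto

lemma S_fnorm: "z \<in> Q' ==> S z = fnorm k (u z)"
 using eq by (simp add: sqn_def fnorm_def L2_set_def)

lemma S_zero: "z \<notin> Q' ==> S z = 0"
 using zero by (simp add: sqn_def)

lemma V_eq: "z \<in> Q' ==> V i z = signed_pow k m (u z) i"
 using S_fnorm eq by (simp add: signed_pow_def)

lemma S_le: "S z <= M"
 using S_fnorm[of z] S_zero[of z] u_le[of z] M by (cases "z \<in> Q'") auto

lemma U_le: "\<bar>U i z\<bar> <= M"
proof (cases "i < k")
 case True
 have "(U i z)^2 <= sqn k U z"
  unfolding sqn_def by (rule member_le_sum) (use True in auto)
 then have "\<bar>U i z\<bar> <= S z" by (intro real_le_rsqrt) simp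
 then show ?thesis using S_le[of z] by simp
next
 case False
 then show ?thesis using zero[of z i] M by simp
qed

lemma sqn_G: "z \<in> Q' ==> (\<Sum>i<k. (norm (G i z))^2) = (fnorm k (g z))^2"
 "z \<in> Q' ==> (\<Sum>i<k. (norm (A i z))^2) = (fnorm k (a z (u z) (g z)))^2"
 using eq by (simp_all add: fnorm_sq)

lemma growth: "(\<Sum>i<k. (norm (A i z))^2) <= L^2 * (\<Sum>i<k. (norm (G i z))^2)"
proof (cases "z \<in> Q'")
 case True
 have "(fnorm k (a z (u z) (g z)))^2 <= (L * fnorm k (g z))^2"
  by (rule power_mono[OF gro[OF True] fnorm_nonneg])
 then show ?thesis using True by (simp add: sqn_G power_mult_distrib)
qed (use zero in simp)

lemma ellipticity: "\<nu> * (\<Sum>i<k. (norm (G i z))^2) <= (\<Sum>i<k. A i z \<bullet> G i z)"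
proof (cases "z \<in> Q'")
 case True
 then show ?thesis using ell[OF True] eq[OF True] unfolding sqn_G(1)[OF True] by (simp add: finner_def)
qed (use zero in simp)

text \<open>The sum over \<alpha> in (G3) is the inner product in R^N of the two vectors displayed
  here: \<open>column\<close> collects the \<alpha>-th coordinates of all components.\<close>

lemma sign: "(\<Sum>i<k. V i z *\<^sub>R A i z) \<bullet> (\<Sum>i<k. V i z *\<^sub>R G i z) \<ge> 0"
proof (cases "z \<in> Q'")
 case True
 have "(\<Sum>i<k. V i z *\<^sub>R A i z) \<bullet> (\<Sum>i<k. V i z *\<^sub>R G i z) =
  (\<Sum>\<alpha>\<in>UNIV. finner k (column (a z (u z) (g z)) \<alpha>) (signed_pow k m (u z)) *
          finner k (column (g z) \<alpha>) (signed_pow k m (u z)))"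
  unfolding inner_vec_def V_eq[OF True]
  using eq[OF True] by (simp add: finner_def column_def mult.commute)
 then show ?thesis using sgn[OF True] by simp
qed (use zero in simp)

lemma G_L2: "integrable lborel (\<lambda>z. (norm (G i z))^2)"
proof (rule in_L2_integrable[OF g2])
 show "norm (G i z) <= fnorm k (g z) * indicator D z" for z
  using zero[of z i] eq[of z i] norm_le_fnorm[of i k "g z"] Q_sub Q' by (cases "z \<in> Q' \<and> i < k") (auto simp: fnorm_nonneg split: split_indicator)
qed simp

lemma F_L2: "integrable lborel (\<lambda>z. (norm (F i z))^2)"
proof (rule in_L2_integrable[OF f2])
 show "norm (F i z) <= fnorm k (f z) * indicator D z" for z
  using zero[of z i] eq[of z i] norm_le_fnorm[of i k "f z"] Q_sub Q' by (cases "z \<in> Q' \<and> i < k") (auto simp: fnorm_nonneg split: split_indicator)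
qed simp

lemma A_L2: "integrable lborel (\<lambda>z. (norm (A i z))^2)"
proof (rule bochner_bound)
 show "integrable lborel (\<lambda>z. L^2 * (\<Sum>i<k. (norm (G i z))^2))" using G_L2 by simp
 have "(norm (A i z))^2 <= (\<Sum>i<k. (norm (A i z))^2)" for z
 proof (cases "i < k")
  case True
  then show ?thesis by (intro member_le_sum) auto
 next
  case False
  then show ?thesis using zero[of z i] by (simp add: sum_nonneg)
 qed
 then have "(norm (A i z))^2 <= L^2 * (\<Sum>i<k. (norm (G i z))^2)" for z using growth order_trans by blast
 then show "AE z in lborel. norm ((norm (A i z))^2) <= norm (L^2 * (\<Sum>i<k. (norm (G i z))^2))"
  by (intro AE_I2) (auto intro: order_trans[OF _ abs_ge_self])
qed measurable

lemma outside: "z \<notin> Q \<or> i \<ge> k ==> U i z = 0 \<and> G i z = 0 \<and> A i z = 0 \<and> F i z = 0"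
 using zero[of z i] Q' by blast

lemma A_int: "integrable lborel (A i)" and F_int: "integrable lborel (F i)"
 using integrable_L2_bounded_set[OF _ Q_meas Q_bdd A_L2] integrable_L2_bounded_set[OF _ Q_meas Q_bdd F_L2] outside by simp_all

text \<open>The second condition says that almost all of the slice lies in Q', so that on it the
  representatives agree with u and g almost everywhere.\<close>

definition T where "T = {t \<in> {t1<..<t2}. has_W12_gradient k \<Omega> (\<lambda>x. signed_pow k m (u (x, t))) (\<lambda>x. g (x, t)) \<and>
 (AE x in lborel. x \<in> ball x0 \<rho> --> (x, t) \<in> Q')}"

lemma T_full: "AE t in lborel. t \<in> {t1<..<t2} --> t \<in> T"
proof -
 have "AE t in lborel. t \<in> {0<..<Tf} --> has_W12_gradient k \<Omega> (\<lambda>x. signed_pow k m (u (x, t))) (\<lambda>x. g (x, t))"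
  using g_slices by (simp add: AE_completion_iff)
 then show ?thesis using AE_lborel_prod[OF Q'(2)]
 proof eventually_elim
  case (elim t)
  show ?case
  proof
   assume t: "t \<in> {t1<..<t2}"
   have "AE x in lborel. x \<in> ball x0 \<rho> --> (x, t) \<in> Q'"
    using elim(2) by eventually_elim (use t in auto)
   then show "t \<in> T" using t elim(1) ts unfolding T_def by auto
  qed
 qed
qed

lemma T_sub: "T \<subseteq> {t1<..<t2}"
 by (auto simp: T_def)

text \<open>The test function is \<phi>(x) \<zeta>(t) in the i-th component and zero in the others,
  which isolates one equation of the system. It vanishes off Q, so the integrals can be moved to the
  Borel representatives.\<close>

lemma weak_product:
 assumes i: "i < k" and \<phi>: "test_function (ball x0 \<rho>) \<phi>" and \<zeta>: "test_function {t1<..<t2} \<zeta>"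
 shows "(LBINT z. U i z * (\<phi> (fst z) * deriv \<zeta> (snd z))) =
  (LBINT z. ((A i z + F i z) \<bullet> grad \<phi> (fst z)) * \<zeta> (snd z))"
  and "integrable lborel (\<lambda>z. U i z * (\<phi> (fst z) * deriv \<zeta> (snd z)))"
  and "integrable lborel (\<lambda>z. ((A i z + F i z) \<bullet> grad \<phi> (fst z)) * \<zeta> (snd z))"
proof -
 note [measurable] = test_function_measurable[OF \<phi>] test_function_measurable[OF \<zeta>] test_function_grad_measurable[OF \<phi>]
  borel_measurable_continuous_onI[OF test_function_deriv_continuous[OF \<zeta>]]
 obtain c1 where c1: "c1 \<ge> 0" "\<forall>x. norm (\<phi> x) <= c1" using test_function_bounded[OF \<phi>] by blast
 obtain c2 where c2: "c2 \<ge> 0" "\<forall>x. norm (grad \<phi> x) <= c2" using test_function_grad_bounded[OF \<phi>] by blast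
 obtain c3 where c3: "c3 \<ge> 0" "\<forall>x. norm (\<zeta> x) <= c3" using test_function_bounded[OF \<zeta>] by blast
 obtain c4 where c4: "c4 \<ge> 0" "\<forall>x. norm (deriv \<zeta> x) <= c4" using test_function_deriv_bounded[OF \<zeta>] by blast
 show iU: "integrable lborel (\<lambda>z. U i z * (\<phi> (fst z) * deriv \<zeta> (snd z)))"
 proof (rule integrable_bounded_set[OF _ Q_meas Q_bdd])
  show "norm (U i z * (\<phi> (fst z) * deriv \<zeta> (snd z))) <= M * (c1 * c4)" for z
   unfolding norm_mult using U_le[of i z] c1 c4 M by (intro mult_mono) auto
  show "U i z * (\<phi> (fst z) * deriv \<zeta> (snd z)) = 0" if "z \<notin> Q" for z using outside[of z i] that by simp
 qed measurable
 have iP: "integrable lborel (\<lambda>z. (P z \<bullet> grad \<phi> (fst z)) * \<zeta> (snd z))" if P: "integrable lborel P" for P :: "(real ^ 'n) \<times> real => real ^ 'n"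
 proof (rule integrable_mult_bounded[OF P, where c = "c2 * c3"])
  note [measurable] = borel_measurable_integrable[OF P]
  show "(\<lambda>z. (P z \<bullet> grad \<phi> (fst z)) * \<zeta> (snd z)) \<in> borel_measurable borel" by measurable
  show "norm ((P z \<bullet> grad \<phi> (fst z)) * \<zeta> (snd z)) <= c2 * c3 * norm (P z)" for z
  proof -
   have "norm (P z \<bullet> grad \<phi> (fst z)) <= norm (P z) * norm (grad \<phi> (fst z))" using Cauchy_Schwarz_ineq2 by simp
   also have "... <= norm (P z) * c2" using c2 by (intro mult_left_mono) auto
   finally have "norm (P z \<bullet> grad \<phi> (fst z)) * norm (\<zeta> (snd z)) <= (norm (P z) * c2) * c3" using c3 c2 by (intro mult_mono) auto
   then show ?thesis unfolding norm_mult by (simp add: mult_ac)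
  qed
 qed
 have "integrable lborel (\<lambda>z. A i z + F i z)" using A_int F_int by simp
 from iP[OF this] show "integrable lborel (\<lambda>z. ((A i z + F i z) \<bullet> grad \<phi> (fst z)) * \<zeta> (snd z))" .
 note iA = iP[OF A_int[of i]] and iF = iP[OF F_int[of i]]
 let ?\<Phi> = "\<lambda>j. if j = i then (\<lambda>z. \<phi> (fst z) * \<zeta> (snd z)) else (\<lambda>_. 0)"
 have tf: "test_function (\<Omega> \<times> {0<..<Tf}) (?\<Phi> j)" for j
 proof -
  have "Q \<subseteq> \<Omega> \<times> {0<..<Tf}" using sub ts by force
  from test_function_product[OF \<phi> \<zeta> this] show ?thesis by (simp add: test_function_zero)
 qed
 have pick: "finner k w (\<lambda>j. if j = i then c else 0) = w i \<bullet> c" for w :: "nat => 'c::real_inner" and c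
  using i by (simp add: finner_def if_distrib[of "\<lambda>x. _ \<bullet> x"] cong: if_cong)
 have Dt\<Phi>: "(\<lambda>j. Dt (?\<Phi> j) z) = (\<lambda>j. if j = i then \<phi> (fst z) * deriv \<zeta> (snd z) else 0)" for z
  using Dt_product[OF \<zeta>, of \<phi> z] Dt_zero[of z] by (intro ext) simp
 have Dx\<Phi>: "(\<lambda>j. Dx (?\<Phi> j) z) = (\<lambda>j. if j = i then \<zeta> (snd z) *\<^sub>R grad \<phi> (fst z) else 0)" for z
  using Dx_product[OF \<phi>, of \<zeta> z] Dx_zero[of z] by (intro ext) simp
 have off: "\<phi> (fst z) * deriv \<zeta> (snd z) = 0" "\<zeta> (snd z) *\<^sub>R grad \<phi> (fst z) = 0" if "z \<notin> Q" for z
 proof -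
  have "fst z \<notin> ball x0 \<rho> \<or> snd z \<notin> {t1<..<t2}" using that by (auto simp: mem_Times_iff)
  then show "\<phi> (fst z) * deriv \<zeta> (snd z) = 0" "\<zeta> (snd z) *\<^sub>R grad \<phi> (fst z) = 0"
   using test_function_vanish(1)[OF \<phi>] test_function_grad_vanish[OF \<phi>] test_function_vanish(1)[OF \<zeta>] test_function_deriv_vanish[OF \<zeta>]
   by (auto)
 qed
 have "(LBINT z. U i z * (\<phi> (fst z) * deriv \<zeta> (snd z)) - (A i z \<bullet> grad \<phi> (fst z)) * \<zeta> (snd z)) =
   (LINT z:\<Omega> \<times> {0<..Tf}|lebesgue. finner k (u z) (\<lambda>i. Dt (?\<Phi> i) z) - finner k (a z (u z) (g z)) (\<lambda>i. Dx (?\<Phi> i) z))"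
  unfolding set_lebesgue_integral_def Dt\<Phi> Dx\<Phi> pick
 proof (rule lebesgue_AE_borel_integral[symmetric])
  show "(\<lambda>z. U i z * (\<phi> (fst z) * deriv \<zeta> (snd z)) - (A i z \<bullet> grad \<phi> (fst z)) * \<zeta> (snd z)) \<in> borel_measurable borel" by measurable
  show "AE z in lborel. indicator D z *\<^sub>R (u z i \<bullet> (\<phi> (fst z) * deriv \<zeta> (snd z)) - a z (u z) (g z) i \<bullet> \<zeta> (snd z) *\<^sub>R grad \<phi> (fst z)) =
    U i z * (\<phi> (fst z) * deriv \<zeta> (snd z)) - (A i z \<bullet> grad \<phi> (fst z)) * \<zeta> (snd z)"
   using Q'(2)
  proof eventually_elim
   case (elim z)
   show ?case
   proof (cases "z \<in> Q")
    case True
    then have "z \<in> D" "z \<in> Q'" using elim Q_sub by auto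
    then show ?thesis using eq[of z i] by (simp add: mult.commute)
   next
    case False
    then show ?thesis unfolding off[OF False] using outside[of z i] by simp
   qed
  qed
 qed
 also have "... = (LINT z:\<Omega> \<times> {0<..Tf}|lebesgue. finner k (f z) (\<lambda>i. Dx (?\<Phi> i) z))"
  by (rule weak[OF tf])
 also have "... = (LBINT z. (F i z \<bullet> grad \<phi> (fst z)) * \<zeta> (snd z))"
  unfolding set_lebesgue_integral_def Dx\<Phi> pick
 proof (rule lebesgue_AE_borel_integral)
  show "(\<lambda>z. (F i z \<bullet> grad \<phi> (fst z)) * \<zeta> (snd z)) \<in> borel_measurable borel" by measurable
  show "AE z in lborel. indicator D z *\<^sub>R (f z i \<bullet> \<zeta> (snd z) *\<^sub>R grad \<phi> (fst z)) = (F i z \<bullet> grad \<phi> (fst z)) * \<zeta> (snd z)"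
   using Q'(2)
  proof eventually_elim
   case (elim z)
   show ?case
   proof (cases "z \<in> Q")
    case True
    then have "z \<in> D" "z \<in> Q'" using elim Q_sub by auto
    then show ?thesis using eq[of z i] by (simp add: mult.commute)
   next
    case False
    then show ?thesis unfolding off[OF False] using outside[of z i] by simp
   qed
  qed
 qed
 finally have "(LBINT z. U i z * (\<phi> (fst z) * deriv \<zeta> (snd z))) - (LBINT z. (A i z \<bullet> grad \<phi> (fst z)) * \<zeta> (snd z)) =
  (LBINT z. (F i z \<bullet> grad \<phi> (fst z)) * \<zeta> (snd z))"
  unfolding bochner_diff[OF iU iA] .
 moreover have "(LBINT z. ((A i z + F i z) \<bullet> grad \<phi> (fst z)) * \<zeta> (snd z)) =
   (LBINT z. (A i z \<bullet> grad \<phi> (fst z)) * \<zeta> (snd z)) + (LBINT z. (F i z \<bullet> grad \<phi> (fst z)) * \<zeta> (snd z))"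
  unfolding inner_add_left distrib_right by (rule Bochner_Integration.integral_add[OF iA iF])
 ultimately show "(LBINT z. U i z * (\<phi> (fst z) * deriv \<zeta> (snd z))) =
  (LBINT z. ((A i z + F i z) \<bullet> grad \<phi> (fst z)) * \<zeta> (snd z))" by linarith
qed

end

lemma powr_add_le:
 assumes "0 <= a" "0 <= b" "0 <= q"
 shows "(a + b) powr q <= 2 powr q * (a powr q + b powr q :: real)"
proof -
 have "(a + b) powr q <= (2 * max a b) powr q" using assms by (intro powr_mono2) auto
 also have "... = 2 powr q * (max a b) powr q" by (rule powr_mult)
 also have "(max a b) powr q <= a powr q + b powr q" by (cases "a <= b") simp_all
 finally show ?thesis by (simp add: mult_left_mono)
qed

text \<open>Integrated over a set of finite measure, this bounds an L^1 norm by \<delta> times the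
  measure plus a multiple of the integral of y^(1+m).\<close>

lemma young_small:
 fixes y \<delta> m :: real
 assumes "y \<ge> 0" "\<delta> > 0" "m > 0" shows "y <= \<delta> + \<delta> powr (- m) * y powr (1 + m)"
proof (cases "y <= \<delta>")
 case True
 then show ?thesis using assms by (simp add: add_increasing2)
next
 case False
 then have "1 <= (y / \<delta>) powr m" using assms by (intro ge_one_powr_ge_zero) auto
 then have "y * 1 <= y * (y / \<delta>) powr m" using assms by (intro mult_left_mono) auto
 also have "... = \<delta> powr (- m) * y powr (1 + m)"
  using assms False by (simp add: powr_divide powr_minus powr_add field_simps)
 finally show ?thesis using assms by linarith
qed

context cylinder_data
begin

lemma T_slice:
 assumes "t \<in> T"
 shows "has_W12_gradient k \<Omega> (\<lambda>x. signed_pow k m (u (x, t))) (\<lambda>x. g (x, t))" "t \<in> {t1<..<t2}" "0 < t" "t < Tf"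
  "AE x in lborel. x \<in> ball x0 \<rho> --> (x, t) \<in> Q'"
 using assms ts by (auto simp: T_def)

lemma slice_L2:
 assumes t: "t \<in> T" shows "integrable lborel (\<lambda>x. (norm (G i (x, t)))^2)"
proof (rule in_L2_integrable[where w = "\<lambda>x. g (x, t)" and k = k and D = \<Omega>])
 show "in_Lp 2 k \<Omega> (\<lambda>x. g (x, t))" using T_slice(1)[OF t] by (simp add: has_W12_gradient_def)
 show "(\<lambda>x. G i (x, t)) \<in> borel_measurable borel" by measurable
 show "norm (G i (x, t)) <= fnorm k (g (x, t)) * indicator \<Omega> x" for x
  using zero[of "(x, t)" i] eq[of "(x, t)" i] norm_le_fnorm[of i k "g (x, t)"] sub Q'
  by (cases "(x, t) \<in> Q' \<and> i < k") (auto simp: fnorm_nonneg split: split_indicator)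
qed

text \<open>A test function of the ball is one of \<Omega>, and on the ball v and g agree almost
  everywhere with the representatives. The vector identity is then read componentwise.\<close>

lemma slice_weak:
 assumes t: "t \<in> T" shows "weak_grad_on (ball x0 \<rho>) (\<lambda>x. V i (x, t)) (\<lambda>x. G i (x, t))"
proof (cases "i < k")
 case False
 then have "U i z = 0" "G i z = 0" for z using zero[of z i] by simp_all
 note this[simp]
 show ?thesis by (simp add: weak_grad_on_def)
next
 case True
 show ?thesis unfolding weak_grad_on_def
 proof (intro allI impI)
  fix \<phi> :: "real ^ 'n => real" and \<alpha>
  assume \<phi>: "test_function (ball x0 \<rho>) \<phi>"
  then have \<phi>': "test_function \<Omega> \<phi>" using sub by (auto simp: test_function_def)
  note [measurable] = borel_measurable_sqn[OF meas(1)]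
  note [measurable] = test_function_measurable[OF \<phi>] test_function_grad_measurable[OF \<phi>]
  obtain c1 where c1: "c1 \<ge> 0" "\<forall>x. norm (\<phi> x) <= c1" using test_function_bounded[OF \<phi>] by blast
  obtain c2 where c2: "c2 \<ge> 0" "\<forall>x. norm (grad \<phi> x) <= c2" using test_function_grad_bounded[OF \<phi>] by blast
  have V_le: "\<bar>V i z\<bar> <= M powr m" for z
  proof (cases "S z = 0")
   case False
   then have S: "S z > 0" using sum_nonneg[of "{..<k}" "\<lambda>i. (U i z)^2"] by (simp add: sqn_def less_le)
   have "(U i z)^2 <= sqn k U z" unfolding sqn_def by (rule member_le_sum) (use True in auto)
   then have "\<bar>U i z\<bar> <= S z" by (intro real_le_rsqrt) simp
   then have "\<bar>V i z\<bar> <= S z powr (m - 1) * S z" unfolding abs_mult by (simp add: mult_left_mono)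
   also have "... = S z powr m" using S by (simp add: powr_diff)
   also have "... <= M powr m" using S S_le[of z] m by (intro powr_mono2) auto
   finally show ?thesis .
  qed simp
  have i1: "integrable lborel (\<lambda>x. V i (x, t) *\<^sub>R grad \<phi> x)"
  proof (rule integrable_bounded_set[OF _ borel_open[OF open_ball[of x0 \<rho>]] bounded_ball, where c = "M powr m * c2"])
   show "norm (V i (x, t) *\<^sub>R grad \<phi> x) <= M powr m * c2" for x
    unfolding norm_scaleR using V_le[of "(x, t)"] c2 by (intro mult_mono) auto
   show "V i (x, t) *\<^sub>R grad \<phi> x = 0" if "x \<notin> ball x0 \<rho>" for x using test_function_grad_vanish[OF \<phi> that] by simp
  qed measurable
  have iG: "integrable lborel (\<lambda>x. G i (x, t))"
   by (rule integrable_L2_bounded_set[where X = "ball x0 \<rho>", OF _ _ bounded_ball slice_L2[OF t]])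
    (use outside[of "(_, t)" i] in \<open>measurable, auto\<close>)
  have i2: "integrable lborel (\<lambda>x. \<phi> x *\<^sub>R G i (x, t))"
  proof (rule integrable_mult_bounded[OF iG])
   show "norm (\<phi> x *\<^sub>R G i (x, t)) <= c1 * norm (G i (x, t))" for x
    using c1 by (simp add: mult_right_mono)
  qed measurable
  have "(LBINT x. V i (x, t) *\<^sub>R grad \<phi> x) = (LINT x:\<Omega>|lebesgue. signed_pow k m (u (x, t)) i *\<^sub>R grad \<phi> x)"
   unfolding set_lebesgue_integral_def
  proof (rule lebesgue_AE_borel_integral[symmetric])
   show "AE x in lborel. indicator \<Omega> x *\<^sub>R signed_pow k m (u (x, t)) i *\<^sub>R grad \<phi> x = V i (x, t) *\<^sub>R grad \<phi> x"
    using T_slice(5)[OF t]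
   proof eventually_elim
    case (elim x)
    show ?case
    proof (cases "x \<in> ball x0 \<rho>")
     case True
     then have "x \<in> \<Omega>" using sub by blast
     then show ?thesis using V_eq[of "(x, t)" i] elim True by simp
    next
     case False
     then show ?thesis using test_function_grad_vanish[OF \<phi> False] by simp
    qed
   qed
  qed measurable
  also have "... = - (LINT x:\<Omega>|lebesgue. \<phi> x *\<^sub>R g (x, t) i)"
   using T_slice(1)[OF t] True \<phi>' unfolding has_W12_gradient_def by blast
  also have "(LINT x:\<Omega>|lebesgue. \<phi> x *\<^sub>R g (x, t) i) = (LBINT x. \<phi> x *\<^sub>R G i (x, t))"
   unfolding set_lebesgue_integral_def
  proof (rule lebesgue_AE_borel_integral)
   show "AE x in lborel. indicator \<Omega> x *\<^sub>R \<phi> x *\<^sub>R g (x, t) i = \<phi> x *\<^sub>R G i (x, t)"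
    using T_slice(5)[OF t]
   proof eventually_elim
    case (elim x)
    show ?case
    proof (cases "x \<in> ball x0 \<rho>")
     case True
     then have "x \<in> \<Omega>" using sub by blast
     then show ?thesis using eq[of "(x, t)" i] elim True by simp
    next
     case False
     then show ?thesis using test_function_vanish(1)[OF \<phi> False] by simp
    qed
   qed
  qed measurable
  finally have "(LBINT x. V i (x, t) *\<^sub>R grad \<phi> x) $ \<alpha> = - (LBINT x. \<phi> x *\<^sub>R G i (x, t)) $ \<alpha>"
   by simp
  moreover have "(LBINT x. (V i (x, t) *\<^sub>R grad \<phi> x) $ \<alpha>) = (LBINT x. V i (x, t) *\<^sub>R grad \<phi> x) $ \<alpha>"
   by (rule integral_bounded_linear[OF bounded_linear_vec_nth i1])
  moreover have "(LBINT x. (\<phi> x *\<^sub>R G i (x, t)) $ \<alpha>) = (LBINT x. \<phi> x *\<^sub>R G i (x, t)) $ \<alpha>"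
   by (rule integral_bounded_linear[OF bounded_linear_vec_nth i2])
  ultimately show "(LBINT x. V i (x, t) * grad \<phi> x $ \<alpha>) = - (LBINT x. \<phi> x * G i (x, t) $ \<alpha>)"
   unfolding vector_scaleR_component real_scaleR_def by linarith
 qed
qed

text \<open>Continuity in L^(1+m) becomes continuity in L^1 on the ball by
  \<open>young_small\<close>: \<delta> is fixed to make the constant part small, then the times are
  taken close enough to make the power part small.\<close>

lemma continuity:
 assumes s: "s \<in> T" and e: "e > 0"
 shows "\<exists>d>0. \<forall>t\<in>T. \<bar>t - s\<bar> < d --> (LBINT x. (\<Sum>i<k. \<bar>U i (x, t) - U i (x, s)\<bar>)) < e"
proof -
 define w where "w t x = fnorm k (\<lambda>i. u (x, t) i - u (x, s) i)" for t x
 define P where "P t = (LINT x:\<Omega>|lebesgue. w t x powr (1 + m))" for t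
 define K where "K = real k + 1"
 have K: "K > 0" by (simp add: K_def)
 define b where "b = measure lborel (ball x0 \<rho>)"
 \<comment> \<open>Each of the two parts may use e / (2 K); \<open>b + 1\<close> in place of
   \<open>b\<close> makes the first bound strict.\<close>
 define \<delta> where "\<delta> = e / (2 * K * (b + 1))"
 have b: "b \<ge> 0" by (simp add: b_def)
 have \<delta>: "\<delta> > 0" using e b K by (simp add: \<delta>_def)
 define e' where "e' = e / (2 * K) * \<delta> powr m"
 have e': "e' > 0" using e \<delta> K by (simp add: e'_def)
 have lim: "((\<lambda>t. P t powr (1 / (1 + m))) \<longlongrightarrow> 0) (at s within {0<..<Tf})"
  using u_C0 T_slice(3,4)[OF s] unfolding in_C0_Lp_def Lp_norm_def P_def w_def by auto
 have "e' powr (1 / (1 + m)) > 0" using e' by simp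
 from order_tendstoD(2)[OF lim this] obtain d where d: "d > 0"
  "\<And>t. t \<in> {0<..<Tf} ==> t \<noteq> s ==> dist t s < d ==> P t powr (1 / (1 + m)) < e' powr (1 / (1 + m))"
  unfolding eventually_at by blast
 have P0: "P t \<ge> 0" for t unfolding P_def set_lebesgue_integral_def by (rule bochner_nonneg) simp
 have "(LBINT x. (\<Sum>i<k. \<bar>U i (x, t) - U i (x, s)\<bar>)) < e" if t: "t \<in> T" "\<bar>t - s\<bar> < d" for t
 proof (cases "t = s")
  case True
  then show ?thesis using e by simp
 next
  case False
  have "P t powr (1 / (1 + m)) < e' powr (1 / (1 + m))"
   using d(2)[of t] T_slice(3,4)[OF t(1)] False t(2) by (auto simp: dist_real_def)
  then have P: "P t < e'" using P0 e' m by (simp add: powr_less_iff)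
  have Om: "\<Omega> \<in> sets lebesgue" using \<Omega> by simp
  have lp: "in_Lp (1 + m) k \<Omega> (\<lambda>x. u (x, \<tau>))" if "\<tau> \<in> T" for \<tau>
   using u_C0 T_slice(3,4)[OF that] by (auto simp: in_C0_Lp_def)
  have iw: "integrable lebesgue (\<lambda>x. indicator \<Omega> x *\<^sub>R w t x powr (1 + m))"
  proof (rule bochner_bound)
   let ?u = "\<lambda>\<tau> x. indicator \<Omega> x *\<^sub>R fnorm k (u (x, \<tau>)) powr (1 + m)"
   have "integrable lebesgue (?u t)" "integrable lebesgue (?u s)"
    using lp[OF t(1)] lp[OF s] by (auto simp: in_Lp_def set_integrable_def)
   then show "integrable lebesgue (\<lambda>x. 2 powr (1 + m) * (?u t x + ?u s x))" by simp
   have "(\<lambda>x. u (x, \<tau>) i) \<in> borel_measurable (lebesgue_on \<Omega>)" if "i < k" "\<tau> \<in> T" for i \<tau>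
    using lp[OF that(2)] that(1) by (simp add: in_Lp_def)
   then have "w t \<in> borel_measurable (lebesgue_on \<Omega>)"
    unfolding w_def[abs_def] using s t by (intro borel_measurable_fnorm borel_measurable_diff) auto
   then have "(\<lambda>x. w t x powr (1 + m)) \<in> borel_measurable (lebesgue_on \<Omega>)" by measurable
   then show "(\<lambda>x. indicator \<Omega> x *\<^sub>R w t x powr (1 + m)) \<in> borel_measurable lebesgue"
    by (subst (asm) borel_measurable_restrict_space_iff) (use Om in auto)
   show "AE x in lebesgue. norm (indicator \<Omega> x *\<^sub>R w t x powr (1 + m)) <= norm (2 powr (1 + m) * (?u t x + ?u s x))"
   proof (rule AE_I2)
    fix x
    have "w t x powr (1 + m) <= (fnorm k (u (x, t)) + fnorm k (u (x, s))) powr (1 + m)"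
     unfolding w_def using m by (intro powr_mono2 fnorm_triangle fnorm_nonneg) auto
    also have "... <= 2 powr (1 + m) * (fnorm k (u (x, t)) powr (1 + m) + fnorm k (u (x, s)) powr (1 + m))"
     using m by (intro powr_add_le fnorm_nonneg) auto
    finally show "norm (indicator \<Omega> x *\<^sub>R w t x powr (1 + m)) <= norm (2 powr (1 + m) * (?u t x + ?u s x))"
     by (cases "x \<in> \<Omega>") (auto intro: order_trans[OF _ abs_ge_self])
   qed
  qed
  let ?D = "\<lambda>x. (\<Sum>i<k. \<bar>U i (x, t) - U i (x, s)\<bar>)"
  have Dm: "?D \<in> borel_measurable borel" by measurable
  let ?E = "\<lambda>x. real k * (\<delta> * indicator (ball x0 \<rho>) x + \<delta> powr (- m) * (indicator \<Omega> x *\<^sub>R w t x powr (1 + m)))"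
  have ib: "integrable lebesgue (indicator (ball x0 \<rho>) :: _ => real)"
  proof (subst integrable_completion)
   show "(indicator (ball x0 \<rho>) :: _ => real) \<in> borel_measurable lborel" by (intro borel_measurable_indicator) simp
  qed (simp add: integrable_indicator_ball)
  have iE: "integrable lebesgue ?E" using ib iw by simp
  have DE: "AE x in lebesgue. ?D x <= ?E x"
   using AE_completion[OF T_slice(5)[OF t(1)]] AE_completion[OF T_slice(5)[OF s]]
  proof eventually_elim
   case (elim x)
   show ?case
   proof (cases "x \<in> ball x0 \<rho>")
    case True
    then have q: "(x, t) \<in> Q'" "(x, s) \<in> Q'" and x: "x \<in> \<Omega>" using elim sub by auto
    have "?D x <= (\<Sum>i<k. w t x)"
    proof (rule sum_mono)
     fix i assume "i \<in> {..<k}"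
     then have "norm (u (x, t) i - u (x, s) i) <= w t x" unfolding w_def by (intro norm_le_fnorm[where v = "\<lambda>i. u (x, t) i - u (x, s) i"]) simp
     then show "\<bar>U i (x, t) - U i (x, s)\<bar> <= w t x" using eq[OF q(1), of i] eq[OF q(2), of i] by simp
    qed
    also have "... = real k * w t x" by simp
    also have "... <= real k * (\<delta> + \<delta> powr (- m) * w t x powr (1 + m))"
     using \<delta> m fnorm_nonneg by (intro mult_left_mono young_small) (auto simp: w_def)
    finally show ?thesis using True x by simp
   next
    case False
    then have "?D x = 0" using outside[of "(x, t)"] outside[of "(x, s)"] by simp
    then show ?thesis using \<delta> by simp
   qed
  qed
  have "(LBINT x. ?D x) = (\<integral>x. ?D x \<partial>lebesgue)" by (rule integral_completion[symmetric]) (use Dm in simp)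
  also have "... <= (\<integral>x. ?E x \<partial>lebesgue)"
  proof (rule integral_mono_AE[OF _ iE DE])
   show "integrable lebesgue ?D"
    by (rule bochner_bound[OF iE measurable_completion])
     (use Dm DE in \<open>auto elim!: eventually_mono intro: order_trans[OF _ abs_ge_self] simp: sum_nonneg\<close>)
  qed
  also have "... = real k * (\<delta> * b + \<delta> powr (- m) * P t)"
  proof -
   have "(\<integral>x. indicator (ball x0 \<rho>) x \<partial>lebesgue) = b" by (simp add: b_def)
   then show ?thesis using ib iw by (simp add: P_def set_lebesgue_integral_def)
  qed
  also have "... <= K * (\<delta> * b + \<delta> powr (- m) * P t)"
   using \<delta> b P0 by (intro mult_right_mono) (auto simp: K_def)
  also have "... < e"
  proof -
   have "\<delta> * b < \<delta> * (b + 1)" using \<delta> by simp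
   also have "... = e / (2 * K)" using b K by (simp add: \<delta>_def)
   finally have 1: "\<delta> * b < e / (2 * K)" .
   have "\<delta> powr (- m) * P t < \<delta> powr (- m) * e'" using P \<delta> by (intro mult_strict_left_mono) auto
   also have "... = e / (2 * K) * (\<delta> powr (- m) * \<delta> powr m)" by (simp add: e'_def)
   also have "... = e / (2 * K)" using \<delta> by (simp flip: powr_add)
   finally have "\<delta> * b + \<delta> powr (- m) * P t < e / (2 * K) + e / (2 * K)" using 1 by linarith
   then have "K * (\<delta> * b + \<delta> powr (- m) * P t) < K * (e / (2 * K) + e / (2 * K))"
    using K by (intro mult_strict_left_mono) auto
   also have "... = e" using K by (simp add: field_simps)
   finally show ?thesis .
  qed
  finally show ?thesis .
 qed
 then show ?thesis using d(1) by blast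
qed

text \<open>Testing with products leaves an equation in time for h(\<tau>), the integral of U_i(.,
  \<tau>) against \<phi>; \<open>weak_derivative_increment\<close> integrates it between two good
  times.\<close>

lemma evolution:
 assumes st: "s \<in> T" "t \<in> T" "s < t" and \<phi>: "test_function (ball x0 \<rho>) \<phi>"
 shows "(LBINT x. (U i (x, t) - U i (x, s)) * \<phi> x) =
   - (LBINT z. indicator {s<..<t} (snd z) * ((A i z + F i z) \<bullet> grad \<phi> (fst z)))"
proof (cases "i < k")
 case False
 then have "U i z = 0" "A i z = 0" "F i z = 0" for z using zero[of z i] by simp_all
 then show ?thesis by simp
next
 case i: True
 note [measurable] = test_function_measurable[OF \<phi>] test_function_grad_measurable[OF \<phi>]
 obtain c1 where c1: "c1 \<ge> 0" "\<forall>x. norm (\<phi> x) <= c1" using test_function_bounded[OF \<phi>] by blast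
 obtain c2 where c2: "c2 \<ge> 0" "\<forall>x. norm (grad \<phi> x) <= c2" using test_function_grad_bounded[OF \<phi>] by blast
 define h where "h \<tau> = (LBINT x. U i (x, \<tau>) * \<phi> x)" for \<tau>
 define b where "b \<tau> = (LBINT x. (A i (x, \<tau>) + F i (x, \<tau>)) \<bullet> grad \<phi> x)" for \<tau>
 have iU: "integrable lborel (\<lambda>z. U i z * \<phi> (fst z))"
 proof (rule integrable_bounded_set[OF _ Q_meas Q_bdd])
  show "norm (U i z * \<phi> (fst z)) <= M * c1" for z
   unfolding norm_mult using U_le[of i z] c1 M by (intro mult_mono) auto
  show "U i z * \<phi> (fst z) = 0" if "z \<notin> Q" for z using outside[of z i] that by simp
 qed measurable
 have iB: "integrable lborel (\<lambda>z. (A i z + F i z) \<bullet> grad \<phi> (fst z))"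
 proof (rule integrable_mult_bounded[where f = "\<lambda>z. A i z + F i z" and c = c2])
  show "integrable lborel (\<lambda>z. A i z + F i z)" using A_int F_int by simp
  show "norm ((A i z + F i z) \<bullet> grad \<phi> (fst z)) <= c2 * norm (A i z + F i z)" for z
  proof -
   have "norm ((A i z + F i z) \<bullet> grad \<phi> (fst z)) <= norm (A i z + F i z) * norm (grad \<phi> (fst z))"
    using Cauchy_Schwarz_ineq2 by simp
   also have "... <= norm (A i z + F i z) * c2" using c2 by (intro mult_left_mono) auto
   finally show ?thesis by (simp add: mult.commute)
  qed
 qed measurable
 have ih: "integrable lborel h" using integral_lborel_prod(3)[OF iU] by (simp add: h_def[abs_def])
 have ib: "integrable lborel b" using integral_lborel_prod(3)[OF iB] by (simp add: b_def[abs_def])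
 have iUx: "integrable lborel (\<lambda>x. U i (x, \<tau>) * \<phi> x)" for \<tau>
 proof (rule integrable_bounded_set[OF _ borel_open[OF open_ball[of x0 \<rho>]] bounded_ball])
  show "norm (U i (x, \<tau>) * \<phi> x) <= M * c1" for x
   unfolding norm_mult using U_le[of i "(x, \<tau>)"] c1 M by (intro mult_mono) auto
  show "U i (x, \<tau>) * \<phi> x = 0" if "x \<notin> ball x0 \<rho>" for x using outside[of "(x, \<tau>)" i] that by simp
 qed measurable
 have hdiff: "h \<tau> - h \<sigma> = (LBINT x. (U i (x, \<tau>) - U i (x, \<sigma>)) * \<phi> x)" for \<tau> \<sigma>
  unfolding h_def left_diff_distrib by (rule bochner_diff[OF iUx iUx, symmetric])
 have "h t - h s = - (LBINT \<tau>. indicator {s<..<t} \<tau> * b \<tau>)"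
 proof (rule weak_derivative_increment[OF ih ib _ T_full T_sub _ st])
  fix \<zeta> :: "real => real" assume \<zeta>: "test_function {t1<..<t2} \<zeta>"
  note wp = weak_product[OF i \<phi> \<zeta>]
  have "(LBINT \<tau>. h \<tau> * deriv \<zeta> \<tau>) = (LBINT z. U i z * (\<phi> (fst z) * deriv \<zeta> (snd z)))"
   unfolding integral_lborel_prod(1)[OF wp(2)] h_def by (simp add: mult.assoc flip: integral_mult_left_zero)
  also have "... = (LBINT z. ((A i z + F i z) \<bullet> grad \<phi> (fst z)) * \<zeta> (snd z))" by (rule wp(1))
  also have "... = (LBINT \<tau>. b \<tau> * \<zeta> \<tau>)"
   unfolding integral_lborel_prod(1)[OF wp(3)] b_def by simp
  finally show "(LBINT \<tau>. h \<tau> * deriv \<zeta> \<tau>) = (LBINT \<tau>. b \<tau> * \<zeta> \<tau>)" .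
 next
  fix s e :: real assume s: "s \<in> T" and e: "e > 0"
  have "e / (c1 + 1) > 0" using e c1 by simp
  from continuity[OF s this] obtain d where d: "d > 0"
   "\<forall>t\<in>T. \<bar>t - s\<bar> < d --> (LBINT x. (\<Sum>i<k. \<bar>U i (x, t) - U i (x, s)\<bar>)) < e / (c1 + 1)" by blast
  have "\<bar>h \<tau> - h s\<bar> < e" if \<tau>: "\<tau> \<in> T" "\<bar>\<tau> - s\<bar> < d" for \<tau>
  proof -
   let ?D = "\<lambda>x. (\<Sum>i<k. \<bar>U i (x, \<tau>) - U i (x, s)\<bar>)"
   have iD: "integrable lborel ?D"
   proof (rule Bochner_Integration.integrable_sum, rule integrable_bounded_set[OF _ borel_open[OF open_ball[of x0 \<rho>]] bounded_ball])
    fix i x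
    show "norm \<bar>U i (x, \<tau>) - U i (x, s)\<bar> <= 2 * M" using U_le[of i "(x, \<tau>)"] U_le[of i "(x, s)"] by simp
    show "\<bar>U i (x, \<tau>) - U i (x, s)\<bar> = 0" if "x \<notin> ball x0 \<rho>" using outside[of "(x, \<tau>)" i] outside[of "(x, s)" i] that by simp
   qed measurable
   have "norm (h \<tau> - h s) <= (LBINT x. norm ((U i (x, \<tau>) - U i (x, s)) * \<phi> x))"
    unfolding hdiff by (rule integral_norm_bound)
   also have "... <= (LBINT x. (c1 + 1) * ?D x)"
   proof (rule integral_mono)
    show "integrable lborel (\<lambda>x. norm ((U i (x, \<tau>) - U i (x, s)) * \<phi> x))"
     using iUx[of \<tau>] iUx[of s] unfolding left_diff_distrib by simp
    show "integrable lborel (\<lambda>x. (c1 + 1) * ?D x)" using iD by simp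
    show "norm ((U i (x, \<tau>) - U i (x, s)) * \<phi> x) <= (c1 + 1) * ?D x" for x
    proof -
     have "\<bar>U i (x, \<tau>) - U i (x, s)\<bar> <= ?D x" by (rule member_le_sum) (use i in auto)
     moreover have "norm (\<phi> x) <= c1 + 1" using c1 by (simp add: add_increasing2)
     ultimately have "\<bar>U i (x, \<tau>) - U i (x, s)\<bar> * norm (\<phi> x) <= ?D x * (c1 + 1)"
      by (intro mult_mono) (auto simp: sum_nonneg)
     then show ?thesis unfolding norm_mult by (simp add: mult.commute)
    qed
   qed
   also have "... = (c1 + 1) * (LBINT x. ?D x)" by (rule integral_mult_right_zero)
   also have "... < (c1 + 1) * (e / (c1 + 1))" using d(2) \<tau> c1 by (intro mult_strict_left_mono) auto
   also have "... = e" using c1 by simp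
   finally show ?thesis by simp
  qed
  then show "\<exists>d>0. \<forall>\<tau>\<in>T. \<bar>\<tau> - s\<bar> < d --> \<bar>h \<tau> - h s\<bar> < e" using d(1) by blast
 qed
 moreover have "(LBINT \<tau>. indicator {s<..<t} \<tau> * b \<tau>) =
   (LBINT z. indicator {s<..<t} (snd z) * ((A i z + F i z) \<bullet> grad \<phi> (fst z)))"
 proof -
  have i3: "integrable lborel (\<lambda>z. indicator {s<..<t} (snd z) * ((A i z + F i z) \<bullet> grad \<phi> (fst z)))"
   by (rule bochner_bound[OF iB]) (measurable, auto split: split_indicator)
  show ?thesis unfolding integral_lborel_prod(1)[OF i3] b_def by simp
 qed
 ultimately show ?thesis unfolding hdiff by simp
qed

lemma local_solution: "local_solution k m \<nu> L M x0 \<rho> t1 t2 U G A F T"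
 by (rule local_solution.intro)
  (assumption | rule m \<nu> L M \<rho> ts(2) meas S_le outside G_L2 A_L2 F_L2 ellipticity growth sign T_sub T_full
   slice_weak slice_L2 evolution continuity)+

end

section \<open>Halving the bound and conclusion\<close>

text \<open>The excess of the recursion exponent over one. It equals (2p - N - 2) / (p N), so for p
  > 0 it is positive exactly when p > (N + 2) / 2.\<close>

definition dg_exp :: "nat => real => real" where
 "dg_exp N p = (1 - 1 / p) * (1 + 2 / real N) - 1"

text \<open>The smallness threshold of \<open>fast_convergence\<close> for the recursion.
  \<open>Cg\<close> takes only the type of the dimension and m, \<nu>, L as arguments, so the
  threshold is available before any solution is fixed, as a uniform constant requires.\<close>

definition dg_small :: "'n::finite itself => real => real => real => real => real" where
 "dg_small n m \<nu> L p = local_solution.Cg n m \<nu> L powr (- 1 / dg_exp CARD('n) p) * 1024 powr (- 1 / (dg_exp CARD('n) p)\<^sup>2)"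

lemma borel_measurable_level:
 fixes S :: "'a::topological_space => real"
 assumes [measurable]: "X \<in> sets borel" "S \<in> borel_measurable borel"
 shows "{z \<in> X. c < S z} \<in> sets borel"
 by measurable

lemma sq_powr: "x \<ge> 0 ==> (x^2) powr p = x powr (2 * p)" for x :: real
 by (cases "x = 0") (simp_all add: powr_powr flip: powr_numeral)

context cylinder_sol
begin

text \<open>Chebyshev's inequality at the level M/4 turns the bound for the integral of |u|^r into
  the smallness that \<open>de_giorgi\<close> asks for. Positivity of the threshold is derived
  inside the proof, from the presence of a local solution; this explains the conditional form of
  \<open>ub\<close>.\<close>

lemma halving:
 assumes p: "p > 1" "dg_exp CARD('n) p > 0" and r: "r > 0" and \<theta>: "t2 - t1 = M powr (1 - m) * \<rho>^2"
  and Fi: "set_integrable lebesgue Q (\<lambda>z. fnorm k (f z) powr (2 * p))"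
  and Fb: "(\<rho>^2 / M powr (2 * m)) powr p * (LINT z:Q|lebesgue. fnorm k (f z) powr (2 * p)) <= measure lborel Q"
  and ub: "dg_small TYPE('n) m \<nu> L p > 0 ==>
   (4 / M) powr r * (LINT z:Q|lebesgue. fnorm k (u z) powr r) <= dg_small TYPE('n) m \<nu> L p * measure lborel Q"
 shows "AE z in lborel. z \<in> ball x0 (\<rho> / 2) \<times> {t2 - (t2 - t1) / 2<..<t2} --> fnorm k (u z) <= M / 2"
proof -
 obtain U G A F Q' where cd: "cylinder_data k m \<nu> L \<Omega> Tf a f g u x0 \<rho> t1 t2 M U G A F Q'"
  using cylinder_data_exists by (elim exE)
 interpret cd: cylinder_data k m \<nu> L \<Omega> Tf a f g u x0 \<rho> t1 t2 M U G A F Q' by (rule cd)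
 interpret ls: local_solution k m \<nu> L M x0 \<rho> t1 t2 U G A F cd.T
  "\<lambda>z. sqrt (sqn k U z)" "\<lambda>i z. sqrt (sqn k U z) powr (m - 1) * U i z"
  by (rule cd.local_solution reflexive)+
 have Q'_ae: "AE z in lborel. z \<in> Q --> z \<in> Q'" by (rule cd.Q')
 have \<phi>_eq: "ls.\<phi>2 z = (fnorm k (f z))^2" if "z \<in> Q'" for z
  using cd.eq[OF that] by (simp add: ls.\<phi>2_def fnorm_sq)
 have out: "ls.\<phi>2 z = 0" "sqrt (sqn k U z) = 0" if "z \<notin> Q" for z
  using cd.outside[of z] that by (simp_all add: ls.\<phi>2_def sqn_def)
 have \<phi>_meas: "(\<lambda>z. ls.\<phi>2 z powr p) \<in> borel_measurable borel"
  unfolding ls.\<phi>2_def by measurable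
 have F_ae: "AE z in lborel. indicator Q z *\<^sub>R fnorm k (f z) powr (2 * p) = ls.\<phi>2 z powr p"
  using Q'_ae
 proof eventually_elim
  case (elim z)
  show ?case
  proof (cases "z \<in> Q")
   case True
   then show ?thesis using \<phi>_eq[of z] elim sq_powr[OF fnorm_nonneg[of k "f z"], of p] by simp
  next
   case False
   then show ?thesis using out(1)[OF False] by simp
  qed
 qed
 have F1: "integrable lborel (\<lambda>z. ls.\<phi>2 z powr p)"
  using Fi unfolding set_integrable_def lebesgue_AE_borel_integrable[OF \<phi>_meas F_ae] .
 have F2: "(LINT z:Q|lebesgue. fnorm k (f z) powr (2 * p)) = (LBINT z. ls.\<phi>2 z powr p)"
  unfolding set_lebesgue_integral_def by (rule lebesgue_AE_borel_integral[OF \<phi>_meas F_ae])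
 have F3: "(\<lambda>z. (\<rho>^2 * ls.\<phi>2 z / ls.\<Lambda>) powr p) = (\<lambda>z. (\<rho>^2 / M powr (2 * m)) powr p * ls.\<phi>2 z powr p)"
  unfolding ls.\<Lambda>_def powr_mult[symmetric] by simp
 have Fi': "integrable lborel (\<lambda>z. (\<rho>^2 * ls.\<phi>2 z / ls.\<Lambda>) powr p)" unfolding F3 using F1 by simp
 have Fb': "(LBINT z. (\<rho>^2 * ls.\<phi>2 z / ls.\<Lambda>) powr p) <= measure lborel Q"
  unfolding F3 integral_mult_right_zero using Fb unfolding F2 .
 have S_meas: "(\<lambda>z. sqrt (sqn k U z) powr r) \<in> borel_measurable borel"
  by (rule measurable_compose[OF ls.S_meas]) measurable
 have u_ae: "AE z in lborel. indicator Q z *\<^sub>R fnorm k (u z) powr r = sqrt (sqn k U z) powr r"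
  using Q'_ae
 proof eventually_elim
  case (elim z)
  show ?case
  proof (cases "z \<in> Q")
   case True
   then show ?thesis using cd.S_fnorm[of z] elim by simp
  next
   case False
   then show ?thesis using out(2)[OF False] r by simp
  qed
 qed
 have u2: "(LINT z:Q|lebesgue. fnorm k (u z) powr r) = (LBINT z. sqrt (sqn k U z) powr r)"
  unfolding set_lebesgue_integral_def by (rule lebesgue_AE_borel_integral[OF S_meas u_ae])
 have iS: "integrable lborel (\<lambda>z. sqrt (sqn k U z) powr r)"
 proof (rule integrable_bounded_set[OF S_meas Q_meas cd.Q_bdd])
  show "norm (sqrt (sqn k U z) powr r) <= M powr r" for z
   using cd.S_le[of z] r ls.S_nonneg[of z] by (simp add: powr_mono2)
  show "sqrt (sqn k U z) powr r = 0" if "z \<notin> Q" for z using out(2)[OF that] r by simp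
 qed
 let ?X = "{z \<in> Q. M / 4 < sqrt (sqn k U z)}"
 have Xm: "?X \<in> sets borel" by (rule borel_measurable_level[OF Q_meas ls.S_meas])
 have dg: "dg_small TYPE('n) m \<nu> L p > 0"
  using ls.Cg_pos by (simp add: dg_small_def)
 have iX: "integrable lborel (indicator ?X :: _ => real)"
  using Xm by (intro integrable_bounded_set[OF _ Q_meas cd.Q_bdd, where c = 1]) (auto simp: indicator_def)
 have "measure lborel ?X = (LBINT z. indicator ?X z)" using Xm by simp
 also have "... <= (LBINT z. (4 / M) powr r * sqrt (sqn k U z) powr r)"
 proof (rule integral_mono[OF iX])
  show "integrable lborel (\<lambda>z. (4 / M) powr r * sqrt (sqn k U z) powr r)" using iS by simp
  show "indicator ?X z <= (4 / M) powr r * sqrt (sqn k U z) powr r" for z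
  proof (cases "z \<in> ?X")
   case True
   then have "1 <= (4 / M * sqrt (sqn k U z)) powr r" using M r by (intro ge_one_powr_ge_zero) (auto simp: field_simps)
   then have "1 <= (4 / M) powr r * sqrt (sqn k U z) powr r" unfolding powr_mult .
   then show ?thesis using True by (simp only: indicator_simps)
  qed simp
 qed
 also have "... <= dg_small TYPE('n) m \<nu> L p * measure lborel Q"
  using ub[OF dg] unfolding u2 by simp
 finally have small: "measure lborel ?X <= dg_small TYPE('n) m \<nu> L p * measure lborel Q" .
 have "AE z in lborel. norm (fst z - x0) < \<rho> / 2 --> t2 - (t2 - t1) / 2 < snd z --> snd z < t2 --> sqrt (sqn k U z) <= M / 2"
  using ls.de_giorgi[OF p(1) dg_exp_def p(2) \<theta> Fi' Fb' small[unfolded dg_small_def]] .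
 then show ?thesis using Q'_ae
 proof eventually_elim
  case (elim z)
  show ?case
  proof
   assume z: "z \<in> ball x0 (\<rho> / 2) \<times> {t2 - (t2 - t1) / 2<..<t2}"
   then have "dist x0 (fst z) < \<rho> / 2" "t2 - (t2 - t1) / 2 < snd z" "snd z < t2" by (auto simp: mem_Times_iff)
   then have "z \<in> Q" using \<rho> ts by (auto simp: mem_Times_iff field_simps)
   then have "z \<in> Q'" using elim by simp
   moreover have "norm (fst z - x0) < \<rho> / 2" using z by (auto simp: mem_Times_iff dist_norm norm_minus_commute)
   ultimately show "fnorm k (u z) <= M / 2" using elim(1) z cd.S_fnorm[of z] by (auto simp: mem_Times_iff)
  qed
 qed
qed

end

text \<open>By Lindeloef's theorem countably many of the neighbourhoods cover X. This takes the
  place of an explicit covering by intrinsic cylinders.\<close>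

lemma AE_local:
 fixes X :: "'a::euclidean_space set"
 assumes "\<And>z. z \<in> X ==> \<exists>W. open W \<and> z \<in> W \<and> (AE w in lborel. w \<in> W --> P w)"
 shows "AE w in lborel. w \<in> X --> P w"
proof -
 define \<F> where "\<F> = {W. open W \<and> (AE w in lborel. w \<in> W --> P w)}"
 have "\<And>W. W \<in> \<F> ==> open W" by (simp add: \<F>_def)
 then obtain \<F>' where F: "\<F>' \<subseteq> \<F>" "countable \<F>'" "\<Union>\<F>' = \<Union>\<F>" by (rule Lindelof)
 have "AE w in lborel. \<forall>W\<in>\<F>'. w \<in> W --> P w"
  using F by (subst AE_ball_countable) (auto simp: \<F>_def)
 moreover have "X \<subseteq> \<Union>\<F>'" unfolding F(3) \<F>_def using assms by blast
 ultimately show ?thesis by (auto elim!: eventually_mono)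
qed

text \<open>R is the radius of the intrinsic cylinder at level M whose length is \<delta>^2
  \<theta>, that is, M^(1-m) R^2 = \<delta>^2 \<theta>.\<close>

lemma rescaled_radius:
 assumes M: "M > 0" and \<theta>: "\<theta> > 0" and \<delta>: "\<delta> > 0" and R: "R = \<delta> * \<theta> powr (1 / 2) * M powr ((m - 1) / 2)"
 shows "R^2 = \<delta>^2 * \<theta> * M powr (m - 1)"
  and "R ^ N = \<delta> ^ N * \<theta> powr (real N / 2) * M powr (real N * (m - 1) / 2)"
proof -
 have p: "(x powr y) ^ n = x powr (real n * y)" if "x > 0" for x y :: real and n
  using that by (simp add: powr_powr mult.commute flip: powr_realpow)
 show "R^2 = \<delta>^2 * \<theta> * M powr (m - 1)" 
 proof -
  have e: "real 2 * ((m - 1) / 2) = m - 1" "real 2 * (1 / 2) = 1" by simp_all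
  show ?thesis unfolding R power_mult_distrib p[OF \<theta>] p[OF M] e using \<theta> by simp
 qed
 show "R ^ N = \<delta> ^ N * \<theta> powr (real N / 2) * M powr (real N * (m - 1) / 2)"
  unfolding R power_mult_distrib p[OF \<theta>] p[OF M] by simp
qed

text \<open>The powers of M combine through N(m-1)/2 + r = \<lambda>_r / 2, and \<delta>^(N+2) comes
  from radius and length together. A bound for the average over the large cylinder thus becomes the
  hypothesis of \<open>halving\<close> on the intrinsic one.\<close>

lemma measure_condition:
 assumes M: "M > 0" and pos: "\<theta> > 0" "\<rho> > 0" "w > 0" "\<delta> > 0" and R: "R = \<delta> * \<theta> powr (1 / 2) * M powr ((m - 1) / 2)"
  and H: "4 powr r * ((\<rho>^2 / \<theta>) powr (real N / 2) * (1 / (w * \<rho> ^ N * \<theta>) * I)) <= e * (\<delta> ^ (N + 2) * M powr (lambda_exp N m r / 2))"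
 shows "(4 / M) powr r * I <= e * (w * R ^ N * (\<delta>^2 * \<theta>))"
proof -
 have 1: "(\<rho>^2 / \<theta>) powr (real N / 2) = \<rho> ^ N / \<theta> powr (real N / 2)"
  using pos by (simp add: powr_divide sq_powr powr_realpow)
 let ?T = "w * \<theta> powr (real N / 2) * \<theta>"
 have T: "?T > 0" using pos by simp
 have "4 powr r * I / ?T = 4 powr r * ((\<rho>^2 / \<theta>) powr (real N / 2) * (1 / (w * \<rho> ^ N * \<theta>) * I))"
  unfolding 1 using pos by simp
 then have "4 powr r * I / ?T <= e * (\<delta> ^ (N + 2) * M powr (lambda_exp N m r / 2))" using H by linarith
 then have "4 powr r * I <= e * (\<delta> ^ (N + 2) * M powr (lambda_exp N m r / 2)) * ?T" using T by (simp only: pos_divide_le_eq)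
 then have "M powr (- r) * (4 powr r * I) <= M powr (- r) * (e * (\<delta> ^ (N + 2) * M powr (lambda_exp N m r / 2)) * ?T)"
  by (intro mult_left_mono) auto
 also have "... = e * (w * (\<delta> ^ N * \<theta> powr (real N / 2) * (M powr (- r) * M powr (lambda_exp N m r / 2))) * (\<delta>\<^sup>2 * \<theta>))"
  by (simp add: power_add power2_eq_square)
 also have "M powr (- r) * M powr (lambda_exp N m r / 2) = M powr (real N * (m - 1) / 2)"
  by (simp add: lambda_exp_def add_divide_distrib flip: powr_add)
 also have "\<delta> ^ N * \<theta> powr (real N / 2) * M powr (real N * (m - 1) / 2) = R ^ N"
  using rescaled_radius(2)[OF M pos(1,4) R] by simp
 also have "M powr (- r) * (4 powr r * I) = (4 / M) powr r * I"
  unfolding powr_divide by (simp add: powr_minus divide_inverse)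
 finally show ?thesis .
qed

text \<open>The same computation for the source, now with N(m-1)/2 + (1+m)p, half of
  \<lambda>_{p(1+m)}. The shrinking enters as \<delta>^(2p), which is at most \<delta>^(N+2) because
  \<delta> <= 1 and 2p >= N + 2; hence the source entry of the theorem carries no power of 1 -
  \<sigma>.\<close>

lemma source_condition:
 assumes M: "M > 0" and pos: "\<theta> > 0" "\<rho> > 0" "w > 0" "\<delta> > 0" "\<delta> <= 1" and R: "R = \<delta> * \<theta> powr (1 / 2) * M powr ((m - 1) / 2)"
  and p: "2 * p \<ge> real N + 2"
  and H: "(\<theta> / \<rho>^2) powr (p - real N / 2) * (1 / (w * \<rho> ^ N * \<theta>) * (\<rho> powr (2 * p) * I)) <= M powr (lambda_exp N m (p * (1 + m)) / 2)"
 shows "(R^2 / M powr (2 * m)) powr p * I <= w * R ^ N * (\<delta>^2 * \<theta>)"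
proof -
 have 1: "(\<theta> / \<rho>^2) powr (p - real N / 2) = \<theta> powr (p - real N / 2) / \<rho> powr (2 * p) * \<rho> ^ N"
 proof -
  have "(\<rho>^2) powr (p - real N / 2) = \<rho> powr (2 * p - real N)"
   using pos by (simp add: sq_powr right_diff_distrib)
  also have "... = \<rho> powr (2 * p) / \<rho> ^ N" using pos by (simp add: powr_diff powr_realpow)
  finally show ?thesis by (simp add: powr_divide)
 qed
 have T: "w * \<theta> > 0" using pos by simp
 have "\<theta> powr (p - real N / 2) * I / (w * \<theta>) =
   (\<theta> / \<rho>^2) powr (p - real N / 2) * (1 / (w * \<rho> ^ N * \<theta>) * (\<rho> powr (2 * p) * I))"
  unfolding 1 using pos by simp
 then have "\<theta> powr (p - real N / 2) * I / (w * \<theta>) <= M powr (lambda_exp N m (p * (1 + m)) / 2)" using H by linarith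
 then have I: "\<theta> powr (p - real N / 2) * I <= M powr (lambda_exp N m (p * (1 + m)) / 2) * (w * \<theta>)" using T by (simp only: pos_divide_le_eq)
 have "R^2 / M powr (2 * m) = \<delta>^2 * \<theta> * (M powr (m - 1) / M powr (2 * m))"
  unfolding rescaled_radius(1)[OF M pos(1,4) R] by simp
 also have "M powr (m - 1) / M powr (2 * m) = M powr (m - 1 - 2 * m)" by (rule powr_diff[symmetric])
 also have "m - 1 - 2 * m = - (1 + m)" by simp
 finally have "(R^2 / M powr (2 * m)) powr p = (\<delta>^2) powr p * \<theta> powr p * (M powr (- (1 + m))) powr p"
  by (simp only: powr_mult)
 also have "... = \<delta> powr (2 * p) * \<theta> powr p * M powr (- (1 + m) * p)"
  using pos by (simp only: sq_powr powr_powr less_imp_le)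
 also have "\<theta> powr p = \<theta> powr (real N / 2) * \<theta> powr (p - real N / 2)" by (simp flip: powr_add)
 finally have "(R^2 / M powr (2 * m)) powr p * I =
   \<delta> powr (2 * p) * \<theta> powr (real N / 2) * M powr (- (1 + m) * p) * (\<theta> powr (p - real N / 2) * I)" by simp
 also have "... <= \<delta> powr (2 * p) * \<theta> powr (real N / 2) * M powr (- (1 + m) * p) * (M powr (lambda_exp N m (p * (1 + m)) / 2) * (w * \<theta>))"
  using I by (intro mult_left_mono) auto
 also have "... = \<delta> powr (2 * p) * (\<theta> powr (real N / 2) * (M powr (- (1 + m) * p) * M powr (lambda_exp N m (p * (1 + m)) / 2)) * w * \<theta>)"
  by simp
 also have "M powr (- (1 + m) * p) * M powr (lambda_exp N m (p * (1 + m)) / 2) = M powr (real N * (m - 1) / 2)"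
  unfolding powr_add[symmetric] lambda_exp_def by (simp add: algebra_simps add_divide_distrib diff_divide_distrib)
 also have "\<delta> powr (2 * p) * (\<theta> powr (real N / 2) * M powr (real N * (m - 1) / 2) * w * \<theta>) <=
   \<delta> powr (real (N + 2)) * (\<theta> powr (real N / 2) * M powr (real N * (m - 1) / 2) * w * \<theta>)"
  using pos p by (intro mult_right_mono powr_mono') auto
 also have "\<delta> powr (real (N + 2)) = \<delta> ^ N * \<delta>^2" using pos by (simp only: powr_realpow power_add)
 also have "\<delta> ^ N * \<delta>^2 * (\<theta> powr (real N / 2) * M powr (real N * (m - 1) / 2) * w * \<theta>) =
   w * (\<delta> ^ N * \<theta> powr (real N / 2) * M powr (real N * (m - 1) / 2)) * (\<delta>^2 * \<theta>)" by simp
 finally show ?thesis unfolding rescaled_radius(2)[OF M pos(1,4) R, of N] .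
qed

lemma set_integral_mono_set:
 fixes h :: "'a => real"
 assumes "set_integrable M B h" "A \<subseteq> B" "A \<in> sets M" "\<And>x. h x \<ge> 0"
 shows "(LINT x:A|M. h x) <= (LINT x:B|M. h x)" "set_integrable M A h"
proof -
 show i: "set_integrable M A h" using assms by (intro set_integrable_subset[of M B h A])
 show "(LINT x:A|M. h x) <= (LINT x:B|M. h x)"
  unfolding set_lebesgue_integral_def
  by (rule integral_mono) (use i assms in \<open>auto simp: set_integrable_def split: split_indicator\<close>)
qed

lemma measure_half_open_cylinder:
 fixes x0 :: "real ^ 'n"
 assumes "\<rho> \<ge> 0" "\<theta> \<ge> 0"
 shows "cylinder x0 t0 \<rho> \<theta> \<in> sets borel"
  and "measure lebesgue (cylinder x0 t0 \<rho> \<theta>) = measure lborel (ball (0 :: real ^ 'n) 1) * \<rho> ^ CARD('n) * \<theta>"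
proof -
 show m: "cylinder x0 t0 \<rho> \<theta> \<in> sets borel" unfolding cylinder_def by (intro borel_Times) auto
 have "emeasure lborel (cylinder x0 t0 \<rho> \<theta>) = emeasure lborel (ball x0 \<rho>) * emeasure lborel {t0 - \<theta><..t0}"
  unfolding cylinder_def by (subst lborel_prod[symmetric]) (simp add: lborel.emeasure_pair_measure_Times)
 then have "measure lborel (cylinder x0 t0 \<rho> \<theta>) = measure lborel (ball x0 \<rho>) * measure lborel {t0 - \<theta><..t0}"
  by (simp add: measure_def enn2real_mult)
 then show "measure lebesgue (cylinder x0 t0 \<rho> \<theta>) = measure lborel (ball (0 :: real ^ 'n) 1) * \<rho> ^ CARD('n) * \<theta>"
  using assms m by (simp add: content_ball)
qed

text \<open>K stands for the right-hand side of the theorem: K1, K2 and K3 say that each entry of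
  the maximum is at most K, with the outer powers inverted. The condition on C is what makes
  Chebyshev's bound meet the threshold \<epsilon> in every step.\<close>

locale scaling = weak_sol k m \<nu> L \<Omega> Tf a f g u
 for k m \<nu> L and \<Omega> :: "(real ^ 'n) set" and Tf a f g u +
 fixes x0 :: "real ^ 'n" and t0 \<rho> \<theta> p r K C \<sigma> \<epsilon> :: real and N :: nat
 assumes \<rho>: "\<rho> > 0" and \<theta>: "\<theta> > 0" and cyl: "ball x0 \<rho> \<subseteq> \<Omega>" "\<theta> <= t0" "t0 <= Tf"
  and p: "p > (real N + 2) / 2" and r: "r > 0" "lambda_exp N m r > 0" and \<sigma>: "0 < \<sigma>" "\<sigma> < 1"
  and ui: "set_integrable lebesgue (cylinder x0 t0 \<rho> \<theta>) (\<lambda>z. fnorm k (u z) powr r)"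
  and fi: "set_integrable lebesgue (cylinder x0 t0 \<rho> \<theta>) (\<lambda>z. fnorm k (f z) powr (2 * p))"
  and K: "K > 0"
  and K1: "C / (1 - \<sigma>) ^ (N + 2) * (\<rho>^2 / \<theta>) powr (real N / 2) *
   avg (cylinder x0 t0 \<rho> \<theta>) (\<lambda>z. fnorm k (u z) powr r) <= K powr (lambda_exp N m r / 2)"
  and K2: "(\<theta> / \<rho>^2) powr (p - real N / 2) *
   avg (cylinder x0 t0 \<rho> \<theta>) (\<lambda>z. fnorm k (\<lambda>i. \<rho> *\<^sub>R f z i) powr (2 * p)) <= K powr (lambda_exp N m (p * (1 + m)) / 2)"
  and K3: "\<theta> / \<rho>^2 <= K powr (1 - m)"
  and N_def: "N = CARD('n)" and \<epsilon>_def: "\<epsilon> = dg_small TYPE('n) m \<nu> L p"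
  and C: "\<epsilon> > 0 ==> 4 powr r <= \<epsilon> * C * (1 - 2 powr (- lambda_exp N m r / (2 * (real N + 2)))) ^ (N + 2)"
begin

abbreviation "Qc \<equiv> cylinder x0 t0 \<rho> \<theta>"
definition "\<omega> = measure lborel (ball (0 :: real ^ 'n) 1)"

lemma \<omega>: "\<omega> > 0" by (simp add: \<omega>_def)

lemma avg_eq: "avg Qc h = 1 / (\<omega> * \<rho> ^ N * \<theta>) * (LINT z:Qc|lebesgue. h z)"
 using measure_half_open_cylinder(2)[of \<rho> \<theta> x0 t0] \<rho> \<theta> by (simp add: avg_def \<omega>_def N_def)

lemma fnorm_scale: "fnorm k (\<lambda>i. \<rho> *\<^sub>R f z i) powr (2 * p) = \<rho> powr (2 * p) * fnorm k (f z) powr (2 * p)"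
proof -
 have "fnorm k (\<lambda>i. \<rho> *\<^sub>R f z i) = \<rho> * fnorm k (f z)"
  using \<rho> by (simp add: fnorm_def L2_set_right_distrib)
 then show ?thesis by (simp only: powr_mult)
qed

lemma dg_exp_pos: "dg_exp N p > 0" and p1: "p > 1"
proof -
 have N: "real N \<ge> 1" by (simp add: N_def)
 have "1 < (1 + 2) / (2 :: real)" by simp
 also have "... <= (real N + 2) / 2" using N by (intro divide_right_mono) auto
 also note p
 finally show p1: "p > 1" .
 have "(1 - 1 / p) * (1 + 2 / real N) - 1 = (2 * p - real N - 2) / (p * real N)"
  using p1 N by (simp add: field_simps)
 also have "... > 0" using p p1 N by (intro divide_pos_pos mult_pos_pos) auto
 finally show "dg_exp N p > 0" by (simp add: dg_exp_def)
qed

text \<open>Because 2p (1 + m) > (N + 2)(1 + m) > N (1 - m). It makes the source condition monotone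
  in the level, so that it passes from K to every M >= K.\<close>

lemma source_exp_pos: "lambda_exp N m (p * (1 + m)) > 0"
proof -
 have "real N * (1 - m) < (real N + 2) * (1 + m)" using m by (intro mult_strict_mono) auto
 also have "... < 2 * p * (1 + m)" using p m by (intro mult_strict_right_mono) auto
 finally show ?thesis by (simp add: lambda_exp_def algebra_simps)
qed

text \<open>Around every point of the smaller cylinder an intrinsic cylinder of radius R <= \<delta>
  \<rho> and length \<delta>^2 \<theta> <= \<delta> \<theta> fits into the larger one, and
  \<open>halving\<close> applies to it. Its integrals are simply bounded by those over all of
  \<open>Qc\<close>; the factor \<delta>^(N+2) in \<open>H\<close> pays for this.\<close>

lemma halving_step:
 assumes M: "K <= M" and \<delta>: "0 < \<delta>" "\<delta> <= 1" and rad: "0 <= \<rho>2" "\<rho>2 + \<delta> * \<rho> <= \<rho>1" "\<rho>1 <= \<rho>" "0 <= \<theta>2" "\<theta>2 + \<delta> * \<theta> <= \<theta>1" "\<theta>1 <= \<theta>"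
  and bd: "AE z in lborel. z \<in> ball x0 \<rho>1 \<times> {t0 - \<theta>1<..<t0} --> fnorm k (u z) <= M"
  and H: "\<epsilon> > 0 ==> 4 powr r * ((\<rho>^2 / \<theta>) powr (real N / 2) * avg Qc (\<lambda>z. fnorm k (u z) powr r)) <=
   \<epsilon> * (\<delta> ^ (N + 2) * M powr (lambda_exp N m r / 2))"
 shows "AE z in lborel. z \<in> ball x0 \<rho>2 \<times> {t0 - \<theta>2<..<t0} --> fnorm k (u z) <= M / 2"
proof (rule AE_local)
 fix z1 :: "(real ^ 'n) \<times> real" assume z1: "z1 \<in> ball x0 \<rho>2 \<times> {t0 - \<theta>2<..<t0}"
 define x1 where "x1 = fst z1"
 define \<tau> where "\<tau> = snd z1"
 have x1: "dist x0 x1 < \<rho>2" and \<tau>: "t0 - \<theta>2 < \<tau>" "\<tau> < t0" using z1 by (auto simp: x1_def \<tau>_def mem_Times_iff)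
 have M0: "M > 0" using K M by simp
 define R where "R = \<delta> * \<theta> powr (1 / 2) * M powr ((m - 1) / 2)"
 note Rs = rescaled_radius[OF M0 \<theta> \<delta>(1) R_def]
 have R0: "R > 0" using \<delta> \<theta> M0 by (simp add: R_def)
 define \<Theta> where "\<Theta> = \<delta>^2 * \<theta>"
 have \<Theta>0: "\<Theta> > 0" using \<delta> \<theta> by (simp add: \<Theta>_def)
 have \<Theta>R: "\<Theta> = M powr (1 - m) * R^2"
 proof -
  have "M powr (1 - m) * R^2 = \<Theta> * (M powr (1 - m) * M powr (m - 1))" unfolding Rs(1) by (simp add: \<Theta>_def)
  also have "M powr (1 - m) * M powr (m - 1) = 1" using M0 by (simp flip: powr_add)
  finally show ?thesis by simp
 qed
 have \<Theta>le: "\<Theta> <= \<delta> * \<theta>"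
 proof -
  have "\<delta> * \<delta> <= \<delta> * 1" using \<delta> by (intro mult_left_mono) auto
  then have "\<delta> * \<delta> * \<theta> <= \<delta> * 1 * \<theta>" using \<theta> by (intro mult_right_mono) auto
  then show ?thesis by (simp add: \<Theta>_def power2_eq_square)
 qed
 \<comment> \<open>This is where K3 enters, in the form \<theta> <= M^(1-m) \<rho>^2.\<close>
 have Rle: "R <= \<delta> * \<rho>"
 proof (rule power2_le_imp_le)
  have "K powr (1 - m) <= M powr (1 - m)" using K M m by (intro powr_mono2) auto
  then have "\<theta> <= M powr (1 - m) * \<rho>^2" using K3 \<rho> by (simp add: pos_divide_le_eq order_trans[OF _ mult_right_mono])
  then have "M powr (m - 1) * \<theta> <= M powr (m - 1) * (M powr (1 - m) * \<rho>^2)" by (intro mult_left_mono) auto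
  also have "... = M powr (m - 1) * M powr (1 - m) * \<rho>^2" by simp
  also have "M powr (m - 1) * M powr (1 - m) = 1" using M0 by (simp flip: powr_add)
  finally have "\<delta>^2 * (M powr (m - 1) * \<theta>) <= \<delta>^2 * \<rho>^2" by (intro mult_left_mono) auto
  then show "R^2 <= (\<delta> * \<rho>)^2" unfolding Rs(1) by (simp add: power_mult_distrib mult_ac)
 qed (use \<delta> \<rho> in simp)
 \<comment> \<open>The halved cylinder is open and ends at s, so s must exceed \<tau>, but it may
   not exceed t0. With \<Theta> / 4 the time \<tau> remains in the upper half.\<close>
 define s where "s = min t0 (\<tau> + \<Theta> / 4)"
 have s: "s <= t0" "\<tau> < s" "s - \<Theta> / 2 < \<tau>" "t0 - \<theta>1 <= s - \<Theta>"
  using \<tau> \<Theta>0 \<Theta>le rad by (auto simp: s_def min_def)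
 have sub1: "ball x1 R \<times> {s - \<Theta><..<s} \<subseteq> ball x0 \<rho>1 \<times> {t0 - \<theta>1<..<t0}"
 proof -
  have "ball x1 R \<subseteq> ball x0 \<rho>1"
  proof
   fix y assume "y \<in> ball x1 R"
   then have "dist x0 y < \<rho>2 + R" using dist_triangle[of x0 y x1] x1 by simp
   then show "y \<in> ball x0 \<rho>1" using Rle rad by simp
  qed
  then show ?thesis using s by force
 qed
 have sub2: "ball x0 \<rho>1 \<times> {t0 - \<theta>1<..<t0} \<subseteq> Qc" using rad by (auto simp: cylinder_def)
 have bd1: "AE z in lebesgue. z \<in> ball x1 R \<times> {s - \<Theta><..<s} --> fnorm k (u z) <= M"
  using AE_completion[OF bd] by eventually_elim (use sub1 in blast)
 interpret cs: cylinder_sol k m \<nu> L \<Omega> Tf a f g u x1 R "s - \<Theta>" s M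
 proof unfold_locales
  have "ball x1 R \<subseteq> ball x0 \<rho>1" using sub1 \<Theta>0 by (auto dest!: subsetD[of "ball x1 R \<times> _" _ "(_, s - \<Theta> / 2)"])
  then show "ball x1 R \<subseteq> \<Omega>" using cyl(1) subset_ball[OF rad(3), of x0] by blast
  show "0 <= s - \<Theta>" using s rad cyl by linarith
  show "s <= Tf" using s cyl by linarith
 qed (use R0 \<Theta>0 M0 bd1 in auto)
 have Q1: "ball x1 R \<times> {s - \<Theta><..<s} \<subseteq> Qc" "ball x1 R \<times> {s - \<Theta><..<s} \<in> sets lebesgue"
  using sub1 sub2 cs.Q_meas by auto
 have mQ: "measure lborel (ball x1 R \<times> {s - \<Theta><..<s}) = \<omega> * R ^ N * (\<delta>^2 * \<theta>)"
  using measure_cylinder[of R "s - \<Theta>" s x1] R0 \<Theta>0 by (simp add: \<omega>_def \<Theta>_def N_def)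
 note um = set_integral_mono_set[OF ui Q1 powr_ge_zero] and fm = set_integral_mono_set[OF fi Q1 powr_ge_zero]
 have "AE z in lborel. z \<in> ball x1 (R / 2) \<times> {s - (s - (s - \<Theta>)) / 2<..<s} --> fnorm k (u z) <= M / 2"
 proof (rule cs.halving[where p = p, folded \<epsilon>_def, folded N_def, OF p1 dg_exp_pos r(1) _ fm(2)])
  show "s - (s - \<Theta>) = M powr (1 - m) * R^2" using \<Theta>R by simp
  have "(R^2 / M powr (2 * m)) powr p * (LINT z:Qc|lebesgue. fnorm k (f z) powr (2 * p)) <= \<omega> * R ^ N * (\<delta>^2 * \<theta>)"
  proof (rule source_condition[OF M0 \<theta> \<rho> \<omega> \<delta> R_def])
   show "real N + 2 <= 2 * p" using p by simp
   have "K powr (lambda_exp N m (p * (1 + m)) / 2) <= M powr (lambda_exp N m (p * (1 + m)) / 2)"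
    using K M source_exp_pos by (intro powr_mono2) auto
   then show "(\<theta> / \<rho>^2) powr (p - real N / 2) * (1 / (\<omega> * \<rho> ^ N * \<theta>) * (\<rho> powr (2 * p) * (LINT z:Qc|lebesgue. fnorm k (f z) powr (2 * p))))
    <= M powr (lambda_exp N m (p * (1 + m)) / 2)"
    using K2 unfolding avg_eq fnorm_scale set_integral_mult_right by linarith
  qed
  then show "(R^2 / M powr (2 * m)) powr p * (LINT z:ball x1 R \<times> {s - \<Theta><..<s}|lebesgue. fnorm k (f z) powr (2 * p))
    <= measure lborel (ball x1 R \<times> {s - \<Theta><..<s})"
   unfolding mQ by (rule order_trans[OF mult_left_mono[OF fm(1)], rotated]) simp
  assume \<epsilon>: "\<epsilon> > 0"
  have "(4 / M) powr r * (LINT z:Qc|lebesgue. fnorm k (u z) powr r) <= \<epsilon> * (\<omega> * R ^ N * (\<delta>^2 * \<theta>))"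
   by (rule measure_condition[OF M0 \<theta> \<rho> \<omega> \<delta>(1) R_def]) (use H[OF \<epsilon>] in \<open>simp only: avg_eq\<close>)
  then show "(4 / M) powr r * (LINT z:ball x1 R \<times> {s - \<Theta><..<s}|lebesgue. fnorm k (u z) powr r)
    <= \<epsilon> * measure lborel (ball x1 R \<times> {s - \<Theta><..<s})"
   unfolding mQ by (rule order_trans[OF mult_left_mono[OF um(1)], rotated]) simp
 qed
 then have "AE z in lborel. z \<in> ball x1 (R / 2) \<times> {s - \<Theta> / 2<..<s} --> fnorm k (u z) <= M / 2" by simp
 moreover have "open (ball x1 (R / 2) \<times> {s - \<Theta> / 2<..<s})" by (intro open_Times) auto
 moreover have "z1 \<in> ball x1 (R / 2) \<times> {s - \<Theta> / 2<..<s}"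
  using s R0 by (simp add: mem_Times_iff x1_def[symmetric] \<tau>_def[symmetric])
 ultimately show "\<exists>W. open W \<and> z1 \<in> W \<and> (AE w in lborel. w \<in> W --> fnorm k (u w) <= M / 2)" by blast
qed

lemma sup_bound:
 assumes bd: "AE z in lborel. z \<in> ball x0 \<rho> \<times> {t0 - \<theta><..<t0} --> fnorm k (u z) <= M0"
 shows "AE z in lborel. z \<in> ball x0 (\<sigma> * \<rho>) \<times> {t0 - \<sigma> * \<theta><..<t0} --> fnorm k (u z) <= K"
proof -
 define q where "q = 2 powr (- lambda_exp N m r / (2 * (real N + 2)))"
 have q: "0 < q" "q < 1" using r(2) by (simp_all add: q_def powr_less_one)
 have qN: "q ^ (N + 2) * 2 powr (lambda_exp N m r / 2) = 1"
 proof -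
  have "q ^ (N + 2) = q powr (real (N + 2))" using q by (simp only: powr_realpow)
  also have "... = 2 powr (- lambda_exp N m r / (2 * (real N + 2)) * real (N + 2))" unfolding q_def powr_powr ..
  also have "- lambda_exp N m r / (2 * (real N + 2)) * real (N + 2) = - (lambda_exp N m r / 2)" by (simp add: field_simps)
  finally show ?thesis by (simp add: powr_minus)
 qed
 \<comment> \<open>The factors increase to 1 with i and are at least \<sigma>, so the cylinders of
   all steps lie between the two of the theorem, whatever the number of steps.\<close>
 define h where "h i = 1 - (1 - \<sigma>) * q ^ Suc i" for i
 have h: "\<sigma> <= h i" "h i <= 1" for i
 proof -
  have "(1 - \<sigma>) * q ^ Suc i <= (1 - \<sigma>) * 1" using \<sigma> q by (intro mult_left_mono power_le_one) auto
  then show "\<sigma> <= h i" by (simp add: h_def)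
  have "0 <= (1 - \<sigma>) * q ^ Suc i" using \<sigma> q by simp
  then show "h i <= 1" by (simp add: h_def)
 qed
 define P where "P i \<longleftrightarrow> (AE z in lborel. z \<in> ball x0 (h i * \<rho>) \<times> {t0 - h i * \<theta><..<t0} --> fnorm k (u z) <= 2 ^ i * K)" for i
 obtain J where J: "M0 / K < 2 ^ J" using real_arch_pow[of 2 "M0 / K"] by auto
 have PJ: "P J" unfolding P_def using bd
 proof eventually_elim
  case (elim z)
  show ?case
  proof
   assume z: "z \<in> ball x0 (h J * \<rho>) \<times> {t0 - h J * \<theta><..<t0}"
   have "h J * \<rho> <= 1 * \<rho>" "h J * \<theta> <= 1 * \<theta>" using h \<rho> \<theta> by (intro mult_right_mono; simp)+
   then have "z \<in> ball x0 \<rho> \<times> {t0 - \<theta><..<t0}" using z by (auto simp: mem_Times_iff)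
   then have "fnorm k (u z) <= M0" using elim by simp
   also have "M0 <= 2 ^ J * K" using J K by (simp add: pos_divide_less_eq)
   finally show "fnorm k (u z) <= 2 ^ J * K" .
  qed
 qed
 have step: "P i" if "P (Suc i)" for i
 proof -
  \<comment> \<open>This is h (Suc i) - h i, the share of the cylinder given up in the step.\<close>
  define \<delta> where "\<delta> = (1 - \<sigma>) * (1 - q) * q ^ Suc i"
  have \<delta>: "0 < \<delta>" "\<delta> <= 1"
  proof -
   show "0 < \<delta>" using \<sigma> q by (simp add: \<delta>_def)
   have "\<delta> <= 1 * 1 * 1" unfolding \<delta>_def using \<sigma> q by (intro mult_mono power_le_one) auto
   then show "\<delta> <= 1" by simp
  qed
  have hd: "h i + \<delta> = h (Suc i)" by (simp add: h_def \<delta>_def algebra_simps)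
  have eq: "h i * c + \<delta> * c = h (Suc i) * c" for c unfolding hd[symmetric] by (simp add: distrib_right)
  let ?M = "2 ^ Suc i * K"
  have KM: "K <= ?M" using K by (simp del: power_Suc)
  have H: "4 powr r * ((\<rho>^2 / \<theta>) powr (real N / 2) * avg Qc (\<lambda>z. fnorm k (u z) powr r)) <=
   \<epsilon> * (\<delta> ^ (N + 2) * ?M powr (lambda_exp N m r / 2))" if \<epsilon>: "\<epsilon> > 0"
  proof -
   let ?a = "(\<rho>^2 / \<theta>) powr (real N / 2) * avg Qc (\<lambda>z. fnorm k (u z) powr r)"
   have a0: "?a \<ge> 0"
    unfolding avg_eq using \<omega> \<rho> \<theta> by (intro mult_nonneg_nonneg) (auto simp: set_lebesgue_integral_def intro!: bochner_nonneg)
   have s: "(1 - \<sigma>) ^ (N + 2) > 0" using \<sigma> by simp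
   have "C / (1 - \<sigma>) ^ (N + 2) * ?a <= K powr (lambda_exp N m r / 2)" using K1 by (simp only: mult.assoc)
   then have 1: "C * ?a <= (1 - \<sigma>) ^ (N + 2) * K powr (lambda_exp N m r / 2)"
    using s by (simp add: pos_divide_le_eq mult.commute)
   have "\<delta> ^ (N + 2) * ?M powr (lambda_exp N m r / 2) =
    (1 - \<sigma>) ^ (N + 2) * (1 - q) ^ (N + 2) * (q ^ (N + 2)) ^ Suc i * ((2 powr (lambda_exp N m r / 2)) ^ Suc i * K powr (lambda_exp N m r / 2))"
   proof -
    have "?M powr (lambda_exp N m r / 2) = (2 ^ Suc i) powr (lambda_exp N m r / 2) * K powr (lambda_exp N m r / 2)" by (rule powr_mult)
    also have "(2 ^ Suc i) powr (lambda_exp N m r / 2) = (2 powr real (Suc i)) powr (lambda_exp N m r / 2)" by (simp only: powr_realpow zero_less_numeral)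
    also have "... = (2 powr (lambda_exp N m r / 2)) powr real (Suc i)" by (simp only: powr_powr mult.commute)
    also have "... = (2 powr (lambda_exp N m r / 2)) ^ Suc i" by (rule powr_realpow) simp
    finally show ?thesis unfolding \<delta>_def power_mult_distrib by (simp only: power_mult[symmetric] mult.commute[of "Suc i"])
   qed
   \<comment> \<open>The loss from the shrinking and the gain from the larger level are powers with
     the same exponent, and their bases are inverse to each other by \<open>qN\<close>; what remains
     is independent of i.\<close>
   also have "... = (1 - \<sigma>) ^ (N + 2) * (1 - q) ^ (N + 2) * (q ^ (N + 2) * 2 powr (lambda_exp N m r / 2)) ^ Suc i * K powr (lambda_exp N m r / 2)"
    by (simp only: power_mult_distrib mult.assoc)
   also have "... = (1 - q) ^ (N + 2) * ((1 - \<sigma>) ^ (N + 2) * K powr (lambda_exp N m r / 2))" unfolding qN by simp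
   also have "... \<ge> (1 - q) ^ (N + 2) * (C * ?a)" using 1 q by (intro mult_left_mono) auto
   finally have "\<epsilon> * ((1 - q) ^ (N + 2) * (C * ?a)) <= \<epsilon> * (\<delta> ^ (N + 2) * ?M powr (lambda_exp N m r / 2))"
    using \<epsilon> by (intro mult_left_mono) auto
   moreover have "4 powr r * ?a <= \<epsilon> * C * (1 - q) ^ (N + 2) * ?a"
    using C[OF \<epsilon>] a0 unfolding q_def by (intro mult_right_mono) auto
   moreover have "\<epsilon> * C * (1 - q) ^ (N + 2) * ?a = \<epsilon> * ((1 - q) ^ (N + 2) * (C * ?a))" by (simp only: mult_ac)
   ultimately show ?thesis by linarith
  qed
  have "AE z in lborel. z \<in> ball x0 (h i * \<rho>) \<times> {t0 - h i * \<theta><..<t0} --> fnorm k (u z) <= ?M / 2"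
  proof (rule halving_step[OF KM \<delta> _ _ _ _ _ _ that[unfolded P_def] H])
   show "h i * \<rho> + \<delta> * \<rho> <= h (Suc i) * \<rho>" "h i * \<theta> + \<delta> * \<theta> <= h (Suc i) * \<theta>" unfolding eq by simp_all
   show "h (Suc i) * \<rho> <= \<rho>" "h (Suc i) * \<theta> <= \<theta>" using h[of "Suc i"] \<rho> \<theta> by (simp_all add: mult_left_le_one_le)
   show "0 <= h i * \<rho>" "0 <= h i * \<theta>" using h[of i] \<sigma> \<rho> \<theta> by simp_all
  qed
  then show ?thesis unfolding P_def by simp
 qed
 have "P (J - n)" for n
 proof (induction n)
  case (Suc n)
  show ?case
  proof (cases "n < J")
   case True
   then have "Suc (J - Suc n) = J - n" by simp
   then show ?thesis using step[of "J - Suc n"] Suc by simp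
  next
   case False
   then show ?thesis using Suc by simp
  qed
 qed (use PJ in simp)
 from this[of J] have "P 0" by simp
 then show ?thesis unfolding P_def
 proof eventually_elim
  case (elim z)
  show ?case
  proof
   assume z: "z \<in> ball x0 (\<sigma> * \<rho>) \<times> {t0 - \<sigma> * \<theta><..<t0}"
   have "\<sigma> * \<rho> <= h 0 * \<rho>" "\<sigma> * \<theta> <= h 0 * \<theta>" using h \<rho> \<theta> by (intro mult_right_mono; simp)+
   then have "z \<in> ball x0 (h 0 * \<rho>) \<times> {t0 - h 0 * \<theta><..<t0}" using z by (auto simp: mem_Times_iff)
   then show "fnorm k (u z) <= K" using elim by simp
  qed
 qed
qed

end

section \<open>The top time slice and the conclusion\<close>

lemma AE_snd_neq: "AE z in lborel. snd (z :: (real ^ 'n) \<times> real) \<noteq> c"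
proof -
 have "emeasure lborel (UNIV \<times> {c} :: ((real ^ 'n) \<times> real) set) = 0"
  by (subst lborel_prod[symmetric]) (simp add: lborel.emeasure_pair_measure_Times)
 then have "AE z in lborel. z \<notin> (UNIV \<times> {c} :: ((real ^ 'n) \<times> real) set)"
  by (intro AE_not_in null_setsI) (auto intro!: borel_Times)
 then show ?thesis by eventually_elim (auto simp: mem_Times_iff)
qed

lemma closure_cylinder:
 assumes "\<rho> > 0" "\<theta> > 0"
 shows "closure (cylinder x0 t0 \<rho> \<theta>) = cball x0 \<rho> \<times> {t0 - \<theta>..t0}"
 using assms by (simp add: cylinder_def closure_Times)

theorem proposition4p2:
  fixes N :: nat and m p r \<nu> L :: real
  assumes N: "N = CARD('n::finite)"
    and m: "0 < m" "m \<le> (real N - 2) / (real N + 2)"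
    and p: "p > (real N + 2) / 2"
    and r: "r \<ge> 1" "lambda_exp N m r > 0"
    and \<nu>: "\<nu> > 0" and L: "L > 0"
  shows "\<exists>C>0. \<forall>k\<ge>1. \<forall>(\<Omega> :: (real ^ 'n) set) T A F u.
    open \<Omega> \<longrightarrow> bounded \<Omega> \<longrightarrow> T > 0 \<longrightarrow>
    caratheodory k \<Omega> T A \<longrightarrow> G1 k \<Omega> T \<nu> A \<longrightarrow> G2 k \<Omega> T L A \<longrightarrow> G3 k m \<Omega> T A \<longrightarrow>
    weak_solution k m \<Omega> T A F u \<longrightarrow>
    locally_bdd k (\<Omega> \<times> {0<..T}) u \<longrightarrow>
    in_Lp_loc (2 * p) k (\<Omega> \<times> {0<..T}) F \<longrightarrow>
    (\<forall>x0 t0 \<rho> \<theta> \<sigma>.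
       \<rho> > 0 \<longrightarrow> \<theta> > 0 \<longrightarrow>
       compact (closure (cylinder x0 t0 \<rho> \<theta>)) \<longrightarrow>
       closure (cylinder x0 t0 \<rho> \<theta>) \<subseteq> \<Omega> \<times> {0<..T} \<longrightarrow>
       1 / 2 \<le> \<sigma> \<longrightarrow> \<sigma> < 1 \<longrightarrow>
       ess_sup_norm k (cylinder x0 t0 (\<sigma> * \<rho>) (\<sigma> * \<theta>)) u \<le> ereal (Max {
         (C / (1 - \<sigma>) ^ (N + 2) * (\<rho>\<^sup>2 / \<theta>) powr (real N / 2) *
            avg (cylinder x0 t0 \<rho> \<theta>) (\<lambda>z. fnorm k (u z) powr r))
           powr (2 / lambda_exp N m r),
         ((\<theta> / \<rho>\<^sup>2) powr (p - real N / 2) *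
            avg (cylinder x0 t0 \<rho> \<theta>) (\<lambda>z. fnorm k (\<lambda>i. \<rho> *\<^sub>R F z i) powr (2 * p)))
           powr (2 / lambda_exp N m (p * (1 + m))),
         (\<theta> / \<rho>\<^sup>2) powr (1 / (1 - m))}))"
proof -
 define \<epsilon> where "\<epsilon> = dg_small TYPE('n) m \<nu> L p"
 define q where "q = 2 powr (- lambda_exp N m r / (2 * (real N + 2)))"
 \<comment> \<open>The second entry makes Chebyshev's bound meet the threshold \<epsilon>; the first
   makes C positive whatever the sign of \<epsilon>, which is not yet known here. Only N, m, \<nu>,
   L, p and r enter.\<close>
 define C where "C = max 1 (4 powr r / (\<epsilon> * (1 - q) ^ (N + 2)))"
 have C0: "C > 0" by (simp add: C_def)
 have q: "q < 1" using r(2) by (simp add: q_def powr_less_one)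
 have C: "4 powr r <= \<epsilon> * C * (1 - q) ^ (N + 2)" if "\<epsilon> > 0"
 proof -
  have pos: "\<epsilon> * (1 - q) ^ (N + 2) > 0" using that q by simp
  have "4 powr r / (\<epsilon> * (1 - q) ^ (N + 2)) <= C" by (simp add: C_def)
  then have "4 powr r <= C * (\<epsilon> * (1 - q) ^ (N + 2))" using pos by (simp only: pos_divide_le_eq)
  then show ?thesis by (simp only: mult_ac)
 qed
 have m1: "m < 1"
 proof -
  have "(real N - 2) / (real N + 2) < 1" by (simp add: pos_divide_less_eq)
  then show ?thesis using m by linarith
 qed
 show ?thesis
 proof (intro exI[of _ C] conjI C0 allI impI)
  fix k :: nat and \<Omega> :: "(real ^ 'n) set" and T A F u x0 t0 \<rho> \<theta> \<sigma>
  assume k: "k \<ge> 1" and \<Omega>: "open \<Omega>" and T: "(T :: real) > 0"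
   and A: "caratheodory k \<Omega> T A" "G1 k \<Omega> T \<nu> A" "G2 k \<Omega> T L A" "G3 k m \<Omega> T A"
   and sol: "weak_solution k m \<Omega> T A F u" and bdd: "locally_bdd k (\<Omega> \<times> {0<..T}) u"
   and F: "in_Lp_loc (2 * p) k (\<Omega> \<times> {0<..T}) F"
   and \<rho>: "(\<rho> :: real) > 0" and \<theta>: "(\<theta> :: real) > 0"
   and comp: "compact (closure (cylinder x0 t0 \<rho> \<theta>))"
   and sub: "closure (cylinder x0 t0 \<rho> \<theta>) \<subseteq> \<Omega> \<times> {0<..T}"
   and \<sigma>: "1 / 2 <= \<sigma>" "(\<sigma> :: real) < 1"
  let ?Q = "cylinder x0 t0 \<rho> \<theta>"
  have cl: "cball x0 \<rho> \<times> {t0 - \<theta>..t0} \<subseteq> \<Omega> \<times> {0<..T}" using sub unfolding closure_cylinder[OF \<rho> \<theta>] .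
  have "(x0, t0) \<in> \<Omega> \<times> {0<..T}" by (rule subsetD[OF cl]) (use \<rho> \<theta> in simp)
  moreover have "(x0, t0 - \<theta>) \<in> \<Omega> \<times> {0<..T}" by (rule subsetD[OF cl]) (use \<rho> \<theta> in simp)
  ultimately have t: "\<theta> <= t0" "t0 <= T" by auto
  have ball: "ball x0 \<rho> \<subseteq> \<Omega>" using cl \<theta> by force
  have QD: "?Q \<subseteq> \<Omega> \<times> {0<..T}" using closure_subset sub by blast
  obtain G where G: "has_L2_W12_gradient k \<Omega> T (\<lambda>z. signed_pow k m (u z)) G"
   "\<forall>\<phi>. (\<forall>i<k. test_function (\<Omega> \<times> {0<..<T}) (\<phi> i)) -->
     (LINT z:\<Omega> \<times> {0<..T}|lebesgue.
       finner k (u z) (\<lambda>i. Dt (\<phi> i) z) -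
       finner k (A z (u z) (G z)) (\<lambda>i. Dx (\<phi> i) z)) =
     (LINT z:\<Omega> \<times> {0<..T}|lebesgue. finner k (F z) (\<lambda>i. Dx (\<phi> i) z))"
   using sol unfolding weak_solution_def by (elim conjE exE)
  have ws: "weak_sol k m \<nu> L \<Omega> T A F G u"
  proof (rule weak_sol.intro)
   show "u z \<in> fvec k" if "z \<in> \<Omega> \<times> {0<..T}" for z using sol that unfolding weak_solution_def by blast
   show "(\<lambda>z. u z i) \<in> borel_measurable (lebesgue_on (\<Omega> \<times> {0<..T}))" if "i < k" for i
    using sol that unfolding weak_solution_def by blast
   show "in_Lp 2 k (\<Omega> \<times> {0<..T}) F" "in_C0_Lp (1 + m) k \<Omega> T u" using sol unfolding weak_solution_def by blast+
  qed (use G in blast | rule m m1 \<nu> L \<Omega> A)+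
  interpret ws: weak_sol k m \<nu> L \<Omega> T A F G u by (rule ws)
  obtain M0 where M0: "AE z in lebesgue. z \<in> closure ?Q --> fnorm k (u z) <= M0"
   using bdd comp sub unfolding locally_bdd_def by blast
  have M0': "AE z in lborel. z \<in> closure ?Q --> fnorm k (u z) <= M0" using M0 by (simp add: AE_completion_iff)
  have Qm: "?Q \<in> sets lebesgue" using measure_half_open_cylinder(1)[of \<rho> \<theta> x0 t0] \<rho> \<theta> by simp
  have um: "(\<lambda>z. fnorm k (u z)) \<in> borel_measurable (lebesgue_on X)" if "X \<subseteq> \<Omega> \<times> {0<..T}" for X
   by (rule borel_measurable_fnorm[OF measurable_restrict_mono[OF ws.u_meas that]])
  have ui: "set_integrable lebesgue ?Q (\<lambda>z. fnorm k (u z) powr r)"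
   unfolding set_integrable_def
  proof (rule bochner_bound)
   have "bounded ?Q" using compact_imp_bounded[OF comp] bounded_subset closure_subset by blast
   then have "emeasure lebesgue ?Q < \<infinity>"
    using emeasure_bounded_finite[of ?Q] measure_half_open_cylinder(1)[of \<rho> \<theta> x0 t0] \<rho> \<theta> by simp
   then show "integrable lebesgue (\<lambda>z. max M0 0 powr r * indicator ?Q z)" using Qm by simp
   have "(\<lambda>z. fnorm k (u z) powr r) \<in> borel_measurable (lebesgue_on ?Q)" using um[OF QD] by measurable
   then show "(\<lambda>z. indicator ?Q z *\<^sub>R fnorm k (u z) powr r) \<in> borel_measurable lebesgue"
    by (subst (asm) borel_measurable_restrict_space_iff) (use Qm in auto)
   show "AE z in lebesgue. norm (indicator ?Q z *\<^sub>R fnorm k (u z) powr r) <= norm (max M0 0 powr r * indicator ?Q z)"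
    using M0
   proof eventually_elim
    case (elim z)
    show ?case
    proof (cases "z \<in> ?Q")
     case True
     then have "fnorm k (u z) <= max M0 0" using elim closure_subset[of ?Q] by auto
     then have "fnorm k (u z) powr r <= max M0 0 powr r" using r(1) by (intro powr_mono2 fnorm_nonneg) auto
     then show ?thesis using True by simp
    qed simp
   qed
  qed
  have fi: "set_integrable lebesgue ?Q (\<lambda>z. fnorm k (F z) powr (2 * p))"
  proof -
   have "in_Lp (2 * p) k (closure ?Q) F" using F comp sub unfolding in_Lp_loc_def by blast
   then have "set_integrable lebesgue (closure ?Q) (\<lambda>z. fnorm k (F z) powr (2 * p))" by (simp add: in_Lp_def)
   then show ?thesis by (rule set_integral_mono_set(2)[OF _ closure_subset Qm powr_ge_zero])
  qed
  define l where "l = lambda_exp N m r"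
  define l' where "l' = lambda_exp N m (p * (1 + m))"
  have l: "l > 0" using r(2) by (simp add: l_def)
  have l': "l' > 0"
  proof -
   have "real N * (1 - m) < (real N + 2) * (1 + m)" using m m1 by (intro mult_strict_mono) auto
   also have "... < 2 * p * (1 + m)" using p m by (intro mult_strict_right_mono) auto
   finally show ?thesis by (simp add: l'_def lambda_exp_def algebra_simps)
  qed
  define X1 where "X1 = C / (1 - \<sigma>) ^ (N + 2) * (\<rho>^2 / \<theta>) powr (real N / 2) * avg ?Q (\<lambda>z. fnorm k (u z) powr r)"
  define X2 where "X2 = (\<theta> / \<rho>^2) powr (p - real N / 2) * avg ?Q (\<lambda>z. fnorm k (\<lambda>i. \<rho> *\<^sub>R F z i) powr (2 * p))"
  define K where "K = Max {X1 powr (2 / l), X2 powr (2 / l'), (\<theta> / \<rho>^2) powr (1 / (1 - m))}"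
  have K_ge: "X1 powr (2 / l) <= K" "X2 powr (2 / l') <= K" "(\<theta> / \<rho>^2) powr (1 / (1 - m)) <= K"
   unfolding K_def by (intro Max_ge; simp)+
  have avg0: "avg ?Q h \<ge> 0" if "\<And>z. h z \<ge> 0" for h
   unfolding avg_def set_lebesgue_integral_def
   by (intro mult_nonneg_nonneg bochner_nonneg) (use that in \<open>simp_all split: split_indicator\<close>)
  have X: "X1 \<ge> 0" "X2 \<ge> 0"
   unfolding X1_def X2_def using C0 \<sigma> by (intro mult_nonneg_nonneg avg0; simp)+
  have root: "x <= K powr (1 / y)" if "x powr y <= K" "x \<ge> 0" "y > 0" for x y
  proof -
   have "x = (x powr y) powr (1 / y)" using that by (simp add: powr_powr)
   also have "... <= K powr (1 / y)" using that by (intro powr_mono2) auto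
   finally show ?thesis .
  qed
  \<comment> \<open>The third entry of the maximum is positive, so K > 0 even when u and F vanish on
    the cylinder.\<close>
  have "(\<theta> / \<rho>^2) powr (1 / (1 - m)) > 0" using \<theta> \<rho> by simp
  then have K0: "K > 0" using K_ge(3) by linarith
  have K1: "X1 <= K powr (l / 2)" using root[OF K_ge(1) X(1)] l by simp
  have K2: "X2 <= K powr (l' / 2)" using root[OF K_ge(2) X(2)] l' by simp
  have K3: "\<theta> / \<rho>^2 <= K powr (1 - m)" using root[OF K_ge(3)] \<theta> m1 by simp
  interpret sc: scaling k m \<nu> L \<Omega> T A F G u x0 t0 \<rho> \<theta> p r K C \<sigma> \<epsilon> N
  proof (rule scaling.intro[OF ws], rule scaling_axioms.intro)
   show "0 < r" "0 < \<sigma>" using r \<sigma> by simp_all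
  qed (rule \<rho> \<theta> ball t p r \<sigma> ui fi K0 N K1[unfolded X1_def l_def] K2[unfolded X2_def l'_def] K3 \<epsilon>_def C[unfolded q_def] | assumption)+
  have "AE z in lborel. z \<in> ball x0 \<rho> \<times> {t0 - \<theta><..<t0} --> fnorm k (u z) <= M0"
   using M0'
  proof eventually_elim
   case (elim z)
   show ?case
   proof
    assume "z \<in> ball x0 \<rho> \<times> {t0 - \<theta><..<t0}"
    then have "z \<in> ?Q" by (auto simp: cylinder_def)
    then show "fnorm k (u z) <= M0" using elim closure_subset by blast
   qed
  qed
  from sc.sup_bound[OF this] AE_snd_neq[of t0]
  have ae: "AE z in lborel. z \<in> cylinder x0 t0 (\<sigma> * \<rho>) (\<sigma> * \<theta>) --> fnorm k (u z) <= K"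
  proof eventually_elim
   case (elim z)
   then show ?case by (auto simp: cylinder_def mem_Times_iff)
  qed
  let ?Qs = "cylinder x0 t0 (\<sigma> * \<rho>) (\<sigma> * \<theta>)"
  have Qs: "?Qs \<in> sets lebesgue" using measure_half_open_cylinder(1)[of "\<sigma> * \<rho>" "\<sigma> * \<theta>" x0 t0] \<rho> \<theta> \<sigma> by simp
  have QsQ: "?Qs \<subseteq> ?Q"
  proof -
   have "\<sigma> * \<rho> <= 1 * \<rho>" "\<sigma> * \<theta> <= 1 * \<theta>" using \<sigma> \<rho> \<theta> by (intro mult_right_mono; simp)+
   then show ?thesis by (auto simp: cylinder_def)
  qed
  have "ess_sup_norm k ?Qs u <= ereal K"
   unfolding ess_sup_norm_def
  proof (rule esssup_I)
   show "(\<lambda>z. ereal (fnorm k (u z))) \<in> borel_measurable (lebesgue_on ?Qs)"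
    using um[OF order_trans[OF QsQ QD]] by measurable
   show "AE z in lebesgue_on ?Qs. ereal (fnorm k (u z)) <= ereal K"
    using AE_completion[OF ae] Qs by (subst AE_restrict_space_iff) auto
  qed
  then show "ess_sup_norm k ?Qs u <= ereal (Max {
    (C / (1 - \<sigma>) ^ (N + 2) * (\<rho>^2 / \<theta>) powr (real N / 2) * avg ?Q (\<lambda>z. fnorm k (u z) powr r)) powr (2 / lambda_exp N m r),
    ((\<theta> / \<rho>^2) powr (p - real N / 2) * avg ?Q (\<lambda>z. fnorm k (\<lambda>i. \<rho> *\<^sub>R F z i) powr (2 * p))) powr (2 / lambda_exp N m (p * (1 + m))),
    (\<theta> / \<rho>^2) powr (1 / (1 - m))})"
   unfolding K_def X1_def X2_def l_def l'_def .
 qed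
qed

end
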